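(* Suppose that $$\mathcal E:=\int_E\nu(dx)\int_{(0,\infty)}u\phi(x)\log^+\big(u\phi(x)\big)\,\pi(x,du)<\infty,\qquad \log^+z:=\max(\log z,0).$$ Then there exists a probability measure $\mathbf Q_{\infty,\infty}$ on $\mathcal M$ such that the following five statements hold for any $\mu\in\mathcal M^o$: (1) $\mathbf Q_{\infty,\infty}(d\eta)=\eta(\phi)\,\mathbf Q_{\infty,0}(d\eta)\big/\int_{\mathcal M}\eta'(\phi)\,\mathbf Q_{\infty,0}(d\eta')$. (2) $\lim_{t\to\infty}e^{-\lambda t}\,\mathrm P_\mu(X_t\ne\mathbf 0)=\mu(\phi)\big/\int_{\mathcal M}\eta(\phi)\,\mathbf Q_{\infty,0}(d\eta)$. (3) $\mathbf Q_{\infty,r}$ converges strongly to $\mathbf Q_{\infty,\infty}$ as $r\to\infty$. (4) $\mathbf Q^\mu_{t,\infty}$ converges weakly to $\mathbf Q_{\infty,\infty}$ as $t\to\infty$. (5) $\mathbf Q^\mu_{t,r}$ converges weakly to $\mathbf Q_{\infty,\infty}$ as $t,r\to\infty$ (jointly).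
   Context: Setting. $E$ is a Polish space. For a metric space $F$, $b\mathcal B(F)$, $p\mathcal B(F)$, $bp\mathcal B(F)$ denote the bounded, the non-negative, and the bounded non-negative Borel functions on $F$. $\mathbb R_+=[0,\infty)$. $(\xi_t)_{t\in[0,\zeta)}$ is an $E$-valued Borel right process with (possibly sub-Markovian) transition semigroup $(P_t)_{t\ge0}$ and lifetime $\zeta$; $\Pi_x$ is its law started from $x\in E$. The branching mechanism is $$\psi(x,z)=-\beta(x)z+\sigma(x)^2z^2+\int_{(0,\infty)}(e^{-zu}-1+zu)\,\pi(x,du),\quad x\in E,\ z\ge0,$$ with $\beta,\sigma\in b\mathcal B(E)$ and $\pi$ a kernel from $E$ to $(0,\infty)$ with $\sup_{x\in E}\int_{(0,\infty)}(u\wedge u^2)\pi(x,du)<\infty$. For $f\in bp\mathcal B(E)$, $(t,x)\mapsto V_tf(x)$ is the unique non-negative Borel function on $\mathbb R_+\times E$ that is bounded on $[0,t_0]\times E$ for every $t_0\ge 0$ and satisfies $V_tf(x)+\int_0^t ds\int_E\psi(y,V_{t-s}f(y))P_s(x,dy)=P_tf(x)$ for all $t\ge0,x\in E$. $\mathcal M$ is the Polish space of finite Borel measures on $E$ with the topology of weak convergence, $\mathbf 0$ is the null measure, $\mathcal M^o=\mathcal M\setminus\{\mathbf 0\}$, and $\gamma(f)=\int f\,d\gamma$. The $(\xi,\psi)$-superprocess $X=(X_t)_{t\ge0}$ is the $\mathcal M$-valued conservative right process with transition semigroup $(Q_t)_{t\ge0}$ determined by $\int_{\mathcal M}e^{-\eta(f)}Q_t(\mu,d\eta)=e^{-\mu(V_tf)}$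 for $\mu\in\mathcal M$, $t\ge0$, $f\in bp\mathcal B(E)$. It is realized as the coordinate process on the space $\Omega$ of $\mathcal M$-valued right-continuous functions on $\mathbb R_+$; $\mathcal F_t=\sigma(X_s:s\le t)$, $\mathcal F=\sigma(X_s:s\ge0)$; $\mathrm P_\mu$ is the law (and expectation) of $X$ with $X_0=\mu$. The mean semigroup is $T_tf(x)=\Pi_x[e^{\int_0^t\beta(\xi_s)ds}f(\xi_t)\mathbf 1_{\{t<\zeta\}}]$, and $L_1^+(\nu)$ is the set of $f\in p\mathcal B(E)$ with $\nu(f)<\infty$. Standing assumptions: (i) There are $\lambda\in\mathbb R$, a bounded strictly positive Borel function $\phi$ on $E$ and a probability measure $\nu$ with full support on $E$ such that $\nu(\phi)=1$ and, for all $t\ge0$, $T_t\phi=e^{\lambda t}\phi$ and $\nu T_t=e^{\lambda t}\nu$. (ii) There is a map $(t,x,f)\mapsto H_tf(x)$ from $(0,\infty)\times E\times L_1^+(\nu)$ to $\mathbb R$ with $T_tf(x)=e^{\lambda t}\phi(x)\nu(f)(1+H_tf(x))$ for all $t>0$, $x\in E$, $f\in L_1^+(\nu)$; $\sup_{x\in E,f\in L_1^+(\nu)}|H_tf(x)|<\infty$ for every $t>0$; and $\lim_{t\to\infty}\sup_{x\in E,f\in L_1^+(\nu)}|H_tf(x)|=0$. (iii) $\lambda<0$ (subcriticality). (iv) $\mathrm P_\nu(X_t=\mathbf 0)>0$ for all $t>0$. For $\mu\in\mathcal M^o$ and $t,r\ge0$, $\mathbf Q^\mu_{t,r}(A):=\mathrm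 P_\mu(X_t\in A\mid X_{t+r}\ne\mathbf 0)$ for Borel $A\subset\mathcal M$. Strong convergence (setwise convergence): probability measures $\mu_n$ on a measurable space converge strongly to a probability measure $\mu$ if $\mu_n(f)\to\mu(f)$ for every bounded measurable $f$. For $r\ge0$, $\mathbf Q_{\infty,r}$ denotes the probability measure on $\mathcal M$ which is the weak limit of $\mathbf Q^\mu_{t,r}$ as $t\to\infty$ (this limit exists and is the same for every $\mu\in\mathcal M^o$). For $\mu\in\mathcal M^o$ and $t\ge0$, $\mathbf Q^\mu_{t,\infty}$ denotes the probability measure on $\mathcal M$ which is the strong limit of $\mathbf Q^\mu_{t,r}$ as $r\to\infty$ (this limit exists). *)

theory Defs
  imports "HOL-Probability.Probability"
begin

typedef (overloaded) ('a::topological_space) finmeas =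
  "{m :: 'a measure. sets m = sets borel \<and> finite_measure m}"
  morphisms meas Abs_finmeas
proof
  show "null_measure borel \<in> {m :: 'a measure. sets m = sets borel \<and> finite_measure m}"
    by (auto intro: finite_measureI)
qed

definition fint :: "'a::topological_space finmeas \<Rightarrow> ('a \<Rightarrow> real) \<Rightarrow> real"
  where "fint \<gamma> f = (\<integral>x. f x \<partial>meas \<gamma>)"

instantiation finmeas :: (topological_space) zero
begin
definition zero_finmeas :: "'a finmeas" where "0 = Abs_finmeas (null_measure borel)"
instance ..
end

instantiation finmeas :: (topological_space) topological_space
begin
definition open_finmeas :: "'a finmeas set \<Rightarrow> bool"
  where "open_finmeas = generate_topology
    {{\<gamma>. fint \<gamma> f \<in> U} | f U. continuous_on UNIV f \<and> bounded (range f) \<and> open U}"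
instance
  by intro_classes (auto simp: open_finmeas_def intro: generate_topology.intros)
end

definition weakly_converges ::
    "('i \<Rightarrow> 'a::topological_space measure) \<Rightarrow> 'a measure \<Rightarrow> 'i filter \<Rightarrow> bool"
  where "weakly_converges m l F \<longleftrightarrow>
    (\<forall>f::'a \<Rightarrow> real. continuous_on UNIV f \<and> bounded (range f) \<longrightarrow>
      ((\<lambda>i. \<integral>x. f x \<partial>m i) \<longlongrightarrow> (\<integral>x. f x \<partial>l)) F)"

definition strongly_converges ::
    "('i \<Rightarrow> 'a::topological_space measure) \<Rightarrow> 'a measure \<Rightarrow> 'i filter \<Rightarrow> bool"
  where "strongly_converges m l F \<longleftrightarrow>
    (\<forall>f::'a \<Rightarrow> real. f \<in> borel_measurable borel \<and> bounded (range f) \<longrightarrow>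
      ((\<lambda>i. \<integral>x. f x \<partial>m i) \<longlongrightarrow> (\<integral>x. f x \<partial>l)) F)"

definition bB :: "('a::topological_space \<Rightarrow> real) set"
  where "bB = {f. f \<in> borel_measurable borel \<and> bounded (range f)}"

definition bpB :: "('a::topological_space \<Rightarrow> real) set"
  where "bpB = {f \<in> bB. \<forall>x. 0 \<le> f x}"

definition L1_plus :: "'a::topological_space measure \<Rightarrow> ('a \<Rightarrow> real) set"
  where "L1_plus m =
    {f. f \<in> borel_measurable borel \<and> (\<forall>x. 0 \<le> f x) \<and> (\<integral>\<^sup>+x. ennreal (f x) \<partial>m) < \<infinity>}"

text \<open>Time is \<open>[0,\<infinity>)\<close>, represented by the non-negative reals; nothing is
  required of negative times.  Semigroups may be sub-Markovian.\<close>

locale borel_semigroup =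
  fixes P :: "real \<Rightarrow> 'a::topological_space \<Rightarrow> 'a measure"
  assumes kernel: "0 \<le> t \<Longrightarrow> P t \<in> borel \<rightarrow>\<^sub>M subprob_algebra borel"
    and start: "P 0 x = return borel x"
    and chapman_kolmogorov: "0 \<le> s \<Longrightarrow> 0 \<le> t \<Longrightarrow> P (s + t) x = P s x \<bind> P t"

definition universally_measurable :: "('a::topological_space \<Rightarrow> ennreal) \<Rightarrow> bool"
  where "universally_measurable f \<longleftrightarrow>
    (\<forall>m. sets m = sets borel \<and> finite_measure m \<longrightarrow> f \<in> borel_measurable (completion m))"

definition excessive ::
    "(real \<Rightarrow> 'a::topological_space \<Rightarrow> 'a measure) \<Rightarrow> real \<Rightarrow> ('a \<Rightarrow> ennreal) \<Rightarrow> bool"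
  where "excessive P \<alpha> f \<longleftrightarrow> universally_measurable f \<and>
    (\<forall>t\<ge>0. \<forall>x. ennreal (exp (- \<alpha> * t)) * (\<integral>\<^sup>+y. f y \<partial>completion (P t x)) \<le> f x) \<and>
    (\<forall>x. ((\<lambda>t. ennreal (exp (- \<alpha> * t)) * (\<integral>\<^sup>+y. f y \<partial>completion (P t x)))
           \<longlongrightarrow> f x) (at_right 0))"

text \<open>The \<sigma>-algebra generated by the process up to time \<open>t\<close>.  The value
  \<open>Y s \<omega>\<close> is meaningful only for \<open>s < \<zeta> \<omega>\<close>; afterwards the process
  sits in a cemetery, which is an isolated point.\<close>

definition past ::
    "'w measure \<Rightarrow> (real \<Rightarrow> 'w \<Rightarrow> 'a::topological_space) \<Rightarrow> ('w \<Rightarrow> ereal) \<Rightarrow> real \<Rightarrow> 'w measure"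
  where "past W Y \<zeta> t = sigma (space W)
    {{\<omega> \<in> space W. ereal s < \<zeta> \<omega> \<and> Y s \<omega> \<in> A} | s A. 0 \<le> s \<and> s \<le> t \<and> A \<in> sets borel}"

text \<open>\<open>W\<close> is the sample space and \<open>L x\<close> the law of the process started from
  \<open>x\<close>.  The last assumption is the second of the classical ``hypotheses droites'', for every
  initial distribution \<open>m\<close>; functions vanish at the cemetery, so right-continuity from
  \<open>\<zeta>\<close> onwards is automatic.\<close>

locale borel_right_process = borel_semigroup P
  for P :: "real \<Rightarrow> 'a::topological_space \<Rightarrow> 'a measure" +
  fixes W :: "'w measure"
    and L :: "'a \<Rightarrow> 'w measure"
    and Y :: "real \<Rightarrow> 'w \<Rightarrow> 'a"
    and \<zeta> :: "'w \<Rightarrow> ereal"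
  assumes law: "L \<in> borel \<rightarrow>\<^sub>M prob_algebra W"
    and adapted: "0 \<le> t \<Longrightarrow> A \<in> sets borel \<Longrightarrow>
      {\<omega> \<in> space W. ereal t < \<zeta> \<omega> \<and> Y t \<omega> \<in> A} \<in> sets W"
    and initial: "AE \<omega> in L x. 0 < \<zeta> \<omega> \<and> Y 0 \<omega> = x"
    and right_continuous: "\<omega> \<in> space W \<Longrightarrow> 0 \<le> t \<Longrightarrow> ereal t < \<zeta> \<omega> \<Longrightarrow>
      ((\<lambda>s. Y s \<omega>) \<longlongrightarrow> Y t \<omega>) (at_right t)"
    and markov: "0 \<le> s \<Longrightarrow> 0 \<le> t \<Longrightarrow> \<Lambda> \<in> sets (past W Y \<zeta> t) \<Longrightarrow> B \<in> sets borel \<Longrightarrow>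
      emeasure (L x) {\<omega> \<in> \<Lambda>. ereal (t + s) < \<zeta> \<omega> \<and> Y (t + s) \<omega> \<in> B} =
      (\<integral>\<^sup>+\<omega>. emeasure (P s (Y t \<omega>)) B * indicator {\<omega> \<in> \<Lambda>. ereal t < \<zeta> \<omega>} \<omega> \<partial>L x)"
    and excessive_right_continuous:
      "0 < \<alpha> \<Longrightarrow> excessive P \<alpha> f \<Longrightarrow> prob_space m \<Longrightarrow> sets m = sets borel \<Longrightarrow>
       AE \<omega> in m \<bind> L. \<forall>t\<ge>0. ereal t < \<zeta> \<omega> \<longrightarrow>
         ((\<lambda>s. f (Y s \<omega>)) \<longlongrightarrow> f (Y t \<omega>)) (at_right t)"

definition mean_semigroup ::
    "('a::topological_space \<Rightarrow> 'w measure) \<Rightarrow> (real \<Rightarrow> 'w \<Rightarrow> 'a) \<Rightarrow> ('w \<Rightarrow> ereal) \<Rightarrow> ('a \<Rightarrow> real) \<Rightarrow>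
     real \<Rightarrow> ('a \<Rightarrow> real) \<Rightarrow> 'a \<Rightarrow> ennreal"
  where "mean_semigroup L Y \<zeta> \<beta> t f x =
    (\<integral>\<^sup>+\<omega>. ennreal (exp (LINT s:{0..t}|lborel. \<beta> (Y s \<omega>)) * f (Y t \<omega>)) *
         indicator {\<omega>. ereal t < \<zeta> \<omega>} \<omega> \<partial>L x)"

text \<open>The Levy kernel lives on the subspace \<open>(0,\<infinity>)\<close>, so integrals against
  \<open>\<pi> x\<close> range over \<open>(0,\<infinity>)\<close>.\<close>

definition levy_kernel :: "('a::topological_space \<Rightarrow> real measure) \<Rightarrow> bool"
  where "levy_kernel \<pi> \<longleftrightarrow>
    (\<forall>x. sets (\<pi> x) = sets (restrict_space borel {0<..})) \<and>
    (\<forall>A \<in> sets (restrict_space borel {0<..}). (\<lambda>x. emeasure (\<pi> x) A) \<in> borel_measurable borel) \<and>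
    (SUP x. \<integral>\<^sup>+u. ennreal (min u (u\<^sup>2)) \<partial>\<pi> x) < \<infinity>"

definition branching_mechanism ::
    "('a \<Rightarrow> real) \<Rightarrow> ('a \<Rightarrow> real) \<Rightarrow> ('a \<Rightarrow> real measure) \<Rightarrow> 'a \<Rightarrow> real \<Rightarrow> real"
  where "branching_mechanism \<beta> \<sigma> \<pi> x z =
    - \<beta> x * z + (\<sigma> x)\<^sup>2 * z\<^sup>2 + (\<integral>u. exp (- z * u) - 1 + z * u \<partial>\<pi> x)"

definition cumulant_equation ::
    "(real \<Rightarrow> 'a::topological_space \<Rightarrow> 'a measure) \<Rightarrow> ('a \<Rightarrow> real \<Rightarrow> real) \<Rightarrow> ('a \<Rightarrow> real) \<Rightarrow>
     (real \<Rightarrow> 'a \<Rightarrow> real) \<Rightarrow> bool"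
  where "cumulant_equation P \<psi> f v \<longleftrightarrow>
    (\<lambda>(t, x). v t x) \<in> borel_measurable (restrict_space borel {0..} \<Otimes>\<^sub>M borel) \<and>
    (\<forall>t\<ge>0. \<forall>x. 0 \<le> v t x) \<and>
    (\<forall>t\<^sub>0\<ge>0. \<exists>C. \<forall>t\<in>{0..t\<^sub>0}. \<forall>x. v t x \<le> C) \<and>
    (\<forall>t\<ge>0. \<forall>x. v t x + (LINT s:{0..t}|lborel. (\<integral>y. \<psi> y (v (t - s) y) \<partial>P s x)) =
       (\<integral>y. f y \<partial>P t x))"

definition cumulant_semigroup ::
    "(real \<Rightarrow> 'a::topological_space \<Rightarrow> 'a measure) \<Rightarrow> ('a \<Rightarrow> real \<Rightarrow> real) \<Rightarrow>
     (real \<Rightarrow> ('a \<Rightarrow> real) \<Rightarrow> 'a \<Rightarrow> real) \<Rightarrow> bool"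
  where "cumulant_semigroup P \<psi> V \<longleftrightarrow>
    (\<forall>f\<in>bpB. cumulant_equation P \<psi> f (\<lambda>t. V t f) \<and>
      (\<forall>w. cumulant_equation P \<psi> f w \<longrightarrow> (\<forall>t\<ge>0. w t = V t f)))"

text \<open>Right-continuous paths with the \<sigma>-algebra generated by the coordinates.  The
  points of the product are functions on \<open>{0..}\<close>, i.e. \<open>undefined\<close> at negative
  times.\<close>

definition path_space :: "(real \<Rightarrow> 'b::topological_space) measure"
  where "path_space = restrict_space (PiM {0..} (\<lambda>_. borel))
    {w. \<forall>t\<ge>0. (w \<longlongrightarrow> w t) (at_right t)}"

text \<open>\<open>PP \<mu>\<close> is the law, on path space, of the superprocess with transition semigroup
  \<open>Q\<close> started from \<open>\<mu>\<close>; the infinite lifetime expresses conservativeness.\<close>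

definition superprocess ::
    "(real \<Rightarrow> ('a::topological_space \<Rightarrow> real) \<Rightarrow> 'a \<Rightarrow> real) \<Rightarrow>
     (real \<Rightarrow> 'a finmeas \<Rightarrow> 'a finmeas measure) \<Rightarrow>
     ('a finmeas \<Rightarrow> (real \<Rightarrow> 'a finmeas) measure) \<Rightarrow> bool"
  where "superprocess V Q PP \<longleftrightarrow>
    (\<forall>t\<ge>0. \<forall>\<mu>. prob_space (Q t \<mu>)) \<and>
    (\<forall>t\<ge>0. \<forall>\<mu>. \<forall>f\<in>bpB. (\<integral>\<eta>. exp (- fint \<eta> f) \<partial>Q t \<mu>) = exp (- fint \<mu> (V t f))) \<and>
    borel_right_process Q path_space PP (\<lambda>t w. w t) (\<lambda>_. \<infinity>)"

definition conditioned_law ::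
    "('a::topological_space finmeas \<Rightarrow> (real \<Rightarrow> 'a finmeas) measure) \<Rightarrow>
     'a finmeas \<Rightarrow> real \<Rightarrow> real \<Rightarrow> 'a finmeas measure"
  where "conditioned_law PP \<mu> t r =
    distr (uniform_measure (PP \<mu>) {w \<in> space (PP \<mu>). w (t + r) \<noteq> 0}) borel (\<lambda>w. w t)"

definition principal_triple ::
    "(real \<Rightarrow> ('a::topological_space \<Rightarrow> real) \<Rightarrow> 'a \<Rightarrow> ennreal) \<Rightarrow> real \<Rightarrow> ('a \<Rightarrow> real) \<Rightarrow>
     'a finmeas \<Rightarrow> bool"
  where "principal_triple T lam \<phi> \<nu> \<longleftrightarrow>
    \<phi> \<in> bB \<and> (\<forall>x. 0 < \<phi> x) \<and>
    prob_space (meas \<nu>) \<and> (\<forall>U. open U \<and> U \<noteq> {} \<longrightarrow> 0 < emeasure (meas \<nu>) U) \<and>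
    fint \<nu> \<phi> = 1 \<and>
    (\<forall>t\<ge>0. \<forall>x. T t \<phi> x = ennreal (exp (lam * t) * \<phi> x)) \<and>
    (\<forall>t\<ge>0. \<forall>A\<in>sets borel. (\<integral>\<^sup>+x. T t (indicator A) x \<partial>meas \<nu>) =
       ennreal (exp (lam * t)) * emeasure (meas \<nu>) A)"

definition uniform_asymptotics ::
    "(real \<Rightarrow> ('a::topological_space \<Rightarrow> real) \<Rightarrow> 'a \<Rightarrow> ennreal) \<Rightarrow> real \<Rightarrow> ('a \<Rightarrow> real) \<Rightarrow>
     'a finmeas \<Rightarrow> (real \<Rightarrow> ('a \<Rightarrow> real) \<Rightarrow> 'a \<Rightarrow> real) \<Rightarrow> bool"
  where "uniform_asymptotics T lam \<phi> \<nu> H \<longleftrightarrow>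
    (\<forall>t>0. \<forall>x. \<forall>f\<in>L1_plus (meas \<nu>). T t f x < \<infinity> \<and>
       enn2real (T t f x) = exp (lam * t) * \<phi> x * fint \<nu> f * (1 + H t f x)) \<and>
    (\<forall>t>0. (SUP (x, f)\<in>UNIV \<times> L1_plus (meas \<nu>). ennreal \<bar>H t f x\<bar>) < \<infinity>) \<and>
    ((\<lambda>t. SUP (x, f)\<in>UNIV \<times> L1_plus (meas \<nu>). ennreal \<bar>H t f x\<bar>) \<longlongrightarrow> 0) at_top"

end

(*
Write v_t(x) for the exponent of the extinction probability from a unit mass at x, so that
P_mu(X_t \<noteq> 0) = 1 - exp (-mu(v_t)). The cumulant semigroup solves a mild equation relative to the
mean semigroup T with a nonnegative nonlinearity; integrated against the eigenmeasure nu this shows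
that e^(-lambda t) nu(v_t) decreases to some k \<ge> 0. Under the L log L condition the total
nonlinear loss of mass, started from a small multiple of phi, is a small fraction of the initial
mass, and hence k > 0. By the asymptotics of T, e^(-lambda t) P_mu(X_t \<noteq> 0) tends to k mu(phi) for
every mu.

The mean measures of the conditioned laws are dominated by a multiple of nu, which extends the
Yaglom limit to linear functionals of bounded Borel functions. The Markov property gives
Q_(infinity,r) = G_r Q_(infinity,0) with G_r(eta) = e^(-lambda r) P_eta(X_r \<noteq> 0), and
G_r(eta) tends to k eta(phi), dominated by a multiple of eta(phi). Total mass one gives
k * (\<integral> eta(phi) dQ_(infinity,0)) = 1, and every limit in question is that of a density G_r with
respect to a conditioned law.
*)
theory Submission
  imports Defs
begin

section \<open>Finite measures with the weak topology\<close>

text \<open>Three obstacles shape the argument. The space of finite measures carries only the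
  topology generated by integrals of bounded continuous functions, so second countability and
  uniqueness of weak limits are derived from cozero sets instead of a metric. Finally
  \<open>\<eta>(\<phi>)\<close> is unbounded and second moments may be infinite under the L log L
  condition; convergence of its conditioned means to its mean under the limit takes the place of
  moment bounds. That v_t is finite comes from the extinction hypothesis at \<nu> alone: half of the
  time bounds \<nu>(v), the other half spreads the bound to every point through the mean semigroup.
  The same splitting of time recurs: one piece makes the error of the mean semigroup small, the
  other carries the decay.\<close>

lemma finmeas_meas [simp]: "finite_measure (meas \<gamma>)" "sets (meas \<gamma>) = sets borel" "space (meas \<gamma>) = UNIV"
proof -
  have "meas \<gamma> \<in> {m. sets m = sets borel \<and> finite_measure m}" by (rule meas)
  then show "finite_measure (meas \<gamma>)" "sets (meas \<gamma>) = sets borel" "space (meas \<gamma>) = UNIV"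
    by (auto dest: sets_eq_imp_space_eq)
qed

lemma sets_meas_cong [measurable_cong]: "sets (meas \<gamma>) = sets borel" by simp

lemma meas_Abs: "sets m = sets borel \<Longrightarrow> finite_measure m \<Longrightarrow> meas (Abs_finmeas m) = m"
  by (simp add: Abs_finmeas_inverse)

lemma measurable_meas [simp]: "f \<in> measurable (meas \<gamma>) M \<longleftrightarrow> f \<in> measurable borel M"
  by (simp add: measurable_def)

lemma meas_zero: "meas 0 = null_measure borel"
  unfolding zero_finmeas_def by (rule meas_Abs) (auto intro: finite_measureI)

lemma finmeas_eq_0_iff: "\<gamma> = 0 \<longleftrightarrow> emeasure (meas \<gamma>) UNIV = 0"
proof
  assume "emeasure (meas \<gamma>) UNIV = 0"
  then have "emeasure (meas \<gamma>) A = 0" for A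
    by (metis emeasure_mono finmeas_meas(2) le_zero_eq sets.top space_borel top_greatest)
  then have "meas \<gamma> = meas 0"
    by (intro measure_eqI) (auto simp: meas_zero)
  then show "\<gamma> = 0" by (simp add: meas_inject)
qed (simp add: meas_zero)

lemma bB_I: "f \<in> borel_measurable borel \<Longrightarrow> (\<And>x. \<bar>f x\<bar> \<le> B) \<Longrightarrow> f \<in> bB"
  unfolding bB_def by (auto simp: bounded_iff)

lemma bB_measurable: "f \<in> bB \<Longrightarrow> f \<in> borel_measurable borel"
  by (simp add: bB_def)

lemma bB_bound:
  assumes "f \<in> bB" obtains B where "0 < B" "\<And>x. \<bar>f x\<bar> \<le> B"
proof -
  from assms obtain B where "\<And>x. \<bar>f x\<bar> \<le> B" by (auto simp: bB_def bounded_iff)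
  then have "\<bar>f x\<bar> \<le> max 1 B" for x by (metis max.coboundedI2)
  then show thesis using that[of "max 1 B"] by auto
qed

lemma bpB_I: "f \<in> borel_measurable borel \<Longrightarrow> (\<And>x. 0 \<le> f x) \<Longrightarrow> (\<And>x. f x \<le> B) \<Longrightarrow> f \<in> bpB"
  unfolding bpB_def by (auto intro: bB_I[where B=B])

lemma bpB_D: "f \<in> bpB \<Longrightarrow> f \<in> bB" "f \<in> bpB \<Longrightarrow> 0 \<le> f x"
  by (auto simp: bpB_def)

lemma integrable_bounded:
  fixes f :: "'a \<Rightarrow> real"
  assumes "finite_measure M" "f \<in> borel_measurable M" "\<And>x. x \<in> space M \<Longrightarrow> \<bar>f x\<bar> \<le> B"
  shows "integrable M f"
  by (rule finite_measure.integrable_const_bound[OF assms(1), of f B])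
     (use assms in auto)

lemma integrable_meas_bB: "f \<in> bB \<Longrightarrow> integrable (meas \<gamma>) f"
  by (frule bB_measurable, erule bB_bound, rule integrable_bounded) auto

lemma fint_nonneg: "(\<And>x. 0 \<le> f x) \<Longrightarrow> 0 \<le> fint \<gamma> f"
  by (simp add: fint_def)

lemma fint_mono: "f \<in> bB \<Longrightarrow> g \<in> bB \<Longrightarrow> (\<And>x. f x \<le> g x) \<Longrightarrow> fint \<gamma> f \<le> fint \<gamma> g"
  unfolding fint_def by (intro integral_mono integrable_meas_bB)

lemma fint_zero [simp]: "fint 0 f = 0"
  by (simp add: fint_def meas_zero)

lemma fint_eq_nn: "f \<in> bpB \<Longrightarrow> ennreal (fint \<gamma> f) = (\<integral>\<^sup>+x. ennreal (f x) \<partial>meas \<gamma>)"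
  unfolding fint_def
  by (subst nn_integral_eq_integral) (auto intro: integrable_meas_bB bpB_D)

lemma fint_const: "fint \<gamma> (\<lambda>_. c) = c * measure (meas \<gamma>) UNIV"
  by (simp add: fint_def)

lemma continuous_fint:
  assumes "continuous_on UNIV f" "bounded (range f)"
  shows "continuous_on UNIV (\<lambda>\<gamma>. fint \<gamma> f)"
proof (rule continuous_on_open_vimage[OF open_UNIV, THEN iffD2], intro allI impI)
  fix U :: "real set" assume "open U"
  then show "open ((\<lambda>\<gamma>. fint \<gamma> f) -` U \<inter> UNIV)"
    unfolding open_finmeas_def
    using assms by (intro generate_topology.Basis CollectI exI[of _ f] exI[of _ U]) auto
qed

section \<open>Approximation of open sets by continuous functions, and measurability of
  evaluation\<close>

lemma continuous_bounded_bB: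
  fixes f :: "'a::topological_space \<Rightarrow> real"
  shows "continuous_on UNIV f \<Longrightarrow> bounded (range f) \<Longrightarrow> f \<in> bB"
  by (simp add: bB_def borel_measurable_continuous_onI)

text \<open>\<open>infdist\<close> to the empty set is 0, so without its own clause the approximants
  of the whole space would vanish instead of being 1.\<close>

definition inner_approx :: "'a::metric_space set \<Rightarrow> nat \<Rightarrow> 'a \<Rightarrow> real"
  where "inner_approx G n x = (if G = UNIV then 1 else min 1 (real n * infdist x (- G)))"

lemma inner_approx:
  shows "continuous_on UNIV (inner_approx G n)" "0 \<le> inner_approx G n x" "inner_approx G n x \<le> 1"
    "m \<le> n \<Longrightarrow> inner_approx G m x \<le> inner_approx G n x"
proof -
  have "continuous_on UNIV (\<lambda>x. min 1 (real n * infdist x (- G)))" by (intro continuous_intros)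
  then show "continuous_on UNIV (inner_approx G n)" by (cases "G = UNIV") (simp_all add: inner_approx_def[abs_def])
  show "0 \<le> inner_approx G n x" "inner_approx G n x \<le> 1" by (simp_all add: inner_approx_def infdist_nonneg)
  assume "m \<le> n"
  then have "real m * infdist x (- G) \<le> real n * infdist x (- G)" by (intro mult_right_mono infdist_nonneg) simp
  then show "inner_approx G m x \<le> inner_approx G n x" by (auto simp: inner_approx_def)
qed

lemma inner_approx_bounded: "bounded (range (inner_approx G n))"
  using inner_approx(2,3)[of G n] by (auto simp: bounded_iff intro!: exI[of _ 1])

lemma inner_approx_le: "inner_approx G n x \<le> indicator G x"
proof (cases "x \<in> G")
  case False
  then show ?thesis by (auto simp: inner_approx_def)
qed (simp add: inner_approx)

lemma inner_approx_tendsto: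
  assumes "open G"
  shows "(\<lambda>n. inner_approx G n x) \<longlonglongrightarrow> indicator G x"
proof (cases "x \<in> G \<and> G \<noteq> UNIV")
  case True
  then have "0 < infdist x (- G)"
    using assms by (intro infdist_pos_not_in_closed) auto
  then obtain N where "1 < real N * infdist x (- G)" using reals_Archimedean3 by blast
  then have "inner_approx G n x = 1" if "n \<ge> N" for n
    using that True mult_right_mono[of "real N" "real n" "infdist x (- G)"]
    by (auto simp: inner_approx_def infdist_nonneg)
  then show ?thesis using True
    by (intro tendsto_eventually) (auto simp: eventually_sequentially)
next
  case False
  then have "inner_approx G n x = indicator G x" for n by (cases "G = UNIV") (auto simp: inner_approx_def)
  then show ?thesis by simp
qed

lemma fint_inner_approx_tendsto:
  assumes "open G"
  shows "(\<lambda>n. fint \<gamma> (inner_approx G n)) \<longlonglongrightarrow> measure (meas \<gamma>) G"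
proof -
  have "(\<lambda>n. fint \<gamma> (inner_approx G n)) \<longlonglongrightarrow> (\<integral>x. indicator G x \<partial>meas \<gamma>)"
    unfolding fint_def
    by (rule integral_dominated_convergence[where w="\<lambda>_. 1"])
       (use assms in \<open>auto simp: inner_approx inner_approx_tendsto finite_measure.integrable_const
          intro: borel_measurable_continuous_onI\<close>)
  then show ?thesis by simp
qed

text \<open>The topology on measures only sees continuous integrands. Masses of open sets are
  increasing limits of such integrals, and the open sets are an intersection-stable generator, so a
  Dynkin argument carries measurability to all Borel sets; finiteness of the measures makes
  complements work.\<close>

lemma emeasure_meas_measurable [measurable]:
  fixes A :: "'a::metric_space set"
  assumes A: "A \<in> sets borel"
  shows "(\<lambda>\<gamma>. emeasure (meas \<gamma>) A) \<in> borel_measurable borel"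
proof -
  have "Int_stable {S::'a set. open S}" "{S::'a set. open S} \<subseteq> Pow UNIV" "A \<in> sigma_sets UNIV {S::'a set. open S}"
    using A by (auto simp: borel_def Int_stable_def)
  then show ?thesis
  proof (induction rule: sigma_sets_induct_disjoint)
    case (basic S)
    then have S: "open S" by simp
    have "(\<lambda>\<gamma>. measure (meas \<gamma>) S) \<in> borel_measurable borel"
      by (rule borel_measurable_LIMSEQ_real[OF fint_inner_approx_tendsto[OF S]])
         (intro borel_measurable_continuous_onI continuous_fint inner_approx inner_approx_bounded)
    then show ?case
      by (simp add: finite_measure.emeasure_eq_measure)
  next
    case (compl S)
    have [measurable]: "(\<lambda>\<gamma>::'a finmeas. emeasure (meas \<gamma>) UNIV) \<in> borel_measurable borel"
    proof -
      have "(\<lambda>\<gamma>::'a finmeas. ennreal (fint \<gamma> (\<lambda>_. 1))) \<in> borel_measurable borel"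
        by (intro measurable_compose[OF _ measurable_ennreal] borel_measurable_continuous_onI continuous_fint) auto
      then show ?thesis
        by (simp add: fint_const finite_measure.emeasure_eq_measure)
    qed
    have "emeasure (meas \<gamma>) (UNIV - S) = emeasure (meas \<gamma>) UNIV - emeasure (meas \<gamma>) S" for \<gamma>
      using compl(1) emeasure_compl[of S "meas \<gamma>"] by (simp add: borel_def finite_measure.emeasure_finite)
    then show ?case using compl(2) by simp
  next
    case (union S)
    then have "(\<lambda>\<gamma>. emeasure (meas \<gamma>) (\<Union> (range S))) = (\<lambda>\<gamma>. \<Sum>i. emeasure (meas \<gamma>) (S i))"
      by (intro ext suminf_emeasure[symmetric]) (auto simp: borel_def)
    then show ?case using union by simp
  qed simp
qed

lemma nn_integral_meas_measurable [measurable]: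
  fixes f :: "'a::metric_space \<Rightarrow> ennreal"
  assumes "f \<in> borel_measurable borel"
  shows "(\<lambda>\<gamma>. \<integral>\<^sup>+x. f x \<partial>meas \<gamma>) \<in> borel_measurable borel"
  using assms
proof induction
  case (cong f g)
  then show ?case by (simp cong: nn_integral_cong)
next
  case (set A)
  then show ?case by simp
next
  case (mult u c)
  then show ?case by (simp add: nn_integral_cmult)
next
  case (add u v)
  then show ?case by (simp add: nn_integral_add)
next
  case (seq U)
  then show ?case
    by (simp add: nn_integral_monotone_convergence_SUP image_comp SUP_apply)
qed

lemma fint_measurable [measurable (raw)]:
  fixes f :: "'a::metric_space \<Rightarrow> real"
  assumes f: "f \<in> bB"
  shows "(\<lambda>\<gamma>. fint \<gamma> f) \<in> borel_measurable borel"
proof -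
  have [measurable]: "f \<in> borel_measurable borel" using f by (rule bB_measurable)
  have "fint \<gamma> f = enn2real (\<integral>\<^sup>+x. ennreal (f x) \<partial>meas \<gamma>) - enn2real (\<integral>\<^sup>+x. ennreal (- f x) \<partial>meas \<gamma>)" for \<gamma>
    unfolding fint_def by (intro real_lebesgue_integral_def integrable_meas_bB f)
  then show ?thesis by simp
qed

lemma zero_finmeas_measurable [measurable]: "{0 :: 'a::metric_space finmeas} \<in> sets borel"
proof -
  have "{0 :: 'a finmeas} = {\<gamma> \<in> space borel. emeasure (meas \<gamma>) UNIV = 0}"
    using finmeas_eq_0_iff by auto
  also have "\<dots> \<in> sets borel" by measurable
  finally show ?thesis .
qed

text \<open>Dirac masses serve to read off pointwise values: an identity of Laplace functionals at
  \<open>dirac x\<close> is an identity of cumulants at \<open>x\<close>.\<close>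

definition dirac :: "'a::topological_space \<Rightarrow> 'a finmeas"
  where "dirac x = Abs_finmeas (return borel x)"

lemma meas_dirac: "meas (dirac x) = return borel x"
  unfolding dirac_def
  by (rule meas_Abs) (auto intro!: prob_space.finite_measure prob_space_return)

lemma fint_dirac: "f \<in> borel_measurable borel \<Longrightarrow> fint (dirac x) f = f x"
  by (simp add: fint_def meas_dirac integral_return)

subsection \<open>Second countability and uniqueness of measures\<close>

text \<open>Semicontinuity is tested against the topology generated by a family \<open>S\<close>,
  because the aim is to show that a countable \<open>S\<close> generates the given topology, and
  this is not yet known.\<close>

definition lsc_for :: "'b set set \<Rightarrow> ('b \<Rightarrow> real) \<Rightarrow> bool"
  where "lsc_for S h \<longleftrightarrow> (\<forall>a. generate_topology S {\<gamma>. a < h \<gamma>})"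

lemma lsc_for_add:
  assumes "lsc_for S f" "lsc_for S g"
  shows "lsc_for S (\<lambda>\<gamma>. f \<gamma> + g \<gamma>)"
  unfolding lsc_for_def
proof
  fix a
  have "{\<gamma>. a < f \<gamma> + g \<gamma>} = (\<Union>q. {\<gamma>. q < f \<gamma>} \<inter> {\<gamma>. a - q < g \<gamma>})" (is "?A = ?B")
  proof
    show "?A \<subseteq> ?B"
    proof
      fix \<gamma> assume "\<gamma> \<in> ?A"
      then have "a - g \<gamma> < f \<gamma>" by auto
      then obtain q where "a - g \<gamma> < q" "q < f \<gamma>" using dense by blast
      then show "\<gamma> \<in> ?B" by (auto intro!: exI[of _ q])
    qed
  qed auto
  also have "generate_topology S \<dots>"
    using assms by (intro generate_topology_Union generate_topology.Int) (auto simp: lsc_for_def)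
  finally show "generate_topology S {\<gamma>. a < f \<gamma> + g \<gamma>}" .
qed

lemma lsc_for_const: "lsc_for S (\<lambda>_. c)"
proof -
  have "generate_topology S {}" using generate_topology.UN[of "{}" S] by simp
  then show ?thesis unfolding lsc_for_def
    by (metis (mono_tags) UNIV_def generate_topology.UNIV Collect_empty_eq Collect_cong)
qed

lemma lsc_for_sum:
  assumes "\<And>i. i \<in> I \<Longrightarrow> lsc_for S (f i)"
  shows "lsc_for S (\<lambda>\<gamma>. \<Sum>i\<in>I. f i \<gamma>)"
  using assms by (induction I rule: infinite_finite_induct) (auto intro: lsc_for_const lsc_for_add)

lemma lsc_for_mult:
  assumes "lsc_for S f" "0 < (c::real)"
  shows "lsc_for S (\<lambda>\<gamma>. c * f \<gamma>)"
proof -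
  have "(a < c * y) = (a / c < y)" for a y using assms(2) by (simp add: field_simps)
  then show ?thesis using assms(1) by (simp add: lsc_for_def)
qed

lemma lsc_for_lim:
  assumes "\<And>n. lsc_for S (f n)" "\<And>n \<gamma>. f n \<gamma> \<le> g \<gamma>" "\<And>\<gamma>. (\<lambda>n. f n \<gamma>) \<longlonglongrightarrow> g \<gamma>"
  shows "lsc_for S g"
  unfolding lsc_for_def
proof
  fix a
  have "{\<gamma>. a < g \<gamma>} = (\<Union>n::nat. {\<gamma>. a < f n \<gamma>})"
  proof
    show "{\<gamma>. a < g \<gamma>} \<subseteq> (\<Union>n::nat. {\<gamma>. a < f n \<gamma>})"
      using order_tendstoD(1)[OF assms(3), of a] by (force simp: eventually_sequentially)
    show "(\<Union>n::nat. {\<gamma>. a < f n \<gamma>}) \<subseteq> {\<gamma>. a < g \<gamma>}"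
      using assms(2) by (auto intro: less_le_trans)
  qed
  also have "generate_topology S \<dots>"
    using assms(1) by (intro generate_topology_Union) (auto simp: lsc_for_def)
  finally show "generate_topology S {\<gamma>. a < g \<gamma>}" .
qed

text \<open>Semicontinuity of \<open>f\<close> and of \<open>- f\<close> gives the preimages of both
  kinds of half-lines, which generate the topology of the reals.\<close>

lemma real_set_generate:
  assumes "lsc_for S f" "lsc_for S (\<lambda>\<gamma>. - f \<gamma>)" "open U"
  shows "generate_topology S {\<gamma>. f \<gamma> \<in> U}"
proof -
  have "generate_topology (range (\<lambda>a::real. {..<a}) \<union> range (\<lambda>a. {a<..})) U"
    using assms(3) by (simp add: open_generated_order)
  then show ?thesis
  proof induction
    case UNIV
    then show ?case using generate_topology.UNIV by simp
  next
    case (Int a b)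
    then show ?case using generate_topology.Int[OF Int.IH] by (simp add: Collect_conj_eq)
  next
    case (UN K)
    then have "generate_topology S (\<Union>k\<in>K. {\<gamma>. f \<gamma> \<in> k})" by (intro generate_topology_Union)
    also have "(\<Union>k\<in>K. {\<gamma>. f \<gamma> \<in> k}) = {\<gamma>. f \<gamma> \<in> \<Union>K}" by auto
    finally show ?case .
  next
    case (Basis s)
    have "generate_topology S {\<gamma>. f \<gamma> < a}" for a
      using assms(2) unfolding lsc_for_def by (auto dest: spec[of _ "-a"])
    then show ?case using Basis assms(1) by (auto simp: lsc_for_def)
  qed
qed

text \<open>Counting the levels \<open>i / N\<close> strictly below \<open>y\<close> measures
  \<open>y\<close> from below up to \<open>1 / N\<close>. For a continuous integrand the sets above
  a level are open, so its integral becomes a limit of positive combinations of masses of open sets,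
  which are the semicontinuous building blocks.\<close>

lemma layer_cake:
  fixes y :: real
  assumes "0 \<le> y" "y \<le> real K" "0 < N"
  shows "y - 1 / real N \<le> (\<Sum>i\<in>{1..K*N}. (1 / real N) * indicator {real i / real N<..} y)"
    and "(\<Sum>i\<in>{1..K*N}. (1 / real N) * indicator {real i / real N<..} y) \<le> y"
proof -
  define m where "m = nat \<lceil>y * real N\<rceil>"
  have yN: "0 \<le> y * real N" "y * real N \<le> real (K * N)" using assms by (auto intro: mult_right_mono)
  have m: "real m < y * real N + 1" "y * real N \<le> real m"
    using yN unfolding m_def by linarith+
  have mK: "m \<le> K * N" unfolding m_def using yN by (simp add: ceiling_le_iff nat_le_iff)
  have iff: "real i / real N < y \<longleftrightarrow> i < m" for i :: nat
    using assms(3) yN unfolding m_def by (simp add: field_simps zless_nat_eq_int_zless less_ceiling_iff)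
  have "(\<Sum>i\<in>{1..K*N}. (1 / real N) * indicator {real i / real N<..} y)
      = (\<Sum>i\<in>{1..K*N}. if i < m then 1 / real N else 0)"
    by (intro sum.cong) (auto simp: iff)
  also have "\<dots> = (\<Sum>i\<in>{1..K*N} \<inter> {i. i < m}. 1 / real N)" by (simp add: sum.If_cases)
  also have "{1..K*N} \<inter> {i. i < m} = {1..<m}" using mK by auto
  finally have eq: "(\<Sum>i\<in>{1..K*N}. (1 / real N) * indicator {real i / real N<..} y) = real (m - 1) / real N"
    by simp
  have "real (m - 1) \<le> y * real N" using m(1) yN by (cases m) auto
  then show "(\<Sum>i\<in>{1..K*N}. (1 / real N) * indicator {real i / real N<..} y) \<le> y"
    unfolding eq using assms(3) by (simp add: field_simps)
  have "y * real N - 1 \<le> real (m - 1)" using m(2) by (cases m) auto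
  from divide_right_mono[OF this, of "real N"]
  show "y - 1 / real N \<le> (\<Sum>i\<in>{1..K*N}. (1 / real N) * indicator {real i / real N<..} y)"
    unfolding eq using assms(3) by (simp add: diff_divide_distrib)
qed

text \<open>Masses of open sets are lower semicontinuous; together with an upper bound on the total
  mass they control every bounded continuous integrand from both sides, since \<open>C + f\<close>
  and \<open>C - f\<close> are nonnegative for large \<open>C\<close>. Countably many open sets and
  rational levels suffice. The result enters later through the Lindelof property.\<close>

instance finmeas :: (polish_space) second_countable_topology
proof
  obtain B :: "'a set set" where B: "countable B" "topological_basis B" using ex_countable_basis by blast
  \<comment> \<open>Finite unions of basic sets are included because masses pass to the limit along
    increasing unions, and every open set is an increasing union of these.\<close>
  define U where "U = Union ` {F. finite F \<and> F \<subseteq> B}"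
  have cU: "countable U" unfolding U_def using B(1) by (intro countable_image countable_Collect_finite_subset)
  have oU: "open G" if "G \<in> U" for G using that topological_basis_open[OF B(2)] unfolding U_def by (auto intro!: open_Union)
  \<comment> \<open>The second family bounds the total mass from above; the first bounds masses from
    below only.\<close>
  define S :: "'a finmeas set set" where "S = (\<lambda>(G,q). {\<gamma>. q < measure (meas \<gamma>) G}) ` (U \<times> \<rat>) \<union>
     (\<lambda>q. {\<gamma>. measure (meas \<gamma>) UNIV < q}) ` \<rat>"
  have cS: "countable S" unfolding S_def using cU
    by (intro countable_Un countable_image countable_SIGMA countable_rat) auto
  have lscU: "lsc_for S (\<lambda>\<gamma>. measure (meas \<gamma>) G)" if "G \<in> U" for G
    unfolding lsc_for_def
  proof
    fix a
    have "{\<gamma>. a < measure (meas \<gamma>) G} = (\<Union>q\<in>{q\<in>\<rat>. a \<le> q}. {\<gamma>. q < measure (meas \<gamma>) G})" (is "?L = ?R")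
    proof
      show "?L \<subseteq> ?R"
      proof
        fix \<gamma> assume "\<gamma> \<in> ?L"
        then obtain q where "q \<in> \<rat>" "a < q" "q < measure (meas \<gamma>) G" using Rats_dense_in_real by auto
        then show "\<gamma> \<in> ?R" by (auto intro!: bexI[of _ q])
      qed
    qed auto
    also have "generate_topology S \<dots>"
      using that by (intro generate_topology_Union generate_topology.Basis) (auto simp: S_def)
    finally show "generate_topology S {\<gamma>. a < measure (meas \<gamma>) G}" .
  qed
  have lsc_open: "lsc_for S (\<lambda>\<gamma>. measure (meas \<gamma>) G)" if G: "open G" for G
  proof (cases "G = {}")
    case True
    then show ?thesis by (simp add: lsc_for_const)
  next
    case False
    obtain B' where B': "B' \<subseteq> B" "\<Union>B' = G" using B(2) G by (auto simp: topological_basis_def)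
    then have B'2: "countable B'" "B' \<noteq> {}" using B(1) False by (auto intro: countable_subset)
    define e where "e = from_nat_into B'"
    have e: "range e = B'" using B'2 by (simp add: e_def range_from_nat_into)
    define A where "A n = (\<Union>i\<le>n. e i)" for n
    have AU: "A n \<in> U" for n
      unfolding A_def U_def using e B'(1) by (auto intro!: image_eqI[of _ _ "e ` {..n}"])
    have "\<Union>(range A) = G" unfolding A_def B'(2)[symmetric] e[symmetric] by auto
    moreover have "incseq A" by (force simp: A_def incseq_def)
    moreover have "range A \<subseteq> sets borel" using AU oU by auto
    ultimately have "(\<lambda>n. measure (meas \<gamma>) (A n)) \<longlonglongrightarrow> measure (meas \<gamma>) G" for \<gamma>
      using finite_measure.finite_Lim_measure_incseq[of "meas \<gamma>" A] by simp
    moreover have "measure (meas \<gamma>) (A n) \<le> measure (meas \<gamma>) G" for n \<gamma>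
    proof (rule finite_measure.finite_measure_mono)
      show "A n \<subseteq> G" unfolding \<open>\<Union>(range A) = G\<close>[symmetric] by (rule UN_upper) simp
    qed (use G in auto)
    ultimately show ?thesis by (rule lsc_for_lim[OF lscU[OF AU], rotated])
  qed
  have lsc_nonneg: "lsc_for S (\<lambda>\<gamma>. fint \<gamma> g)" if g: "continuous_on UNIV g" "bounded (range g)" "\<And>x. 0 \<le> g x" for g :: "'a \<Rightarrow> real"
  proof -
    have gB: "g \<in> bB" using g by (intro continuous_bounded_bB)
    obtain C where C: "\<And>x. \<bar>g x\<bar> \<le> C" using bB_bound[OF gB] by metis
    obtain K :: nat where "C \<le> real K" using real_arch_simple by blast
    with C have K: "g x \<le> real K" for x by (meson abs_le_D1 order_trans)
    define h where "h N x = (\<Sum>i\<in>{1..K*Suc N}. (1 / real (Suc N)) * indicator {x. real i / real (Suc N) < g x} x)" for N x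
    have op: "open {x. real i / real (Suc N) < g x}" for i N
      using g(1) by (intro open_Collect_less continuous_intros)
    have h: "g x - 1 / real (Suc N) \<le> h N x" "h N x \<le> g x" for N x
    proof -
      have "h N x = (\<Sum>i\<in>{1..K*Suc N}. (1 / real (Suc N)) * indicator {real i / real (Suc N)<..} (g x))"
        unfolding h_def by (intro sum.cong) (auto simp: indicator_def)
      then show "g x - 1 / real (Suc N) \<le> h N x" "h N x \<le> g x"
        using layer_cake[of "g x" K "Suc N"] K g(3) by simp_all
    qed
    have h0: "0 \<le> h N x" for N x unfolding h_def by (intro sum_nonneg) auto
    have hB: "h N \<in> bB" for N
    proof (rule bB_I[where B=C])
      show "h N \<in> borel_measurable borel"
        unfolding h_def using op by (intro borel_measurable_sum borel_measurable_times borel_measurable_indicator) auto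
      show "\<bar>h N x\<bar> \<le> C" for x using h0[of N x] h(2)[of N x] C[of x] by auto
    qed
    have heq: "fint \<gamma> (h N) = (\<Sum>i\<in>{1..K*Suc N}. (1 / real (Suc N)) * measure (meas \<gamma>) {x. real i / real (Suc N) < g x})" for \<gamma> N
      unfolding h_def fint_def using op
      by (subst Bochner_Integration.integral_sum) (auto intro!: integrable_mult_right integrable_real_indicator
           simp: finite_measure.emeasure_finite less_top[symmetric])
    have "lsc_for S (\<lambda>\<gamma>. fint \<gamma> (h N))" for N
      unfolding heq using op by (intro lsc_for_sum lsc_for_mult lsc_open) auto
    moreover have "(\<lambda>N. fint \<gamma> (h N)) \<longlonglongrightarrow> fint \<gamma> g" for \<gamma>
      unfolding fint_def
    proof (rule integral_dominated_convergence[where w="\<lambda>_. C"])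
      have "(\<lambda>N. g x - 1 / real (Suc N)) \<longlonglongrightarrow> g x - 0" for x
        by (intro tendsto_intros LIMSEQ_Suc[OF lim_1_over_n])
      then have "(\<lambda>N. h N x) \<longlonglongrightarrow> g x" for x
        using tendsto_sandwich[of "\<lambda>N. g x - 1 / real (Suc N)" "\<lambda>N. h N x" sequentially "\<lambda>_. g x" "g x"] h by auto
      then show "AE x in meas \<gamma>. (\<lambda>N. h N x) \<longlonglongrightarrow> g x" by simp
      show "AE x in meas \<gamma>. norm (h N x) \<le> C" for N
      proof (rule AE_I2)
        show "norm (h N x) \<le> C" for x using h0[of N x] h(2)[of N x] C[of x] by simp
      qed
    qed (use gB hB in \<open>auto dest: bB_measurable simp: finite_measure.integrable_const\<close>)
    moreover have "fint \<gamma> (h N) \<le> fint \<gamma> g" for N \<gamma> by (rule fint_mono[OF hB gB h(2)])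
    ultimately show ?thesis
      using lsc_for_lim[of S "\<lambda>N \<gamma>. fint \<gamma> (h N)" "\<lambda>\<gamma>. fint \<gamma> g"] by blast
  qed
  have lsc_neg_mass: "lsc_for S (\<lambda>\<gamma>. - (c * measure (meas \<gamma>) UNIV))" if "0 < c" for c
  proof -
    have "lsc_for S (\<lambda>\<gamma>. - measure (meas \<gamma>) UNIV)"
      unfolding lsc_for_def
    proof
      fix a
      have "{\<gamma>::'a finmeas. a < - measure (meas \<gamma>) UNIV} = (\<Union>q\<in>{q\<in>\<rat>. q \<le> -a}. {\<gamma>. measure (meas \<gamma>) UNIV < q})" (is "?L = ?R")
      proof
        show "?L \<subseteq> ?R"
        proof
          fix \<gamma> assume "\<gamma> \<in> ?L"
          then have "measure (meas \<gamma>) UNIV < -a" by auto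
          then obtain q where "q \<in> \<rat>" "measure (meas \<gamma>) UNIV < q" "q < -a" using Rats_dense_in_real by auto
          then show "\<gamma> \<in> ?R" by (auto intro!: bexI[of _ q])
        qed
      qed auto
      also have "generate_topology S \<dots>"
        by (intro generate_topology_Union generate_topology.Basis) (auto simp: S_def)
      finally show "generate_topology S {\<gamma>. a < - measure (meas \<gamma>) UNIV}" .
    qed
    from lsc_for_mult[OF this that] show ?thesis by simp
  qed
  have lsc_bdd: "lsc_for S (\<lambda>\<gamma>. fint \<gamma> f)" if f: "continuous_on UNIV f" "bounded (range f)" for f :: "'a \<Rightarrow> real"
  proof -
    have fB: "f \<in> bB" using f by (intro continuous_bounded_bB)
    obtain C where C: "0 < C" "\<And>x. \<bar>f x\<bar> \<le> C" using bB_bound[OF fB] by metis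
    have b: "bounded (range (\<lambda>x. f x + C))" using C
      by (auto simp: bounded_iff intro!: exI[of _ "C + C"] order_trans[OF abs_triangle_ineq] add_right_mono)
    \<comment> \<open>The shift by \<open>C\<close> makes the integrand nonnegative; it is undone by
      a negative multiple of the total mass, which is lower semicontinuous by the second
      family.\<close>
    have "fint \<gamma> f = fint \<gamma> (\<lambda>x. f x + C) + - (C * measure (meas \<gamma>) UNIV)" for \<gamma>
      unfolding fint_def using integrable_meas_bB[OF fB, of \<gamma>]
      by (subst Bochner_Integration.integral_add) (auto simp: finite_measure.integrable_const)
    moreover have "lsc_for S (\<lambda>\<gamma>. fint \<gamma> (\<lambda>x. f x + C) + - (C * measure (meas \<gamma>) UNIV))"
    proof (intro lsc_for_add lsc_nonneg lsc_neg_mass b C(1))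
      show "continuous_on UNIV (\<lambda>x. f x + C)" by (intro continuous_intros f)
      show "0 \<le> f x + C" for x using C(2)[of x] by auto
    qed
    ultimately show ?thesis by simp
  qed
  have fneg: "fint \<gamma> (\<lambda>x. - f x) = - fint \<gamma> f" for \<gamma> and f :: "'a \<Rightarrow> real" by (simp add: fint_def)
  have sub1: "generate_topology S {\<gamma>. fint \<gamma> f \<in> V}" if "continuous_on UNIV f" "bounded (range f)" "open V" for f and V :: "real set"
  proof (rule real_set_generate)
    show "lsc_for S (\<lambda>\<gamma>. - fint \<gamma> f)"
      using lsc_bdd[of "\<lambda>x. - f x"] that by (auto simp: fneg intro: continuous_intros)
  qed (use that lsc_bdd in auto)
  have opS: "open s" if "s \<in> S" for s
  proof -
    have 1: "open {\<gamma>::'a finmeas. q < measure (meas \<gamma>) G}" if "open G" for G q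
    proof -
      have "{\<gamma>::'a finmeas. q < measure (meas \<gamma>) G} = (\<Union>n. {\<gamma>. q < fint \<gamma> (inner_approx G n)})" (is "?L = ?R")
      proof
        show "?L \<subseteq> ?R"
          using order_tendstoD(1)[OF fint_inner_approx_tendsto[OF that], of q]
          by (force simp: eventually_sequentially)
        have "fint \<gamma> (inner_approx G n) \<le> measure (meas \<gamma>) G" for \<gamma> n
        proof -
          have "fint \<gamma> (inner_approx G n) \<le> fint \<gamma> (indicator G)" using that
            by (intro fint_mono inner_approx_le continuous_bounded_bB inner_approx inner_approx_bounded bB_I[where B=1])
               (auto simp: indicator_def)
          then show ?thesis using that by (simp add: fint_def)
        qed
        then show "?R \<subseteq> ?L" by (auto intro: less_le_trans)
      qed
      also have "open \<dots>"
        by (intro open_UN ballI open_Collect_less continuous_intros continuous_fint inner_approx inner_approx_bounded)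
      finally show ?thesis .
    qed
    have 2: "open {\<gamma>::'a finmeas. measure (meas \<gamma>) UNIV < q}" for q
    proof -
      have "open {\<gamma>::'a finmeas. fint \<gamma> (\<lambda>_. 1) < q}"
        by (intro open_Collect_less continuous_intros continuous_fint) auto
      then show ?thesis by (simp add: fint_const)
    qed
    from that 1 2 oU show ?thesis unfolding S_def by auto
  qed
  have "(open :: 'a finmeas set \<Rightarrow> bool) = generate_topology S"
  proof (intro ext iffI)
    fix X :: "'a finmeas set"
    assume "open X"
    then show "generate_topology S X"
      unfolding open_finmeas_def
      by induction (auto intro: generate_topology.intros sub1)
  next
    fix X :: "'a finmeas set"
    assume "generate_topology S X"
    then show "open X" by induction (auto intro: opS)
  qed
  with cS show "\<exists>B::'a finmeas set set. countable B \<and> open = generate_topology B" by blast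
qed

section \<open>Cozero sets, Borel sets of the measure space and uniqueness of weak limits\<close>

definition cozero :: "'b::topological_space set \<Rightarrow> bool"
  where "cozero A \<longleftrightarrow> (\<exists>g::'b \<Rightarrow> real. continuous_on UNIV g \<and> (\<forall>x. 0 \<le> g x) \<and> (\<forall>x. g x \<le> 1) \<and> A = {x. 0 < g x})"

lemma cozero_UNIV: "cozero UNIV"
  unfolding cozero_def by (rule exI[of _ "\<lambda>_. 1"]) auto

lemma cozero_Int: assumes "cozero A" "cozero B" shows "cozero (A \<inter> B)"
proof -
  from assms obtain f g :: "'a \<Rightarrow> real" where "continuous_on UNIV f" "\<And>x. 0 \<le> f x" "\<And>x. f x \<le> 1" "A = {x. 0 < f x}"
     "continuous_on UNIV g" "\<And>x. 0 \<le> g x" "\<And>x. g x \<le> 1" "B = {x. 0 < g x}"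
    unfolding cozero_def by metis
  moreover from this have "0 \<le> f x * g x" "f x * g x \<le> 1" "0 < f x * g x \<longleftrightarrow> 0 < f x \<and> 0 < g x" for x
    by (simp_all add: mult_le_one zero_less_mult_iff) (meson not_less)+
  ultimately show ?thesis unfolding cozero_def
    by (intro exI[of _ "\<lambda>x. f x * g x"]) (auto intro: continuous_on_mult)
qed

lemma cozero_open: "cozero A \<Longrightarrow> open A"
  unfolding cozero_def by (auto intro!: open_Collect_less continuous_intros)

lemma cozero_fint:
  assumes "continuous_on UNIV f" "bounded (range f)" "open U"
  shows "cozero {\<gamma>. fint \<gamma> f \<in> U}"
proof (cases "U = UNIV")
  case True
  then show ?thesis using cozero_UNIV by simp
next
  case False
  have "{\<gamma>. fint \<gamma> f \<in> U} = {\<gamma>. 0 < min 1 (infdist (fint \<gamma> f) (- U))}"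
  proof -
    have "x \<in> U \<longleftrightarrow> 0 < infdist x (- U)" for x
      using infdist_pos_not_in_closed[of "- U" x] False assms(3) by (cases "x \<in> U") auto
    then show ?thesis by simp
  qed
  then show ?thesis unfolding cozero_def
    by (intro exI[of _ "\<lambda>\<gamma>. min 1 (infdist (fint \<gamma> f) (- U))"])
       (auto intro!: continuous_intros continuous_fint assms infdist_nonneg)
qed

text \<open>The subbasic sets are cozero sets and cozero sets are stable under finite intersections,
  so they form a basis. They take over the role of open sets in a metric space, where each open set
  is the positivity set of a continuous function.\<close>

lemma open_finmeas_cozero:
  fixes X :: "'a::topological_space finmeas set"
  assumes "open X" "x \<in> X"
  shows "\<exists>A. cozero A \<and> x \<in> A \<and> A \<subseteq> X"
  using assms unfolding open_finmeas_def
proof (induction arbitrary: x)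
  case UNIV
  then show ?case using cozero_UNIV by auto
next
  case (Int a b)
  then obtain A A' where "cozero A" "x \<in> A" "A \<subseteq> a" "cozero A'" "x \<in> A'" "A' \<subseteq> b" by blast
  then show ?case by (intro exI[of _ "A \<inter> A'"]) (auto intro: cozero_Int)
next
  case (UN K)
  then show ?case by (meson UnionE Union_upper subset_trans)
next
  case (Basis s)
  then show ?case using cozero_fint by fastforce
qed

text \<open>An open set is a union of cozero sets over an index set of any size; the Lindelof
  property reduces it to a countable union, which stays in the generated \<sigma>-algebra.\<close>

lemma borel_finmeas_cozero:
  "sets (borel :: 'a::polish_space finmeas measure) = sigma_sets UNIV (Collect cozero)"
proof
  have "X \<in> sigma_sets UNIV (Collect cozero)" if "open X" for X :: "'a finmeas set"
  proof -
    obtain F where F: "F \<subseteq> {A. cozero A \<and> A \<subseteq> X}" "countable F" "\<Union>F = \<Union>{A. cozero A \<and> A \<subseteq> X}"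
      using Lindelof[of "{A. cozero A \<and> A \<subseteq> X}"] cozero_open by auto
    have "X = \<Union>F" using open_finmeas_cozero[OF that] unfolding F(3) by auto
    also have "\<dots> \<in> sigma_sets UNIV (Collect cozero)"
      using F by (intro sigma_sets_UNION) auto
    finally show ?thesis .
  qed
  then show "sets (borel :: 'a finmeas measure) \<subseteq> sigma_sets UNIV (Collect cozero)"
    unfolding borel_def by (auto intro!: sigma_sets_mono)
  show "sigma_sets UNIV (Collect cozero) \<subseteq> sets (borel :: 'a finmeas measure)"
    by (intro sets.sigma_sets_subset') (auto intro: cozero_open borel_open)
qed

text \<open>This gives uniqueness of weak limits. Cozero sets are an intersection-stable generator,
  and the indicator of a cozero set is the limit of the continuous functions
  \<open>min 1 (n * g)\<close>.\<close>

lemma finmeas_measure_eqI: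
  fixes M N :: "'a::polish_space finmeas measure"
  assumes M: "finite_measure M" "sets M = sets borel" and N: "finite_measure N" "sets N = sets borel"
    and eq: "\<And>f::'a finmeas \<Rightarrow> real. continuous_on UNIV f \<Longrightarrow> bounded (range f) \<Longrightarrow> (\<integral>x. f x \<partial>M) = (\<integral>x. f x \<partial>N)"
  shows "M = N"
proof (rule measure_eqI_generator_eq[where E="Collect cozero" and \<Omega>=UNIV and A="\<lambda>_. UNIV"])
  fix X :: "'a finmeas set" assume "X \<in> Collect cozero"
  then obtain g where g: "continuous_on UNIV g" "\<And>x. 0 \<le> g x" "\<And>x. g x \<le> (1::real)" "X = {x. 0 < g x}"
    unfolding cozero_def by auto
  have gm [measurable]: "g \<in> borel_measurable borel" using g(1) by (rule borel_measurable_continuous_onI)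
  define f where "f n x = min 1 (real n * g x)" for n x
  have fc: "continuous_on UNIV (f n)" for n unfolding f_def by (intro continuous_intros g)
  have fb: "0 \<le> f n x" "f n x \<le> 1" for n x using g(2) by (auto simp: f_def)
  have lim: "(\<lambda>n. f n x) \<longlonglongrightarrow> indicator X x" for x
  proof (cases "0 < g x")
    case True
    then obtain n0 where "1 < real n0 * g x" using reals_Archimedean3 by blast
    then have "f n x = 1" if "n \<ge> n0" for n
    proof -
      have "real n0 * g x \<le> real n * g x" using that True by (intro mult_right_mono) auto
      then show ?thesis using \<open>1 < real n0 * g x\<close> by (simp add: f_def)
    qed
    then show ?thesis using True g(4)
      by (intro tendsto_eventually) (auto simp: eventually_sequentially)
  next
    case False
    then have "g x = 0" using g(2)[of x] by simp
    then show ?thesis using g(4) by (simp add: f_def)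
  qed
  have conv: "(\<lambda>n. \<integral>x. f n x \<partial>K) \<longlonglongrightarrow> measure K X" if K: "finite_measure K" "sets K = sets borel" for K
  proof -
    note K(2)[measurable_cong]
    have XK [measurable]: "X \<in> sets K" using g(1) by (auto simp: K g(4) intro!: borel_open open_Collect_less continuous_intros)
    have "(\<lambda>n. \<integral>x. f n x \<partial>K) \<longlonglongrightarrow> (\<integral>x. indicator X x \<partial>K)"
      by (rule integral_dominated_convergence[where w="\<lambda>_. 1"])
         (use K lim fb in \<open>auto simp: finite_measure.integrable_const f_def\<close>)
    then show ?thesis using sets_eq_imp_space_eq[OF K(2)] by simp
  qed
  have "(\<integral>x. f n x \<partial>M) = (\<integral>x. f n x \<partial>N)" for n
    using fb by (intro eq fc) (auto simp: bounded_iff intro!: exI[of _ 1])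
  then have "measure M X = measure N X"
    using conv[OF M] conv[OF N] LIMSEQ_unique by simp
  then show "emeasure M X = emeasure N X"
    using M N by (simp add: finite_measure.emeasure_eq_measure)
qed (use M N cozero_UNIV in \<open>auto simp: Int_stable_def cozero_Int borel_finmeas_cozero finite_measure.emeasure_finite\<close>)

text \<open>Indicators of open sets are limits of \<open>inner_approx\<close>; a Dynkin argument
  gives all Borel sets, and since the class \<open>P\<close> is linear and closed under limits in
  the mean, it contains every integrable function.\<close>

lemma integrable_approx_continuous:
  fixes f :: "'a::metric_space \<Rightarrow> real"
  assumes N: "finite_measure N" "sets N = sets borel" and f: "integrable N f" and "0 < \<epsilon>"
  shows "\<exists>g. continuous_on UNIV g \<and> bounded (range g) \<and> (\<integral>x. \<bar>f x - g x\<bar> \<partial>N) < \<epsilon>"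
proof -
  note N(2)[measurable_cong]
  have spN: "space N = UNIV" using sets_eq_imp_space_eq[OF N(2)] by simp
  have gint: "integrable N g" if g: "continuous_on UNIV g" "bounded (range g)" for g :: "'a \<Rightarrow> real"
  proof -
    obtain B where "\<And>x. \<bar>g x\<bar> \<le> B" using g(2) by (auto simp: bounded_iff)
    then show ?thesis using g(1) N
      by (intro integrable_bounded[of N g B]) (auto simp: measurable_cong_sets[OF N(2) refl] intro: borel_measurable_continuous_onI)
  qed
  define P where "P f \<longleftrightarrow> (\<forall>\<epsilon>>0. \<exists>g. continuous_on UNIV g \<and> bounded (range g) \<and> (\<integral>x. \<bar>f x - g x\<bar> \<partial>N) < \<epsilon>)"
    for f :: "'a \<Rightarrow> real"
  have scale: "P (\<lambda>x. c * f x)" if f: "P f" "integrable N f" for c f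
    unfolding P_def
  proof (intro allI impI)
    fix e :: real assume "0 < e"
    then have "0 < e / (\<bar>c\<bar> + 1)" by simp
    then obtain g where g: "continuous_on UNIV g" "bounded (range g)" "(\<integral>x. \<bar>f x - g x\<bar> \<partial>N) < e / (\<bar>c\<bar> + 1)"
      using f(1) unfolding P_def by blast
    have "(\<integral>x. \<bar>c * f x - c * g x\<bar> \<partial>N) = \<bar>c\<bar> * (\<integral>x. \<bar>f x - g x\<bar> \<partial>N)"
      by (simp add: abs_mult flip: right_diff_distrib)
    also have "\<dots> \<le> (\<bar>c\<bar> + 1) * (\<integral>x. \<bar>f x - g x\<bar> \<partial>N)"
      by (intro mult_right_mono) auto
    also have "\<dots> < e" using g(3) by (simp add: field_simps)
    finally have lt: "(\<integral>x. \<bar>c * f x - c * g x\<bar> \<partial>N) < e" .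
    have "bounded (range (\<lambda>x. c * g x))"
      using bounded_scaling[OF g(2), of c] by (simp add: image_image)
    with lt g(1) show "\<exists>g. continuous_on UNIV g \<and> bounded (range g) \<and> (\<integral>x. \<bar>c * f x - g x\<bar> \<partial>N) < e"
      by (intro exI[of _ "\<lambda>x. c * g x"]) (auto intro!: continuous_intros)
  qed
  have add: "P (\<lambda>x. f x + g x)" if fg: "P f" "P g" "integrable N f" "integrable N g" for f g
    unfolding P_def
  proof (intro allI impI)
    fix e :: real assume e: "0 < e"
    obtain f' where f': "continuous_on UNIV f'" "bounded (range f')" "(\<integral>x. \<bar>f x - f' x\<bar> \<partial>N) < e/2"
      using fg(1) e unfolding P_def by (meson half_gt_zero)
    obtain g' where g': "continuous_on UNIV g'" "bounded (range g')" "(\<integral>x. \<bar>g x - g' x\<bar> \<partial>N) < e/2"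
      using fg(2) e unfolding P_def by (meson half_gt_zero)
    have i: "integrable N (\<lambda>x. \<bar>f x - f' x\<bar>)" "integrable N (\<lambda>x. \<bar>g x - g' x\<bar>)"
      using fg gint f' g' by auto
    have "(\<integral>x. \<bar>f x + g x - (f' x + g' x)\<bar> \<partial>N) \<le> (\<integral>x. \<bar>f x - f' x\<bar> + \<bar>g x - g' x\<bar> \<partial>N)"
      using fg gint f' g' by (intro integral_mono) auto
    also have "\<dots> < e" using i f'(3) g'(3) by simp
    finally show "\<exists>h. continuous_on UNIV h \<and> bounded (range h) \<and> (\<integral>x. \<bar>f x + g x - h x\<bar> \<partial>N) < e"
      using f' g' by (intro exI[of _ "\<lambda>x. f' x + g' x"]) (auto intro!: continuous_intros bounded_plus_comp)
  qed
  have lim: "P f" if s: "\<And>i. P (s i)" "\<And>i::nat. integrable N (s i)"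
    and l: "(\<lambda>i. \<integral>x. \<bar>f x - s i x\<bar> \<partial>N) \<longlonglongrightarrow> 0" and fi: "integrable N f" for f s
    unfolding P_def
  proof (intro allI impI)
    fix e :: real assume e: "0 < e"
    then obtain i where i: "(\<integral>x. \<bar>f x - s i x\<bar> \<partial>N) < e/2"
      using order_tendstoD(2)[OF l, of "e/2"] by (auto simp: eventually_sequentially)
    obtain g where g: "continuous_on UNIV g" "bounded (range g)" "(\<integral>x. \<bar>s i x - g x\<bar> \<partial>N) < e/2"
      using s(1)[of i] e unfolding P_def by (meson half_gt_zero)
    have ii: "integrable N (\<lambda>x. \<bar>f x - s i x\<bar>)" "integrable N (\<lambda>x. \<bar>s i x - g x\<bar>)"
      using fi s(2) gint g by auto
    have "(\<integral>x. \<bar>f x - g x\<bar> \<partial>N) \<le> (\<integral>x. \<bar>f x - s i x\<bar> + \<bar>s i x - g x\<bar> \<partial>N)"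
      using fi s(2) gint g by (intro integral_mono) auto
    also have "\<dots> < e" using ii i g(3) by simp
    finally show "\<exists>h. continuous_on UNIV h \<and> bounded (range h) \<and> (\<integral>x. \<bar>f x - h x\<bar> \<partial>N) < e"
      using g by auto
  qed
  have ind: "P (indicator A)" if A: "A \<in> sets N" for A
  proof -
    have "Int_stable {S::'a set. open S}" "{S::'a set. open S} \<subseteq> Pow UNIV" "A \<in> sigma_sets UNIV {S::'a set. open S}"
      using A N by (auto simp: borel_def Int_stable_def)
    then show ?thesis
    proof (induction rule: sigma_sets_induct_disjoint)
      case (basic S)
      then have S: "open S" by simp
      show ?case
      proof (rule lim)
        show "P (inner_approx S n)" for n
          unfolding P_def using inner_approx_bounded[of S n] inner_approx(1)[of S n]
          by (intro allI impI exI[of _ "inner_approx S n"]) auto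
        show "integrable N (inner_approx S i)" for i by (intro gint inner_approx inner_approx_bounded)
        show "integrable N (indicator S :: 'a \<Rightarrow> real)" using S N by (auto simp: finite_measure.emeasure_finite less_top[symmetric])
        have "(\<lambda>i. \<integral>x. \<bar>indicator S x - inner_approx S i x\<bar> \<partial>N) \<longlonglongrightarrow> (\<integral>x. 0 \<partial>N)"
        proof (rule integral_dominated_convergence[where w="\<lambda>_. 1"])
          show "integrable N (\<lambda>_. 1::real)" by (rule finite_measure.integrable_const[OF N(1)])
          have [measurable]: "inner_approx S i \<in> borel_measurable borel" for i
            by (intro borel_measurable_continuous_onI inner_approx)
          show "(\<lambda>x. \<bar>indicator S x - inner_approx S i x\<bar>) \<in> borel_measurable N" for i
            using S by (intro borel_measurable_abs borel_measurable_diff) (auto simp: measurable_cong_sets[OF N(2) refl])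
          show "AE x in N. (\<lambda>i. \<bar>indicator S x - inner_approx S i x\<bar>) \<longlonglongrightarrow> 0"
          proof (rule AE_I2)
            show "(\<lambda>i. \<bar>indicator S x - inner_approx S i x\<bar>) \<longlonglongrightarrow> 0" for x
              using tendsto_rabs[OF tendsto_diff[OF tendsto_const inner_approx_tendsto[OF S]], of "indicator S x" x] by simp
          qed
          show "AE x in N. norm \<bar>indicator S x - inner_approx S i x\<bar> \<le> 1" for i
          proof (rule AE_I2)
            show "norm \<bar>indicator S x - inner_approx S i x\<bar> \<le> 1" for x
              using inner_approx(2,3)[of S i x] by (auto simp: indicator_def)
          qed
        qed simp
        then show "(\<lambda>i. \<integral>x. \<bar>indicator S x - inner_approx S i x\<bar> \<partial>N) \<longlonglongrightarrow> 0" by simp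
      qed
    next
      case empty
      show ?case unfolding P_def by (intro allI impI exI[of _ "\<lambda>_. 0"]) auto
    next
      case (compl S)
      have SN: "S \<in> sets N" using compl(1) N by (simp add: borel_def)
      have one: "P (\<lambda>_. 1)" unfolding P_def by (intro allI impI exI[of _ "\<lambda>_. 1"]) auto
      have i: "integrable N (indicator S :: 'a \<Rightarrow> real)"
        using SN by (auto simp: finite_measure.emeasure_finite[OF N(1)] less_top[symmetric])
      have "P (\<lambda>x. 1 + (-1) * indicator S x)"
        by (intro add scale one compl i integrable_mult_right finite_measure.integrable_const[OF N(1)])
      also have "(\<lambda>x. 1 + (-1) * indicator S x) = (indicator (UNIV - S) :: 'a \<Rightarrow> real)"
        by (auto simp: indicator_def)
      finally show ?case .
    next
      case (union S)
      have SN: "S i \<in> sets N" for i using union(2) N by (auto simp: borel_def)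
      have int: "integrable N (indicator (S i) :: 'a \<Rightarrow> real)" for i
        using SN by (auto simp: finite_measure.emeasure_finite[OF N(1)] less_top[symmetric])
      define s where "s n x = (\<Sum>i<n. indicator (S i) x :: real)" for n x
      have si: "integrable N (s n)" for n unfolding s_def[abs_def] by (intro Bochner_Integration.integrable_sum int)
      have "P (s n) \<and> integrable N (s n)" for n
      proof (induction n)
        case 0
        show ?case unfolding P_def s_def by (auto intro!: exI[of _ "\<lambda>_. 0"])
      next
        case (Suc n)
        have "s (Suc n) = (\<lambda>x. s n x + indicator (S n) x)" by (simp add: s_def fun_eq_iff)
        then show ?case using add[OF _ union(3)[of n] _ int] Suc int by auto
      qed
      then have Ps: "P (s n)" for n by blast
      have s_eq: "s n x = indicator (\<Union>i<n. S i) x" for n x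
        unfolding s_def using union(1) by (subst indicator_UN_disjoint) (auto simp: disjoint_family_on_def)
      show ?case
      proof (rule lim[OF Ps si])
        show "integrable N (indicator (\<Union> (range S)) :: 'a \<Rightarrow> real)"
          using SN by (auto simp: finite_measure.emeasure_finite[OF N(1)] less_top[symmetric])
        have "(\<lambda>i. \<integral>x. \<bar>indicator (\<Union> (range S)) x - s i x\<bar> \<partial>N) \<longlonglongrightarrow> (\<integral>x. 0 \<partial>N)"
        proof (rule integral_dominated_convergence[where w="\<lambda>_. 1"])
          show "integrable N (\<lambda>_. 1::real)" by (rule finite_measure.integrable_const[OF N(1)])
          show "(\<lambda>x. \<bar>indicator (\<Union> (range S)) x - s i x\<bar>) \<in> borel_measurable N" for i
            using SN si by measurable
          show "AE x in N. (\<lambda>i. \<bar>indicator (\<Union> (range S)) x - s i x\<bar>) \<longlonglongrightarrow> 0"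
          proof (rule AE_I2)
            fix x
            show "(\<lambda>i. \<bar>indicator (\<Union> (range S)) x - s i x\<bar>) \<longlonglongrightarrow> 0"
            proof (cases "x \<in> \<Union> (range S)")
              case True
              then obtain j where "x \<in> S j" by auto
              then have "\<forall>n\<ge>Suc j. s n x = 1" unfolding s_eq by (auto simp: indicator_def)
              then show ?thesis using True by (intro tendsto_eventually) (auto simp: eventually_sequentially)
            next
              case False
              then have "s n x = 0" for n unfolding s_eq by (auto simp: indicator_def)
              then show ?thesis using False by simp
            qed
          qed
          show "AE x in N. norm \<bar>indicator (\<Union> (range S)) x - s i x\<bar> \<le> 1" for i
            unfolding s_eq by (intro AE_I2) (auto simp: indicator_def)
        qed simp
        then show "(\<lambda>i. \<integral>x. \<bar>indicator (\<Union> (range S)) x - s i x\<bar> \<partial>N) \<longlonglongrightarrow> 0" by simp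
      qed
    qed
  qed
  have "P f" using f
  proof (induction rule: integrable_induct)
    case (base A c)
    have "P (\<lambda>x. c * indicator A x)" using base ind by (intro scale) auto
    then show ?case by (simp add: mult.commute)
  next
    case (add f g)
    then show ?case using \<open>\<And>g f. P f \<Longrightarrow> P g \<Longrightarrow> integrable N f \<Longrightarrow> integrable N g \<Longrightarrow> P (\<lambda>x. f x + g x)\<close> by blast
  next
    case (lim f s)
    show ?case
    proof (rule \<open>\<And>s f. (\<And>i. P (s i)) \<Longrightarrow> (\<And>i::nat. integrable N (s i)) \<Longrightarrow> (\<lambda>i. \<integral>x. \<bar>f x - s i x\<bar> \<partial>N) \<longlonglongrightarrow> 0 \<Longrightarrow> integrable N f \<Longrightarrow> P f\<close>)
      show "P (s i)" "integrable N (s i)" for i by fact+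
      show "integrable N f" by fact
      \<comment> \<open>The approximating simple functions are bounded by twice the absolute value
        of \<open>f\<close>, hence the factor 3 in the majorant.\<close>
      have "(\<lambda>i. \<integral>x. \<bar>f x - s i x\<bar> \<partial>N) \<longlonglongrightarrow> (\<integral>x. 0 \<partial>N)"
      proof (rule integral_dominated_convergence[where w="\<lambda>x. 3 * \<bar>f x\<bar>"])
        show "integrable N (\<lambda>x. 3 * \<bar>f x\<bar>)" using lim by auto
        show "(\<lambda>x. \<bar>f x - s i x\<bar>) \<in> borel_measurable N" for i using lim by auto
        show "AE x in N. (\<lambda>i. \<bar>f x - s i x\<bar>) \<longlonglongrightarrow> 0"
        proof (rule AE_I2)
          show "(\<lambda>i. \<bar>f x - s i x\<bar>) \<longlonglongrightarrow> 0" if "x \<in> space N" for x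
            using tendsto_rabs[OF tendsto_diff[OF tendsto_const lim(2)[OF that]], of "f x"] by simp
        qed
        show "AE x in N. norm \<bar>f x - s i x\<bar> \<le> 3 * \<bar>f x\<bar>" for i
        proof (rule AE_I2)
          show "norm \<bar>f x - s i x\<bar> \<le> 3 * \<bar>f x\<bar>" if "x \<in> space N" for x
            using lim(3)[OF that, of i] by auto
        qed
      qed simp
      then show "(\<lambda>i. \<integral>x. \<bar>f x - s i x\<bar> \<partial>N) \<longlonglongrightarrow> 0" by simp
    qed
  qed
  then show ?thesis using \<open>0 < \<epsilon>\<close> unfolding P_def by blast
qed

text \<open>Cutting an approximant off at 0 only brings it closer to the nonnegative
  \<open>h\<close>. The sign is wanted so that \<open>exp (- fint \<eta> g)\<close> stays
  bounded.\<close>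

lemma bpB_approx_continuous:
  fixes h :: "'a::metric_space \<Rightarrow> real"
  assumes N: "finite_measure N" "sets N = sets borel" and h: "h \<in> bpB" and "0 < \<epsilon>"
  shows "\<exists>g. continuous_on UNIV g \<and> g \<in> bpB \<and> bounded (range g) \<and> (\<integral>x. \<bar>h x - g x\<bar> \<partial>N) < \<epsilon>"
proof -
  have spN: "space N = UNIV" using sets_eq_imp_space_eq[OF N(2)] by simp
  obtain B where B: "\<And>x. \<bar>h x\<bar> \<le> B" using bB_bound[OF bpB_D(1)[OF h]] by metis
  have hi: "integrable N h"
    using B bB_measurable[OF bpB_D(1)[OF h]] by (intro integrable_bounded[OF N(1), of h B]) (auto simp: measurable_cong_sets[OF N(2) refl])
  obtain g where g: "continuous_on UNIV g" "bounded (range g)" "(\<integral>x. \<bar>h x - g x\<bar> \<partial>N) < \<epsilon>"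
    using integrable_approx_continuous[OF N hi \<open>0 < \<epsilon>\<close>] by blast
  obtain C where C: "\<And>x. \<bar>g x\<bar> \<le> C" using g(2) by (auto simp: bounded_iff)
  define g' where "g' x = max 0 (g x)" for x
  have c: "continuous_on UNIV g'" unfolding g'_def by (intro continuous_intros g)
  have b: "0 \<le> g' x" "g' x \<le> C" for x using C[of x] by (auto simp: g'_def)
  have int: "integrable N k" if "continuous_on UNIV k" "\<And>x. \<bar>k x\<bar> \<le> C" for k :: "'a \<Rightarrow> real"
    using that N by (intro integrable_bounded[of N k C]) (auto simp: measurable_cong_sets[OF N(2) refl] intro: borel_measurable_continuous_onI)
  have "\<bar>g' x\<bar> \<le> C" for x using b[of x] by simp
  then have "integrable N g" "integrable N g'" using int[OF g(1) C] int[OF c] by blast+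
  then have "(\<integral>x. \<bar>h x - g' x\<bar> \<partial>N) \<le> (\<integral>x. \<bar>h x - g x\<bar> \<partial>N)"
  proof (intro integral_mono)
    show "\<bar>h x - g' x\<bar> \<le> \<bar>h x - g x\<bar>" for x using bpB_D(2)[OF h, of x] by (auto simp: g'_def)
  qed (use hi in auto)
  with g(3) c b show ?thesis
    by (intro exI[of _ g']) (auto intro!: bpB_I borel_measurable_continuous_onI simp: bounded_iff intro!: exI[of _ C])
qed

section \<open>The branching mechanism\<close>

text \<open>The compensated exponential of the Levy part of the branching mechanism. It is also the
  error made when \<open>1 - exp (- y)\<close> is replaced by \<open>y\<close>, and in that role it
  reappears in the asymptotics of survival probabilities.\<close>

definition excess :: "real \<Rightarrow> real"
  where "excess y = exp (- y) - 1 + y"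

lemma excess_nonneg: "0 \<le> excess y"
  unfolding excess_def using exp_ge_add_one_self[of "-y"] by simp

lemma excess_le_self: "0 \<le> y \<Longrightarrow> excess y \<le> y"
  by (simp add: excess_def)

lemma excess_mono:
  assumes "0 \<le> x" "x \<le> y" shows "excess x \<le> excess y"
proof -
  have "exp (- x) - exp (- y) = exp (- x) * (1 - exp (- (y - x)))"
    by (simp add: algebra_simps flip: exp_add)
  also have "1 - exp (- (y - x)) \<le> y - x" using exp_ge_add_one_self[of "- (y - x)"] by linarith
  then have "exp (- x) * (1 - exp (- (y - x))) \<le> 1 * (y - x)"
    using assms by (intro mult_mono) auto
  finally show ?thesis by (simp add: excess_def)
qed

lemma excess_le_sq:
  assumes "0 \<le> y" shows "excess y \<le> y\<^sup>2"
proof -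
  have "(1 + y) * exp (- y) \<le> 1"
    using exp_ge_add_one_self[of y] by (simp add: exp_minus field_simps)
  then have "exp (- y) \<le> 1 / (1 + y)" using assms by (simp add: field_simps)
  also have "1 / (1 + y) - 1 + y = y\<^sup>2 / (1 + y)" using assms by (simp add: field_simps power2_eq_square)
  finally have "excess y \<le> y\<^sup>2 / (1 + y)" unfolding excess_def
    using \<open>1 / (1 + y) - 1 + y = y\<^sup>2 / (1 + y)\<close> by linarith
  also have "\<dots> \<le> y\<^sup>2 / 1" using assms by (intro divide_left_mono) auto
  finally show ?thesis by simp
qed

lemma excess_measurable [measurable]: "excess \<in> borel_measurable borel"
  unfolding excess_def[abs_def] by measurable

text \<open>The case split at \<open>u = 1\<close> matches the two bounds \<open>y\<close> and
  \<open>y\<^sup>2\<close> of \<open>excess y\<close> with the weight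
  \<open>min u (u\<^sup>2)\<close>, whose integrals against the Levy kernel are bounded.\<close>

lemma excess_scale_le:
  assumes "0 \<le> z" "0 < u"
  shows "excess (z * u) \<le> max z (z\<^sup>2) * min u (u\<^sup>2)"
proof (cases "u \<le> 1")
  case True
  then have "min u (u\<^sup>2) = u\<^sup>2" using assms by (simp add: power2_eq_square mult_left_le min_def)
  moreover have "excess (z * u) \<le> z\<^sup>2 * u\<^sup>2" using excess_le_sq[of "z * u"] assms by (simp add: power_mult_distrib)
  moreover have "z\<^sup>2 * u\<^sup>2 \<le> max z (z\<^sup>2) * u\<^sup>2" by (intro mult_right_mono) auto
  ultimately show ?thesis by simp
next
  case False
  then have "min u (u\<^sup>2) = u" using assms by (simp add: power2_eq_square min_def)
  moreover have "excess (z * u) \<le> z * u" using excess_le_self[of "z * u"] assms by simp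
  moreover have "z * u \<le> max z (z\<^sup>2) * u" using assms by (intro mult_right_mono) auto
  ultimately show ?thesis by simp
qed

locale branching_data =
  fixes \<beta> \<sigma> :: "'e::polish_space \<Rightarrow> real" and \<pi> :: "'e \<Rightarrow> real measure"
  assumes beta: "\<beta> \<in> bB" and sigma: "\<sigma> \<in> bB" and levy: "levy_kernel \<pi>"
begin

lemma beta_measurable [measurable]: "\<beta> \<in> borel_measurable borel" by (rule bB_measurable[OF beta])
lemma sigma_measurable [measurable]: "\<sigma> \<in> borel_measurable borel" by (rule bB_measurable[OF sigma])

lemma sets_pi: "sets (\<pi> x) = sets (restrict_space borel {0<..})"
  using levy by (simp add: levy_kernel_def)

lemma sets_pi_cong [measurable_cong]: "sets (\<pi> x) = sets (restrict_space borel {0<..})"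
  by (rule sets_pi)

lemma space_pi: "space (\<pi> x) = {0<..}"
  using sets_eq_imp_space_eq[OF sets_pi, of x] by (simp add: space_restrict_space)

lemma measurable_pi: "f \<in> borel_measurable borel \<Longrightarrow> f \<in> borel_measurable (\<pi> x)"
  by (simp add: measurable_cong_sets[OF sets_pi refl] measurable_restrict_space1)

lemma levy_bound: "\<exists>C\<ge>0. \<forall>x. (\<integral>\<^sup>+u. ennreal (min u (u\<^sup>2)) \<partial>\<pi> x) \<le> ennreal C"
proof -
  have "(SUP x. \<integral>\<^sup>+u. ennreal (min u (u\<^sup>2)) \<partial>\<pi> x) < \<infinity>" using levy by (simp add: levy_kernel_def)
  then obtain C where C: "(SUP x. \<integral>\<^sup>+u. ennreal (min u (u\<^sup>2)) \<partial>\<pi> x) = ennreal C" "0 \<le> C"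
    by (cases "SUP x. \<integral>\<^sup>+u. ennreal (min u (u\<^sup>2)) \<partial>\<pi> x") auto
  have "(\<integral>\<^sup>+u. ennreal (min u (u\<^sup>2)) \<partial>\<pi> x) \<le> ennreal C" for x
    unfolding C(1)[symmetric] by (rule SUP_upper) simp
  then show ?thesis using C(2) by blast
qed

lemma nn_integral_pi_measurable:
  assumes "f \<in> borel_measurable (restrict_space borel {0<..})"
  shows "(\<lambda>x. \<integral>\<^sup>+u. f u \<partial>\<pi> x) \<in> borel_measurable borel"
  using assms
proof induction
  case (cong f g)
  then have "(\<integral>\<^sup>+u. f u \<partial>\<pi> x) = (\<integral>\<^sup>+u. g u \<partial>\<pi> x)" for x
    by (intro nn_integral_cong) (simp add: space_pi space_restrict_space)
  then show ?case using cong by simp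
next
  case (set A)
  then have "(\<lambda>x. emeasure (\<pi> x) A) \<in> borel_measurable borel" using levy by (simp add: levy_kernel_def)
  then show ?case using set by (simp add: sets_pi)
next
  case (mult u c)
  then show ?case by (simp add: nn_integral_cmult measurable_cong_sets[OF sets_pi refl])
next
  case (add u v)
  then show ?case by (simp add: nn_integral_add measurable_cong_sets[OF sets_pi refl])
next
  case (seq U)
  then show ?case
    by (simp add: nn_integral_monotone_convergence_SUP image_comp SUP_apply measurable_cong_sets[OF sets_pi refl])
qed

text \<open>The branching mechanism without its linear term, which is absorbed into the mean
  semigroup. What remains is nonnegative and increasing in \<open>z\<close>, so that cumulants lie
  below the mean semigroup.\<close>

definition psi0 :: "'e \<Rightarrow> real \<Rightarrow> real"
  where "psi0 x z = (\<sigma> x)\<^sup>2 * z\<^sup>2 + (\<integral>u. excess (z * u) \<partial>\<pi> x)"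

lemma branching_mechanism_eq: "branching_mechanism \<beta> \<sigma> \<pi> x z = psi0 x z - \<beta> x * z"
  by (simp add: branching_mechanism_def psi0_def excess_def)

lemma excess_integrable:
  assumes "0 \<le> z"
  shows "integrable (\<pi> x) (\<lambda>u. excess (z * u))"
    and "(\<integral>\<^sup>+u. ennreal (excess (z * u)) \<partial>\<pi> x) = ennreal (\<integral>u. excess (z * u) \<partial>\<pi> x)"
    and "(\<integral>\<^sup>+u. ennreal (excess (z * u)) \<partial>\<pi> x) \<le> ennreal (max z (z\<^sup>2)) * (\<integral>\<^sup>+u. ennreal (min u (u\<^sup>2)) \<partial>\<pi> x)"
proof -
  have [measurable]: "(\<lambda>u. excess (z * u)) \<in> borel_measurable (\<pi> x)" "(\<lambda>u. min u (u\<^sup>2)) \<in> borel_measurable (\<pi> x)"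
    by (intro measurable_pi; measurable)+
  have "(\<integral>\<^sup>+u. ennreal (excess (z * u)) \<partial>\<pi> x) \<le> (\<integral>\<^sup>+u. ennreal (max z (z\<^sup>2)) * ennreal (min u (u\<^sup>2)) \<partial>\<pi> x)"
    using assms by (intro nn_integral_mono) (auto simp: space_pi ennreal_mult[symmetric] intro!: ennreal_leI excess_scale_le)
  then show le: "(\<integral>\<^sup>+u. ennreal (excess (z * u)) \<partial>\<pi> x) \<le> ennreal (max z (z\<^sup>2)) * (\<integral>\<^sup>+u. ennreal (min u (u\<^sup>2)) \<partial>\<pi> x)"
    by (simp add: nn_integral_cmult)
  also have "\<dots> < \<infinity>" using levy_bound by (metis ennreal_less_top ennreal_mult_less_top infinity_ennreal_def le_less_trans)
  finally show int: "integrable (\<pi> x) (\<lambda>u. excess (z * u))"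
    by (intro integrableI_nonneg) (auto simp: excess_nonneg)
  show "(\<integral>\<^sup>+u. ennreal (excess (z * u)) \<partial>\<pi> x) = ennreal (\<integral>u. excess (z * u) \<partial>\<pi> x)"
    by (intro nn_integral_eq_integral int) (auto simp: excess_nonneg)
qed

lemma psi0_nonneg: "0 \<le> psi0 x z"
  unfolding psi0_def by (intro add_nonneg_nonneg Bochner_Integration.integral_nonneg excess_nonneg) simp

lemma psi0_mono:
  assumes "0 \<le> y" "y \<le> z"
  shows "psi0 x y \<le> psi0 x z"
  unfolding psi0_def
proof (intro add_mono mult_left_mono integral_mono excess_integrable)
  show "excess (y * u) \<le> excess (z * u)" if "u \<in> space (\<pi> x)" for u
    using that assms by (intro excess_mono mult_right_mono) (auto simp: space_pi)
qed (use assms in \<open>auto intro!: power_mono\<close>)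

lemma psi0_bound: "\<exists>C\<ge>0. \<forall>x. \<forall>z\<ge>0. psi0 x z \<le> C * max z (z\<^sup>2)"
proof -
  obtain C where C: "0 \<le> C" "\<And>x. (\<integral>\<^sup>+u. ennreal (min u (u\<^sup>2)) \<partial>\<pi> x) \<le> ennreal C" using levy_bound by blast
  obtain S where S: "0 < S" "\<And>x. \<bar>\<sigma> x\<bar> \<le> S" using bB_bound[OF sigma] by metis
  have "psi0 x z \<le> (S\<^sup>2 + C) * max z (z\<^sup>2)" if z: "0 \<le> z" for x z
  proof -
    have "ennreal (\<integral>u. excess (z * u) \<partial>\<pi> x) \<le> ennreal (max z (z\<^sup>2)) * ennreal C"
      unfolding excess_integrable(2)[OF z, symmetric]
      by (rule order_trans[OF excess_integrable(3)[OF z] mult_left_mono[OF C(2)]]) simp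
    then have 1: "(\<integral>u. excess (z * u) \<partial>\<pi> x) \<le> max z (z\<^sup>2) * C"
      using C(1) z by (simp add: ennreal_mult[symmetric] le_max_iff_disj)
    have "(\<sigma> x)\<^sup>2 \<le> S\<^sup>2" using S(2)[of x] power_mono[of "\<bar>\<sigma> x\<bar>" S 2] by simp
    then have "(\<sigma> x)\<^sup>2 * z\<^sup>2 \<le> S\<^sup>2 * max z (z\<^sup>2)" by (intro mult_mono) auto
    with 1 show ?thesis unfolding psi0_def by (simp add: algebra_simps)
  qed
  then show ?thesis using C by (intro exI[of _ "S\<^sup>2 + C"]) auto
qed

lemma psi0_measurable1: "0 \<le> z \<Longrightarrow> (\<lambda>x. psi0 x z) \<in> borel_measurable borel"
proof -
  assume z: "0 \<le> z"
  have "(\<integral>u. excess (z * u) \<partial>\<pi> x) = enn2real (\<integral>\<^sup>+u. ennreal (excess (z * u)) \<partial>\<pi> x)" for x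
    using excess_integrable(2)[OF z, of x] by (simp add: excess_nonneg)
  moreover have "(\<lambda>x. \<integral>\<^sup>+u. ennreal (excess (z * u)) \<partial>\<pi> x) \<in> borel_measurable borel"
    by (intro nn_integral_pi_measurable measurable_restrict_space1) measurable
  ultimately show ?thesis unfolding psi0_def by simp
qed

text \<open>A convergent sequence is bounded by some \<open>B\<close>, and monotonicity makes
  \<open>excess (B * u)\<close> an integrable majorant.\<close>

lemma psi0_tendsto:
  assumes "0 \<le> z" "\<And>n. 0 \<le> y n" "y \<longlonglongrightarrow> z"
  shows "(\<lambda>n. psi0 x (y n)) \<longlonglongrightarrow> psi0 x z"
  unfolding psi0_def
proof (intro tendsto_intros assms(3))
  obtain B where "0 < B" and B: "\<And>n. \<bar>y n\<bar> \<le> B"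
    using convergent_imp_Bseq[of y] assms(3) by (auto simp: convergent_def Bseq_def)
  show "(\<lambda>n. \<integral>u. excess (y n * u) \<partial>\<pi> x) \<longlonglongrightarrow> (\<integral>u. excess (z * u) \<partial>\<pi> x)"
  proof (rule integral_dominated_convergence[where w="\<lambda>u. excess (B * u)"])
    show "integrable (\<pi> x) (\<lambda>u. excess (B * u))" using \<open>0 < B\<close> by (intro excess_integrable) simp
    show "AE u in \<pi> x. (\<lambda>n. excess (y n * u)) \<longlonglongrightarrow> excess (z * u)"
      unfolding excess_def by (intro AE_I2 tendsto_intros assms(3))
    show "AE u in \<pi> x. norm (excess (y n * u)) \<le> excess (B * u)" for n
      using B[of n] assms(2)[of n] by (intro AE_I2) (auto simp: space_pi excess_nonneg intro!: excess_mono mult_right_mono)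
  qed (intro measurable_pi; measurable)+
qed

text \<open>\<open>psi0\<close> is measurable in \<open>x\<close> and continuous in
  \<open>z\<close>, hence jointly measurable: \<open>z\<close> is replaced by grid values, countably
  many for each mesh. The cutoff \<open>max 0 z\<close> stands there because continuity and
  integrability are established for nonnegative \<open>z\<close>.\<close>

lemma psi0_measurable2: "(\<lambda>(x, z). psi0 x (max 0 z)) \<in> borel_measurable (borel \<Otimes>\<^sub>M borel)"
proof -
  define r where "r n z = real_of_int \<lfloor>real (Suc n) * max 0 z\<rfloor> / real (Suc n)" for n z
  have r0: "0 \<le> r n z" for n z by (simp add: r_def)
  have rlim: "(\<lambda>n. r n z) \<longlonglongrightarrow> max 0 z" for z
  proof (rule tendsto_sandwich[where f="\<lambda>n. max 0 z - 1 / real (Suc n)" and h="\<lambda>_. max 0 z"])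
    have b: "max 0 z - 1 / real (Suc n) \<le> r n z \<and> r n z \<le> max 0 z" for n
    proof -
      have "real (Suc n) * max 0 z - 1 \<le> real_of_int \<lfloor>real (Suc n) * max 0 z\<rfloor>"
        "real_of_int \<lfloor>real (Suc n) * max 0 z\<rfloor> \<le> real (Suc n) * max 0 z" by linarith+
      from divide_right_mono[OF this(1), of "real (Suc n)"] divide_right_mono[OF this(2), of "real (Suc n)"]
      show ?thesis unfolding r_def by (simp add: diff_divide_distrib)
    qed
    show "\<forall>\<^sub>F n in sequentially. max 0 z - 1 / real (Suc n) \<le> r n z"
      "\<forall>\<^sub>F n in sequentially. r n z \<le> max 0 z" using b by auto
    show "(\<lambda>n. max 0 z - 1 / real (Suc n)) \<longlonglongrightarrow> max 0 z"
      using tendsto_diff[OF tendsto_const LIMSEQ_Suc[OF lim_1_over_n], of "max 0 z"] by simp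
  qed simp
  have "(\<lambda>xz. psi0 (fst xz) (r n (snd xz))) \<in> borel_measurable (borel \<Otimes>\<^sub>M borel)" for n
  proof -
    have "(\<lambda>xz. psi0 (fst xz) (real_of_int (max 0 i) / real (Suc n))) \<in> borel_measurable (borel \<Otimes>\<^sub>M (borel :: real measure))" for i :: int
      by (intro measurable_compose[OF measurable_fst psi0_measurable1]) simp
    from measurable_compose_countable[OF this, of "\<lambda>xz. \<lfloor>real (Suc n) * max 0 (snd xz)\<rfloor>"]
    have "(\<lambda>xz. psi0 (fst xz) (real_of_int (max 0 \<lfloor>real (Suc n) * max 0 (snd xz)\<rfloor>) / real (Suc n))) \<in> borel_measurable (borel \<Otimes>\<^sub>M (borel :: real measure))"
      by measurable
    moreover have "max 0 \<lfloor>real (Suc n) * max 0 z\<rfloor> = \<lfloor>real (Suc n) * max 0 z\<rfloor>" for z :: real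
      by (simp add: max_absorb2)
    ultimately show ?thesis unfolding r_def by simp
  qed
  then have "(\<lambda>xz. psi0 (fst xz) (max 0 (snd xz))) \<in> borel_measurable (borel \<Otimes>\<^sub>M borel)"
    by (rule borel_measurable_LIMSEQ_real[where u="\<lambda>n xz. psi0 (fst xz) (r n (snd xz))", rotated])
       (rule psi0_tendsto[OF _ r0 rlim], simp)
  then show ?thesis by (simp add: case_prod_unfold)
qed

text \<open>Linear functionals of the superprocess are obtained by differentiating its Laplace functional
  at 0; there the nonlinear part of the branching mechanism is negligible.\<close>

lemma psi0_div_tendsto:
  assumes "0 \<le> b"
  shows "(\<lambda>n. real (Suc n) * psi0 x (b / real (Suc n))) \<longlonglongrightarrow> 0"
    and "\<exists>C\<ge>0. \<forall>n x. real (Suc n) * psi0 x (b / real (Suc n)) \<le> C"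
proof -
  have eq: "real (Suc n) * psi0 x (b / real (Suc n)) =
     (\<sigma> x)\<^sup>2 * b\<^sup>2 * (1 / real (Suc n)) + (\<integral>u. real (Suc n) * excess (b / real (Suc n) * u) \<partial>\<pi> x)" for n
  proof -
    have A: "real (Suc n) * ((\<sigma> x)\<^sup>2 * (b / real (Suc n))\<^sup>2) = (\<sigma> x)\<^sup>2 * b\<^sup>2 * (1 / real (Suc n))"
      by (simp add: power2_eq_square)
    show ?thesis unfolding psi0_def by (simp only: distrib_left A integral_mult_right_zero)
  qed
  \<comment> \<open>With \<open>z = b / Suc n\<close>, the factor \<open>max z (z\<^sup>2)\<close>
    is at most \<open>max b (b\<^sup>2) / Suc n\<close>; the prefactor cancels and the majorant does
    not depend on \<open>n\<close>.\<close>
  have le1: "real (Suc n) * excess (b / real (Suc n) * u) \<le> max b (b\<^sup>2) * min u (u\<^sup>2)" if "0 < u" for n u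
  proof -
    have "excess (b / real (Suc n) * u) \<le> max (b / real (Suc n)) ((b / real (Suc n))\<^sup>2) * min u (u\<^sup>2)"
      using that assms by (intro excess_scale_le) auto
    also have "max (b / real (Suc n)) ((b / real (Suc n))\<^sup>2) \<le> max b (b\<^sup>2) / real (Suc n)"
    proof -
      have "(b / real (Suc n))\<^sup>2 = b\<^sup>2 / real (Suc n) * (1 / real (Suc n))" by (simp add: power2_eq_square)
      also have "\<dots> \<le> b\<^sup>2 / real (Suc n) * 1" by (intro mult_left_mono) auto
      finally have "(b / real (Suc n))\<^sup>2 \<le> max b (b\<^sup>2) / real (Suc n)"
        by (simp add: order_trans[OF _ divide_right_mono])
      moreover have "b / real (Suc n) \<le> max b (b\<^sup>2) / real (Suc n)" by (intro divide_right_mono) auto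
      ultimately show ?thesis by (rule max.boundedI[rotated])
    qed
    finally show ?thesis using that by (simp add: field_simps mult_right_mono)
  qed
  have "(\<lambda>n. \<integral>u. real (Suc n) * excess (b / real (Suc n) * u) \<partial>\<pi> x) \<longlonglongrightarrow> (\<integral>u. 0 \<partial>\<pi> x)"
  proof (rule integral_dominated_convergence[where w="\<lambda>u. max b (b\<^sup>2) * min u (u\<^sup>2)"])
    obtain C where C: "\<And>x. (\<integral>\<^sup>+u. ennreal (min u (u\<^sup>2)) \<partial>\<pi> x) \<le> ennreal C" using levy_bound by blast
    show "integrable (\<pi> x) (\<lambda>u. max b (b\<^sup>2) * min u (u\<^sup>2))"
    proof (intro integrable_mult_right integrableI_nonneg)
      show "(\<integral>\<^sup>+u. ennreal (min u (u\<^sup>2)) \<partial>\<pi> x) < \<infinity>" using C[of x] by (simp add: le_less_trans)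
      show "(\<lambda>u. min u (u\<^sup>2)) \<in> borel_measurable (\<pi> x)" by (intro measurable_pi) measurable
    qed (auto simp: space_pi)
    show "AE u in \<pi> x. norm (real (Suc n) * excess (b / real (Suc n) * u)) \<le> max b (b\<^sup>2) * min u (u\<^sup>2)" for n
      using le1[of _ n] by (intro AE_I2) (simp add: space_pi excess_nonneg)
    show "AE u in \<pi> x. (\<lambda>n. real (Suc n) * excess (b / real (Suc n) * u)) \<longlonglongrightarrow> 0"
    proof (rule AE_I2)
      fix u assume "u \<in> space (\<pi> x)"
      then have u: "0 < u" by (simp add: space_pi)
      have "real (Suc n) * excess (b / real (Suc n) * u) \<le> (b * u)\<^sup>2 * (1 / real (Suc n))" for n
      proof -
        have "real (Suc n) * excess (b / real (Suc n) * u) \<le> real (Suc n) * (b / real (Suc n) * u)\<^sup>2"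
          using u assms by (intro mult_left_mono excess_le_sq) auto
        also have "\<dots> = (b * u)\<^sup>2 * (1 / real (Suc n))" by (simp add: power2_eq_square)
        finally show ?thesis .
      qed
      moreover have "(\<lambda>n. (b * u)\<^sup>2 * (1 / real (Suc n))) \<longlonglongrightarrow> (b * u)\<^sup>2 * 0"
        by (intro tendsto_intros LIMSEQ_Suc[OF lim_1_over_n])
      ultimately show "(\<lambda>n. real (Suc n) * excess (b / real (Suc n) * u)) \<longlonglongrightarrow> 0"
        using tendsto_sandwich[of "\<lambda>_. 0" "\<lambda>n. real (Suc n) * excess (b / real (Suc n) * u)" sequentially
          "\<lambda>n. (b * u)\<^sup>2 * (1 / real (Suc n))" 0] excess_nonneg by simp
    qed
  qed (intro measurable_pi; measurable)+
  moreover have "(\<lambda>n. (\<sigma> x)\<^sup>2 * b\<^sup>2 * (1 / real (Suc n))) \<longlonglongrightarrow> (\<sigma> x)\<^sup>2 * b\<^sup>2 * 0"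
    by (intro tendsto_intros LIMSEQ_Suc[OF lim_1_over_n])
  ultimately show "(\<lambda>n. real (Suc n) * psi0 x (b / real (Suc n))) \<longlonglongrightarrow> 0"
    unfolding eq using tendsto_add by fastforce
  obtain C where C: "0 \<le> C" "\<And>x z. 0 \<le> z \<Longrightarrow> psi0 x z \<le> C * max z (z\<^sup>2)" using psi0_bound by blast
  have "real (Suc n) * psi0 x (b / real (Suc n)) \<le> C * max b (b\<^sup>2)" for n x
  proof -
    have "psi0 x (b / real (Suc n)) \<le> C * max (b / real (Suc n)) ((b / real (Suc n))\<^sup>2)"
      using C assms by simp
    also have "max (b / real (Suc n)) ((b / real (Suc n))\<^sup>2) \<le> max b (b\<^sup>2) / real (Suc n)"
    proof -
      have "(b / real (Suc n))\<^sup>2 = b\<^sup>2 / real (Suc n) * (1 / real (Suc n))" by (simp add: power2_eq_square)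
      also have "\<dots> \<le> b\<^sup>2 / real (Suc n) * 1" by (intro mult_left_mono) auto
      finally have "(b / real (Suc n))\<^sup>2 \<le> max b (b\<^sup>2) / real (Suc n)"
        by (simp add: order_trans[OF _ divide_right_mono])
      moreover have "b / real (Suc n) \<le> max b (b\<^sup>2) / real (Suc n)" by (intro divide_right_mono) auto
      ultimately show ?thesis by (rule max.boundedI[rotated])
    qed
    finally have "psi0 x (b / real (Suc n)) \<le> C * (max b (b\<^sup>2) / real (Suc n))" using C(1) by (simp add: mult_left_mono)
    then have "real (Suc n) * psi0 x (b / real (Suc n)) \<le> real (Suc n) * (C * (max b (b\<^sup>2) / real (Suc n)))"
      by (rule mult_left_mono) simp
    then show ?thesis by simp
  qed
  moreover have "0 \<le> C * max b (b\<^sup>2)" using C assms by (auto simp: le_max_iff_disj)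
  ultimately show "\<exists>C\<ge>0. \<forall>n x. real (Suc n) * psi0 x (b / real (Suc n)) \<le> C" by blast
qed

end

section \<open>The mean semigroup and its perturbation formula\<close>

lemma Fubini_bounded:
  fixes f :: "'a \<times> 'b \<Rightarrow> real"
  assumes "sigma_finite_measure M1" "sigma_finite_measure M2"
    and f [measurable]: "f \<in> borel_measurable (M1 \<Otimes>\<^sub>M M2)"
    and A: "A \<in> sets M1" "emeasure M1 A < \<infinity>" and B: "B \<in> sets M2" "emeasure M2 B < \<infinity>"
    and le: "\<And>x y. x \<in> space M1 \<Longrightarrow> y \<in> space M2 \<Longrightarrow> \<bar>f (x, y)\<bar> \<le> C * indicator A x * indicator B y"
  shows "(\<integral>x. (\<integral>y. f (x, y) \<partial>M2) \<partial>M1) = (\<integral>y. (\<integral>x. f (x, y) \<partial>M1) \<partial>M2)"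
    and "integrable M1 (\<lambda>x. \<integral>y. f (x, y) \<partial>M2)"
    and "integrable M2 (\<lambda>y. \<integral>x. f (x, y) \<partial>M1)"
proof -
  interpret M1: sigma_finite_measure M1 by fact
  interpret M2: sigma_finite_measure M2 by fact
  interpret pair_sigma_finite M1 M2 ..
  note A(1)[measurable] B(1)[measurable]
  have "integrable (M1 \<Otimes>\<^sub>M M2) (\<lambda>z. C * indicator (A \<times> B) z)"
    using A B by (intro integrable_mult_right integrable_real_indicator)
      (auto simp: M2.emeasure_pair_measure_Times ennreal_mult_less_top)
  then have int: "integrable (M1 \<Otimes>\<^sub>M M2) f"
  proof (rule Bochner_Integration.integrable_bound)
    show "AE z in M1 \<Otimes>\<^sub>M M2. norm (f z) \<le> norm (C * indicator (A \<times> B) z)"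
    proof (rule AE_I2)
      fix z assume "z \<in> space (M1 \<Otimes>\<^sub>M M2)"
      then have "\<bar>f z\<bar> \<le> C * indicator A (fst z) * indicator B (snd z)"
        using le[of "fst z" "snd z"] by (auto simp: space_pair_measure)
      also have "\<dots> \<le> \<bar>C * indicator (A \<times> B) z\<bar>" by (cases z) (auto simp: indicator_def)
      finally show "norm (f z) \<le> norm (C * indicator (A \<times> B) z)" by simp
    qed
  qed simp
  show "(\<integral>x. (\<integral>y. f (x, y) \<partial>M2) \<partial>M1) = (\<integral>y. (\<integral>x. f (x, y) \<partial>M1) \<partial>M2)"
    using Fubini_integral[of "\<lambda>x y. f (x, y)"] int by (simp add: case_prod_unfold)
  show "integrable M1 (\<lambda>x. \<integral>y. f (x, y) \<partial>M2)" by (rule integrable_fst'[OF int])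
  show "integrable M2 (\<lambda>y. \<integral>x. f (x, y) \<partial>M1)"
    using integrable_snd[of "\<lambda>x y. f (x, y)"] int by (simp add: case_prod_unfold)
qed

section \<open>The exponential of an integral\<close>

lemma exp_bounds:
  fixes h :: real
  assumes "\<bar>h\<bar> \<le> 1"
  shows "\<bar>exp h - 1 - h\<bar> \<le> h\<^sup>2" "\<bar>exp h - 1\<bar> \<le> 2 * \<bar>h\<bar>"
proof -
  have 0: "0 \<le> exp h - 1 - h" using exp_ge_add_one_self[of h] by linarith
  have "exp h - 1 - h \<le> h\<^sup>2"
  proof (cases "0 \<le> h")
    case True
    then show ?thesis using exp_bound[of h] assms by simp
  next
    case False
    then show ?thesis using excess_le_sq[of "-h"] by (simp add: excess_def)
  qed
  with 0 show 1: "\<bar>exp h - 1 - h\<bar> \<le> h\<^sup>2" by simp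
  have "h\<^sup>2 \<le> \<bar>h\<bar>" using assms mult_left_le[of "\<bar>h\<bar>" "\<bar>h\<bar>"] by (simp add: power2_eq_square flip: abs_mult)
  with 1 show "\<bar>exp h - 1\<bar> \<le> 2 * \<bar>h\<bar>" by linarith
qed

lemma interval_integrable:
  fixes g :: "real \<Rightarrow> real"
  assumes [measurable]: "g \<in> borel_measurable borel" and g: "\<And>s. s \<in> {u..v} \<Longrightarrow> \<bar>g s\<bar> \<le> K"
  shows "integrable lborel (\<lambda>s. indicator {u..v} s * g s)"
    and "integrable lborel (\<lambda>s. indicator {u<..v} s * g s)"
proof -
  have i: "integrable lborel (\<lambda>s. indicator {u..v} s * K)"
    by (intro integrable_mult_left integrable_real_indicator) (auto simp: emeasure_lborel_Icc_eq)
  show "integrable lborel (\<lambda>s. indicator {u..v} s * g s)"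
    by (rule Bochner_Integration.integrable_bound[OF i]) (use g in \<open>force simp: indicator_def intro!: AE_I2\<close>)+
  show "integrable lborel (\<lambda>s. indicator {u<..v} s * g s)"
  proof (rule Bochner_Integration.integrable_bound[OF i])
    have "norm (indicator {u<..v} s * g s) \<le> norm (indicator {u..v} s * K)" for s
      using g[of s] by (cases "u < s \<and> s \<le> v") (auto simp: indicator_def)
    then show "AE s in lborel. norm (indicator {u<..v} s * g s) \<le> norm (indicator {u..v} s * K)" by simp
  qed simp
qed

lemma interval_integral_diff:
  fixes g :: "real \<Rightarrow> real"
  assumes "0 \<le> u" "u \<le> v" and g: "g \<in> borel_measurable borel" "\<And>s. s \<in> {0..v} \<Longrightarrow> \<bar>g s\<bar> \<le> K"
  shows "(\<integral>s. indicator {0..v} s * g s \<partial>lborel) - (\<integral>s. indicator {0..u} s * g s \<partial>lborel) = (\<integral>s. indicator {u<..v} s * g s \<partial>lborel)"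
proof -
  have "integrable lborel (\<lambda>s. indicator {0..v} s * g s)" "integrable lborel (\<lambda>s. indicator {0..u} s * g s)"
    using assms by (auto intro!: interval_integrable(1)[where K=K])
  then have "(\<integral>s. indicator {0..v} s * g s \<partial>lborel) - (\<integral>s. indicator {0..u} s * g s \<partial>lborel) = (\<integral>s. indicator {0..v} s * g s - indicator {0..u} s * g s \<partial>lborel)"
    by simp
  also have "\<dots> = (\<integral>s. indicator {u<..v} s * g s \<partial>lborel)"
  proof (rule Bochner_Integration.integral_cong)
    show "indicator {0..v} s * g s - indicator {0..u} s * g s = indicator {u<..v} s * g s" for s
      using assms(1,2) by (cases "s < 0"; cases "s \<le> u"; cases "s \<le> v") auto
  qed simp
  finally show ?thesis .
qed

lemma interval_integral_bound:
  fixes g :: "real \<Rightarrow> real"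
  assumes "u \<le> v" "\<And>s. s \<in> {u<..v} \<Longrightarrow> \<bar>g s\<bar> \<le> K" "0 \<le> K"
  shows "\<bar>\<integral>s. indicator {u<..v} s * g s \<partial>lborel\<bar> \<le> K * (v - u)"
proof -
  have "\<bar>\<integral>s. indicator {u<..v} s * g s \<partial>lborel\<bar> \<le> (\<integral>s. \<bar>indicator {u<..v} s * g s\<bar> \<partial>lborel)"
    using integral_norm_bound[of lborel "\<lambda>s. indicator {u<..v} s * g s"] by simp
  also have "\<dots> \<le> (\<integral>s. K * indicator {u<..v} s \<partial>lborel)"
  proof (rule integral_mono')
    show "integrable lborel (\<lambda>s. K * indicator {u<..v} s)"
      by (intro integrable_mult_right integrable_real_indicator) (use assms in auto)
  qed (use assms in \<open>auto simp: indicator_def\<close>)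
  also have "\<dots> = K * (v - u)" using assms by simp
  finally show ?thesis .
qed

text \<open>The integrand is only measurable; both sides differ by a function of the upper limit whose
  increments are quadratically small.\<close>

lemma exp_integral_identity:
  fixes b :: "real \<Rightarrow> real"
  assumes b [measurable]: "b \<in> borel_measurable borel" and B: "\<And>s. \<bar>b s\<bar> \<le> B" and t: "0 \<le> t"
  defines "A \<equiv> \<lambda>t. \<integral>s. indicator {0..t} s * b s \<partial>lborel"
  shows "exp (A t) - 1 = (\<integral>s. indicator {0..t} s * (exp (A s) * b s) \<partial>lborel)"
proof -
  have B0: "0 \<le> B" using B[of 0] by simp
  have [measurable]: "A \<in> borel_measurable borel"
    unfolding A_def by (rule lborel.borel_measurable_lebesgue_integral) (simp add: indicator_def, measurable)
  have Aabs: "\<bar>A v - A u\<bar> \<le> B * (v - u)" if "0 \<le> u" "u \<le> v" for u v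
    unfolding A_def using that B B0 by (subst interval_integral_diff[where K=B]) (auto intro: interval_integral_bound)
  have A0: "A 0 = 0"
  proof -
    have "A 0 = (\<integral>s. indicator {0::real} s * b 0 \<partial>lborel)" unfolding A_def by (intro Bochner_Integration.integral_cong) (auto simp: indicator_def)
    then show ?thesis by simp
  qed
  define M where "M = exp (B * t)"
  have M0: "0 \<le> M" by (simp add: M_def)
  have Mb: "exp (A u) \<le> M" if "0 \<le> u" "u \<le> t" for u
  proof -
    have "\<bar>A u\<bar> \<le> B * u" using Aabs[of 0 u] A0 that by simp
    also have "\<dots> \<le> B * t" using that B0 by (intro mult_left_mono)
    finally show ?thesis unfolding M_def by simp
  qed
  define J where "J t = (\<integral>s. indicator {0..t} s * (exp (A s) * b s) \<partial>lborel)" for t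
  define D where "D u = exp (A u) - J u" for u
  \<comment> \<open>The constant 3 is 2 + 1: freezing \<open>exp (A s)\<close> at time
    \<open>u\<close> changes the integral term by at most
    \<open>2 * M * B\<^sup>2 * (v - u)\<^sup>2\<close>, and the exponential leaves a Taylor
    remainder of at most \<open>M * B\<^sup>2 * (v - u)\<^sup>2\<close>. Smallness of
    \<open>B * (v - u)\<close> keeps the increments of \<open>A\<close> within the range of
    \<open>exp_bounds\<close>.\<close>
  have step: "\<bar>D v - D u\<bar> \<le> 3 * M * B\<^sup>2 * (v - u)\<^sup>2" if uv: "0 \<le> u" "u \<le> v" "v \<le> t" and small: "B * (v - u) \<le> 1" for u v
  proof -
    have Jd: "J v - J u = (\<integral>s. indicator {u<..v} s * (exp (A s) * b s) \<partial>lborel)"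
      unfolding J_def using uv Mb M0 B by (intro interval_integral_diff[where K="M * B"]) (auto simp: abs_mult intro!: mult_mono)
    have Ad: "exp (A u) * (A v - A u) = (\<integral>s. indicator {u<..v} s * (exp (A u) * b s) \<partial>lborel)"
    proof -
      have "A v - A u = (\<integral>s. indicator {u<..v} s * b s \<partial>lborel)"
        unfolding A_def using uv B by (intro interval_integral_diff[where K=B]) auto
      then show ?thesis by (simp add: mult.left_commute)
    qed
    have "(J v - J u) - exp (A u) * (A v - A u) = (\<integral>s. indicator {u<..v} s * ((exp (A s) - exp (A u)) * b s) \<partial>lborel)"
      unfolding Jd Ad
    proof (subst Bochner_Integration.integral_diff[symmetric])
      show "integrable lborel (\<lambda>s. indicator {u<..v} s * (exp (A s) * b s))"
        "integrable lborel (\<lambda>s. indicator {u<..v} s * (exp (A u) * b s))"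
        using uv Mb M0 B by (auto intro!: interval_integrable(2)[where K="M * B"] mult_mono simp: abs_mult)
    qed (auto intro!: Bochner_Integration.integral_cong simp: algebra_simps)
    also have "\<bar>\<dots>\<bar> \<le> (M * (2 * (B * (v - u))) * B) * (v - u)"
    proof (rule interval_integral_bound)
      fix s assume s: "s \<in> {u<..v}"
      have h: "\<bar>A s - A u\<bar> \<le> B * (v - u)"
        using Aabs[of u s] s uv B0 mult_left_mono[of "s - u" "v - u" B] by auto
      have "\<bar>exp (A s) - exp (A u)\<bar> = exp (A u) * \<bar>exp (A s - A u) - 1\<bar>"
        by (simp add: exp_diff abs_mult[symmetric, of "exp (A u)", simplified] field_simps)
      also have "\<dots> \<le> M * (2 * (B * (v - u)))"
        using h small M0 Mb[of u] uv exp_bounds(2)[of "A s - A u"] by (intro mult_mono) auto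
      finally show "\<bar>(exp (A s) - exp (A u)) * b s\<bar> \<le> M * (2 * (B * (v - u))) * B"
        unfolding abs_mult using B[of s] M0 B0 uv by (intro mult_mono) auto
    qed (use uv B0 in \<open>auto simp: M_def\<close>)
    finally have 1: "\<bar>(J v - J u) - exp (A u) * (A v - A u)\<bar> \<le> 2 * M * B\<^sup>2 * (v - u)\<^sup>2"
      by (simp add: power2_eq_square algebra_simps)
    have h: "\<bar>A v - A u\<bar> \<le> B * (v - u)" using Aabs uv by simp
    have "exp (A v) - exp (A u) - exp (A u) * (A v - A u) = exp (A u) * (exp (A v - A u) - 1 - (A v - A u))"
      by (simp add: exp_diff field_simps)
    also have "\<bar>\<dots>\<bar> \<le> M * (A v - A u)\<^sup>2"
      using h small M0 Mb[of u] uv exp_bounds(1)[of "A v - A u"] by (auto simp: abs_mult intro!: mult_mono)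
    also have "\<dots> \<le> M * (B * (v - u))\<^sup>2"
      using h power_mono[OF h, of 2] by (intro mult_left_mono) (auto simp: M_def)
    finally have 2: "\<bar>exp (A v) - exp (A u) - exp (A u) * (A v - A u)\<bar> \<le> M * B\<^sup>2 * (v - u)\<^sup>2"
      by (simp add: power_mult_distrib mult.assoc)
    have "D v - D u = (exp (A v) - exp (A u) - exp (A u) * (A v - A u)) - ((J v - J u) - exp (A u) * (A v - A u))"
      by (simp add: D_def)
    then show ?thesis using 1 2 by (simp add: abs_le_iff)
  qed
  have "D t = D 0"
  proof -
    define K where "K = 3 * M * B\<^sup>2"
    \<comment> \<open>A function with quadratically small increments is constant:
      \<open>Suc n\<close> equal steps contribute \<open>K * t\<^sup>2 / Suc n\<close> in total. The
      condition on \<open>n\<close> makes each step short enough for \<open>step\<close>.\<close>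
    have "\<bar>D t - D 0\<bar> \<le> K * t\<^sup>2 * (1 / real (Suc n))" if n: "B * t \<le> real (Suc n)" for n
    proof -
      define u where "u i = t * real i / real (Suc n)" for i
      have ud: "u (Suc i) - u i = t / real (Suc n)" for i
        unfolding u_def by (simp add: diff_divide_distrib[symmetric] right_diff_distrib[symmetric])
      have "D t - D 0 = (\<Sum>i<Suc n. D (u (Suc i)) - D (u i))"
        by (subst sum_lessThan_telescope) (simp add: u_def)
      also have "\<bar>\<dots>\<bar> \<le> (\<Sum>i<Suc n. \<bar>D (u (Suc i)) - D (u i)\<bar>)" by (rule sum_abs)
      also have "\<dots> \<le> (\<Sum>i<Suc n. K * (t / real (Suc n))\<^sup>2)"
      proof (rule sum_mono)
        fix i assume "i \<in> {..<Suc n}"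
        then have i: "Suc i \<le> Suc n" by simp
        have "0 \<le> u i" using t by (simp add: u_def)
        moreover have "u i \<le> u (Suc i)" using ud[of i] t by (simp add: diff_eq_eq)
        moreover have "u (Suc i) \<le> t"
          unfolding u_def using t i mult_left_mono[of "real (Suc i)" "real (Suc n)" t] by (simp add: divide_le_eq)
        moreover have "B * (u (Suc i) - u i) \<le> 1" unfolding ud using n by (simp add: divide_le_eq)
        ultimately show "\<bar>D (u (Suc i)) - D (u i)\<bar> \<le> K * (t / real (Suc n))\<^sup>2"
          using step[of "u i" "u (Suc i)"] unfolding K_def ud by simp
      qed
      also have "\<dots> = K * t\<^sup>2 * (1 / real (Suc n))" by (simp add: power2_eq_square)
      finally show ?thesis .
    qed
    moreover obtain N :: nat where "B * t \<le> real N" using real_arch_simple by blast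
    ultimately have ev: "\<forall>n\<ge>N. \<bar>D t - D 0\<bar> \<le> K * t\<^sup>2 * (1 / real (Suc n))" by force
    have "(\<lambda>n. K * t\<^sup>2 * (1 / real (Suc n))) \<longlonglongrightarrow> K * t\<^sup>2 * 0"
      by (intro tendsto_intros LIMSEQ_Suc[OF lim_1_over_n])
    with ev have "\<bar>D t - D 0\<bar> \<le> 0"
      by (intro LIMSEQ_le_const) auto
    then show ?thesis by simp
  qed
  moreover have "J 0 = 0"
  proof -
    have "J 0 = (\<integral>s. indicator {0::real} s * (exp (A 0) * b 0) \<partial>lborel)" unfolding J_def
      by (intro Bochner_Integration.integral_cong) (auto simp: indicator_def)
    then show ?thesis by simp
  qed
  ultimately show ?thesis using A0 by (simp add: D_def J_def)
qed

locale branching_motion = borel_right_process P W L Y \<zeta> + branching_data \<beta> \<sigma> \<pi>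
  for P :: "real \<Rightarrow> 'e::polish_space \<Rightarrow> 'e measure" and W :: "'w measure"
    and L :: "'e \<Rightarrow> 'w measure" and Y :: "real \<Rightarrow> 'w \<Rightarrow> 'e" and \<zeta> :: "'w \<Rightarrow> ereal"
    and \<beta> \<sigma> :: "'e \<Rightarrow> real" and \<pi> :: "'e \<Rightarrow> real measure"
begin

definition alive :: "real \<Rightarrow> 'w \<Rightarrow> bool"
  where "alive t \<omega> \<longleftrightarrow> 0 \<le> t \<and> ereal t < \<zeta> \<omega>"

text \<open>The position, with a dummy value outside the lifetime to make it jointly measurable.\<close>

definition pos :: "real \<Rightarrow> 'w \<Rightarrow> 'e"
  where "pos t \<omega> = (if alive t \<omega> then Y t \<omega> else undefined)"

lemma alive_antimono: "alive t \<omega> \<Longrightarrow> 0 \<le> s \<Longrightarrow> s \<le> t \<Longrightarrow> alive s \<omega>"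
  unfolding alive_def by (meson ereal_less_eq(3) le_less_trans)

text \<open>Progressive measurability of a right-continuous adapted path: its value at
  \<open>s\<close> is the limit of values at grid times to the right of \<open>s\<close>, capped at
  \<open>T\<close> so that only the history up to \<open>T\<close> is used. The \<sigma>-algebra
  \<open>F\<close> is general in order to cover both \<open>W\<close> and the past of the
  process.\<close>

lemma progressive:
  assumes sp: "space F = space W"
    and ad: "\<And>u A. 0 \<le> u \<Longrightarrow> u \<le> T \<Longrightarrow> A \<in> sets borel \<Longrightarrow> {\<omega> \<in> space W. ereal u < \<zeta> \<omega> \<and> Y u \<omega> \<in> A} \<in> sets F"
  shows "(\<lambda>(s, \<omega>). if s \<le> T then pos s \<omega> else undefined) \<in> borel_measurable (borel \<Otimes>\<^sub>M F)"
    and "Measurable.pred (borel \<Otimes>\<^sub>M F) (\<lambda>(s, \<omega>). s \<le> T \<and> alive s \<omega>)"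
proof -
  have alive_m: "Measurable.pred F (\<lambda>\<omega>. alive u \<omega>)" if "u \<le> T" for u
  proof (cases "0 \<le> u")
    case True
    then have "{\<omega> \<in> space F. alive u \<omega>} = {\<omega> \<in> space W. ereal u < \<zeta> \<omega> \<and> Y u \<omega> \<in> UNIV}"
      by (auto simp: alive_def sp)
    then show ?thesis using ad[OF True that, of UNIV] unfolding pred_def by simp
  qed (simp add: alive_def)
  have pos_m: "pos u \<in> borel_measurable F" if "u \<le> T" for u
  proof (cases "0 \<le> u")
    case True
    show ?thesis
    proof (rule measurableI)
      fix A :: "'e set" assume A: "A \<in> sets borel"
      have "pos u -` A \<inter> space F = {\<omega> \<in> space W. ereal u < \<zeta> \<omega> \<and> Y u \<omega> \<in> A} \<union>
         (if undefined \<in> A then space F - {\<omega> \<in> space F. alive u \<omega>} else {})"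
        using True by (auto simp: pos_def alive_def sp split: if_splits)
      also have "\<dots> \<in> sets F"
        using ad[OF True that A] alive_m[OF that] by (auto simp: pred_def)
      finally show "pos u -` A \<inter> space F \<in> sets F" .
    qed simp
  next
    case False
    then have "pos u = (\<lambda>_. undefined)" by (auto simp: pos_def alive_def)
    then show ?thesis by simp
  qed
  \<comment> \<open>The \<open>+ 1\<close> puts the grid point strictly to the right of
    \<open>s\<close>, as right-continuity requires; at \<open>s = T\<close> the cap makes the
    approximation exact.\<close>
  define g where "g n s = min ((real_of_int \<lfloor>real (Suc n) * s\<rfloor> + 1) / real (Suc n)) T" for n s
  have g_le: "g n s \<le> T" for n s by (simp add: g_def)
  have g_gt: "s < (real_of_int \<lfloor>real (Suc n) * s\<rfloor> + 1) / real (Suc n)" for n s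
  proof -
    have "real (Suc n) * s < real_of_int \<lfloor>real (Suc n) * s\<rfloor> + 1" by linarith
    then show ?thesis by (simp add: less_divide_eq mult.commute)
  qed
  have g_up: "(real_of_int \<lfloor>real (Suc n) * s\<rfloor> + 1) / real (Suc n) \<le> s + 1 / real (Suc n)" for n s
  proof -
    have "real_of_int \<lfloor>real (Suc n) * s\<rfloor> + 1 \<le> real (Suc n) * s + 1" by linarith
    from divide_right_mono[OF this, of "real (Suc n)"] show ?thesis by (simp add: add_divide_distrib)
  qed
  have g_lim: "(\<lambda>n. g n s) \<longlonglongrightarrow> s" if "s \<le> T" for s
  proof (rule tendsto_sandwich[where f="\<lambda>_. s" and h="\<lambda>n. s + 1 / real (Suc n)"])
    show "\<forall>\<^sub>F n in sequentially. s \<le> g n s" using g_gt that by (auto simp: g_def less_imp_le)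
    show "\<forall>\<^sub>F n in sequentially. g n s \<le> s + 1 / real (Suc n)" using g_up by (auto simp: g_def min.coboundedI1)
    show "(\<lambda>n. s + 1 / real (Suc n)) \<longlonglongrightarrow> s"
      using tendsto_add[OF tendsto_const LIMSEQ_Suc[OF lim_1_over_n], of s] by simp
  qed simp
  have g_ge: "s \<le> g n s" if "s \<le> T" for n s using g_gt that by (auto simp: g_def less_imp_le)
  have ev_alive: "\<forall>\<^sub>F n in sequentially. alive (g n s) \<omega>" if "alive s \<omega>" "s \<le> T" for s \<omega>
  proof -
    have "(\<lambda>n. ereal (g n s)) \<longlonglongrightarrow> ereal s" using g_lim[OF that(2)] by simp
    then have "\<forall>\<^sub>F n in sequentially. ereal (g n s) < \<zeta> \<omega>"
      using that(1) by (intro order_tendstoD) (auto simp: alive_def)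
    then show ?thesis
      by eventually_elim (use that g_ge[OF that(2)] in \<open>auto simp: alive_def intro: order_trans\<close>)
  qed
  have lim_pos: "(\<lambda>n. pos (g n s) \<omega>) \<longlonglongrightarrow> pos s \<omega>" if s: "0 \<le> s" "s \<le> T" and w: "\<omega> \<in> space W" for s \<omega>
  proof (cases "alive s \<omega>")
    case True
    have "(\<lambda>n. Y (g n s) \<omega>) \<longlonglongrightarrow> Y s \<omega>"
    proof (cases "s = T")
      case True
      then have "g n s = s" for n using g_ge[of s n] g_le[of n s] by simp
      then show ?thesis by simp
    next
      case False
      then have "s < g n s" for n using s g_gt[of s n] by (auto simp: g_def)
      then have "filterlim (\<lambda>n. g n s) (at_right s) sequentially"
        using g_lim[OF s(2)] by (simp add: filterlim_at less_imp_neq[THEN not_sym])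
      then show ?thesis
        using right_continuous[OF w s(1)] True by (auto simp: alive_def intro: filterlim_compose)
    qed
    moreover have "\<forall>\<^sub>F n in sequentially. Y (g n s) \<omega> = pos (g n s) \<omega>"
      using ev_alive[OF True s(2)] by eventually_elim (simp add: pos_def)
    ultimately have "(\<lambda>n. pos (g n s) \<omega>) \<longlonglongrightarrow> Y s \<omega>" by (rule Lim_transform_eventually)
    then show ?thesis using True by (simp add: pos_def)
  next
    case False
    then have "\<not> alive (g n s) \<omega>" for n using alive_antimono[of "g n s" \<omega> s] g_ge[OF s(2)] s(1) by blast
    then show ?thesis using False by (simp add: pos_def)
  qed
  have cm: "(\<lambda>(s, \<omega>). h (g n s) \<omega>) \<in> measurable (borel \<Otimes>\<^sub>M F) N" if h: "\<And>u. u \<le> T \<Longrightarrow> h u \<in> measurable F N" for h n and N :: "'c measure"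
  proof -
    have "(\<lambda>z. h (min ((real_of_int i + 1) / real (Suc n)) T) (snd z)) \<in> measurable (borel \<Otimes>\<^sub>M F) N" for i :: int
      by (intro measurable_compose[OF measurable_snd h]) simp
    from measurable_compose_countable[OF this, of "\<lambda>z. \<lfloor>real (Suc n) * fst z\<rfloor>"]
    show ?thesis unfolding g_def by (simp add: case_prod_unfold)
  qed
  have [measurable]: "(\<lambda>(s, \<omega>). pos (g n s) \<omega>) \<in> borel_measurable (borel \<Otimes>\<^sub>M F)" for n
    by (intro cm pos_m)
  have "(\<lambda>(s, \<omega>). if 0 \<le> s \<and> s \<le> T then pos (g n s) \<omega> else undefined) \<in> borel_measurable (borel \<Otimes>\<^sub>M F)" for n
    by measurable
  then have "(\<lambda>(s, \<omega>). if 0 \<le> s \<and> s \<le> T then pos s \<omega> else undefined) \<in> borel_measurable (borel \<Otimes>\<^sub>M F)"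
  proof (rule borel_measurable_LIMSEQ_metric)
    show "(\<lambda>n. case z of (s, \<omega>) \<Rightarrow> if 0 \<le> s \<and> s \<le> T then pos (g n s) \<omega> else undefined)
       \<longlonglongrightarrow> (case z of (s, \<omega>) \<Rightarrow> if 0 \<le> s \<and> s \<le> T then pos s \<omega> else undefined)" if "z \<in> space (borel \<Otimes>\<^sub>M F)" for z
      using that lim_pos[of "fst z" "snd z"] by (auto simp: space_pair_measure sp split: prod.split)
  qed
  moreover have "(if 0 \<le> s \<and> s \<le> T then pos s \<omega> else undefined) = (if s \<le> T then pos s \<omega> else undefined)" for s \<omega>
    by (auto simp: pos_def alive_def)
  ultimately show "(\<lambda>(s, \<omega>). if s \<le> T then pos s \<omega> else undefined) \<in> borel_measurable (borel \<Otimes>\<^sub>M F)" by simp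
  have [measurable]: "Measurable.pred (borel \<Otimes>\<^sub>M F) (\<lambda>(s, \<omega>). alive (g n s) \<omega>)" for n
    by (intro cm alive_m)
  \<comment> \<open>The lifetime interval is open at its right end, so a living path is still alive
    at the grid times close enough to \<open>s\<close>; the union over \<open>n\<close> is
    countable.\<close>
  have "(s \<le> T \<and> alive s \<omega>) = (0 \<le> s \<and> s \<le> T \<and> (\<exists>n. alive (g n s) \<omega>))" for s \<omega>
    using ev_alive[of s \<omega>] g_ge[of s] alive_antimono[of _ \<omega> s]
    by (auto simp: eventually_sequentially alive_def)
  moreover have "Measurable.pred (borel \<Otimes>\<^sub>M F) (\<lambda>(s, \<omega>). 0 \<le> s \<and> s \<le> T \<and> (\<exists>n. alive (g n s) \<omega>))"
    by measurable
  ultimately show "Measurable.pred (borel \<Otimes>\<^sub>M F) (\<lambda>(s, \<omega>). s \<le> T \<and> alive s \<omega>)" by simp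
qed


lemma pos_measurable_pair: "(\<lambda>(s, \<omega>). pos s \<omega>) \<in> borel_measurable (borel \<Otimes>\<^sub>M W)"
proof -
  have "(\<lambda>(s, \<omega>). if s \<le> real n then pos s \<omega> else undefined) \<in> borel_measurable (borel \<Otimes>\<^sub>M W)" for n
    by (rule progressive) (auto intro: adapted)
  then show ?thesis
  proof (rule borel_measurable_LIMSEQ_metric)
    fix z :: "real \<times> 'w"
    obtain N where "fst z \<le> real N" using real_arch_simple by blast
    then show "(\<lambda>n. case z of (s, \<omega>) \<Rightarrow> if s \<le> real n then pos s \<omega> else undefined) \<longlonglongrightarrow> (case z of (s, \<omega>) \<Rightarrow> pos s \<omega>)"
      by (intro tendsto_eventually eventually_sequentiallyI[of N]) (auto split: prod.split)
  qed
qed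

lemma alive_measurable_pair: "Measurable.pred (borel \<Otimes>\<^sub>M W) (\<lambda>(s, \<omega>). alive s \<omega>)"
proof -
  have [measurable]: "Measurable.pred (borel \<Otimes>\<^sub>M W) (\<lambda>(s, \<omega>). s \<le> real n \<and> alive s \<omega>)" for n
    by (rule progressive) (auto intro: adapted)
  have "alive s \<omega> = (\<exists>n. s \<le> real n \<and> alive s \<omega>)" for s \<omega>
    using real_arch_simple by blast
  moreover have "Measurable.pred (borel \<Otimes>\<^sub>M W) (\<lambda>z. \<exists>n. (\<lambda>(s, \<omega>). s \<le> real n \<and> alive s \<omega>) z)"
    by measurable
  ultimately show ?thesis by (simp add: case_prod_unfold)
qed

section \<open>Feynman-Kac weights and the laws as a kernel\<close>

definition live :: "real \<Rightarrow> 'w \<Rightarrow> real"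
  where "live t \<omega> = (if alive t \<omega> then 1 else 0)"

text \<open>After the lifetime this keeps integrating at the dummy value of \<open>pos\<close>; the
  factor \<open>live\<close> in \<open>wt\<close> discards that part.\<close>

definition acc :: "real \<Rightarrow> 'w \<Rightarrow> real"
  where "acc t \<omega> = (\<integral>s. indicator {0..t} s * \<beta> (pos s \<omega>) \<partial>lborel)"

definition wt :: "real \<Rightarrow> 'w \<Rightarrow> real"
  where "wt t \<omega> = live t \<omega> * exp (acc t \<omega>)"

lemma pos_measurable [measurable (raw)]:
  "f \<in> borel_measurable M \<Longrightarrow> g \<in> measurable M W \<Longrightarrow> (\<lambda>x. pos (f x) (g x)) \<in> borel_measurable M"
  using measurable_compose[OF _ pos_measurable_pair, of "\<lambda>x. (f x, g x)" M] by simp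

lemma alive_measurable [measurable (raw)]:
  "f \<in> borel_measurable M \<Longrightarrow> g \<in> measurable M W \<Longrightarrow> Measurable.pred M (\<lambda>x. alive (f x) (g x))"
  using measurable_compose[OF _ alive_measurable_pair, of "\<lambda>x. (f x, g x)" M] by simp

lemma live_measurable [measurable (raw)]:
  "f \<in> borel_measurable M \<Longrightarrow> g \<in> measurable M W \<Longrightarrow> (\<lambda>x. live (f x) (g x)) \<in> borel_measurable M"
  unfolding live_def by measurable

lemma acc_measurable [measurable (raw)]:
  assumes [measurable]: "f \<in> borel_measurable M" "g \<in> measurable M W"
  shows "(\<lambda>x. acc (f x) (g x)) \<in> borel_measurable M"
  unfolding acc_def
  by (rule lborel.borel_measurable_lebesgue_integral) (simp add: indicator_def, measurable)

lemma wt_measurable [measurable (raw)]: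
  assumes [measurable]: "f \<in> borel_measurable M" "g \<in> measurable M W"
  shows "(\<lambda>x. wt (f x) (g x)) \<in> borel_measurable M"
  unfolding wt_def by measurable

definition bsup :: real where "bsup = (SUP x. \<bar>\<beta> x\<bar>)"

lemma beta_le: "\<bar>\<beta> x\<bar> \<le> bsup"
proof -
  obtain B where "\<And>x. \<bar>\<beta> x\<bar> \<le> B" using bB_bound[OF beta] by metis
  then show ?thesis unfolding bsup_def by (intro cSUP_upper bdd_aboveI2[where M=B]) auto
qed

lemma bsup_nonneg: "0 \<le> bsup"
  using beta_le[of undefined] by linarith

lemma acc_bound: assumes "0 \<le> t" shows "\<bar>acc t \<omega>\<bar> \<le> bsup * t"
proof -
  have "\<bar>acc t \<omega>\<bar> \<le> (\<integral>s. \<bar>indicator {0..t} s * \<beta> (pos s \<omega>)\<bar> \<partial>lborel)"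
    unfolding acc_def using integral_norm_bound[of lborel "\<lambda>s. indicator {0..t} s * \<beta> (pos s \<omega>)"] by simp
  also have "\<dots> \<le> (\<integral>s. bsup * indicator {0..t} s \<partial>lborel)"
  proof (rule integral_mono')
    show "integrable lborel (\<lambda>s. bsup * indicator {0..t} s)"
      by (intro integrable_mult_right integrable_real_indicator) (auto simp: emeasure_lborel_Icc_eq)
  qed (use beta_le bsup_nonneg in \<open>auto simp: indicator_def\<close>)
  also have "\<dots> = bsup * t" using assms by simp
  finally show ?thesis .
qed

lemma wt_nonneg: "0 \<le> wt t \<omega>" by (simp add: wt_def live_def)

lemma wt_bound: "0 \<le> t \<Longrightarrow> wt t \<omega> \<le> exp (bsup * t)"
  using acc_bound[of t \<omega>] by (auto simp: wt_def live_def)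

lemma live_bounds: "0 \<le> live t \<omega>" "live t \<omega> \<le> 1" by (auto simp: live_def)

lemma L_prob: "prob_space (L x)" and sets_L [simp, measurable_cong]: "sets (L x) = sets W"
  using measurable_space[OF law, of x] by (auto simp: space_prob_algebra)

lemma space_L [simp]: "space (L x) = space W"
  using sets_eq_imp_space_eq[OF sets_L] .

lemma L_kernel: "L \<in> borel \<rightarrow>\<^sub>M subprob_algebra W"
  using law by (rule measurable_prob_algebraD)

lemma L_integrable:
  fixes f :: "'w \<Rightarrow> real"
  assumes "f \<in> borel_measurable W" "\<And>\<omega>. \<omega> \<in> space W \<Longrightarrow> \<bar>f \<omega>\<bar> \<le> C"
  shows "integrable (L x) f"
  using assms prob_space.finite_measure[OF L_prob]
  by (intro integrable_bounded[of _ f C]) (auto simp: measurable_cong_sets[OF sets_L refl])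

lemma L_integral_bound:
  fixes f :: "'w \<Rightarrow> real"
  assumes "\<And>\<omega>. \<omega> \<in> space W \<Longrightarrow> \<bar>f \<omega>\<bar> \<le> C"
  shows "\<bar>\<integral>\<omega>. f \<omega> \<partial>L x\<bar> \<le> C"
proof -
  interpret prob_space "L x" by (rule L_prob)
  obtain \<omega> where "\<omega> \<in> space W" using not_empty by auto
  then have C: "0 \<le> C" using assms[of \<omega>] by simp
  have "\<bar>\<integral>\<omega>. f \<omega> \<partial>L x\<bar> \<le> (\<integral>\<omega>. \<bar>f \<omega>\<bar> \<partial>L x)"
    using integral_norm_bound[of "L x" f] by simp
  also have "\<dots> \<le> (\<integral>\<omega>. C \<partial>L x)"
    using assms C by (intro integral_mono') auto
  finally show ?thesis using prob_space by simp
qed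

text \<open>Pairing the path with its parameter turns the family of laws into a kernel into the
  product space, so that integrands depending on both at once are covered.\<close>

lemma L_integral_measurable:
  fixes f :: "'a \<Rightarrow> 'w \<Rightarrow> real"
  assumes [measurable]: "(\<lambda>(z, \<omega>). f z \<omega>) \<in> borel_measurable (M \<Otimes>\<^sub>M W)" "g \<in> borel_measurable M"
  shows "(\<lambda>z. \<integral>\<omega>. f z \<omega> \<partial>L (g z)) \<in> borel_measurable M"
proof -
  have k: "(\<lambda>z. distr (L (g z)) (M \<Otimes>\<^sub>M W) (\<lambda>\<omega>. (z, \<omega>))) \<in> measurable M (subprob_algebra (M \<Otimes>\<^sub>M W))"
    by (rule measurable_distr2[where M=W]) (auto intro: measurable_compose[OF _ L_kernel])
  have "(\<lambda>z. \<integral>p. (case p of (z, \<omega>) \<Rightarrow> f z \<omega>) \<partial>distr (L (g z)) (M \<Otimes>\<^sub>M W) (\<lambda>\<omega>. (z, \<omega>))) \<in> borel_measurable M"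
    by (rule measurable_compose[OF k integral_measurable_subprob_algebra]) measurable
  also have "?this \<longleftrightarrow> ?thesis"
    by (intro measurable_cong, subst integral_distr) auto
  finally show ?thesis .
qed

section \<open>Mean semigroup, motion semigroup and the Markov property for functionals\<close>

definition T :: "real \<Rightarrow> ('e \<Rightarrow> real) \<Rightarrow> 'e \<Rightarrow> real"
  where "T t f x = (\<integral>\<omega>. wt t \<omega> * f (pos t \<omega>) \<partial>L x)"

definition PS :: "real \<Rightarrow> ('e \<Rightarrow> real) \<Rightarrow> 'e \<Rightarrow> real"
  where "PS t f x = (\<integral>y. f y \<partial>P t x)"

lemma sets_P: "0 \<le> t \<Longrightarrow> sets (P t x) = sets borel"
  using measurable_space[OF kernel, of t x] by (auto simp: space_subprob_algebra)

lemma subprob_P: "0 \<le> t \<Longrightarrow> subprob_space (P t x)"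
  using measurable_space[OF kernel, of t x] by (auto simp: space_subprob_algebra)

lemma nn_P_measurable:
  assumes "0 \<le> s" and [measurable]: "f \<in> borel_measurable borel"
  shows "(\<lambda>y. \<integral>\<^sup>+z. f z \<partial>P s y) \<in> borel_measurable borel"
  by (rule measurable_compose[OF kernel[OF assms(1)] nn_integral_measurable_subprob_algebra]) simp

lemma sets_past_subset: "0 \<le> t \<Longrightarrow> subalgebra W (past W Y \<zeta> t)"
  unfolding subalgebra_def past_def
  by (auto intro!: sets.sigma_sets_subset adapted simp: space_measure_of_conv sets_measure_of_conv)

text \<open>The Markov property is assumed for an event of the past and a Borel set. Two monotone
  class arguments extend it, first in the functional \<open>G\<close> of the past, then in the
  function \<open>f\<close> of the later position.\<close>

lemma markov_nn:
  fixes G :: "'w \<Rightarrow> ennreal" and f :: "'e \<Rightarrow> ennreal"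
  assumes st: "0 \<le> s" "0 \<le> t" and G: "G \<in> borel_measurable (past W Y \<zeta> t)" and f: "f \<in> borel_measurable borel"
  shows "(\<integral>\<^sup>+\<omega>. G \<omega> * (live (t + s) \<omega> * f (pos (t + s) \<omega>)) \<partial>L x) =
         (\<integral>\<^sup>+\<omega>. G \<omega> * (live t \<omega> * (\<integral>\<^sup>+y. f y \<partial>P s (pos t \<omega>))) \<partial>L x)"
proof -
  note [measurable] = nn_P_measurable[OF st(1)]
  have GW: "g \<in> borel_measurable (L x)" if "g \<in> borel_measurable (past W Y \<zeta> t)" for g :: "'w \<Rightarrow> ennreal"
    using measurable_from_subalg[OF sets_past_subset[OF st(2)] that] by (simp add: measurable_cong_sets[OF sets_L refl])
  have base: "(\<integral>\<^sup>+\<omega>. indicator \<Lambda> \<omega> * (ennreal (live (t + s) \<omega>) * indicator B (pos (t + s) \<omega>)) \<partial>L x) =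
         (\<integral>\<^sup>+\<omega>. indicator \<Lambda> \<omega> * (live t \<omega> * (\<integral>\<^sup>+y. indicator B y \<partial>P s (pos t \<omega>))) \<partial>L x)"
    if \<Lambda>: "\<Lambda> \<in> sets (past W Y \<zeta> t)" and B: "B \<in> sets borel" for \<Lambda> B
  proof -
    have \<Lambda>W: "\<Lambda> \<in> sets W" using \<Lambda> sets_past_subset[OF st(2)] by (auto simp: subalgebra_def)
    then have sub: "\<Lambda> \<subseteq> space W" by (rule sets.sets_into_space)
    have "(\<integral>\<^sup>+\<omega>. indicator \<Lambda> \<omega> * (ennreal (live (t + s) \<omega>) * indicator B (pos (t + s) \<omega>)) \<partial>L x)
       = (\<integral>\<^sup>+\<omega>. indicator {\<omega> \<in> \<Lambda>. ereal (t + s) < \<zeta> \<omega> \<and> Y (t + s) \<omega> \<in> B} \<omega> \<partial>L x)"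
      using st by (intro nn_integral_cong) (auto simp: live_def alive_def pos_def indicator_def)
    also have "\<dots> = emeasure (L x) {\<omega> \<in> \<Lambda>. ereal (t + s) < \<zeta> \<omega> \<and> Y (t + s) \<omega> \<in> B}"
    proof (rule nn_integral_indicator)
      have "{\<omega> \<in> \<Lambda>. ereal (t + s) < \<zeta> \<omega> \<and> Y (t + s) \<omega> \<in> B} = \<Lambda> \<inter> {\<omega> \<in> space W. ereal (t + s) < \<zeta> \<omega> \<and> Y (t + s) \<omega> \<in> B}"
        using sub by auto
      then show "{\<omega> \<in> \<Lambda>. ereal (t + s) < \<zeta> \<omega> \<and> Y (t + s) \<omega> \<in> B} \<in> sets (L x)"
        using \<Lambda>W adapted[of "t + s" B] st B by simp
    qed
    also have "\<dots> = (\<integral>\<^sup>+\<omega>. emeasure (P s (Y t \<omega>)) B * indicator {\<omega> \<in> \<Lambda>. ereal t < \<zeta> \<omega>} \<omega> \<partial>L x)"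
      by (rule markov[OF st \<Lambda> B])
    also have "\<dots> = (\<integral>\<^sup>+\<omega>. indicator \<Lambda> \<omega> * (live t \<omega> * (\<integral>\<^sup>+y. indicator B y \<partial>P s (pos t \<omega>))) \<partial>L x)"
    proof (rule nn_integral_cong)
      fix \<omega> assume "\<omega> \<in> space (L x)"
      have "(\<integral>\<^sup>+y. indicator B y \<partial>P s (pos t \<omega>)) = emeasure (P s (pos t \<omega>)) B" using B sets_P[OF st(1)] by simp
      then show "emeasure (P s (Y t \<omega>)) B * indicator {\<omega> \<in> \<Lambda>. ereal t < \<zeta> \<omega>} \<omega> =
        indicator \<Lambda> \<omega> * (live t \<omega> * (\<integral>\<^sup>+y. indicator B y \<partial>P s (pos t \<omega>)))"
        using st by (cases "\<omega> \<in> \<Lambda>"; cases "ereal t < \<zeta> \<omega>") (auto simp: live_def alive_def pos_def)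
    qed
    finally show ?thesis .
  qed
  have step1: "(\<integral>\<^sup>+\<omega>. G \<omega> * (ennreal (live (t + s) \<omega>) * indicator B (pos (t + s) \<omega>)) \<partial>L x) =
         (\<integral>\<^sup>+\<omega>. G \<omega> * (live t \<omega> * (\<integral>\<^sup>+y. indicator B y \<partial>P s (pos t \<omega>))) \<partial>L x)"
    if B [measurable]: "B \<in> sets borel" for B
    using G
  proof induction
    case (cong f g)
    have eq: "(\<integral>\<^sup>+\<omega>. f \<omega> * h \<omega> \<partial>L x) = (\<integral>\<^sup>+\<omega>. g \<omega> * h \<omega> \<partial>L x)" for h
      using cong(3) by (intro nn_integral_cong) (simp add: past_def space_measure_of_conv)
    show ?case using cong(4) by (simp only: eq)
  next
    case (set A)
    then show ?case using base B by blast
  next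
    case (mult u c)
    note [measurable] = GW[OF \<open>u \<in> borel_measurable (past W Y \<zeta> t)\<close>]
    show ?case using mult by (simp add: mult.assoc nn_integral_cmult)
  next
    case (add u v)
    note [measurable] = GW[OF \<open>u \<in> borel_measurable (past W Y \<zeta> t)\<close>] GW[OF \<open>v \<in> borel_measurable (past W Y \<zeta> t)\<close>]
    show ?case using add by (simp add: distrib_right nn_integral_add)
  next
    case (seq U)
    note [measurable] = GW[OF seq(1)]
    have sup: "(\<integral>\<^sup>+\<omega>. (SUP i. U i) \<omega> * h \<omega> \<partial>L x) = (SUP i. \<integral>\<^sup>+\<omega>. U i \<omega> * h \<omega> \<partial>L x)"
      if [measurable]: "h \<in> borel_measurable (L x)" for h
    proof -
      have "(\<integral>\<^sup>+\<omega>. (SUP i. U i) \<omega> * h \<omega> \<partial>L x) = (\<integral>\<^sup>+\<omega>. (SUP i. U i \<omega> * h \<omega>) \<partial>L x)"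
        by (simp add: SUP_mult_right_ennreal image_comp SUP_apply)
      also have "\<dots> = (SUP i. \<integral>\<^sup>+\<omega>. U i \<omega> * h \<omega> \<partial>L x)"
        using \<open>incseq U\<close> by (intro nn_integral_monotone_convergence_SUP) (auto simp: incseq_def le_fun_def intro!: mult_right_mono)
      finally show ?thesis .
    qed
    show ?case using seq.IH by (subst (1 2) sup) auto
  qed
  note [measurable] = GW[OF G]
  show ?thesis using f
  proof induction
    case (cong f g)
    then have "f = g" by auto
    then show ?case using cong by simp
  next
    case (set A)
    then show ?case by (rule step1)
  next
    case (mult u c)
    have eq: "(\<integral>\<^sup>+ y. c * u y \<partial>P s z) = c * (\<integral>\<^sup>+ y. u y \<partial>P s z)" for z
      using mult by (intro nn_integral_cmult) (simp add: measurable_cong_sets[OF sets_P[OF st(1)] refl])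
    show ?case using mult by (simp add: eq mult.left_commute[of _ c] nn_integral_cmult)
  next
    case (add u v)
    have eq: "(\<integral>\<^sup>+ y. v y + u y \<partial>P s z) = (\<integral>\<^sup>+ y. v y \<partial>P s z) + (\<integral>\<^sup>+ y. u y \<partial>P s z)" for z
      using add by (intro nn_integral_add) (simp_all add: measurable_cong_sets[OF sets_P[OF st(1)] refl])
    show ?case using add by (simp add: eq distrib_left nn_integral_add)
  next
    case (seq U)
    note [measurable] = seq(1)
    have eq: "(\<integral>\<^sup>+ y. (SUP i. U i) y \<partial>P s z) = (SUP i. \<integral>\<^sup>+ y. U i y \<partial>P s z)" for z
    proof -
      have "(\<integral>\<^sup>+ y. (SUP i. U i) y \<partial>P s z) = (\<integral>\<^sup>+ y. (SUP i. U i y) \<partial>P s z)"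
        by (simp add: SUP_apply image_comp)
      also have "\<dots> = (SUP i. \<integral>\<^sup>+ y. U i y \<partial>P s z)"
        using \<open>incseq U\<close> by (intro nn_integral_monotone_convergence_SUP) (auto simp: measurable_cong_sets[OF sets_P[OF st(1)] refl])
      finally show ?thesis .
    qed
    have inc: "incseq (\<lambda>i. \<integral>\<^sup>+ y. U i y \<partial>P s z)" for z
      using \<open>incseq U\<close> by (auto simp: incseq_def le_fun_def intro!: nn_integral_mono)
    have sup: "(\<integral>\<^sup>+\<omega>. G \<omega> * (l \<omega> * (SUP i. h i \<omega>)) \<partial>L x) = (SUP i. \<integral>\<^sup>+\<omega>. G \<omega> * (l \<omega> * h i \<omega>) \<partial>L x)"
      if [measurable]: "\<And>i. h i \<in> borel_measurable (L x)" "l \<in> borel_measurable (L x)" and i: "\<And>\<omega>. incseq (\<lambda>i. h i \<omega>)" for h :: "nat \<Rightarrow> 'w \<Rightarrow> ennreal" and l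
    proof -
      have "(\<integral>\<^sup>+\<omega>. G \<omega> * (l \<omega> * (SUP i. h i \<omega>)) \<partial>L x) = (\<integral>\<^sup>+\<omega>. (SUP i. G \<omega> * (l \<omega> * h i \<omega>)) \<partial>L x)"
        by (simp add: SUP_mult_left_ennreal)
      also have "\<dots> = (SUP i. \<integral>\<^sup>+\<omega>. G \<omega> * (l \<omega> * h i \<omega>) \<partial>L x)"
        using i by (intro nn_integral_monotone_convergence_SUP) (auto simp: incseq_def le_fun_def intro!: mult_left_mono)
      finally show ?thesis .
    qed
    have "(\<integral>\<^sup>+\<omega>. G \<omega> * (live (t + s) \<omega> * (SUP i. U i) (pos (t + s) \<omega>)) \<partial>L x) =
       (\<integral>\<^sup>+\<omega>. G \<omega> * (live (t + s) \<omega> * (SUP i. U i (pos (t + s) \<omega>))) \<partial>L x)"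
      by (simp add: SUP_apply image_comp)
    also have "\<dots> = (SUP i. \<integral>\<^sup>+\<omega>. G \<omega> * (live (t + s) \<omega> * U i (pos (t + s) \<omega>)) \<partial>L x)"
      using \<open>incseq U\<close> by (intro sup) (auto simp: incseq_def le_fun_def)
    also have "\<dots> = (SUP i. \<integral>\<^sup>+\<omega>. G \<omega> * (live t \<omega> * (\<integral>\<^sup>+y. U i y \<partial>P s (pos t \<omega>))) \<partial>L x)"
      using seq.IH by simp
    also have "\<dots> = (\<integral>\<^sup>+\<omega>. G \<omega> * (live t \<omega> * (SUP i. \<integral>\<^sup>+y. U i y \<partial>P s (pos t \<omega>))) \<partial>L x)"
      by (intro sup[symmetric] inc) auto
    finally show ?case unfolding eq .
  qed
qed


lemma PS_bound: "0 \<le> s \<Longrightarrow> (\<And>y. \<bar>f y\<bar> \<le> C) \<Longrightarrow> \<bar>PS s f x\<bar> \<le> C"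
proof -
  assume s: "0 \<le> s" and C: "\<And>y. \<bar>f y\<bar> \<le> C"
  interpret subprob_space "P s x" by (rule subprob_P[OF s])
  have C0: "0 \<le> C" using C[of x] by simp
  have "\<bar>PS s f x\<bar> \<le> (\<integral>y. \<bar>f y\<bar> \<partial>P s x)" unfolding PS_def using integral_norm_bound[of "P s x" f] by simp
  also have "\<dots> \<le> (\<integral>y. C \<partial>P s x)" using C C0 by (intro integral_mono') auto
  also have "\<dots> \<le> C * 1" unfolding lebesgue_integral_const using C0 subprob_measure_le_1 by (simp add: mult_left_le mult.commute)
  finally show ?thesis by simp
qed

lemma P_integrable: "0 \<le> s \<Longrightarrow> f \<in> bB \<Longrightarrow> integrable (P s x) f"
  by (frule bB_measurable, erule bB_bound, rule integrable_bounded[OF subprob_space.axioms(1)[OF subprob_P]])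
     (auto simp: measurable_cong_sets[OF sets_P refl])

lemma PS_nonneg: "(\<And>y. 0 \<le> f y) \<Longrightarrow> 0 \<le> PS s f x"
  by (simp add: PS_def)

lemma PS_measurable: "0 \<le> s \<Longrightarrow> f \<in> bB \<Longrightarrow> PS s f \<in> borel_measurable borel"
  unfolding PS_def[abs_def]
  by (rule measurable_compose[OF kernel integral_measurable_subprob_algebra]) (auto dest: bB_measurable)

lemma past_W: "0 \<le> t \<Longrightarrow> G \<in> borel_measurable (past W Y \<zeta> t) \<Longrightarrow> G \<in> borel_measurable W"
  by (rule measurable_from_subalg[OF sets_past_subset])

text \<open>Adding the constants \<open>C\<close> and \<open>D\<close> makes both factors
  nonnegative, and the original product is a combination of four nonnegative cases. The constant
  \<open>D\<close> is carried as a function under \<open>PS\<close>, since a sub-Markovian semigroup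
  need not preserve constants.\<close>

lemma markov_real:
  fixes G :: "'w \<Rightarrow> real"
  assumes st: "0 \<le> s" "0 \<le> t" and G: "G \<in> borel_measurable (past W Y \<zeta> t)" "\<And>\<omega>. \<bar>G \<omega>\<bar> \<le> C" and f: "f \<in> bB"
  shows "(\<integral>\<omega>. G \<omega> * (live (t + s) \<omega> * f (pos (t + s) \<omega>)) \<partial>L x) = (\<integral>\<omega>. G \<omega> * (live t \<omega> * PS s f (pos t \<omega>)) \<partial>L x)"
proof -
  obtain D where D: "0 < D" "\<And>y. \<bar>f y\<bar> \<le> D" using bB_bound[OF f] by metis
  have C0: "0 \<le> C" using G(2)[of undefined] by linarith
  define l r where "l G f = (\<integral>\<omega>. G \<omega> * (live (t + s) \<omega> * f (pos (t + s) \<omega>)) \<partial>L x)"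
    and "r G f = (\<integral>\<omega>. G \<omega> * (live t \<omega> * PS s f (pos t \<omega>)) \<partial>L x)" for G :: "'w \<Rightarrow> real" and f
  have i: "integrable (L x) (\<lambda>\<omega>. g \<omega> * (live (t + s) \<omega> * h (pos (t + s) \<omega>)))" "integrable (L x) (\<lambda>\<omega>. g \<omega> * (live t \<omega> * PS s h (pos t \<omega>)))"
    if g: "g \<in> borel_measurable (past W Y \<zeta> t)" "\<And>\<omega>. \<bar>g \<omega>\<bar> \<le> C'" and h: "h \<in> bB" for g :: "'w \<Rightarrow> real" and C' h
  proof -
    note [measurable] = past_W[OF st(2) g(1)] PS_measurable[OF st(1) h] bB_measurable[OF h]
    obtain D' where D': "0 < D'" "\<And>y. \<bar>h y\<bar> \<le> D'" using bB_bound[OF h] by metis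
    have C'0: "0 \<le> C'" using g(2)[of undefined] by linarith
    have "\<bar>g \<omega> * (live u \<omega> * k)\<bar> \<le> C' * (1 * D')" if "\<bar>k\<bar> \<le> D'" for u \<omega> k
      unfolding abs_mult using live_bounds[of u \<omega>] D'(1) C'0 g(2) that by (intro mult_mono) auto
    then show "integrable (L x) (\<lambda>\<omega>. g \<omega> * (live (t + s) \<omega> * h (pos (t + s) \<omega>)))"
      "integrable (L x) (\<lambda>\<omega>. g \<omega> * (live t \<omega> * PS s h (pos t \<omega>)))"
      using D'(2) PS_bound[OF st(1) D'(2)] by (auto intro!: L_integrable[where C="C' * (1 * D')"])
  qed
  have pos: "l g h = r g h" if g: "g \<in> borel_measurable (past W Y \<zeta> t)" "\<And>\<omega>. \<bar>g \<omega>\<bar> \<le> C'" "\<And>\<omega>. 0 \<le> g \<omega>" and h: "h \<in> bpB" for g C' h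
  proof -
    note [measurable] = past_W[OF st(2) g(1)] PS_measurable[OF st(1) bpB_D(1)[OF h]] bB_measurable[OF bpB_D(1)[OF h]]
    have eq: "ennreal (PS s h y) = (\<integral>\<^sup>+z. ennreal (h z) \<partial>P s y)" for y
      unfolding PS_def using P_integrable[OF st(1) bpB_D(1)[OF h]] bpB_D(2)[OF h] by (intro nn_integral_eq_integral[symmetric]) auto
    have "ennreal (l g h) = (\<integral>\<^sup>+\<omega>. ennreal (g \<omega>) * (live (t + s) \<omega> * ennreal (h (pos (t + s) \<omega>))) \<partial>L x)"
      unfolding l_def using g(3) bpB_D(2)[OF h] live_bounds
      by (subst nn_integral_eq_integral[symmetric]) (auto intro!: i[OF g(1,2) bpB_D(1)[OF h]] nn_integral_cong simp: ennreal_mult)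
    also have "\<dots> = (\<integral>\<^sup>+\<omega>. ennreal (g \<omega>) * (live t \<omega> * (\<integral>\<^sup>+y. ennreal (h y) \<partial>P s (pos t \<omega>))) \<partial>L x)"
      using g(1) by (intro markov_nn st) auto
    also have "\<dots> = ennreal (r g h)"
      unfolding r_def eq[symmetric] using g(3) bpB_D(2)[OF h] live_bounds PS_nonneg[of h s]
      by (subst nn_integral_eq_integral[symmetric]) (auto intro!: i[OF g(1,2) bpB_D(1)[OF h]] nn_integral_cong simp: ennreal_mult)
    finally show ?thesis
      using g(3) bpB_D(2)[OF h] live_bounds PS_nonneg[of h s]
      by (subst (asm) ennreal_inj) (auto simp: l_def r_def intro!: integral_nonneg)
  qed
  have cb: "(\<lambda>_. D) \<in> bpB" "(\<lambda>y. f y + D) \<in> bpB"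
  proof -
    note [measurable] = bB_measurable[OF f]
    have "0 \<le> f y + D \<and> f y + D \<le> 2 * D" for y using D(2)[of y] by auto
    then show "(\<lambda>_. D) \<in> bpB" "(\<lambda>y. f y + D) \<in> bpB" using D(1) by (auto intro!: bpB_I[where B="2 * D"])
  qed
  have G_bound: "(\<lambda>\<omega>. G \<omega> + C) \<in> borel_measurable (past W Y \<zeta> t)" "\<bar>G \<omega> + C\<bar> \<le> 2 * C" "0 \<le> G \<omega> + C"
    "(\<lambda>_. C) \<in> borel_measurable (past W Y \<zeta> t)" "\<bar>C\<bar> \<le> C" "0 \<le> C" for \<omega>
    using G(1) G(2)[of \<omega>] C0 by auto
  have PSadd: "PS s (\<lambda>y. f y + D) y = PS s f y + PS s (\<lambda>_. D) y" for y
    unfolding PS_def using P_integrable[OF st(1) f] P_integrable[OF st(1) bpB_D(1)[OF cb(1)]] by simp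
  note ii = i[OF G_bound(1,2) bpB_D(1)[OF cb(2)]] i[OF G_bound(1,2) bpB_D(1)[OF cb(1)]] i[OF G_bound(4,5) bpB_D(1)[OF cb(2)]] i[OF G_bound(4,5) bpB_D(1)[OF cb(1)]]
  have comb: "(\<integral>\<omega>. a \<omega> \<partial>L x) - (\<integral>\<omega>. b \<omega> \<partial>L x) - (\<integral>\<omega>. c \<omega> \<partial>L x) + (\<integral>\<omega>. d \<omega> \<partial>L x) = (\<integral>\<omega>. a \<omega> - b \<omega> - c \<omega> + d \<omega> \<partial>L x)"
    if "integrable (L x) a" "integrable (L x) b" "integrable (L x) c" "integrable (L x) d" for a b c d :: "'w \<Rightarrow> real"
    using that by simp
  have "l G f = l (\<lambda>\<omega>. G \<omega> + C) (\<lambda>y. f y + D) - l (\<lambda>\<omega>. G \<omega> + C) (\<lambda>_. D) - l (\<lambda>_. C) (\<lambda>y. f y + D) + l (\<lambda>_. C) (\<lambda>_. D)"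
    unfolding l_def comb[OF ii(1,3,5,7)] by (intro Bochner_Integration.integral_cong) (simp_all add: algebra_simps)
  also have "\<dots> = r (\<lambda>\<omega>. G \<omega> + C) (\<lambda>y. f y + D) - r (\<lambda>\<omega>. G \<omega> + C) (\<lambda>_. D) - r (\<lambda>_. C) (\<lambda>y. f y + D) + r (\<lambda>_. C) (\<lambda>_. D)"
    unfolding pos[OF G_bound(1,2,3) cb(1)] pos[OF G_bound(1,2,3) cb(2)] pos[OF G_bound(4,5,6) cb(1)] pos[OF G_bound(4,5,6) cb(2)] ..
  also have "\<dots> = r G f"
    unfolding r_def comb[OF ii(2,4,6,8)]
    by (intro Bochner_Integration.integral_cong refl) (simp only: PSadd, simp add: algebra_simps)
  finally show ?thesis by (simp add: l_def r_def)
qed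

text \<open>The Markov property at time 0. Writing motion integrals over path space matters because
  joint measurability in time and position is available there.\<close>

lemma PS_eq_L:
  assumes t: "0 \<le> t" and f: "f \<in> bB"
  shows "PS t f x = (\<integral>\<omega>. live t \<omega> * f (pos t \<omega>) \<partial>L x)"
proof -
  interpret prob_space "L x" by (rule L_prob)
  note [measurable] = PS_measurable[OF t f] bB_measurable[OF f]
  have "(\<integral>\<omega>. 1 * (live (0 + t) \<omega> * f (pos (0 + t) \<omega>)) \<partial>L x) = (\<integral>\<omega>. 1 * (live 0 \<omega> * PS t f (pos 0 \<omega>)) \<partial>L x)"
    by (rule markov_real[OF t order_refl _ _ f, where C=1]) auto
  also have "\<dots> = (\<integral>\<omega>. PS t f x \<partial>L x)"
  proof (rule integral_cong_AE)
    show "AE \<omega> in L x. 1 * (live 0 \<omega> * PS t f (pos 0 \<omega>)) = PS t f x"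
      using initial[of x] by eventually_elim (auto simp: live_def pos_def alive_def zero_ereal_def)
  qed measurable
  finally show ?thesis using prob_space by simp
qed

lemma PS_joint_measurable:
  assumes [measurable]: "(\<lambda>(z, y). q z y) \<in> borel_measurable (M \<Otimes>\<^sub>M borel)" "s \<in> borel_measurable M" "g \<in> borel_measurable M"
  shows "(\<lambda>z. \<integral>\<omega>. live (s z) \<omega> * q z (pos (s z) \<omega>) \<partial>L (g z)) \<in> borel_measurable M"
  by (rule L_integral_measurable) measurable

text \<open>The weight integrates \<open>\<beta>\<close> along the whole path up to
  \<open>t\<close>, so adaptedness at single times does not suffice and progressive measurability is
  used.\<close>

lemma wt_adapted:
  assumes sp: "space F = space W"
    and ad: "\<And>u A. 0 \<le> u \<Longrightarrow> u \<le> t \<Longrightarrow> A \<in> sets borel \<Longrightarrow> {\<omega> \<in> space W. ereal u < \<zeta> \<omega> \<and> Y u \<omega> \<in> A} \<in> sets F"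
  shows "(\<lambda>\<omega>. wt t \<omega> * \<beta> (pos t \<omega>)) \<in> borel_measurable F"
proof -
  define p where "p = (\<lambda>(s, \<omega>). if s \<le> t then pos s \<omega> else undefined)"
  define a where "a = (\<lambda>(s, \<omega>). s \<le> t \<and> alive s \<omega>)"
  have p [measurable]: "p \<in> borel_measurable (borel \<Otimes>\<^sub>M F)" unfolding p_def by (rule progressive(1)[OF sp ad])
  have a [measurable]: "Measurable.pred (borel \<Otimes>\<^sub>M F) a" unfolding a_def by (rule progressive(2)[OF sp ad])
  have c: "(\<lambda>\<omega>. (t, \<omega>)) \<in> F \<rightarrow>\<^sub>M (borel \<Otimes>\<^sub>M F)" by (rule measurable_Pair1') simp
  have p': "(\<lambda>\<omega>. p (t, \<omega>)) = pos t" and a': "(\<lambda>\<omega>. a (t, \<omega>)) = alive t" by (auto simp: p_def a_def)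
  have 1: "pos t \<in> borel_measurable F" using measurable_compose[OF c p] unfolding p' .
  have 2: "Measurable.pred F (alive t)" using measurable_compose[OF c a] unfolding a' .
  have sw: "(\<lambda>z. (snd z, fst z)) \<in> (F \<Otimes>\<^sub>M lborel) \<rightarrow>\<^sub>M (borel \<Otimes>\<^sub>M F)"
    by (intro measurable_Pair) (auto intro: measurable_compose[OF measurable_snd])
  have "(\<lambda>z. p (snd z, fst z)) \<in> borel_measurable (F \<Otimes>\<^sub>M lborel)"
    by (rule measurable_compose[OF sw p])
  then have "(\<lambda>z. indicator {0..t} (snd z) * \<beta> (p (snd z, fst z))) \<in> borel_measurable (F \<Otimes>\<^sub>M lborel)"
    by (intro borel_measurable_times measurable_compose[OF _ beta_measurable] measurable_compose[OF measurable_snd borel_measurable_indicator]) simp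
  then have "(\<lambda>\<omega>. \<integral>s. indicator {0..t} s * \<beta> (p (s, \<omega>)) \<partial>lborel) \<in> borel_measurable F"
    by (intro lborel.borel_measurable_lebesgue_integral) (simp add: case_prod_unfold)
  also have "(\<lambda>\<omega>. \<integral>s. indicator {0..t} s * \<beta> (p (s, \<omega>)) \<partial>lborel) = acc t"
    unfolding acc_def p_def by (intro ext Bochner_Integration.integral_cong) (auto simp: indicator_def)
  finally have 3: "acc t \<in> borel_measurable F" .
  have "(\<lambda>\<omega>. exp (acc t \<omega>)) \<in> borel_measurable F"
    by (rule measurable_compose[OF 3]) simp
  moreover have "(\<lambda>\<omega>. \<beta> (pos t \<omega>)) \<in> borel_measurable F"
    by (rule measurable_compose[OF 1 beta_measurable])
  moreover have "live t \<in> borel_measurable F"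
    using measurable_If[OF _ _ 2[unfolded pred_def], of "\<lambda>_. 1::real" borel "\<lambda>_. 0"]
    by (simp add: live_def[abs_def])
  ultimately show ?thesis unfolding wt_def by (intro borel_measurable_times)
qed

lemma wt_past: "(\<lambda>\<omega>. wt t \<omega> * \<beta> (pos t \<omega>)) \<in> borel_measurable (past W Y \<zeta> t)"
proof (rule wt_adapted)
  show "space (past W Y \<zeta> t) = space W" by (simp add: past_def space_measure_of_conv)
  show "{\<omega> \<in> space W. ereal u < \<zeta> \<omega> \<and> Y u \<omega> \<in> A} \<in> sets (past W Y \<zeta> t)" if "0 \<le> u" "u \<le> t" "A \<in> sets borel" for u A
    unfolding past_def using that by (subst sets_measure_of) (auto intro!: sigma_sets.Basic)
qed

lemma live_mult_bound: "\<bar>z\<bar> \<le> C \<Longrightarrow> \<bar>live t \<omega> * z\<bar> \<le> C"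
  by (auto simp: live_def)

lemma T_bound: "0 \<le> t \<Longrightarrow> (\<And>y. \<bar>f y\<bar> \<le> C) \<Longrightarrow> \<bar>T t f x\<bar> \<le> exp (bsup * t) * C"
  unfolding T_def
  by (rule L_integral_bound) (auto simp: abs_mult wt_nonneg intro!: mult_mono wt_bound)

lemma T_integrable: "0 \<le> t \<Longrightarrow> f \<in> bB \<Longrightarrow> integrable (L x) (\<lambda>\<omega>. wt t \<omega> * f (pos t \<omega>))"
proof -
  assume t: "0 \<le> t" and f: "f \<in> bB"
  note [measurable] = bB_measurable[OF f]
  obtain C where C: "0 < C" "\<And>x. \<bar>f x\<bar> \<le> C" using bB_bound[OF f] by metis
  show ?thesis
    by (rule L_integrable[where C="exp (bsup * t) * C"])
       (use C wt_bound[OF t] in \<open>auto simp: abs_mult wt_nonneg intro!: mult_mono\<close>)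
qed

lemma T_joint_measurable:
  assumes [measurable]: "(\<lambda>(z, y). q z y) \<in> borel_measurable (M \<Otimes>\<^sub>M borel)" "s \<in> borel_measurable M" "g \<in> borel_measurable M"
  shows "(\<lambda>z. T (s z) (q z) (g z)) \<in> borel_measurable M"
  unfolding T_def by (rule L_integral_measurable) measurable

lemma T_bB: assumes t: "0 \<le> t" and f: "f \<in> bB" shows "T t f \<in> bB"
proof -
  note [measurable] = bB_measurable[OF f]
  obtain C where C: "\<And>x. \<bar>f x\<bar> \<le> C" using bB_bound[OF f] by metis
  have "(\<lambda>z. T t f z) \<in> borel_measurable borel"
    by (rule T_joint_measurable[where q="\<lambda>_. f"]) measurable
  then show ?thesis using T_bound[OF t C] by (intro bB_I) auto
qed

text \<open>The term of the perturbation expansion in which the path is weighted up to time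
  \<open>s\<close>, meets the rate \<open>\<beta>\<close> there, and is afterwards weighted only by
  survival until \<open>u\<close>.\<close>

definition K :: "real \<Rightarrow> real \<Rightarrow> ('e \<Rightarrow> real) \<Rightarrow> 'e \<Rightarrow> real"
  where "K s u g x = (\<integral>\<omega>. wt s \<omega> * \<beta> (pos s \<omega>) * (live u \<omega> * g (pos u \<omega>)) \<partial>L x)"

lemma wt_beta_bound: "0 \<le> s \<Longrightarrow> s \<le> t \<Longrightarrow> \<bar>wt s \<omega> * \<beta> (pos s \<omega>)\<bar> \<le> exp (bsup * t) * bsup"
proof -
  assume s: "0 \<le> s" "s \<le> t"
  then have "exp (bsup * s) \<le> exp (bsup * t)" using bsup_nonneg by (simp add: mult_left_mono)
  then have "wt s \<omega> \<le> exp (bsup * t)" using wt_bound[OF s(1), of \<omega>] by (rule order_trans[rotated])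
  then show ?thesis unfolding abs_mult using wt_nonneg[of s \<omega>] beta_le by (intro mult_mono) auto
qed

text \<open>The Markov property at time \<open>s\<close>, with the weight as the functional of the
  past; the factor \<open>live s\<close> is already contained in \<open>wt s\<close>.\<close>

lemma K_eq:
  assumes "0 \<le> s" "s \<le> u" "g \<in> bB"
  shows "K s u g x = (\<integral>\<omega>. wt s \<omega> * \<beta> (pos s \<omega>) * PS (u - s) g (pos s \<omega>) \<partial>L x)"
proof -
  have "K s u g x = (\<integral>\<omega>. wt s \<omega> * \<beta> (pos s \<omega>) * (live (s + (u - s)) \<omega> * g (pos (s + (u - s)) \<omega>)) \<partial>L x)"
    by (simp add: K_def)
  also have "\<dots> = (\<integral>\<omega>. wt s \<omega> * \<beta> (pos s \<omega>) * (live s \<omega> * PS (u - s) g (pos s \<omega>)) \<partial>L x)"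
    using assms wt_past wt_beta_bound[OF assms(1) order_refl] by (intro markov_real) auto
  also have "\<dots> = (\<integral>\<omega>. wt s \<omega> * \<beta> (pos s \<omega>) * PS (u - s) g (pos s \<omega>) \<partial>L x)"
    by (intro Bochner_Integration.integral_cong) (auto simp: wt_def live_def)
  finally show ?thesis .
qed

text \<open>Survival to \<open>t\<close> forces survival at every earlier \<open>s\<close>, so on
  this event \<open>wt s\<close> is the plain exponential and \<open>exp_integral_identity\<close>
  applies; otherwise both sides vanish.\<close>

lemma wt_identity:
  assumes t: "0 \<le> t" and w: "\<omega> \<in> space W"
  shows "(wt t \<omega> - live t \<omega>) = (\<integral>s. indicator {0..t} s * (wt s \<omega> * \<beta> (pos s \<omega>) * live t \<omega>) \<partial>lborel)"
proof (cases "alive t \<omega>")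
  case True
  have m: "(\<lambda>s. \<beta> (pos s \<omega>)) \<in> borel_measurable borel"
    using w by measurable
  have "wt t \<omega> - live t \<omega> = exp (acc t \<omega>) - 1" using True by (simp add: wt_def live_def)
  also have "\<dots> = (\<integral>s. indicator {0..t} s * (exp (acc s \<omega>) * \<beta> (pos s \<omega>)) \<partial>lborel)"
    unfolding acc_def using exp_integral_identity[OF m beta_le t] .
  also have "\<dots> = (\<integral>s. indicator {0..t} s * (wt s \<omega> * \<beta> (pos s \<omega>) * live t \<omega>) \<partial>lborel)"
    using True alive_antimono[OF True] by (intro Bochner_Integration.integral_cong) (auto simp: wt_def live_def indicator_def)
  finally show ?thesis .
qed (simp add: wt_def live_def)

lemma Fubini_L:
  fixes f :: "real \<Rightarrow> 'w \<Rightarrow> real"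
  assumes [measurable]: "(\<lambda>(s, \<omega>). f s \<omega>) \<in> borel_measurable (borel \<Otimes>\<^sub>M W)"
    and le: "\<And>s \<omega>. s \<in> {a..t} \<Longrightarrow> \<bar>f s \<omega>\<bar> \<le> C"
  shows "(\<integral>\<omega>. (\<integral>s. indicator {a..t} s * f s \<omega> \<partial>lborel) \<partial>L x) = (\<integral>s. indicator {a..t} s * (\<integral>\<omega>. f s \<omega> \<partial>L x) \<partial>lborel)"
    and "integrable lborel (\<lambda>s. indicator {a..t} s * (\<integral>\<omega>. f s \<omega> \<partial>L x))"
    and "integrable (L x) (\<lambda>\<omega>. \<integral>s. indicator {a..t} s * f s \<omega> \<partial>lborel)"
proof -
  interpret prob_space "L x" by (rule L_prob)
  have m: "(\<lambda>(s, \<omega>). indicator {a..t} s * f s \<omega>) \<in> borel_measurable (lborel \<Otimes>\<^sub>M L x)" by measurable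
  have b: "\<bar>case (s, \<omega>) of (s, \<omega>) \<Rightarrow> indicator {a..t} s * f s \<omega>\<bar> \<le> C * indicator {a..t} s * indicator (space W) \<omega>" if "\<omega> \<in> space (L x)" for s \<omega>
    using le[of s \<omega>] that by (auto simp: indicator_def)
  note F = Fubini_bounded[OF lborel.sigma_finite_measure_axioms sigma_finite_measure_axioms m, of "{a..t}" "space W" C]
  show "(\<integral>\<omega>. (\<integral>s. indicator {a..t} s * f s \<omega> \<partial>lborel) \<partial>L x) = (\<integral>s. indicator {a..t} s * (\<integral>\<omega>. f s \<omega> \<partial>L x) \<partial>lborel)"
    using F(1) b by (simp add: emeasure_lborel_Icc_eq less_top[symmetric])
  show "integrable lborel (\<lambda>s. indicator {a..t} s * (\<integral>\<omega>. f s \<omega> \<partial>L x))"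
    using F(2) b by (simp add: emeasure_lborel_Icc_eq less_top[symmetric])
  show "integrable (L x) (\<lambda>\<omega>. \<integral>s. indicator {a..t} s * f s \<omega> \<partial>lborel)"
    using F(3) b by (simp add: emeasure_lborel_Icc_eq less_top[symmetric])
qed

text \<open>The pathwise identity for the weight, multiplied by \<open>f\<close> at time
  \<open>t\<close> and integrated over paths; boundedness of \<open>\<beta>\<close> permits the
  exchange of integrals.\<close>

lemma feynman_kac:
  assumes t: "0 \<le> t" and f: "f \<in> bB"
  shows "T t f x - PS t f x = (\<integral>s. indicator {0..t} s * K s t f x \<partial>lborel)"
proof -
  note [measurable] = bB_measurable[OF f]
  obtain C where C: "0 < C" "\<And>x. \<bar>f x\<bar> \<le> C" using bB_bound[OF f] by metis
  have "T t f x - PS t f x = (\<integral>\<omega>. wt t \<omega> * f (pos t \<omega>) - live t \<omega> * f (pos t \<omega>) \<partial>L x)"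
    unfolding PS_eq_L[OF t f] T_def
    using C by (intro Bochner_Integration.integral_diff[symmetric] T_integrable t f L_integrable[where C=C] live_mult_bound)
      auto
  also have "\<dots> = (\<integral>\<omega>. (\<integral>s. indicator {0..t} s * (wt s \<omega> * \<beta> (pos s \<omega>) * (live t \<omega> * f (pos t \<omega>))) \<partial>lborel) \<partial>L x)"
  proof (rule Bochner_Integration.integral_cong)
    fix \<omega> assume "\<omega> \<in> space (L x)"
    then have "wt t \<omega> * f (pos t \<omega>) - live t \<omega> * f (pos t \<omega>) = (\<integral>s. indicator {0..t} s * (wt s \<omega> * \<beta> (pos s \<omega>) * live t \<omega>) \<partial>lborel) * f (pos t \<omega>)"
      using wt_identity[OF t, of \<omega>] by (simp flip: left_diff_distrib)
    also have "\<dots> = (\<integral>s. indicator {0..t} s * (wt s \<omega> * \<beta> (pos s \<omega>) * live t \<omega>) * f (pos t \<omega>) \<partial>lborel)" by simp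
    finally show "wt t \<omega> * f (pos t \<omega>) - live t \<omega> * f (pos t \<omega>) = (\<integral>s. indicator {0..t} s * (wt s \<omega> * \<beta> (pos s \<omega>) * (live t \<omega> * f (pos t \<omega>))) \<partial>lborel)"
      by (simp add: mult.assoc)
  qed simp
  also have "\<dots> = (\<integral>s. indicator {0..t} s * K s t f x \<partial>lborel)"
    unfolding K_def
  proof (rule Fubini_L(1)[where C="exp (bsup * t) * bsup * (1 * C)"])
    show "\<bar>wt s \<omega> * \<beta> (pos s \<omega>) * (live t \<omega> * f (pos t \<omega>))\<bar> \<le> exp (bsup * t) * bsup * (1 * C)" if "s \<in> {0..t}" for s \<omega>
      unfolding abs_mult[of "wt s \<omega> * \<beta> (pos s \<omega>)"] abs_mult[of "live t \<omega>"]
      using that C live_bounds[of t \<omega>] bsup_nonneg by (intro mult_mono wt_beta_bound) auto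
  qed measurable
  finally show ?thesis .
qed

text \<open>Convolving the given equation with \<open>T \<beta>\<close> turns each occurrence of \<open>P\<close> into \<open>T - P\<close>
  by the perturbation formula; adding the result to the equation removes \<open>P\<close>.\<close>

lemma duhamel:
  fixes w q :: "real \<Rightarrow> 'e \<Rightarrow> real"
  assumes t: "0 \<le> t" and f: "f \<in> bB"
    and q [measurable]: "(\<lambda>(s, y). q s y) \<in> borel_measurable (borel \<Otimes>\<^sub>M borel)" and qC: "\<And>s y. \<bar>q s y\<bar> \<le> Cq"
    and w [measurable]: "(\<lambda>(s, y). w s y) \<in> borel_measurable (borel \<Otimes>\<^sub>M borel)" and wC: "\<And>s y. \<bar>w s y\<bar> \<le> Cw"
    and eq: "\<And>u y. 0 \<le> u \<Longrightarrow> u \<le> t \<Longrightarrow> w u y = PS u f y - (\<integral>s. indicator {0..u} s * PS s (q (u - s)) y \<partial>lborel)"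
  shows "w t x = T t f x - (\<integral>s. indicator {0..t} s * T s (\<lambda>y. q (t - s) y + \<beta> y * w (t - s) y) x \<partial>lborel)"
proof -
  have Cq0: "0 \<le> Cq" using qC[of 0 undefined] by simp
  have qb: "q s \<in> bB" for s using qC by (intro bB_I) auto
  have wb: "w s \<in> bB" for s using wC by (intro bB_I) auto
  define E where "E = exp (bsup * t) * bsup"
  have E0: "0 \<le> E" using bsup_nonneg by (simp add: E_def)
  have wl: "\<bar>wt s \<omega> * \<beta> (pos s \<omega>)\<bar> \<le> E" if "s \<in> {0..t}" for s \<omega>
    unfolding E_def using that by (intro wt_beta_bound) auto
  have PSq: "PS (u - s) (q (t - u)) y = (\<integral>\<omega>. live (u - s) \<omega> * q (t - u) (pos (u - s) \<omega>) \<partial>L y)" if "s \<le> u" for s u y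
    using that by (intro PS_eq_L qb) auto
  \<comment> \<open>The equation at time \<open>t - s\<close> is inserted under \<open>T s\<close>;
    the Markov property at time \<open>s\<close> then expresses both resulting terms through
    \<open>K\<close>.\<close>
  have main: "T s (\<lambda>y. \<beta> y * w (t - s) y) x = K s t f x - (\<integral>u. indicator {s..t} u * K s u (q (t - u)) x \<partial>lborel)"
    if s: "s \<in> {0..t}" for s
  proof -
    \<comment> \<open>The substitution \<open>u = s + r\<close> frees the argument
      \<open>t - u\<close> of \<open>q\<close> from \<open>s\<close>, as the later exchange of the
      two time integrals requires.\<close>
    have shift: "(\<integral>r. indicator {0..t - s} r * PS r (q (t - s - r)) y \<partial>lborel) = (\<integral>u. indicator {s..t} u * PS (u - s) (q (t - u)) y \<partial>lborel)" for y
    proof -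
      have "(\<integral>r. indicator {0..t - s} r * PS r (q (t - s - r)) y \<partial>lborel) = (\<integral>u. indicator {0..t - s} (-s + u) * PS (-s + u) (q (t - s - (-s + u))) y \<partial>lborel)"
        by (subst lborel_integral_real_affine[where c=1 and t="-s"]) simp_all
      also have "\<dots> = (\<integral>u. indicator {s..t} u * PS (u - s) (q (t - u)) y \<partial>lborel)"
        by (intro Bochner_Integration.integral_cong) (auto simp: indicator_def)
      finally show ?thesis .
    qed
    have wsub: "w (t - s) y = PS (t - s) f y - (\<integral>u. indicator {s..t} u * PS (u - s) (q (t - u)) y \<partial>lborel)" for y
      using eq[of "t - s" y] s shift[of y] by simp
    have PSm: "PS (t - s) f \<in> borel_measurable borel" using s f by (intro PS_measurable) auto
    obtain Cf where Cf: "0 < Cf" "\<And>x. \<bar>f x\<bar> \<le> Cf" using bB_bound[OF f] by metis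
    have PSf: "\<bar>PS (t - s) f y\<bar> \<le> Cf" for y using s Cf by (intro PS_bound) auto
    \<comment> \<open>The motion integral is written over path space because that form is jointly
      measurable in \<open>u\<close> and \<open>\<omega>\<close>; it agrees with \<open>PS\<close>
      for \<open>s \<le> u\<close>.\<close>
    define Z where "Z u \<omega> = wt s \<omega> * \<beta> (pos s \<omega>) * (\<integral>\<omega>'. live (u - s) \<omega>' * q (t - u) (pos (u - s) \<omega>') \<partial>L (pos s \<omega>))" for u \<omega>
    have Zm: "(\<lambda>(u, \<omega>). Z u \<omega>) \<in> borel_measurable (borel \<Otimes>\<^sub>M W)"
    proof -
      have [measurable]: "(\<lambda>z. \<integral>\<omega>'. live (fst z - s) \<omega>' * q (t - fst z) (pos (fst z - s) \<omega>') \<partial>L (pos s (snd z))) \<in> borel_measurable (borel \<Otimes>\<^sub>M W)"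
        by (rule PS_joint_measurable) measurable
      show ?thesis unfolding Z_def by (simp add: case_prod_unfold)
    qed
    have Zb: "\<bar>Z u \<omega>\<bar> \<le> E * Cq" if "u \<in> {s..t}" for u \<omega>
      unfolding Z_def abs_mult[of "wt s \<omega> * \<beta> (pos s \<omega>)"]
      using PSq[of s u "pos s \<omega>"] that PS_bound[of "u - s" "q (t - u)" Cq "pos s \<omega>"] qC E0 wl[OF s] by (intro mult_mono) auto
    have "T s (\<lambda>y. \<beta> y * w (t - s) y) x = (\<integral>\<omega>. wt s \<omega> * \<beta> (pos s \<omega>) * PS (t - s) f (pos s \<omega>) - (\<integral>u. indicator {s..t} u * Z u \<omega> \<partial>lborel) \<partial>L x)"
      unfolding T_def
    proof (rule Bochner_Integration.integral_cong)
      fix \<omega>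
      have eqZ: "(\<integral>u. indicator {s..t} u * Z u \<omega> \<partial>lborel) = wt s \<omega> * \<beta> (pos s \<omega>) * (\<integral>u. indicator {s..t} u * PS (u - s) (q (t - u)) (pos s \<omega>) \<partial>lborel)"
        unfolding Z_def integral_mult_right_zero[symmetric]
        by (intro Bochner_Integration.integral_cong) (auto simp: PSq indicator_def)
      show "wt s \<omega> * (\<beta> (pos s \<omega>) * w (t - s) (pos s \<omega>)) = wt s \<omega> * \<beta> (pos s \<omega>) * PS (t - s) f (pos s \<omega>) - (\<integral>u. indicator {s..t} u * Z u \<omega> \<partial>lborel)"
        unfolding wsub eqZ by (simp only: right_diff_distrib mult.assoc)
    qed simp
    also have "\<dots> = (\<integral>\<omega>. wt s \<omega> * \<beta> (pos s \<omega>) * PS (t - s) f (pos s \<omega>) \<partial>L x) - (\<integral>\<omega>. (\<integral>u. indicator {s..t} u * Z u \<omega> \<partial>lborel) \<partial>L x)"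
    proof (rule Bochner_Integration.integral_diff)
      note [measurable] = PSm
      show "integrable (L x) (\<lambda>\<omega>. wt s \<omega> * \<beta> (pos s \<omega>) * PS (t - s) f (pos s \<omega>))"
        by (rule L_integrable[where C="E * Cf"])
           (use wl[OF s] PSf E0 in \<open>auto simp: abs_mult[of "wt s _ * \<beta> (pos s _)"] intro!: mult_mono simp del: abs_mult\<close>)
      show "integrable (L x) (\<lambda>\<omega>. \<integral>u. indicator {s..t} u * Z u \<omega> \<partial>lborel)"
        by (rule Fubini_L(3)[OF Zm Zb])
    qed
    also have "(\<integral>\<omega>. wt s \<omega> * \<beta> (pos s \<omega>) * PS (t - s) f (pos s \<omega>) \<partial>L x) = K s t f x"
      using s f by (intro K_eq[symmetric]) auto
    also have "(\<integral>\<omega>. (\<integral>u. indicator {s..t} u * Z u \<omega> \<partial>lborel) \<partial>L x) = (\<integral>u. indicator {s..t} u * (\<integral>\<omega>. Z u \<omega> \<partial>L x) \<partial>lborel)"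
      by (rule Fubini_L(1)[OF Zm Zb])
    also have "\<dots> = (\<integral>u. indicator {s..t} u * K s u (q (t - u)) x \<partial>lborel)"
    proof (rule Bochner_Integration.integral_cong)
      fix u show "indicator {s..t} u * (\<integral>\<omega>. Z u \<omega> \<partial>L x) = indicator {s..t} u * K s u (q (t - u)) x"
        using s K_eq[of s u "q (t - u)" x, OF _ _ qb] by (cases "u \<in> {s..t}") (auto simp: Z_def PSq)
    qed simp
    finally show ?thesis .
  qed
  define k where "k s u = K s u (q (t - u)) x" for s u
  have km: "(\<lambda>(s, u). k s u) \<in> borel_measurable (borel \<Otimes>\<^sub>M borel)"
  proof -
    have "(\<lambda>z. \<integral>\<omega>. wt (fst z) \<omega> * \<beta> (pos (fst z) \<omega>) * (live (snd z) \<omega> * q (t - snd z) (pos (snd z) \<omega>)) \<partial>L x) \<in> borel_measurable (borel \<Otimes>\<^sub>M borel)"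
      by (rule L_integral_measurable) measurable
    then show ?thesis by (simp add: k_def K_def case_prod_unfold)
  qed
  have kb: "\<bar>k s u\<bar> \<le> E * (1 * Cq)" if "s \<in> {0..t}" for s u
    unfolding k_def K_def
  proof (rule L_integral_bound)
    show "\<bar>wt s \<omega> * \<beta> (pos s \<omega>) * (live u \<omega> * q (t - u) (pos u \<omega>))\<bar> \<le> E * (1 * Cq)" for \<omega>
      unfolding abs_mult[of "wt s \<omega> * \<beta> (pos s \<omega>)"] abs_mult[of "live u \<omega>"]
      using wl[OF that, of \<omega>] live_bounds[of u \<omega>] qC E0 by (intro mult_mono) auto
  qed
  \<comment> \<open>Exchange of integration over the triangle
    \<open>0 \<le> s \<le> u \<le> t\<close>.\<close>
  have swap: "(\<integral>s. indicator {0..t} s * (\<integral>u. indicator {s..t} u * k s u \<partial>lborel) \<partial>lborel) = (\<integral>u. indicator {0..t} u * (\<integral>s. indicator {0..u} s * k s u \<partial>lborel) \<partial>lborel)"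
    and swi: "integrable lborel (\<lambda>s. indicator {0..t} s * (\<integral>u. indicator {s..t} u * k s u \<partial>lborel))"
  proof -
    note km [measurable]
    define F where "F = (\<lambda>(s, u). if 0 \<le> s \<and> s \<le> u \<and> u \<le> t then k s u else 0)"
    have Fm: "F \<in> borel_measurable (lborel \<Otimes>\<^sub>M lborel)" unfolding F_def by measurable
    have Fb: "\<bar>F (s, u)\<bar> \<le> E * (1 * Cq) * indicator {0..t} s * indicator {0..t} u" for s u
      using kb[of s u] by (auto simp: F_def indicator_def)
    note FF = Fubini_bounded[OF lborel.sigma_finite_measure_axioms lborel.sigma_finite_measure_axioms Fm _ _ _ _ Fb]
    have 1: "(\<integral>u. F (s, u) \<partial>lborel) = indicator {0..t} s * (\<integral>u. indicator {s..t} u * k s u \<partial>lborel)" for s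
      by (subst integral_mult_right_zero[symmetric], intro Bochner_Integration.integral_cong) (auto simp: F_def indicator_def)
    have 2: "(\<integral>s. F (s, u) \<partial>lborel) = indicator {0..t} u * (\<integral>s. indicator {0..u} s * k s u \<partial>lborel)" for u
      by (subst integral_mult_right_zero[symmetric], intro Bochner_Integration.integral_cong) (auto simp: F_def indicator_def)
    show "(\<integral>s. indicator {0..t} s * (\<integral>u. indicator {s..t} u * k s u \<partial>lborel) \<partial>lborel) = (\<integral>u. indicator {0..t} u * (\<integral>s. indicator {0..u} s * k s u \<partial>lborel) \<partial>lborel)"
      using FF(1) unfolding 1 2 by (simp add: emeasure_lborel_Icc_eq)
    show "integrable lborel (\<lambda>s. indicator {0..t} s * (\<integral>u. indicator {s..t} u * k s u \<partial>lborel))"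
      using FF(2) unfolding 1 by (simp add: emeasure_lborel_Icc_eq)
  qed
  \<comment> \<open>The perturbation formula read backwards: the integral over \<open>s\<close>
    collapses to the difference of the two semigroups.\<close>
  have inner: "(\<integral>s. indicator {0..u} s * k s u \<partial>lborel) = T u (q (t - u)) x - PS u (q (t - u)) x" if "u \<in> {0..t}" for u
    unfolding k_def using that feynman_kac[OF _ qb, of u "t - u" x] by simp
  have Tint: "integrable lborel (\<lambda>s. indicator {0..t} s * T s (h s) x)"
    if [measurable]: "(\<lambda>(s, y). h s y) \<in> borel_measurable (borel \<Otimes>\<^sub>M borel)" and hC: "\<And>s y. \<bar>h s y\<bar> \<le> C" for h :: "real \<Rightarrow> 'e \<Rightarrow> real" and C
  proof (rule interval_integrable(1))
    show "(\<lambda>s. T s (h s) x) \<in> borel_measurable borel" by (rule T_joint_measurable) measurable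
    have C0: "0 \<le> C" using hC[of 0 undefined] by simp
    show "\<bar>T s (h s) x\<bar> \<le> exp (bsup * t) * C" if "s \<in> {0..t}" for s
    proof -
      have "\<bar>T s (h s) x\<bar> \<le> exp (bsup * s) * C" using that hC by (intro T_bound) auto
      also have "\<dots> \<le> exp (bsup * t) * C" using that bsup_nonneg C0 by (intro mult_right_mono) (auto simp: mult_left_mono)
      finally show ?thesis .
    qed
  qed
  have qint: "integrable lborel (\<lambda>s. indicator {0..t} s * T s (q (t - s)) x)"
    using qC by (intro Tint) measurable
  have wint: "integrable lborel (\<lambda>s. indicator {0..t} s * T s (\<lambda>y. \<beta> y * w (t - s) y) x)"
  proof (rule Tint)
    show "\<bar>\<beta> y * w (t - s) y\<bar> \<le> bsup * Cw" for s y
      unfolding abs_mult using beta_le wC bsup_nonneg by (intro mult_mono) auto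
  qed measurable
  have pint: "integrable lborel (\<lambda>s. indicator {0..t} s * PS s (q (t - s)) x)"
  proof -
    have "integrable lborel (\<lambda>s. indicator {0..t} s * (\<integral>\<omega>. live s \<omega> * q (t - s) (pos s \<omega>) \<partial>L x))"
    proof (rule interval_integrable(1))
      show "(\<lambda>s. \<integral>\<omega>. live s \<omega> * q (t - s) (pos s \<omega>) \<partial>L x) \<in> borel_measurable borel"
        by (rule L_integral_measurable) measurable
      show "\<bar>\<integral>\<omega>. live s \<omega> * q (t - s) (pos s \<omega>) \<partial>L x\<bar> \<le> 1 * Cq" for s
        by (intro L_integral_bound live_mult_bound) (use qC in simp)
    qed
    moreover have "indicator {0..t} s * (\<integral>\<omega>. live s \<omega> * q (t - s) (pos s \<omega>) \<partial>L x) = indicator {0..t} s * PS s (q (t - s)) x" for s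
      using PS_eq_L[OF _ qb, of s "t - s" x] by (auto simp: indicator_def)
    ultimately show ?thesis by simp
  qed
  have kint: "integrable lborel (\<lambda>s. indicator {0..t} s * K s t f x)"
  proof -
    have "indicator {0..t} s * K s t f x = indicator {0..t} s * T s (\<lambda>y. \<beta> y * w (t - s) y) x + indicator {0..t} s * (\<integral>u. indicator {s..t} u * k s u \<partial>lborel)" for s
      using main[of s] by (cases "s \<in> {0..t}") (auto simp: k_def)
    then show ?thesis using wint swi by simp
  qed
  have "(\<integral>s. indicator {0..t} s * T s (\<lambda>y. \<beta> y * w (t - s) y) x \<partial>lborel) =
     (\<integral>s. indicator {0..t} s * K s t f x - indicator {0..t} s * (\<integral>u. indicator {s..t} u * k s u \<partial>lborel) \<partial>lborel)"
    by (intro Bochner_Integration.integral_cong) (auto simp: main k_def indicator_def)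
  also have "\<dots> = (T t f x - PS t f x) - (\<integral>u. indicator {0..t} u * (\<integral>s. indicator {0..u} s * k s u \<partial>lborel) \<partial>lborel)"
    unfolding Bochner_Integration.integral_diff[OF kint swi] swap feynman_kac[OF t f] ..
  also have "(\<integral>u. indicator {0..t} u * (\<integral>s. indicator {0..u} s * k s u \<partial>lborel) \<partial>lborel) =
     (\<integral>u. indicator {0..t} u * T u (q (t - u)) x - indicator {0..t} u * PS u (q (t - u)) x \<partial>lborel)"
  proof (rule Bochner_Integration.integral_cong)
    fix u show "indicator {0..t} u * (\<integral>s. indicator {0..u} s * k s u \<partial>lborel) = indicator {0..t} u * T u (q (t - u)) x - indicator {0..t} u * PS u (q (t - u)) x"
      using inner[of u] by (cases "u \<in> {0..t}") simp_all
  qed simp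
  also have "\<dots> = (\<integral>u. indicator {0..t} u * T u (q (t - u)) x \<partial>lborel) - (\<integral>u. indicator {0..t} u * PS u (q (t - u)) x \<partial>lborel)"
    by (rule Bochner_Integration.integral_diff[OF qint pint])
  \<comment> \<open>The given equation at time \<open>t\<close> eliminates the last integral against
    the motion semigroup.\<close>
  also have "(\<integral>u. indicator {0..t} u * PS u (q (t - u)) x \<partial>lborel) = PS t f x - w t x"
    using eq[of t x] t by simp
  finally have "w t x = T t f x - ((\<integral>s. indicator {0..t} s * T s (\<lambda>y. \<beta> y * w (t - s) y) x \<partial>lborel) + (\<integral>u. indicator {0..t} u * T u (q (t - u)) x \<partial>lborel))"
    by simp
  also have "(\<integral>s. indicator {0..t} s * T s (\<lambda>y. \<beta> y * w (t - s) y) x \<partial>lborel) + (\<integral>u. indicator {0..t} u * T u (q (t - u)) x \<partial>lborel)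
     = (\<integral>s. indicator {0..t} s * T s (\<lambda>y. q (t - s) y + \<beta> y * w (t - s) y) x \<partial>lborel)"
  proof (subst Bochner_Integration.integral_add[OF wint qint, symmetric], rule Bochner_Integration.integral_cong)
    fix s
    have "T s (\<lambda>y. q (t - s) y + \<beta> y * w (t - s) y) x = T s (q (t - s)) x + T s (\<lambda>y. \<beta> y * w (t - s) y) x" if "0 \<le> s"
    proof -
      have b: "(\<lambda>y. \<beta> y * w (t - s) y) \<in> bB"
      proof (rule bB_I)
        show "(\<lambda>y. \<beta> y * w (t - s) y) \<in> borel_measurable borel" by measurable
        show "\<bar>\<beta> y * w (t - s) y\<bar> \<le> bsup * Cw" for y
          unfolding abs_mult using beta_le wC bsup_nonneg by (intro mult_mono) auto
      qed
      show ?thesis unfolding T_def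
        by (subst Bochner_Integration.integral_add[OF T_integrable[OF that qb] T_integrable[OF that b], symmetric]) (simp add: distrib_left)
    qed
    then show "indicator {0..t} s * T s (\<lambda>y. \<beta> y * w (t - s) y) x + indicator {0..t} s * T s (q (t - s)) x = indicator {0..t} s * T s (\<lambda>y. q (t - s) y + \<beta> y * w (t - s) y) x"
      by (auto simp: indicator_def)
  qed simp
  finally show ?thesis .
qed

end

section \<open>The superprocess and its mean\<close>

context branching_motion
begin

lemma T_mono: "0 \<le> t \<Longrightarrow> f \<in> bB \<Longrightarrow> g \<in> bB \<Longrightarrow> (\<And>y. f y \<le> g y) \<Longrightarrow> T t f x \<le> T t g x"
  unfolding T_def by (intro integral_mono T_integrable mult_left_mono wt_nonneg)

lemma T_cmult: "T t (\<lambda>y. c * f y) x = c * T t f x"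
  unfolding T_def by (simp add: mult.left_commute)

lemma T_nonneg: "(\<And>y. 0 \<le> f y) \<Longrightarrow> 0 \<le> T t f x"
  unfolding T_def by (simp add: wt_nonneg)

lemma T_bpB: "0 \<le> t \<Longrightarrow> f \<in> bpB \<Longrightarrow> T t f \<in> bpB"
  using T_bB[of t f] T_nonneg[of f t] by (auto simp: bpB_def)

text \<open>The extended-valued form allows the eigenmeasure relation to be extended from sets to
  functions by monotone limits.\<close>

definition Tn :: "real \<Rightarrow> ('e \<Rightarrow> ennreal) \<Rightarrow> 'e \<Rightarrow> ennreal"
  where "Tn t g x = (\<integral>\<^sup>+\<omega>. ennreal (wt t \<omega>) * g (pos t \<omega>) \<partial>L x)"

lemma Tn_eq: "0 \<le> t \<Longrightarrow> f \<in> bpB \<Longrightarrow> Tn t (\<lambda>y. ennreal (f y)) x = ennreal (T t f x)"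
  unfolding T_def Tn_def
  by (subst nn_integral_eq_integral[symmetric])
     (auto intro!: T_integrable bpB_D nn_integral_cong simp: ennreal_mult wt_nonneg bpB_D(2))

lemma mean_semigroup_eq:
  assumes t: "0 \<le> t" and f: "\<And>y. 0 \<le> f y"
  shows "mean_semigroup L Y \<zeta> \<beta> t f x = Tn t (\<lambda>y. ennreal (f y)) x"
  unfolding mean_semigroup_def Tn_def
proof (rule nn_integral_cong)
  fix \<omega>
  have "(LINT s:{0..t}|lborel. \<beta> (Y s \<omega>)) = acc t \<omega>" if "ereal t < \<zeta> \<omega>"
    unfolding acc_def set_lebesgue_integral_def
  proof (rule Bochner_Integration.integral_cong)
    fix s
    have "pos s \<omega> = Y s \<omega>" if "0 \<le> s" "s \<le> t"
    proof -
      have "ereal s < \<zeta> \<omega>" using \<open>ereal t < \<zeta> \<omega>\<close> \<open>s \<le> t\<close> by (meson ereal_less_eq(3) le_less_trans)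
      then show ?thesis using that by (simp add: pos_def alive_def)
    qed
    then show "indicat_real {0..t} s *\<^sub>R \<beta> (Y s \<omega>) = indicat_real {0..t} s * \<beta> (pos s \<omega>)"
      by (simp add: indicator_def)
  qed simp
  then show "ennreal (exp (LINT s:{0..t}|lborel. \<beta> (Y s \<omega>)) * f (Y t \<omega>)) * indicator {\<omega>. ereal t < \<zeta> \<omega>} \<omega> =
    ennreal (wt t \<omega>) * ennreal (f (pos t \<omega>))"
    using t f by (auto simp: wt_def live_def alive_def pos_def ennreal_mult)
qed

lemma Tn_measurable:
  assumes [measurable]: "g \<in> borel_measurable borel"
  shows "Tn t g \<in> borel_measurable borel"
  unfolding Tn_def[abs_def]
  by (rule nn_integral_measurable_subprob_algebra2[OF _ L_kernel]) measurable

end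

locale superprocess_model = branching_motion P W L Y \<zeta> \<beta> \<sigma> \<pi>
  for P :: "real \<Rightarrow> 'e::polish_space \<Rightarrow> 'e measure" and W :: "'w measure"
    and L :: "'e \<Rightarrow> 'w measure" and Y :: "real \<Rightarrow> 'w \<Rightarrow> 'e" and \<zeta> :: "'w \<Rightarrow> ereal"
    and \<beta> \<sigma> :: "'e \<Rightarrow> real" and \<pi> :: "'e \<Rightarrow> real measure" +
  fixes V :: "real \<Rightarrow> ('e \<Rightarrow> real) \<Rightarrow> 'e \<Rightarrow> real"
    and Q :: "real \<Rightarrow> 'e finmeas \<Rightarrow> 'e finmeas measure"
    and PP :: "'e finmeas \<Rightarrow> (real \<Rightarrow> 'e finmeas) measure"
  assumes cumulant: "cumulant_semigroup P (branching_mechanism \<beta> \<sigma> \<pi>) V"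
    and superprocess: "superprocess V Q PP"
begin

section \<open>The mild equation relative to the mean semigroup, and its linearization at
  zero\<close>

lemma V_eqn: "f \<in> bpB \<Longrightarrow> cumulant_equation P (branching_mechanism \<beta> \<sigma> \<pi>) f (\<lambda>t. V t f)"
  using cumulant by (simp add: cumulant_semigroup_def)

lemma V_nonneg: "f \<in> bpB \<Longrightarrow> 0 \<le> t \<Longrightarrow> 0 \<le> V t f x"
  using V_eqn[of f] by (simp add: cumulant_equation_def)

lemma V_bounded: "f \<in> bpB \<Longrightarrow> 0 \<le> t \<Longrightarrow> \<exists>C\<ge>0. \<forall>s x. 0 \<le> s \<longrightarrow> s \<le> t \<longrightarrow> V s f x \<le> C"
proof -
  assume f: "f \<in> bpB" and t: "0 \<le> t"
  then obtain C where "\<forall>s\<in>{0..t}. \<forall>x. V s f x \<le> C" using V_eqn[OF f] by (auto simp: cumulant_equation_def)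
  then show ?thesis by (intro exI[of _ "max 0 C"]) (auto simp: le_max_iff_disj)
qed

text \<open>The equation provides measurability for nonnegative times and bounds on compact time
  intervals. Cutting off to \<open>{0..t}\<close> yields a function on the whole line that is
  measurable and bounded, which is the form \<open>duhamel\<close> takes.\<close>

lemma V_joint_measurable:
  assumes f: "f \<in> bpB"
  shows "(\<lambda>(s, y). if 0 \<le> s \<and> s \<le> t then V s f y else 0) \<in> borel_measurable (borel \<Otimes>\<^sub>M borel)"
proof -
  have "(\<lambda>z :: real \<times> 'e. (max 0 (fst z), snd z)) \<in> (borel \<Otimes>\<^sub>M borel) \<rightarrow>\<^sub>M (restrict_space borel {0..} \<Otimes>\<^sub>M (borel :: 'e measure))"
  proof (intro measurable_Pair measurable_restrict_space2)
    show "(\<lambda>z :: real \<times> 'e. max 0 (fst z)) \<in> borel_measurable (borel \<Otimes>\<^sub>M (borel :: 'e measure))" by measurable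
  qed (auto simp: le_max_iff_disj)
  from measurable_compose[OF this, of "\<lambda>(s, y). V s f y" borel]
  have [measurable]: "(\<lambda>z. V (max 0 (fst z)) f (snd z)) \<in> borel_measurable (borel \<Otimes>\<^sub>M borel)"
    using V_eqn[OF f] by (simp add: cumulant_equation_def)
  have "(\<lambda>z. if 0 \<le> fst z \<and> fst z \<le> t then V (max 0 (fst z)) f (snd z) else 0) \<in> borel_measurable (borel \<Otimes>\<^sub>M borel)"
    by measurable
  then show ?thesis by (rule measurable_cong[THEN iffD1, rotated]) auto
qed

lemma V_measurable: assumes f: "f \<in> bpB" and t: "0 \<le> t" shows "V t f \<in> borel_measurable borel"
proof -
  have "(\<lambda>y. (t, y)) \<in> borel \<rightarrow>\<^sub>M (borel \<Otimes>\<^sub>M (borel :: 'e measure))" by simp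
  from measurable_compose[OF this V_joint_measurable[OF f, of t]] show ?thesis using t by simp
qed

lemma V_bpB: assumes f: "f \<in> bpB" and t: "0 \<le> t" shows "V t f \<in> bpB"
proof -
  obtain C where "\<And>s x. 0 \<le> s \<Longrightarrow> s \<le> t \<Longrightarrow> V s f x \<le> C" using V_bounded[OF f t] by blast
  then show ?thesis using V_measurable[OF f t] V_nonneg[OF f t] t by (intro bpB_I[where B=C]) auto
qed

lemma psi0_V_measurable:
  assumes f: "f \<in> bpB"
  shows "(\<lambda>(s, y). if 0 \<le> s \<and> s \<le> t then psi0 y (V s f y) else 0) \<in> borel_measurable (borel \<Otimes>\<^sub>M borel)"
proof -
  note [measurable] = V_joint_measurable[OF f, of t]
  have "(\<lambda>z. (snd z, (\<lambda>(s, y). if 0 \<le> s \<and> s \<le> t then V s f y else 0) z)) \<in> (borel \<Otimes>\<^sub>M borel) \<rightarrow>\<^sub>M (borel \<Otimes>\<^sub>M borel)"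
    by measurable
  from measurable_compose[OF this psi0_measurable2]
  have [measurable]: "(\<lambda>z. psi0 (snd z) (max 0 ((\<lambda>(s, y). if 0 \<le> s \<and> s \<le> t then V s f y else 0) z))) \<in> borel_measurable (borel \<Otimes>\<^sub>M borel)"
    by simp
  have "(\<lambda>z. if 0 \<le> fst z \<and> fst z \<le> t then psi0 (snd z) (max 0 ((\<lambda>(s, y). if 0 \<le> s \<and> s \<le> t then V s f y else 0) z)) else 0) \<in> borel_measurable (borel \<Otimes>\<^sub>M borel)"
    by measurable
  then show ?thesis by (rule measurable_cong[THEN iffD1, rotated]) (use V_nonneg[OF f] in \<open>auto simp: max_absorb2\<close>)
qed

lemma psi0_V_bound:
  assumes f: "f \<in> bpB" and t: "0 \<le> t"
  shows "\<exists>C\<ge>0. \<forall>s y. 0 \<le> s \<longrightarrow> s \<le> t \<longrightarrow> psi0 y (V s f y) \<le> C"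
proof -
  obtain C where C: "0 \<le> C" "\<And>s x. 0 \<le> s \<Longrightarrow> s \<le> t \<Longrightarrow> V s f x \<le> C" using V_bounded[OF f t] by blast
  obtain D where D: "0 \<le> D" "\<And>x z. 0 \<le> z \<Longrightarrow> psi0 x z \<le> D * max z (z\<^sup>2)" using psi0_bound by blast
  have "psi0 y (V s f y) \<le> D * max C (C\<^sup>2)" if "0 \<le> s" "s \<le> t" for s y
    using psi0_mono[OF V_nonneg[OF f that(1)] C(2)[OF that], of y] D(2)[OF C(1)] by (rule order_trans)
  moreover have "0 \<le> D * max C (C\<^sup>2)" using C D by (auto simp: le_max_iff_disj)
  ultimately show ?thesis by blast
qed

text \<open>This is \<open>duhamel\<close> with
  \<open>psi0 y (V s f y) - \<beta> y * V s f y\<close> as inhomogeneity: the linear term added in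
  its conclusion cancels the one in the branching mechanism.\<close>

lemma V_mean_equation:
  assumes f: "f \<in> bpB" and t: "0 \<le> t"
  shows "V t f x = T t f x - (\<integral>s. indicator {0..t} s * T s (\<lambda>y. psi0 y (V (t - s) f y)) x \<partial>lborel)"
proof -
  define w where "w s y = (if 0 \<le> s \<and> s \<le> t then V s f y else 0)" for s y
  define p where "p s y = (if 0 \<le> s \<and> s \<le> t then psi0 y (V s f y) else 0)" for s y
  define q where "q s y = p s y - \<beta> y * w s y" for s y
  obtain C where C: "0 \<le> C" "\<And>s x. 0 \<le> s \<Longrightarrow> s \<le> t \<Longrightarrow> V s f x \<le> C" using V_bounded[OF f t] by blast
  obtain D where D: "0 \<le> D" "\<And>s x. 0 \<le> s \<Longrightarrow> s \<le> t \<Longrightarrow> psi0 x (V s f x) \<le> D" using psi0_V_bound[OF f t] by blast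
  have wm [measurable]: "(\<lambda>(s, y). w s y) \<in> borel_measurable (borel \<Otimes>\<^sub>M borel)"
    unfolding w_def by (rule V_joint_measurable[OF f])
  have pm [measurable]: "(\<lambda>(s, y). p s y) \<in> borel_measurable (borel \<Otimes>\<^sub>M borel)"
    unfolding p_def by (rule psi0_V_measurable[OF f])
  have wb: "\<bar>w s y\<bar> \<le> C" for s y using C V_nonneg[OF f] by (auto simp: w_def)
  have pb: "\<bar>p s y\<bar> \<le> D" for s y using D psi0_nonneg by (auto simp: p_def)
  have "w t x = T t f x - (\<integral>s. indicator {0..t} s * T s (\<lambda>y. q (t - s) y + \<beta> y * w (t - s) y) x \<partial>lborel)"
  proof (rule duhamel[OF t bpB_D(1)[OF f] _ _ wm wb])
    show "(\<lambda>(s, y). q s y) \<in> borel_measurable (borel \<Otimes>\<^sub>M borel)"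
      unfolding q_def by measurable
    show "\<bar>q s y\<bar> \<le> D + bsup * C" for s y
    proof -
      have "\<bar>\<beta> y * w s y\<bar> \<le> bsup * C" unfolding abs_mult using beta_le wb bsup_nonneg by (intro mult_mono) auto
      then show ?thesis unfolding q_def using pb[of s y] by linarith
    qed
    fix u y assume u: "0 \<le> u" "u \<le> t"
    have "V u f y + (LINT s:{0..u}|lborel. (\<integral>z. branching_mechanism \<beta> \<sigma> \<pi> z (V (u - s) f z) \<partial>P s y)) = PS u f y"
      using V_eqn[OF f] u(1) unfolding cumulant_equation_def PS_def by blast
    moreover have "(LINT s:{0..u}|lborel. (\<integral>z. branching_mechanism \<beta> \<sigma> \<pi> z (V (u - s) f z) \<partial>P s y)) = (\<integral>s. indicator {0..u} s * PS s (q (u - s)) y \<partial>lborel)"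
      unfolding set_lebesgue_integral_def
      by (intro Bochner_Integration.integral_cong) (use u in \<open>auto simp: indicator_def PS_def q_def p_def w_def branching_mechanism_eq\<close>)
    ultimately show "w u y = PS u f y - (\<integral>s. indicator {0..u} s * PS s (q (u - s)) y \<partial>lborel)"
      using u by (simp add: w_def)
  qed
  also have "(\<integral>s. indicator {0..t} s * T s (\<lambda>y. q (t - s) y + \<beta> y * w (t - s) y) x \<partial>lborel) =
      (\<integral>s. indicator {0..t} s * T s (\<lambda>y. psi0 y (V (t - s) f y)) x \<partial>lborel)"
    by (intro Bochner_Integration.integral_cong) (auto simp: indicator_def q_def p_def)
  finally show ?thesis using t by (simp add: w_def)
qed

lemma psi0_V_bpB: "f \<in> bpB \<Longrightarrow> 0 \<le> t \<Longrightarrow> (\<lambda>y. psi0 y (V t f y)) \<in> bpB"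
proof -
  assume f: "f \<in> bpB" and t: "0 \<le> t"
  obtain D where D: "\<And>s x. 0 \<le> s \<Longrightarrow> s \<le> t \<Longrightarrow> psi0 x (V s f x) \<le> D" using psi0_V_bound[OF f t] by blast
  have "(\<lambda>y. (t, y)) \<in> borel \<rightarrow>\<^sub>M (borel \<Otimes>\<^sub>M (borel :: 'e measure))" by simp
  from measurable_compose[OF this psi0_V_measurable[OF f, of t]] show ?thesis
    using t D[of t] by (intro bpB_I[where B=D] psi0_nonneg) simp_all
qed

lemma T_psi0_V:
  assumes f: "f \<in> bpB" and t: "0 \<le> t"
  shows "(\<lambda>(s, x). indicator {0..t} s * T s (\<lambda>y. psi0 y (V (t - s) f y)) x) \<in> borel_measurable (borel \<Otimes>\<^sub>M borel)"
    and "\<exists>C. \<forall>s x. s \<in> {0..t} \<longrightarrow> \<bar>T s (\<lambda>y. psi0 y (V (t - s) f y)) x\<bar> \<le> C"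
proof -
  define p where "p s y = (if 0 \<le> s \<and> s \<le> t then psi0 y (V s f y) else 0)" for s y
  have pm [measurable]: "(\<lambda>(s, y). p s y) \<in> borel_measurable (borel \<Otimes>\<^sub>M borel)"
    unfolding p_def by (rule psi0_V_measurable[OF f])
  have "(\<lambda>z. T (fst z) (p (t - fst z)) (snd z)) \<in> borel_measurable (borel \<Otimes>\<^sub>M borel)"
    by (rule T_joint_measurable) measurable
  then have "(\<lambda>z. indicator {0..t} (fst z) * T (fst z) (p (t - fst z)) (snd z)) \<in> borel_measurable (borel \<Otimes>\<^sub>M borel)"
    by measurable
  then show "(\<lambda>(s, x). indicator {0..t} s * T s (\<lambda>y. psi0 y (V (t - s) f y)) x) \<in> borel_measurable (borel \<Otimes>\<^sub>M borel)"
  proof (rule measurable_cong[THEN iffD1, rotated])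
    have "p (t - a) = (\<lambda>y. psi0 y (V (t - a) f y))" if "a \<in> {0..t}" for a using that by (auto simp: p_def)
    then show "indicator {0..t} (fst z) * T (fst z) (p (t - fst z)) (snd z) =
      (case z of (s, x) \<Rightarrow> indicator {0..t} s * T s (\<lambda>y. psi0 y (V (t - s) f y)) x)" for z
      by (auto simp: indicator_def split: prod.split)
  qed
  obtain D where D: "0 \<le> D" "\<And>s x. 0 \<le> s \<Longrightarrow> s \<le> t \<Longrightarrow> psi0 x (V s f x) \<le> D" using psi0_V_bound[OF f t] by blast
  have "\<bar>T s (\<lambda>y. psi0 y (V (t - s) f y)) x\<bar> \<le> exp (bsup * t) * D" if "s \<in> {0..t}" for s x
  proof -
    have "\<bar>T s (\<lambda>y. psi0 y (V (t - s) f y)) x\<bar> \<le> exp (bsup * s) * D"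
      using that D(2)[of "t - s"] by (intro T_bound) (auto simp: psi0_nonneg)
    also have "\<dots> \<le> exp (bsup * t) * D" using that bsup_nonneg D(1) by (intro mult_right_mono) (auto simp: mult_left_mono)
    finally show ?thesis .
  qed
  then show "\<exists>C. \<forall>s x. s \<in> {0..t} \<longrightarrow> \<bar>T s (\<lambda>y. psi0 y (V (t - s) f y)) x\<bar> \<le> C" by blast
qed

lemma V_le_T: "f \<in> bpB \<Longrightarrow> 0 \<le> t \<Longrightarrow> V t f x \<le> T t f x"
  unfolding V_mean_equation[of f t x] by (simp add: integral_nonneg T_nonneg psi0_nonneg)

text \<open>\<open>T t f\<close> is the derivative of \<open>V t\<close> at 0 in the direction
  \<open>f\<close>. The scaled nonlinear term is squeezed between 0 and an integral of
  \<open>T s (g n)\<close>, where \<open>g n\<close> is the scaled nonlinearity at the level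
  \<open>B / Suc n\<close> dominating the cumulant; it tends to 0 boundedly.\<close>

lemma V_scaled_tendsto:
  assumes f: "f \<in> bpB" and t: "0 \<le> t"
  shows "(\<lambda>n. real (Suc n) * V t (\<lambda>y. f y / real (Suc n)) x) \<longlonglongrightarrow> T t f x"
proof -
  obtain C where C: "0 < C" "\<And>x. \<bar>f x\<bar> \<le> C" using bB_bound[OF bpB_D(1)[OF f]] by metis
  define B where "B = exp (bsup * t) * C"
  have B0: "0 \<le> B" using C by (simp add: B_def)
  define fn where "fn n = (\<lambda>y. f y / real (Suc n))" for n
  have fn: "fn n \<in> bpB" for n
  proof (rule bpB_I[where B=C])
    show "fn n \<in> borel_measurable borel" unfolding fn_def using bB_measurable[OF bpB_D(1)[OF f]] by measurable
    show "0 \<le> fn n x" for x unfolding fn_def using bpB_D(2)[OF f] by simp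
    show "fn n x \<le> C" for x
    proof -
      have "f x / real (Suc n) \<le> f x / 1" using bpB_D(2)[OF f] by (intro divide_left_mono) auto
      then show ?thesis unfolding fn_def using C(2)[of x] by simp
    qed
  qed
  have Tfn: "T s (fn n) y = T s f y / real (Suc n)" for s n y
    using T_cmult[where t=s and c="1 / real (Suc n)" and f=f and x=y] by (simp add: fn_def)
  have Vb: "V s (fn n) y \<le> B / real (Suc n)" if "0 \<le> s" "s \<le> t" for s n y
  proof -
    have "V s (fn n) y \<le> T s f y / real (Suc n)" using V_le_T[OF fn that(1)] Tfn by metis
    also have "T s f y \<le> exp (bsup * s) * C" using T_bound[OF that(1), of f C y] C(2) by simp
    also have "exp (bsup * s) * C \<le> B" unfolding B_def using that bsup_nonneg C(1) by (intro mult_right_mono) (auto simp: mult_left_mono)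
    finally show ?thesis by (simp add: divide_right_mono)
  qed
  define g where "g n y = real (Suc n) * psi0 y (B / real (Suc n))" for n y
  obtain Cg where Cg: "0 \<le> Cg" "\<And>n y. g n y \<le> Cg" using psi0_div_tendsto(2)[OF B0] unfolding g_def by blast
  have g0: "0 \<le> g n y" for n y by (simp add: g_def psi0_nonneg)
  have gm [measurable]: "g n \<in> borel_measurable borel" for n
  proof -
    have "0 \<le> B / real (Suc n)" using B0 by simp
    note [measurable] = psi0_measurable1[OF this]
    show ?thesis unfolding g_def[abs_def] by measurable
  qed
  have gB: "g n \<in> bB" for n using Cg g0 by (intro bB_I[where B=Cg]) auto
  have Tg0: "(\<lambda>n. T s (g n) x) \<longlonglongrightarrow> 0" if "0 \<le> s" for s
  proof -
    have "(\<lambda>n. T s (g n) x) \<longlonglongrightarrow> (\<integral>\<omega>. 0 \<partial>L x)"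
      unfolding T_def
    proof (rule integral_dominated_convergence[where w="\<lambda>\<omega>. wt s \<omega> * Cg"])
      show "AE \<omega> in L x. (\<lambda>n. wt s \<omega> * g n (pos s \<omega>)) \<longlonglongrightarrow> 0"
        using tendsto_mult[OF tendsto_const psi0_div_tendsto(1)[OF B0]] by (intro AE_I2) (simp add: g_def)
      show "AE \<omega> in L x. norm (wt s \<omega> * g n (pos s \<omega>)) \<le> wt s \<omega> * Cg" for n
        using g0 Cg by (intro AE_I2) (auto simp: wt_nonneg abs_mult intro!: mult_left_mono)
      show "integrable (L x) (\<lambda>\<omega>. wt s \<omega> * Cg)"
        using T_integrable[OF that, of "\<lambda>_. Cg"] by (simp add: bB_I[where B=Cg] Cg)
    qed measurable
    then show ?thesis by simp
  qed
  have Tgb: "\<bar>T s (g n) x\<bar> \<le> exp (bsup * t) * Cg" if "s \<in> {0..t}" for s n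
  proof -
    have "\<bar>T s (g n) x\<bar> \<le> exp (bsup * s) * Cg" using that g0 Cg(2) by (intro T_bound) auto
    also have "\<dots> \<le> exp (bsup * t) * Cg" using that bsup_nonneg Cg(1) by (intro mult_right_mono) (auto simp: mult_left_mono)
    finally show ?thesis .
  qed
  have Tgm: "(\<lambda>s. T s (g n) x) \<in> borel_measurable borel" for n by (rule T_joint_measurable) measurable
  define R where "R n = (\<integral>s. indicator {0..t} s * T s (g n) x \<partial>lborel)" for n
  have R0: "R \<longlonglongrightarrow> 0"
  proof -
    have "(\<lambda>n. \<integral>s. indicator {0..t} s * T s (g n) x \<partial>lborel) \<longlonglongrightarrow> (\<integral>s. 0 \<partial>(lborel :: real measure))"
    proof (rule integral_dominated_convergence[where w="\<lambda>s. indicator {0..t} s * (exp (bsup * t) * Cg)"])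
      show "AE s in lborel. (\<lambda>n. indicator {0..t} s * T s (g n) x) \<longlonglongrightarrow> 0"
        using Tg0 by (intro AE_I2) (auto simp: indicator_def)
      show "AE s in lborel. norm (indicator {0..t} s * T s (g n) x) \<le> indicator {0..t} s * (exp (bsup * t) * Cg)" for n
        using Tgb by (intro AE_I2) (auto simp: indicator_def)
      show "integrable lborel (\<lambda>s. indicator {0..t} s * (exp (bsup * t) * Cg))"
        by (rule interval_integrable(1)[where K="exp (bsup * t) * Cg"]) (use Cg in auto)
    qed (use Tgm in auto)
    then show ?thesis by (simp add: R_def[abs_def])
  qed
  have key: "T t f x - R n \<le> real (Suc n) * V t (fn n) x" "real (Suc n) * V t (fn n) x \<le> T t f x" for n
  proof -
    show "real (Suc n) * V t (fn n) x \<le> T t f x"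
      using V_le_T[OF fn t, of n x] unfolding Tfn by (simp add: field_simps)
    obtain D where D: "\<And>s x. s \<in> {0..t} \<Longrightarrow> \<bar>T s (\<lambda>y. psi0 y (V (t - s) (fn n) y)) x\<bar> \<le> D"
      using T_psi0_V(2)[OF fn t] by blast
    have "real (Suc n) * (\<integral>s. indicator {0..t} s * T s (\<lambda>y. psi0 y (V (t - s) (fn n) y)) x \<partial>lborel) =
       (\<integral>s. indicator {0..t} s * (real (Suc n) * T s (\<lambda>y. psi0 y (V (t - s) (fn n) y)) x) \<partial>lborel)"
      by (subst integral_mult_right_zero[symmetric]) (simp add: mult.left_commute)
    also have "\<dots> \<le> R n" unfolding R_def
    proof (rule integral_mono')
      show "integrable lborel (\<lambda>s. indicator {0..t} s * T s (g n) x)"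
        by (rule interval_integrable(1)[OF Tgm Tgb])
      fix s
      show "0 \<le> indicator {0..t} s * T s (g n) x" using T_nonneg[OF g0] by (simp add: indicator_def)
      show "indicator {0..t} s * (real (Suc n) * T s (\<lambda>y. psi0 y (V (t - s) (fn n) y)) x) \<le> indicator {0..t} s * T s (g n) x"
      proof (cases "s \<in> {0..t}")
        case True
        have "T s (\<lambda>y. real (Suc n) * psi0 y (V (t - s) (fn n) y)) x \<le> T s (g n) x"
        proof (rule T_mono[OF _ _ gB])
          show "0 \<le> s" using True by simp
          have "(\<lambda>y. psi0 y (V (t - s) (fn n) y)) \<in> bB" using True by (intro bpB_D(1)[OF psi0_V_bpB[OF fn]]) simp
          then obtain D where "0 < D" "\<And>y. \<bar>psi0 y (V (t - s) (fn n) y)\<bar> \<le> D" "(\<lambda>y. psi0 y (V (t - s) (fn n) y)) \<in> borel_measurable borel"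
            using bB_bound bB_measurable by metis
          then show "(\<lambda>y. real (Suc n) * psi0 y (V (t - s) (fn n) y)) \<in> bB"
            by (intro bB_I[where B="real (Suc n) * D"]) (auto simp: abs_mult intro!: mult_left_mono simp del: of_nat_Suc)
          show "real (Suc n) * psi0 y (V (t - s) (fn n) y) \<le> g n y" for y
            unfolding g_def using True by (intro mult_left_mono psi0_mono V_nonneg fn Vb) auto
        qed
        then show ?thesis using True unfolding T_cmult by simp
      qed simp
    qed
    finally have "real (Suc n) * (\<integral>s. indicator {0..t} s * T s (\<lambda>y. psi0 y (V (t - s) (fn n) y)) x \<partial>lborel) \<le> R n" .
    moreover have "real (Suc n) * V t (fn n) x = T t f x - real (Suc n) * (\<integral>s. indicator {0..t} s * T s (\<lambda>y. psi0 y (V (t - s) (fn n) y)) x \<partial>lborel)"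
      by (subst V_mean_equation[OF fn t]) (simp only: right_diff_distrib Tfn, simp)
    ultimately show "T t f x - R n \<le> real (Suc n) * V t (fn n) x" by simp
  qed
  have "(\<lambda>n. T t f x - R n) \<longlonglongrightarrow> T t f x" using tendsto_diff[OF tendsto_const R0] by simp
  then show ?thesis
    using key tendsto_sandwich[of "\<lambda>n. T t f x - R n" "\<lambda>n. real (Suc n) * V t (fn n) x" sequentially "\<lambda>_. T t f x" "T t f x"]
    by (simp add: fn_def)
qed

section \<open>Transition kernel of the superprocess: Laplace functional and mean\<close>

lemma SP: "borel_right_process Q path_space PP (\<lambda>t w. w t) (\<lambda>_. \<infinity>)"
  using superprocess by (simp add: superprocess_def)

lemma Q_prob: "0 \<le> t \<Longrightarrow> prob_space (Q t \<mu>)"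
  using superprocess by (simp add: superprocess_def)

lemma Q_kernel: "0 \<le> t \<Longrightarrow> Q t \<in> borel \<rightarrow>\<^sub>M subprob_algebra borel"
  using SP by (auto simp: borel_right_process_def borel_semigroup_def)

lemma sets_Q [simp]: "0 \<le> t \<Longrightarrow> sets (Q t \<mu>) = sets borel"
  using measurable_space[OF Q_kernel, of t \<mu>] by (simp add: space_subprob_algebra)

lemma space_Q [simp]: "0 \<le> t \<Longrightarrow> space (Q t \<mu>) = UNIV"
  using sets_eq_imp_space_eq[OF sets_Q, of t \<mu>] by simp

lemma measurable_Q [simp]: "0 \<le> t \<Longrightarrow> f \<in> measurable (Q t \<mu>) M \<longleftrightarrow> f \<in> measurable borel M"
  by (simp add: measurable_cong_sets[OF sets_Q refl])

lemma Q_zero: "Q 0 \<mu> = return borel \<mu>"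
  using SP by (auto simp: borel_right_process_def borel_semigroup_def)

lemma Q_add: "0 \<le> s \<Longrightarrow> 0 \<le> t \<Longrightarrow> Q (s + t) \<mu> = Q s \<mu> \<bind> Q t"
  using SP by (auto simp: borel_right_process_def borel_semigroup_def)

lemma nn_Q_add:
  assumes "0 \<le> s" "0 \<le> t" "F \<in> borel_measurable borel"
  shows "(\<integral>\<^sup>+\<eta>. F \<eta> \<partial>Q (s + t) \<mu>) = (\<integral>\<^sup>+\<eta>. (\<integral>\<^sup>+\<eta>'. F \<eta>' \<partial>Q t \<eta>) \<partial>Q s \<mu>)"
  unfolding Q_add[OF assms(1,2)]
  by (rule nn_integral_bind[OF assms(3)]) (use assms Q_kernel in auto)

lemma Q_integrable:
  fixes F :: "'e finmeas \<Rightarrow> real"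
  shows "0 \<le> t \<Longrightarrow> F \<in> borel_measurable borel \<Longrightarrow> (\<And>\<eta>. \<bar>F \<eta>\<bar> \<le> C) \<Longrightarrow> integrable (Q t \<mu>) F"
  using prob_space.finite_measure[OF Q_prob] by (intro integrable_bounded[where B=C]) auto

lemma laplace: "0 \<le> t \<Longrightarrow> f \<in> bpB \<Longrightarrow> (\<integral>\<eta>. exp (- fint \<eta> f) \<partial>Q t \<mu>) = exp (- fint \<mu> (V t f))"
  using superprocess by (simp add: superprocess_def)

lemma fint_bpB_nonneg: "f \<in> bpB \<Longrightarrow> 0 \<le> fint \<eta> f"
  by (simp add: fint_nonneg bpB_D)

lemma fint_bpB_measurable: "(f :: 'e \<Rightarrow> real) \<in> bpB \<Longrightarrow> (\<lambda>\<eta>. fint \<eta> f) \<in> borel_measurable borel"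
  by (rule fint_measurable[OF bpB_D(1)])

lemma nn_laplace: "0 \<le> t \<Longrightarrow> f \<in> bpB \<Longrightarrow> (\<integral>\<^sup>+\<eta>. ennreal (exp (- fint \<eta> f)) \<partial>Q t \<mu>) = ennreal (exp (- fint \<mu> (V t f)))"
  unfolding laplace[symmetric]
  by (intro nn_integral_eq_integral Q_integrable[where C=1])
     (auto simp: fint_bpB_nonneg intro!: borel_measurable_exp measurable_compose[OF fint_bpB_measurable])

text \<open>Chapman-Kolmogorov for the kernels, read through Laplace functionals at Dirac
  masses.\<close>

lemma V_semigroup:
  assumes s: "0 \<le> s" and t: "0 \<le> t" and f: "f \<in> bpB"
  shows "V (s + t) f = V s (V t f)"
proof
  fix x
  have m: "(\<lambda>\<eta>. ennreal (exp (- fint \<eta> f))) \<in> borel_measurable borel"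
    by (intro measurable_compose[OF fint_bpB_measurable[OF f]]) measurable
  have "ennreal (exp (- fint (dirac x) (V (s + t) f))) = (\<integral>\<^sup>+\<eta>. ennreal (exp (- fint \<eta> f)) \<partial>Q (s + t) (dirac x))"
    using s t f by (intro nn_laplace[symmetric]) auto
  also have "\<dots> = (\<integral>\<^sup>+\<eta>. ennreal (exp (- fint \<eta> (V t f))) \<partial>Q s (dirac x))"
    by (simp add: nn_Q_add[OF s t m] nn_laplace[OF t f])
  also have "\<dots> = ennreal (exp (- fint (dirac x) (V s (V t f))))"
    by (intro nn_laplace s V_bpB f t)
  finally show "V (s + t) f x = V s (V t f) x"
    using s t f by (simp add: fint_dirac V_measurable V_bpB)
qed

lemma fint_cmult: "fint \<eta> (\<lambda>y. c * f y) = c * fint \<eta> f"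
  by (simp add: fint_def)

text \<open>The difference quotients \<open>F n\<close> of the Laplace functional tend to
  \<open>fint \<eta> f\<close> from below. Fatou gives one inequality and
  \<open>F n \<eta> \<le> fint \<eta> f\<close> the other, so that integrability of
  \<open>fint \<eta> f\<close> comes out as a result.\<close>

lemma mean_nn:
  assumes t: "0 \<le> t" and f: "f \<in> bpB"
  shows "(\<integral>\<^sup>+\<eta>. ennreal (fint \<eta> f) \<partial>Q t \<mu>) = ennreal (fint \<mu> (T t f))"
proof -
  obtain C where C: "0 < C" "\<And>x. \<bar>f x\<bar> \<le> C" using bB_bound[OF bpB_D(1)[OF f]] by metis
  define fn where "fn n = (\<lambda>y. f y / real (Suc n))" for n
  have fn: "fn n \<in> bpB" for n
  proof (rule bpB_I[where B="C / real (Suc n)"])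
    show "fn n \<in> borel_measurable borel" unfolding fn_def using bB_measurable[OF bpB_D(1)[OF f]] by measurable
    show "0 \<le> fn n x" for x unfolding fn_def using bpB_D(2)[OF f] by simp
    show "fn n x \<le> C / real (Suc n)" for x unfolding fn_def using C(2)[of x] by (intro divide_right_mono) auto
  qed
  have fintn: "fint \<eta> (fn n) = fint \<eta> f / real (Suc n)" for \<eta> n
    using fint_cmult[of \<eta> "1 / real (Suc n)" f] by (simp add: fn_def)
  define M where "M = fint \<mu> (T t f)"
  have Tb: "T t f \<in> bpB" by (rule T_bpB[OF t f])
  have lim1: "(\<lambda>n. real (Suc n) * fint \<mu> (V t (fn n))) \<longlonglongrightarrow> M"
  proof -
    have "(\<lambda>n. \<integral>x. real (Suc n) * V t (fn n) x \<partial>meas \<mu>) \<longlonglongrightarrow> (\<integral>x. T t f x \<partial>meas \<mu>)"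
    proof (rule integral_dominated_convergence[where w="T t f"])
      show "integrable (meas \<mu>) (T t f)" by (intro integrable_meas_bB bpB_D Tb)
      show "AE x in meas \<mu>. (\<lambda>n. real (Suc n) * V t (fn n) x) \<longlonglongrightarrow> T t f x"
        using V_scaled_tendsto[OF f t] by (simp add: fn_def)
      show "AE x in meas \<mu>. norm (real (Suc n) * V t (fn n) x) \<le> T t f x" for n
      proof (rule AE_I2)
        fix x
        have "T t (fn n) x = T t f x / real (Suc n)"
          using T_cmult[where t=t and c="1 / real (Suc n)" and f=f and x=x] by (simp add: fn_def)
        then have "real (Suc n) * V t (fn n) x \<le> real (Suc n) * (T t f x / real (Suc n))"
          using V_le_T[OF fn t, of n x] by (intro mult_left_mono) auto
        then show "norm (real (Suc n) * V t (fn n) x) \<le> T t f x"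
          using V_nonneg[OF fn t, of n x] by (simp add: abs_mult)
      qed
    qed (use bB_measurable[OF bpB_D(1)[OF Tb]] V_measurable[OF fn t] in auto)
    then show ?thesis by (simp add: M_def fint_def)
  qed
  define F where "F n \<eta> = real (Suc n) * (1 - exp (- fint \<eta> (fn n)))" for n \<eta>
  have Fm [measurable]: "F n \<in> borel_measurable borel" for n
    unfolding F_def[abs_def] using fint_bpB_measurable[OF fn, of n] by measurable
  have F0: "0 \<le> F n \<eta>" for n \<eta> unfolding F_def using fint_bpB_nonneg[OF fn, of \<eta> n] by simp
  have Fle: "F n \<eta> \<le> fint \<eta> f" for n \<eta>
  proof -
    have "1 - exp (- fint \<eta> (fn n)) \<le> fint \<eta> f / real (Suc n)"
      using exp_ge_add_one_self[of "- fint \<eta> (fn n)"] unfolding fintn by linarith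
    from mult_left_mono[OF this, of "real (Suc n)"] show ?thesis by (simp add: F_def)
  qed
  have Flim: "(\<lambda>n. F n \<eta>) \<longlonglongrightarrow> fint \<eta> f" for \<eta>
  proof -
    define a where "a = fint \<eta> f"
    have a0: "0 \<le> a" unfolding a_def by (rule fint_bpB_nonneg[OF f])
    have "a - a\<^sup>2 * (1 / real (Suc n)) \<le> F n \<eta>" for n
    proof -
      have "excess (a / real (Suc n)) \<le> (a / real (Suc n))\<^sup>2" using a0 by (intro excess_le_sq) simp
      then have "a / real (Suc n) - (a / real (Suc n))\<^sup>2 \<le> 1 - exp (- (a / real (Suc n)))" unfolding excess_def by linarith
      from mult_left_mono[OF this, of "real (Suc n)"]
      show ?thesis unfolding F_def fintn a_def[symmetric] by (simp add: right_diff_distrib power2_eq_square)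
    qed
    moreover have "(\<lambda>n. a - a\<^sup>2 * (1 / real (Suc n))) \<longlonglongrightarrow> a - a\<^sup>2 * 0"
      by (intro tendsto_intros LIMSEQ_Suc[OF lim_1_over_n])
    ultimately show ?thesis unfolding a_def[symmetric]
      using Fle[of _ \<eta>] tendsto_sandwich[of "\<lambda>n. a - a\<^sup>2 * (1 / real (Suc n))" "\<lambda>n. F n \<eta>" sequentially "\<lambda>_. a" a]
      by (simp add: a_def)
  qed
  have Fint: "(\<integral>\<^sup>+\<eta>. ennreal (F n \<eta>) \<partial>Q t \<mu>) = ennreal (real (Suc n) * (1 - exp (- fint \<mu> (V t (fn n)))))" for n
  proof -
    interpret prob_space "Q t \<mu>" by (rule Q_prob[OF t])
    have i1: "integrable (Q t \<mu>) (\<lambda>\<eta>. exp (- fint \<eta> (fn n)))"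
      using fint_bpB_measurable[OF fn, of n] fint_bpB_nonneg[OF fn] by (intro Q_integrable[OF t, where C=1]) auto
    have "(\<integral>\<eta>. F n \<eta> \<partial>Q t \<mu>) = real (Suc n) * (1 - exp (- fint \<mu> (V t (fn n))))"
      unfolding F_def using i1 by (simp add: laplace[OF t fn] prob_space space_Q[OF t, symmetric] del: space_Q of_nat_Suc)
    moreover have "integrable (Q t \<mu>) (F n)" unfolding F_def using i1 by simp
    ultimately show ?thesis using F0 by (subst nn_integral_eq_integral) auto
  qed
  \<comment> \<open>Replacing \<open>1 - exp (- m n)\<close> by \<open>m n\<close> costs at most the
    square of \<open>m n\<close>, which vanishes after scaling because \<open>Suc n * m n\<close>
    converges.\<close>
  have lim2: "(\<lambda>n. real (Suc n) * (1 - exp (- fint \<mu> (V t (fn n))))) \<longlonglongrightarrow> M"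
  proof -
    define m where "m n = fint \<mu> (V t (fn n))" for n
    have m0: "0 \<le> m n" for n unfolding m_def by (intro fint_bpB_nonneg V_bpB fn t)
    have lm: "(\<lambda>n. real (Suc n) * m n) \<longlonglongrightarrow> M" using lim1 by (simp add: m_def)
    have l2: "(\<lambda>n. real (Suc n) * m n - (real (Suc n) * m n)\<^sup>2 * (1 / real (Suc n))) \<longlonglongrightarrow> M - M\<^sup>2 * 0"
      by (intro tendsto_intros lm LIMSEQ_Suc[OF lim_1_over_n])
    have "real (Suc n) * m n - (real (Suc n) * m n)\<^sup>2 * (1 / real (Suc n)) \<le> real (Suc n) * (1 - exp (- m n))" for n
    proof -
      have "m n - (m n)\<^sup>2 \<le> 1 - exp (- m n)" using excess_le_sq[OF m0[of n]] unfolding excess_def by linarith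
      from mult_left_mono[OF this, of "real (Suc n)"]
      have "real (Suc n) * m n - real (Suc n) * (m n)\<^sup>2 \<le> real (Suc n) * (1 - exp (- m n))"
        by (simp only: right_diff_distrib of_nat_0_le_iff simp_thms)
      moreover have "(real (Suc n) * m n)\<^sup>2 * (1 / real (Suc n)) = real (Suc n) * (m n)\<^sup>2" by (simp add: power2_eq_square)
      ultimately show ?thesis by simp
    qed
    moreover have "real (Suc n) * (1 - exp (- m n)) \<le> real (Suc n) * m n" for n
      using exp_ge_add_one_self[of "- m n"] by (intro mult_left_mono) linarith+
    ultimately show ?thesis unfolding m_def[symmetric]
      using tendsto_sandwich[of _ "\<lambda>n. real (Suc n) * (1 - exp (- m n))" sequentially, OF _ _ l2 , of "\<lambda>n. real (Suc n) * m n"] lm by simp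
  qed
  have lim3: "(\<lambda>n. \<integral>\<^sup>+\<eta>. ennreal (F n \<eta>) \<partial>Q t \<mu>) \<longlonglongrightarrow> ennreal M"
    unfolding Fint by (rule tendsto_ennrealI[OF lim2])
  have "(\<integral>\<^sup>+\<eta>. ennreal (fint \<eta> f) \<partial>Q t \<mu>) = (\<integral>\<^sup>+\<eta>. liminf (\<lambda>n. ennreal (F n \<eta>)) \<partial>Q t \<mu>)"
    by (intro nn_integral_cong lim_imp_Liminf[OF _ tendsto_ennrealI[OF Flim], symmetric]) simp
  also have "\<dots> \<le> liminf (\<lambda>n. \<integral>\<^sup>+\<eta>. ennreal (F n \<eta>) \<partial>Q t \<mu>)"
    using t Fm by (intro nn_integral_liminf) simp
  also have "\<dots> = ennreal M" using lim3 by (rule lim_imp_Liminf[rotated]) simp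
  finally have "(\<integral>\<^sup>+\<eta>. ennreal (fint \<eta> f) \<partial>Q t \<mu>) \<le> ennreal M" .
  moreover have "ennreal M \<le> (\<integral>\<^sup>+\<eta>. ennreal (fint \<eta> f) \<partial>Q t \<mu>)"
    by (rule LIMSEQ_le_const2[OF lim3]) (auto intro!: nn_integral_mono ennreal_leI Fle)
  ultimately show ?thesis by (simp add: M_def)
qed

lemma mean:
  assumes t: "0 \<le> t" and f: "f \<in> bpB"
  shows "integrable (Q t \<mu>) (\<lambda>\<eta>. fint \<eta> f)" "(\<integral>\<eta>. fint \<eta> f \<partial>Q t \<mu>) = fint \<mu> (T t f)"
proof -
  show i: "integrable (Q t \<mu>) (\<lambda>\<eta>. fint \<eta> f)"
    using mean_nn[OF t f, of \<mu>] fint_bpB_measurable[OF f] t fint_bpB_nonneg[OF f]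
    by (intro integrableI_nonneg) auto
  have "ennreal (\<integral>\<eta>. fint \<eta> f \<partial>Q t \<mu>) = ennreal (fint \<mu> (T t f))"
    unfolding mean_nn[OF t f, symmetric] using fint_bpB_nonneg[OF f] by (intro nn_integral_eq_integral[symmetric] i) auto
  then show "(\<integral>\<eta>. fint \<eta> f \<partial>Q t \<mu>) = fint \<mu> (T t f)"
    using fint_bpB_nonneg[OF f] fint_bpB_nonneg[OF T_bpB[OF t f]] by (subst (asm) ennreal_inj) auto
qed

end

section \<open>Extinction probabilities\<close>

locale subcritical_model = superprocess_model P W L Y \<zeta> \<beta> \<sigma> \<pi> V Q PP
  for P :: "real \<Rightarrow> 'e::polish_space \<Rightarrow> 'e measure" and W :: "'w measure"
    and L :: "'e \<Rightarrow> 'w measure" and Y :: "real \<Rightarrow> 'w \<Rightarrow> 'e" and \<zeta> :: "'w \<Rightarrow> ereal"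
    and \<beta> \<sigma> :: "'e \<Rightarrow> real" and \<pi> :: "'e \<Rightarrow> real measure"
    and V :: "real \<Rightarrow> ('e \<Rightarrow> real) \<Rightarrow> 'e \<Rightarrow> real"
    and Q :: "real \<Rightarrow> 'e finmeas \<Rightarrow> 'e finmeas measure"
    and PP :: "'e finmeas \<Rightarrow> (real \<Rightarrow> 'e finmeas) measure" +
  fixes lam :: real and \<phi> :: "'e \<Rightarrow> real" and \<nu> :: "'e finmeas" and H :: "real \<Rightarrow> ('e \<Rightarrow> real) \<Rightarrow> 'e \<Rightarrow> real"
  assumes eigen: "principal_triple (mean_semigroup L Y \<zeta> \<beta>) lam \<phi> \<nu>"
    and asymptotics: "uniform_asymptotics (mean_semigroup L Y \<zeta> \<beta>) lam \<phi> \<nu> H"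
    and subcritical: "lam < 0"
    and extinction: "\<And>t. 0 < t \<Longrightarrow> 0 < emeasure (PP \<nu>) {w \<in> space (PP \<nu>). w t = 0}"
begin

section \<open>Eigenfunction, eigenmeasure and the uniform error of the mean semigroup\<close>

lemma phi_pos: "0 < \<phi> x"
  using eigen by (simp add: principal_triple_def)

lemma phi_bpB: "\<phi> \<in> bpB"
  using eigen by (auto simp: principal_triple_def bpB_def less_imp_le)

lemma nu_phi: "fint \<nu> \<phi> = 1"
  using eigen by (simp add: principal_triple_def)

lemma T_phi: assumes "0 \<le> t" shows "T t \<phi> x = exp (lam * t) * \<phi> x"
proof -
  have "ennreal (T t \<phi> x) = ennreal (exp (lam * t) * \<phi> x)"
    using eigen assms Tn_eq[OF assms phi_bpB, of x] mean_semigroup_eq[OF assms, of \<phi> x] phi_pos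
    by (simp add: principal_triple_def less_imp_le)
  then show ?thesis using phi_pos[of x] T_nonneg[of \<phi> t x] phi_pos by (subst (asm) ennreal_inj) (auto simp: less_imp_le)
qed

text \<open>The eigenmeasure relation is given on Borel sets and extends to nonnegative functions by
  linearity and monotone limits.\<close>

lemma nu_Tn:
  assumes t: "0 \<le> t" and g: "g \<in> borel_measurable borel"
  shows "(\<integral>\<^sup>+x. Tn t g x \<partial>meas \<nu>) = ennreal (exp (lam * t)) * (\<integral>\<^sup>+x. g x \<partial>meas \<nu>)"
  using g
proof induction
  case (cong f g)
  then have "f = g" by auto
  then show ?case using cong by simp
next
  case (set A)
  have "Tn t (indicator A) x = mean_semigroup L Y \<zeta> \<beta> t (indicator A) x" for x
  proof -
    have "(indicator A :: 'e \<Rightarrow> ennreal) = (\<lambda>y. ennreal (indicator A y))" by (auto simp: indicator_def)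
    then show ?thesis using mean_semigroup_eq[OF t, of "indicator A" x] by simp
  qed
  then show ?case using eigen t set by (simp add: principal_triple_def)
next
  case (mult u c)
  note [measurable] = mult(2)
  have "Tn t (\<lambda>x. c * u x) y = c * Tn t u y" for y
    unfolding Tn_def using mult by (subst nn_integral_cmult[symmetric]) (auto simp: mult.left_commute)
  then show ?case using mult Tn_measurable[OF \<open>u \<in> borel_measurable borel\<close>] by (simp add: nn_integral_cmult mult.left_commute)
next
  case (add u v)
  have "Tn t (\<lambda>x. v x + u x) y = Tn t v y + Tn t u y" for y
    unfolding Tn_def using add by (subst nn_integral_add[symmetric]) (auto simp: distrib_left)
  then show ?case using add Tn_measurable[OF \<open>u \<in> borel_measurable borel\<close>] Tn_measurable[OF \<open>v \<in> borel_measurable borel\<close>]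
    by (simp add: nn_integral_add distrib_left)
next
  case (seq U)
  note U [measurable] = \<open>\<And>i. U i \<in> borel_measurable borel\<close>
  note inc = \<open>incseq U\<close>
  have 1: "Tn t (SUP i. U i) y = (SUP i. Tn t (U i) y)" for y
  proof -
    have "Tn t (SUP i. U i) y = (\<integral>\<^sup>+\<omega>. (SUP i. wt t \<omega> * U i (pos t \<omega>)) \<partial>L y)"
      unfolding Tn_def by (simp add: SUP_apply image_comp SUP_mult_left_ennreal)
    also have "\<dots> = (SUP i. Tn t (U i) y)" unfolding Tn_def
      using inc by (intro nn_integral_monotone_convergence_SUP) (auto simp: incseq_def le_fun_def intro!: mult_left_mono)
    finally show ?thesis .
  qed
  have inc2: "incseq (\<lambda>i. Tn t (U i))"
    using inc by (auto simp: incseq_def le_fun_def Tn_def intro!: nn_integral_mono mult_left_mono)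
  have "(\<integral>\<^sup>+x. Tn t (SUP i. U i) x \<partial>meas \<nu>) = (SUP i. \<integral>\<^sup>+x. Tn t (U i) x \<partial>meas \<nu>)"
    unfolding 1 using inc2 Tn_measurable[OF U] by (intro nn_integral_monotone_convergence_SUP) auto
  also have "\<dots> = ennreal (exp (lam * t)) * (SUP i. \<integral>\<^sup>+x. U i x \<partial>meas \<nu>)"
    using seq.IH by (simp add: SUP_mult_left_ennreal)
  also have "(SUP i. \<integral>\<^sup>+x. U i x \<partial>meas \<nu>) = (\<integral>\<^sup>+x. (SUP i. U i x) \<partial>meas \<nu>)"
    using inc U by (intro nn_integral_monotone_convergence_SUP[symmetric]) auto
  also have "\<dots> = (\<integral>\<^sup>+x. (SUP i. U i) x \<partial>meas \<nu>)" by (simp add: SUP_apply image_comp)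
  finally show ?case .
qed

lemma nu_T: assumes t: "0 \<le> t" and f: "f \<in> bpB" shows "fint \<nu> (T t f) = exp (lam * t) * fint \<nu> f"
proof -
  have "ennreal (fint \<nu> (T t f)) = (\<integral>\<^sup>+x. Tn t (\<lambda>y. ennreal (f y)) x \<partial>meas \<nu>)"
    unfolding Tn_eq[OF t f] by (rule fint_eq_nn[OF T_bpB[OF t f]])
  also have "\<dots> = ennreal (exp (lam * t)) * (\<integral>\<^sup>+x. ennreal (f x) \<partial>meas \<nu>)"
    using bB_measurable[OF bpB_D(1)[OF f]] by (intro nu_Tn t) simp
  also have "\<dots> = ennreal (exp (lam * t) * fint \<nu> f)"
    using fint_bpB_nonneg[OF f] by (simp add: fint_eq_nn[OF f, symmetric] ennreal_mult)
  finally show ?thesis using fint_bpB_nonneg[OF f] fint_bpB_nonneg[OF T_bpB[OF t f]] by (subst (asm) ennreal_inj) auto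
qed

text \<open>The supremum is finite at every positive time, so the conversion to a real loses nothing
  there.\<close>

definition H_sup :: "real \<Rightarrow> real"
  where "H_sup t = enn2real (SUP (x, f)\<in>UNIV \<times> L1_plus (meas \<nu>). ennreal \<bar>H t f x\<bar>)"

lemma bpB_L1: "f \<in> bpB \<Longrightarrow> f \<in> L1_plus (meas \<nu>)"
  by (auto simp: L1_plus_def fint_eq_nn[symmetric] bpB_D dest: bB_measurable bpB_D(1))

lemma H_sup_nonneg: "0 \<le> H_sup t" by (simp add: H_sup_def)

lemma H_sup_tendsto: "(H_sup \<longlongrightarrow> 0) at_top"
  using tendsto_enn2real[of "\<lambda>t. SUP (x, f)\<in>UNIV \<times> L1_plus (meas \<nu>). ennreal \<bar>H t f x\<bar>" 0 at_top] asymptotics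
  by (simp add: uniform_asymptotics_def H_sup_def[abs_def] zero_ennreal.rep_eq)

lemma H_le: assumes t: "0 < t" and f: "f \<in> bpB" shows "\<bar>H t f x\<bar> \<le> H_sup t"
proof -
  define S where "S = (SUP (x, f)\<in>UNIV \<times> L1_plus (meas \<nu>). ennreal \<bar>H t f x\<bar>)"
  have fin: "S < \<infinity>" using asymptotics t by (simp add: uniform_asymptotics_def S_def)
  have "ennreal \<bar>H t f x\<bar> \<le> S" unfolding S_def
    by (rule SUP_upper2[of "(x, f)"]) (use bpB_L1[OF f] in auto)
  from enn2real_mono[OF this] fin show ?thesis by (simp add: H_sup_def S_def[symmetric] less_top)
qed

lemma T_asymp:
  assumes t: "0 < t" and f: "f \<in> bpB"
  shows "T t f x \<le> exp (lam * t) * \<phi> x * fint \<nu> f * (1 + H_sup t)"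
    and "exp (lam * t) * \<phi> x * fint \<nu> f * (1 - H_sup t) \<le> T t f x"
proof -
  have "enn2real (mean_semigroup L Y \<zeta> \<beta> t f x) = exp (lam * t) * \<phi> x * fint \<nu> f * (1 + H t f x)"
    using asymptotics t bpB_L1[OF f] by (simp add: uniform_asymptotics_def)
  moreover have "mean_semigroup L Y \<zeta> \<beta> t f x = ennreal (T t f x)"
    using t f by (simp add: mean_semigroup_eq Tn_eq bpB_D)
  ultimately have eq: "T t f x = exp (lam * t) * \<phi> x * fint \<nu> f * (1 + H t f x)"
    using T_nonneg[of f t x] f by (simp add: bpB_D)
  have nn: "0 \<le> exp (lam * t) * \<phi> x * fint \<nu> f" using phi_pos[of x] fint_bpB_nonneg[OF f, of \<nu>] by simp
  show "T t f x \<le> exp (lam * t) * \<phi> x * fint \<nu> f * (1 + H_sup t)"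
    "exp (lam * t) * \<phi> x * fint \<nu> f * (1 - H_sup t) \<le> T t f x"
    unfolding eq using H_le[OF t f, of x] by (intro mult_left_mono[OF _ nn]; simp)+
qed

subsection \<open>Reduction to the transition kernel\<close>

lemma PP_prob: "prob_space (PP \<mu>)" and sets_PP: "sets (PP \<mu>) = sets path_space"
  using measurable_space[OF borel_right_process.law[OF SP], of \<mu>] by (auto simp: space_prob_algebra)

lemma space_PP: "space (PP \<mu>) = space path_space"
  using sets_eq_imp_space_eq[OF sets_PP] .

lemma coord_measurable:
  assumes "0 \<le> t" shows "(\<lambda>w. w t) \<in> measurable (PP \<mu>) borel"
proof (rule measurableI)
  fix A :: "'e finmeas set" assume "A \<in> sets borel"
  from borel_right_process.adapted[OF SP assms this]
  have "{w \<in> space path_space. w t \<in> A} \<in> sets path_space" by simp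
  also have "{w \<in> space path_space. w t \<in> A} = (\<lambda>w. w t) -` A \<inter> space (PP \<mu>)" by (auto simp: space_PP)
  finally show "(\<lambda>w. w t) -` A \<inter> space (PP \<mu>) \<in> sets (PP \<mu>)" by (simp add: sets_PP)
qed simp

lemma PP_initial: "AE w in PP \<mu>. w 0 = \<mu>"
  using borel_right_process.initial[OF SP, of \<mu>] by simp

text \<open>The conditioned laws involve the path at two times only, so this formula carries what is
  needed of the path space over to the transition kernel.\<close>

lemma PP_two_times:
  assumes t: "0 \<le> t" "0 \<le> s" and A: "A \<in> sets borel" and B: "B \<in> sets borel"
  shows "emeasure (PP \<mu>) {w \<in> space (PP \<mu>). w t \<in> A \<and> w (t + s) \<in> B} = (\<integral>\<^sup>+w. indicator A (w t) * emeasure (Q s (w t)) B \<partial>PP \<mu>)"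
proof -
  let ?L = "{w \<in> space path_space. w t \<in> A}"
  have L: "?L \<in> sets (past path_space (\<lambda>t w. w t) (\<lambda>_. \<infinity>) t)"
    unfolding past_def using t A by (subst sets_measure_of) (auto intro!: sigma_sets.Basic)
  have "{w \<in> space (PP \<mu>). w t \<in> A \<and> w (t + s) \<in> B} = {w \<in> ?L. ereal (t + s) < \<infinity> \<and> w (t + s) \<in> B}"
    by (auto simp: space_PP)
  then have "emeasure (PP \<mu>) {w \<in> space (PP \<mu>). w t \<in> A \<and> w (t + s) \<in> B} =
     (\<integral>\<^sup>+w. emeasure (Q s (w t)) B * indicator {w \<in> ?L. ereal t < \<infinity>} w \<partial>PP \<mu>)"
    using borel_right_process.markov[OF SP t(2) t(1) L B, of \<mu>] by simp
  also have "\<dots> = (\<integral>\<^sup>+w. indicator A (w t) * emeasure (Q s (w t)) B \<partial>PP \<mu>)"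
    by (intro nn_integral_cong) (auto simp: space_PP indicator_def)
  finally show ?thesis .
qed

text \<open>The two-time formula started at time 0, where the path almost surely sits at its initial
  value.\<close>

lemma distr_PP: assumes t: "0 \<le> t" shows "distr (PP \<mu>) borel (\<lambda>w. w t) = Q t \<mu>"
proof (rule measure_eqI)
  show "sets (distr (PP \<mu>) borel (\<lambda>w. w t)) = sets (Q t \<mu>)" using t by simp
  fix A assume "A \<in> sets (distr (PP \<mu>) borel (\<lambda>w. w t))"
  then have A: "A \<in> sets borel" by simp
  have "emeasure (distr (PP \<mu>) borel (\<lambda>w. w t)) A = emeasure (PP \<mu>) {w \<in> space (PP \<mu>). w 0 \<in> UNIV \<and> w (0 + t) \<in> A}"
    using coord_measurable[OF t] A by (subst emeasure_distr) (auto intro!: arg_cong[where f="emeasure _"])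
  also have "\<dots> = (\<integral>\<^sup>+w. indicator UNIV (w 0) * emeasure (Q t (w 0)) A \<partial>PP \<mu>)"
    by (rule PP_two_times) (use t A in auto)
  also have "\<dots> = (\<integral>\<^sup>+w. emeasure (Q t \<mu>) A \<partial>PP \<mu>)"
    by (intro nn_integral_cong_AE) (use PP_initial[of \<mu>] in auto)
  also have "\<dots> = emeasure (Q t \<mu>) A" using prob_space.emeasure_space_1[OF PP_prob, of \<mu>] by simp
  finally show "emeasure (distr (PP \<mu>) borel (\<lambda>w. w t)) A = emeasure (Q t \<mu>) A" .
qed

section \<open>Survival probabilities and conditioning on survival\<close>

definition surv :: "real \<Rightarrow> 'e finmeas \<Rightarrow> real"
  where "surv t \<mu> = measure (Q t \<mu>) (- {0})"

lemma surv_bounds: "0 \<le> t \<Longrightarrow> 0 \<le> surv t \<mu>" "0 \<le> t \<Longrightarrow> surv t \<mu> \<le> 1"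
  using prob_space.prob_le_1[OF Q_prob] by (auto simp: surv_def)

lemma emeasure_surv: "0 \<le> t \<Longrightarrow> emeasure (Q t \<mu>) (- {0}) = ennreal (surv t \<mu>)"
  unfolding surv_def by (rule finite_measure.emeasure_eq_measure[OF prob_space.finite_measure[OF Q_prob]])

lemma surv_measurable: assumes t: "0 \<le> t" shows "surv t \<in> borel_measurable borel"
  unfolding surv_def[abs_def]
  by (rule measurable_compose[OF Q_kernel[OF t] measurable_measure_subprob_algebra]) auto

lemma PP_nonzero: "0 \<le> t \<Longrightarrow> emeasure (PP \<mu>) {w \<in> space (PP \<mu>). w t \<noteq> 0} = ennreal (surv t \<mu>)"
proof -
  assume t: "0 \<le> t"
  have "ennreal (surv t \<mu>) = emeasure (distr (PP \<mu>) borel (\<lambda>w. w t)) (- {0})"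
    unfolding distr_PP[OF t] using t by (simp add: emeasure_surv)
  also have "\<dots> = emeasure (PP \<mu>) {w \<in> space (PP \<mu>). w t \<noteq> 0}"
    using coord_measurable[OF t] by (subst emeasure_distr) (auto intro!: arg_cong[where f="emeasure _"])
  finally show ?thesis by simp
qed

lemma surv_add: assumes "0 \<le> t" "0 \<le> r"
  shows "surv (t + r) \<mu> = (\<integral>\<eta>. surv r \<eta> \<partial>Q t \<mu>)"
proof -
  have "ennreal (surv (t + r) \<mu>) = (\<integral>\<^sup>+\<eta>. indicator (- {0}) \<eta> \<partial>Q (t + r) \<mu>)"
    using assms by (simp add: emeasure_surv)
  also have "\<dots> = (\<integral>\<^sup>+\<eta>. ennreal (surv r \<eta>) \<partial>Q t \<mu>)"
    by (subst nn_Q_add) (use assms in \<open>auto simp: emeasure_surv\<close>)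
  also have "\<dots> = ennreal (\<integral>\<eta>. surv r \<eta> \<partial>Q t \<mu>)"
    using assms surv_bounds[of r] surv_measurable[of r]
    by (intro nn_integral_eq_integral Q_integrable[where C=1]) auto
  finally show ?thesis using surv_bounds assms by (subst (asm) ennreal_inj) (auto intro!: integral_nonneg)
qed

text \<open>By the Markov property, conditioning on survival to \<open>t + r\<close> weights the
  state at time \<open>t\<close> by its own chance of surviving a further \<open>r\<close>: the
  conditioned law has density \<open>surv r \<eta> / surv (t + r) \<mu>\<close> with respect to
  \<open>Q t \<mu>\<close>.\<close>

lemma conditioned_integral:
  fixes F :: "'e finmeas \<Rightarrow> real"
  assumes t: "0 \<le> t" "0 \<le> r" and F: "F \<in> borel_measurable borel" "\<And>\<eta>. \<bar>F \<eta>\<bar> \<le> C" and pos: "0 < surv (t + r) \<mu>"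
  shows "(\<integral>\<eta>. F \<eta> \<partial>conditioned_law PP \<mu> t r) = (\<integral>\<eta>. F \<eta> * surv r \<eta> \<partial>Q t \<mu>) / surv (t + r) \<mu>"
proof -
  let ?B = "{w \<in> space (PP \<mu>). w (t + r) \<noteq> 0}"
  note [measurable] = coord_measurable[OF t(1), of \<mu>] coord_measurable[of "t + r" \<mu>] surv_measurable[OF t(2)] F(1)
  have B [measurable]: "?B \<in> sets (PP \<mu>)"
  proof -
    have "?B = (\<lambda>w. w (t + r)) -` (- {0}) \<inter> space (PP \<mu>)" by auto
    also have "\<dots> \<in> sets (PP \<mu>)" using t by (intro measurable_sets[OF coord_measurable]) auto
    finally show ?thesis .
  qed
  have eB: "emeasure (PP \<mu>) ?B = ennreal (surv (t + r) \<mu>)" using t by (intro PP_nonzero) simp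
  have sets_eq: "sets (uniform_measure (PP \<mu>) ?B) = sets (PP \<mu>)" by simp
  have eq: "conditioned_law PP \<mu> t r = density (Q t \<mu>) (\<lambda>\<eta>. ennreal (surv r \<eta> / surv (t + r) \<mu>))"
  proof (rule measure_eqI)
    show "sets (conditioned_law PP \<mu> t r) = sets (density (Q t \<mu>) (\<lambda>\<eta>. ennreal (surv r \<eta> / surv (t + r) \<mu>)))"
      using t by (simp add: conditioned_law_def)
    fix A assume "A \<in> sets (conditioned_law PP \<mu> t r)"
    then have A [measurable]: "A \<in> sets borel" by (simp add: conditioned_law_def)
    have "emeasure (conditioned_law PP \<mu> t r) A = emeasure (uniform_measure (PP \<mu>) ?B) ((\<lambda>w. w t) -` A \<inter> space (PP \<mu>))"
      unfolding conditioned_law_def by (subst emeasure_distr) (auto simp: space_uniform_measure)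
    also have "\<dots> = emeasure (PP \<mu>) (?B \<inter> ((\<lambda>w. w t) -` A \<inter> space (PP \<mu>))) / emeasure (PP \<mu>) ?B"
      by (rule emeasure_uniform_measure) (auto intro: measurable_sets[OF coord_measurable[OF t(1)] A])
    also have "?B \<inter> ((\<lambda>w. w t) -` A \<inter> space (PP \<mu>)) = {w \<in> space (PP \<mu>). w t \<in> A \<and> w (t + r) \<in> - {0}}" by auto
    also have "emeasure (PP \<mu>) \<dots> = (\<integral>\<^sup>+w. indicator A (w t) * emeasure (Q r (w t)) (- {0}) \<partial>PP \<mu>)"
      by (rule PP_two_times) (use t A in auto)
    also have "\<dots> = (\<integral>\<^sup>+w. (\<lambda>\<eta>. indicator A \<eta> * ennreal (surv r \<eta>)) (w t) \<partial>PP \<mu>)"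
      using t by (simp add: emeasure_surv)
    also have "\<dots> = (\<integral>\<^sup>+\<eta>. indicator A \<eta> * ennreal (surv r \<eta>) \<partial>Q t \<mu>)"
      unfolding distr_PP[OF t(1), symmetric] by (rule nn_integral_distr[OF coord_measurable[OF t(1)], symmetric]) simp
    also have "(\<integral>\<^sup>+\<eta>. indicator A \<eta> * ennreal (surv r \<eta>) \<partial>Q t \<mu>) / emeasure (PP \<mu>) ?B = (\<integral>\<^sup>+\<eta>. ennreal (surv r \<eta> / surv (t + r) \<mu>) * indicator A \<eta> \<partial>Q t \<mu>)"
      unfolding eB using t pos surv_bounds[OF t(2)]
      by (subst nn_integral_divide[symmetric]) (auto simp: divide_ennreal[symmetric] indicator_def intro!: nn_integral_cong)
    also have "\<dots> = emeasure (density (Q t \<mu>) (\<lambda>\<eta>. ennreal (surv r \<eta> / surv (t + r) \<mu>))) A"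
      using t A by (subst emeasure_density) auto
    finally show "emeasure (conditioned_law PP \<mu> t r) A = emeasure (density (Q t \<mu>) (\<lambda>\<eta>. ennreal (surv r \<eta> / surv (t + r) \<mu>))) A" .
  qed
  have "(\<integral>\<eta>. F \<eta> \<partial>conditioned_law PP \<mu> t r) = (\<integral>\<eta>. (surv r \<eta> / surv (t + r) \<mu>) * F \<eta> \<partial>Q t \<mu>)"
    unfolding eq using t pos surv_bounds[OF t(2)] by (subst integral_density) auto
  also have "\<dots> = (\<integral>\<eta>. F \<eta> * surv r \<eta> / surv (t + r) \<mu> \<partial>Q t \<mu>)" by (simp add: mult.commute)
  finally show ?thesis by simp
qed

end

context subcritical_model
begin

lemma const_bpB: "0 \<le> c \<Longrightarrow> (\<lambda>_. c) \<in> bpB"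
  by (intro bpB_I[where B=c]) auto

lemma exp_fint_measurable: "(f :: 'e \<Rightarrow> real) \<in> bpB \<Longrightarrow> (\<lambda>\<eta>. exp (- fint \<eta> f)) \<in> borel_measurable borel"
  by (intro measurable_compose[OF fint_bpB_measurable]) auto

lemma exp_fint_integrable: "0 \<le> t \<Longrightarrow> f \<in> bpB \<Longrightarrow> integrable (Q t \<mu>) (\<lambda>\<eta>. exp (- fint \<eta> f))"
  by (rule Q_integrable[where C=1]) (auto simp: exp_fint_measurable fint_bpB_nonneg)

lemma extinction_prob: "0 \<le> t \<Longrightarrow> (\<integral>\<eta>. indicator {0} \<eta> \<partial>Q t \<mu>) = 1 - surv t \<mu>"
proof -
  assume t: "0 \<le> t"
  have "measure (Q t \<mu>) (space (Q t \<mu>) - (- {0})) = 1 - measure (Q t \<mu>) (- {0})"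
    using t by (intro prob_space.prob_compl Q_prob) auto
  then show ?thesis using t by (simp add: surv_def)
qed

lemma surv_le_laplace: "0 \<le> t \<Longrightarrow> f \<in> bpB \<Longrightarrow> 1 - surv t \<mu> \<le> exp (- fint \<mu> (V t f))"
proof -
  assume t: "0 \<le> t" and f: "f \<in> bpB"
  have "(\<integral>\<eta>. indicator {0} \<eta> \<partial>Q t \<mu>) \<le> (\<integral>\<eta>. exp (- fint \<eta> f) \<partial>Q t \<mu>)"
  proof (rule integral_mono)
    show "integrable (Q t \<mu>) (indicator {0} :: 'e finmeas \<Rightarrow> real)" using t by (intro Q_integrable[where C=1]) (auto simp: indicator_def)
    show "indicator {0} \<eta> \<le> exp (- fint \<eta> f)" for \<eta> by (auto simp: indicator_def)
  qed (rule exp_fint_integrable[OF t f])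
  then show ?thesis by (simp only: extinction_prob[OF t] laplace[OF t f])
qed

text \<open>\<open>exp (- fint \<eta> (\<lambda>_. real n))\<close> decreases to the indicator of
  the null measure, so extinction probabilities are limits of Laplace functionals of large
  constants.\<close>

lemma laplace_tendsto: assumes t: "0 \<le> t"
  shows "(\<lambda>n. exp (- fint \<mu> (V t (\<lambda>_. real n)))) \<longlonglongrightarrow> 1 - surv t \<mu>"
proof -
  interpret prob_space "Q t \<mu>" by (rule Q_prob[OF t])
  have "(\<lambda>n. \<integral>\<eta>. exp (- fint \<eta> (\<lambda>_. real n)) \<partial>Q t \<mu>) \<longlonglongrightarrow> (\<integral>\<eta>. indicator {0} \<eta> \<partial>Q t \<mu>)"
  proof (rule integral_dominated_convergence[where w="\<lambda>_. 1"])
    have "(\<lambda>n. exp (- fint \<eta> (\<lambda>_. real n))) \<longlonglongrightarrow> indicator {0} \<eta>" for \<eta> :: "'e finmeas"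
    proof (cases "\<eta> = 0")
      case False
      define m where "m = measure (meas \<eta>) UNIV"
      have "emeasure (meas \<eta>) UNIV = ennreal m" by (simp add: m_def finite_measure.emeasure_eq_measure)
      then have m: "0 < m" using False unfolding finmeas_eq_0_iff m_def by (metis ennreal_0 less_eq_real_def measure_nonneg)
      have "(\<lambda>n. (exp (- m)) ^ n) \<longlonglongrightarrow> 0" using m by (intro LIMSEQ_power_zero) simp
      moreover have "exp (- fint \<eta> (\<lambda>_. real n)) = (exp (- m)) ^ n" for n
        by (simp add: fint_const m_def exp_of_nat_mult[symmetric])
      ultimately show ?thesis using False by simp
    qed simp
    then show "AE \<eta> in Q t \<mu>. (\<lambda>n. exp (- fint \<eta> (\<lambda>_. real n))) \<longlonglongrightarrow> indicator {0} \<eta>" by simp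
    show "AE \<eta> in Q t \<mu>. norm (exp (- fint \<eta> (\<lambda>_. real n))) \<le> 1" for n
      by (intro AE_I2) (simp add: fint_bpB_nonneg const_bpB)
    show "(\<lambda>\<eta>. exp (- fint \<eta> (\<lambda>_. real n))) \<in> borel_measurable (Q t \<mu>)" for n
      using t by (simp add: exp_fint_measurable const_bpB)
  qed (use t in auto)
  then show ?thesis unfolding extinction_prob[OF t] laplace[OF t const_bpB[OF of_nat_0_le_iff]] .
qed

lemma surv_nu: assumes t: "0 < t" shows "surv t \<nu> < 1"
proof -
  have "{w \<in> space (PP \<nu>). w t = 0} = (\<lambda>w. w t) -` {0} \<inter> space (PP \<nu>)" by auto
  then have "emeasure (PP \<nu>) {w \<in> space (PP \<nu>). w t = 0} = emeasure (distr (PP \<nu>) borel (\<lambda>w. w t)) {0}"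
    using coord_measurable[of t \<nu>] t by (subst emeasure_distr) auto
  also have "\<dots> = emeasure (Q t \<nu>) {0}" using t by (simp add: distr_PP)
  also have "\<dots> = ennreal (1 - surv t \<nu>)"
    using t extinction_prob[of t \<nu>] by (simp add: finite_measure.emeasure_eq_measure[OF prob_space.finite_measure[OF Q_prob]])
  finally show ?thesis using extinction[OF t] by (simp add: ennreal_less_zero_iff)
qed

section \<open>The extinction exponent\<close>

definition vn :: "nat \<Rightarrow> real \<Rightarrow> 'e \<Rightarrow> real"
  where "vn n t = V t (\<lambda>_. real n)"

text \<open>The cumulant of an infinite test function. It is meaningful at positive times, where
  \<open>vn_le\<close> bounds the supremum.\<close>

definition v :: "real \<Rightarrow> 'e \<Rightarrow> real"
  where "v t x = (SUP n. vn n t x)"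

lemma vn_bpB: "0 \<le> t \<Longrightarrow> vn n t \<in> bpB"
  unfolding vn_def by (intro V_bpB const_bpB) auto

lemma vn_mono: "0 \<le> t \<Longrightarrow> m \<le> n \<Longrightarrow> vn m t x \<le> vn n t x"
proof -
  assume t: "0 \<le> t" and "m \<le> n"
  have "(\<integral>\<eta>. exp (- fint \<eta> (\<lambda>_. real n)) \<partial>Q t (dirac x)) \<le> (\<integral>\<eta>. exp (- fint \<eta> (\<lambda>_. real m)) \<partial>Q t (dirac x))"
    using t \<open>m \<le> n\<close> by (intro integral_mono exp_fint_integrable const_bpB) (auto simp: fint_const intro!: mult_right_mono)
  then show ?thesis
    using t bB_measurable[OF bpB_D(1)[OF vn_bpB[OF t]]] by (simp add: laplace const_bpB fint_dirac vn_def)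
qed

text \<open>The logarithm bounds the integral of the exponent against \<open>\<nu>\<close> at time
  \<open>t / 2\<close>; the other two factors are the cost of carrying this bound to single points
  during the other half of the time.\<close>

definition vbound :: "real \<Rightarrow> real"
  where "vbound t = exp (lam * (t / 2)) * (- ln (1 - surv (t / 2) \<nu>)) * (1 + H_sup (t / 2))"

text \<open>The positive extinction probability under \<open>\<nu>\<close> bounds
  \<open>fint \<nu> (vn n (t / 2))\<close> uniformly in \<open>n\<close>. The mean semigroup turns
  this integrated bound into a pointwise one proportional to \<open>\<phi>\<close>.\<close>

lemma vn_le: assumes t: "0 < t" shows "vn n t x \<le> \<phi> x * vbound t"
proof -
  have t2: "0 < t / 2" using t by simp
  have "exp (ln (1 - surv (t / 2) \<nu>)) \<le> exp (- fint \<nu> (vn n (t / 2)))"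
    using surv_nu[OF t2] surv_le_laplace[of "t / 2" "\<lambda>_. real n" \<nu>] t2 by (simp add: const_bpB vn_def)
  then have le: "fint \<nu> (vn n (t / 2)) \<le> - ln (1 - surv (t / 2) \<nu>)" by simp
  have "vn n t x = V (t / 2) (vn n (t / 2)) x"
    using V_semigroup[of "t / 2" "t / 2" "\<lambda>_. real n"] t by (simp add: const_bpB vn_def)
  also have "\<dots> \<le> T (t / 2) (vn n (t / 2)) x" using t by (intro V_le_T vn_bpB) auto
  also have "\<dots> \<le> exp (lam * (t / 2)) * \<phi> x * fint \<nu> (vn n (t / 2)) * (1 + H_sup (t / 2))"
    using t by (intro T_asymp vn_bpB) auto
  also have "\<dots> \<le> exp (lam * (t / 2)) * \<phi> x * (- ln (1 - surv (t / 2) \<nu>)) * (1 + H_sup (t / 2))"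
    using le phi_pos[of x] H_sup_nonneg[of "t / 2"] by (intro mult_right_mono mult_left_mono) auto
  also have "\<dots> = \<phi> x * vbound t" by (simp add: vbound_def mult_ac)
  finally show ?thesis .
qed

lemma vn_tendsto: assumes t: "0 < t" shows "(\<lambda>n. vn n t x) \<longlonglongrightarrow> v t x"
  unfolding v_def using vn_le[OF t] vn_mono t
  by (intro LIMSEQ_incseq_SUP) (auto simp: incseq_def intro!: bdd_aboveI2[where M="\<phi> x * vbound t"])

lemma v_bounds: assumes t: "0 < t" shows "0 \<le> v t x" "v t x \<le> \<phi> x * vbound t"
proof -
  show "0 \<le> v t x" using t bpB_D(2)[OF vn_bpB] by (intro LIMSEQ_le_const[OF vn_tendsto[OF t]]) auto
  show "v t x \<le> \<phi> x * vbound t" using vn_le[OF t] by (intro LIMSEQ_le_const2[OF vn_tendsto[OF t]]) auto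
qed

lemma vbound_nonneg: "0 < t \<Longrightarrow> 0 \<le> vbound t"
  using v_bounds[of t undefined] phi_pos[of undefined] by (metis order_trans zero_le_mult_iff not_less)

lemma v_bpB: assumes t: "0 < t" shows "v t \<in> bpB"
proof -
  obtain b where b: "0 < b" "\<And>x. \<bar>\<phi> x\<bar> \<le> b" using bB_bound[OF bpB_D(1)[OF phi_bpB]] by metis
  have "v t \<in> borel_measurable borel"
    using t bB_measurable[OF bpB_D(1)[OF vn_bpB]] by (intro borel_measurable_LIMSEQ_real[OF vn_tendsto[OF t]]) auto
  moreover have "v t x \<le> b * vbound t" for x
    using v_bounds(2)[OF t, of x] b(2)[of x] vbound_nonneg[OF t] mult_right_mono[of "\<phi> x" b "vbound t"] by linarith
  ultimately show ?thesis using v_bounds[OF t] by (intro bpB_I) auto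
qed

lemma surv_v: assumes t: "0 < t" shows "surv t \<mu> = 1 - exp (- fint \<mu> (v t))"
proof -
  have "(\<lambda>n. fint \<mu> (vn n t)) \<longlonglongrightarrow> fint \<mu> (v t)"
    unfolding fint_def
  proof (rule integral_dominated_convergence[where w="\<lambda>x. vbound t * \<phi> x"])
    show "integrable (meas \<mu>) (\<lambda>x. vbound t * \<phi> x)"
      by (intro integrable_mult_right integrable_meas_bB bpB_D(1) phi_bpB)
    show "AE x in meas \<mu>. (\<lambda>n. vn n t x) \<longlonglongrightarrow> v t x" using vn_tendsto[OF t] by simp
    show "AE x in meas \<mu>. norm (vn n t x) \<le> vbound t * \<phi> x" for n
      using vn_le[OF t] bpB_D(2)[OF vn_bpB] t by (intro AE_I2) (simp add: mult.commute)
  qed (use t in \<open>auto intro!: bB_measurable bpB_D(1) vn_bpB v_bpB\<close>)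
  then have "(\<lambda>n. exp (- fint \<mu> (vn n t))) \<longlonglongrightarrow> exp (- fint \<mu> (v t))"
    by (intro tendsto_intros)
  moreover have "(\<lambda>n. exp (- fint \<mu> (vn n t))) \<longlonglongrightarrow> 1 - surv t \<mu>"
    using laplace_tendsto[of t \<mu>] t by (simp add: vn_def)
  ultimately show ?thesis using LIMSEQ_unique by fastforce
qed

text \<open>The Markov property of survival makes \<open>v\<close> a trajectory of the cumulant
  semigroup at positive times, although it starts from an infinite value.\<close>

lemma v_flow: assumes s: "0 \<le> s" and t: "0 < t" shows "v (s + t) = V s (v t)"
proof
  fix x
  have "1 - exp (- fint (dirac x) (v (s + t))) = (\<integral>\<eta>. 1 - exp (- fint \<eta> (v t)) \<partial>Q s (dirac x))"
    using s t surv_add[of s t "dirac x"] by (simp add: surv_v)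
  also have "\<dots> = 1 - (\<integral>\<eta>. exp (- fint \<eta> (v t)) \<partial>Q s (dirac x))"
  proof -
    interpret prob_space "Q s (dirac x)" by (rule Q_prob[OF s])
    show ?thesis using exp_fint_integrable[OF s v_bpB[OF t], of "dirac x"] prob_space by simp
  qed
  also have "\<dots> = 1 - exp (- fint (dirac x) (V s (v t)))" using s t by (simp add: laplace v_bpB)
  finally show "v (s + t) x = V s (v t) x"
    using s t by (simp add: fint_dirac V_measurable v_bpB bB_measurable bpB_D(1))
qed

section \<open>Decay of the extinction exponent and asymptotics of survival\<close>

definition nu_mass :: "real \<Rightarrow> real"
  where "nu_mass t = exp (- lam * t) * fint \<nu> (v t)"

lemma nu_mass_nonneg: "0 < t \<Longrightarrow> 0 \<le> nu_mass t"
  by (simp add: nu_mass_def fint_bpB_nonneg v_bpB)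

lemma nu_v: "fint \<nu> (v t) = exp (lam * t) * nu_mass t"
  by (simp add: nu_mass_def exp_minus)

lemma v_le_T: "0 \<le> s \<Longrightarrow> 0 < t \<Longrightarrow> v (s + t) x \<le> T s (v t) x"
  by (simp add: v_flow V_le_T v_bpB)

text \<open>\<open>v (s + t)\<close> lies below \<open>T s (v t)\<close>, and integrating
  \<open>T s\<close> against \<open>\<nu>\<close> produces exactly the factor
  \<open>exp (lam * s)\<close>.\<close>

lemma nu_mass_antimono: assumes "0 < t" "t \<le> u" shows "nu_mass u \<le> nu_mass t"
proof -
  define s where "s = u - t"
  have s: "0 \<le> s" "u = s + t" using assms by (auto simp: s_def)
  have "fint \<nu> (v u) \<le> fint \<nu> (T s (v t))"
    unfolding s(2) using s(1) assms by (intro fint_mono v_le_T bpB_D(1) T_bpB v_bpB) auto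
  also have "\<dots> = exp (lam * s) * fint \<nu> (v t)" using s assms by (intro nu_T v_bpB)
  finally have "nu_mass u \<le> exp (- lam * u) * (exp (lam * s) * fint \<nu> (v t))" unfolding nu_mass_def by (intro mult_left_mono) auto
  also have "\<dots> = nu_mass t" by (simp add: nu_mass_def s(2) exp_add[symmetric] mult.assoc[symmetric] algebra_simps)
  finally show ?thesis .
qed

definition surv_rate :: real where "surv_rate = (INF t\<in>{0<..}. nu_mass t)"

lemma surv_rate_le: "0 < t \<Longrightarrow> surv_rate \<le> nu_mass t"
  unfolding surv_rate_def by (rule cINF_lower) (auto intro!: bdd_belowI2[where m=0] nu_mass_nonneg)

lemma nu_mass_tendsto: "(nu_mass \<longlongrightarrow> surv_rate) at_top"
proof (rule order_tendstoI)
  fix l assume "l < surv_rate"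
  then show "\<forall>\<^sub>F t in at_top. l < nu_mass t"
    by (intro eventually_mono[OF eventually_gt_at_top[of 0]] less_le_trans[OF _ surv_rate_le])
next
  fix l assume "surv_rate < l"
  then obtain t where t: "0 < t" "nu_mass t < l"
    unfolding surv_rate_def by (subst (asm) cINF_less_iff) (auto intro!: bdd_belowI2[where m=0] nu_mass_nonneg)
  show "\<forall>\<^sub>F u in at_top. nu_mass u < l"
    using eventually_ge_at_top[of t] by eventually_elim (use t nu_mass_antimono[of t] in force)
qed

lemma v_upper: assumes "0 < s" "0 < t" shows "v (s + t) x \<le> exp (lam * (s + t)) * \<phi> x * nu_mass t * (1 + H_sup s)"
proof -
  have "v (s + t) x \<le> T s (v t) x" using assms by (intro v_le_T) auto
  also have "\<dots> \<le> exp (lam * s) * \<phi> x * fint \<nu> (v t) * (1 + H_sup s)" using assms by (intro T_asymp v_bpB)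
  also have "\<dots> = exp (lam * (s + t)) * \<phi> x * nu_mass t * (1 + H_sup s)"
    unfolding nu_v by (simp add: distrib_left exp_add mult_ac)
  finally show ?thesis .
qed

lemma surv_upper: assumes "0 < s" "0 < t" shows "surv (s + t) \<mu> \<le> exp (lam * (s + t)) * fint \<mu> \<phi> * nu_mass t * (1 + H_sup s)"
proof -
  have "surv (s + t) \<mu> \<le> fint \<mu> (v (s + t))"
    using assms exp_ge_add_one_self[of "- fint \<mu> (v (s + t))"] by (simp add: surv_v)
  also have "\<dots> \<le> fint \<mu> (\<lambda>x. (exp (lam * (s + t)) * nu_mass t * (1 + H_sup s)) * \<phi> x)"
  proof (intro fint_mono)
    obtain b where b: "0 < b" "\<And>x. \<bar>\<phi> x\<bar> \<le> b" using bB_bound[OF bpB_D(1)[OF phi_bpB]] by metis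
    have m: "\<phi> \<in> borel_measurable borel" by (intro bB_measurable bpB_D(1) phi_bpB)
    show "(\<lambda>x. (exp (lam * (s + t)) * nu_mass t * (1 + H_sup s)) * \<phi> x) \<in> bB"
      by (rule bB_I[where B="\<bar>exp (lam * (s + t)) * nu_mass t * (1 + H_sup s)\<bar> * b"])
         (use b m in \<open>auto simp: abs_mult intro!: mult_left_mono\<close>)
    show "v (s + t) x \<le> (exp (lam * (s + t)) * nu_mass t * (1 + H_sup s)) * \<phi> x" for x
      using v_upper[OF assms, of x] by (simp add: mult_ac)
  qed (use assms in \<open>auto intro!: bpB_D(1) v_bpB\<close>)
  also have "\<dots> = exp (lam * (s + t)) * fint \<mu> \<phi> * nu_mass t * (1 + H_sup s)" unfolding fint_cmult by (simp add: mult_ac)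
  finally show ?thesis .
qed

lemma exp_lam_tendsto: "((\<lambda>t. exp (lam * t)) \<longlongrightarrow> 0) at_top"
  by (rule filterlim_compose[OF exp_at_bot])
     (use subcritical in \<open>intro filterlim_tendsto_neg_mult_at_bot[OF tendsto_const] filterlim_ident\<close>)

lemma half_at_top: "filterlim (\<lambda>t::real. t / 2) at_top at_top"
  by (rule filterlim_at_top_mult_tendsto_pos[where c="1/2" and f="\<lambda>_. 1/2" and g="\<lambda>t. t", simplified mult.commute, simplified])
     (auto intro: filterlim_ident)

text \<open>Dominated convergence with a first moment: the integrand is at most
  \<open>C * fint \<eta> \<phi>\<close>, and for fixed \<open>\<eta>\<close> the quadratic bound on
  \<open>excess\<close> makes it decay like \<open>exp (lam * t)\<close>.\<close>

lemma excess_small: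
  assumes s: "0 \<le> s" and C: "0 \<le> C"
  shows "((\<lambda>t. \<integral>\<eta>. exp (- lam * t) * excess (C * exp (lam * t) * fint \<eta> \<phi>) \<partial>Q s \<mu>) \<longlongrightarrow> 0) at_top"
proof -
  have fm [measurable]: "(\<lambda>\<eta>. fint \<eta> \<phi>) \<in> borel_measurable borel" by (rule fint_bpB_measurable[OF phi_bpB])
  have "((\<lambda>t. \<integral>\<eta>. exp (- lam * t) * excess (C * exp (lam * t) * fint \<eta> \<phi>) \<partial>Q s \<mu>) \<longlongrightarrow> (\<integral>\<eta>. 0 \<partial>Q s \<mu>)) at_top"
  proof (rule integral_dominated_convergence_at_top[where w="\<lambda>\<eta>. C * fint \<eta> \<phi>"])
    show "integrable (Q s \<mu>) (\<lambda>\<eta>. C * fint \<eta> \<phi>)" by (intro integrable_mult_right mean s phi_bpB)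
    show "\<forall>\<^sub>F t in at_top. AE \<eta> in Q s \<mu>. norm (exp (- lam * t) * excess (C * exp (lam * t) * fint \<eta> \<phi>)) \<le> C * fint \<eta> \<phi>"
    proof (intro always_eventually allI AE_I2)
      fix t and \<eta> :: "'e finmeas"
      have "exp (- lam * t) * excess (C * exp (lam * t) * fint \<eta> \<phi>) \<le> exp (- lam * t) * (C * exp (lam * t) * fint \<eta> \<phi>)"
        using C fint_bpB_nonneg[OF phi_bpB, of \<eta>] by (intro mult_left_mono excess_le_self) auto
      also have "\<dots> = C * fint \<eta> \<phi>" by (simp add: exp_minus)
      finally show "norm (exp (- lam * t) * excess (C * exp (lam * t) * fint \<eta> \<phi>)) \<le> C * fint \<eta> \<phi>"
        by (simp add: excess_nonneg abs_mult)
    qed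
    show "AE \<eta> in Q s \<mu>. ((\<lambda>t. exp (- lam * t) * excess (C * exp (lam * t) * fint \<eta> \<phi>)) \<longlongrightarrow> 0) at_top"
    proof (rule AE_I2)
      fix \<eta> :: "'e finmeas"
      have "exp (- lam * t) * excess (C * exp (lam * t) * fint \<eta> \<phi>) \<le> (C * fint \<eta> \<phi>)\<^sup>2 * exp (lam * t)" for t
      proof -
        have "exp (- lam * t) * excess (C * exp (lam * t) * fint \<eta> \<phi>) \<le> exp (- lam * t) * (C * exp (lam * t) * fint \<eta> \<phi>)\<^sup>2"
          using C fint_bpB_nonneg[OF phi_bpB, of \<eta>] by (intro mult_left_mono excess_le_sq) auto
        also have "\<dots> = (C * fint \<eta> \<phi>)\<^sup>2 * exp (lam * t)" by (simp add: exp_minus power2_eq_square field_simps)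
        finally show ?thesis .
      qed
      moreover have "((\<lambda>t. (C * fint \<eta> \<phi>)\<^sup>2 * exp (lam * t)) \<longlongrightarrow> (C * fint \<eta> \<phi>)\<^sup>2 * 0) at_top"
        by (intro tendsto_intros exp_lam_tendsto)
      ultimately show "((\<lambda>t. exp (- lam * t) * excess (C * exp (lam * t) * fint \<eta> \<phi>)) \<longlongrightarrow> 0) at_top"
        using tendsto_sandwich[of "\<lambda>_. 0" "\<lambda>t. exp (- lam * t) * excess (C * exp (lam * t) * fint \<eta> \<phi>)" at_top
          "\<lambda>t. (C * fint \<eta> \<phi>)\<^sup>2 * exp (lam * t)" 0] excess_nonneg by simp
    qed
  qed (use s in auto)
  then show ?thesis by simp
qed

text \<open>At fixed \<open>s\<close>, the chance of a population \<open>\<eta>\<close> to survive a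
  long further time \<open>t\<close> is \<open>fint \<eta> (v t)\<close> up to an
  \<open>excess\<close> term, and \<open>fint \<eta> (v t)\<close> is at most of order
  \<open>exp (lam * t)\<close>. The linear part has mean \<open>fint \<mu> (T s (v t))\<close>,
  which the asymptotics of the mean semigroup bound from below.\<close>

lemma surv_lower:
  assumes s: "0 < s" "H_sup s \<le> 1" and t: "2 \<le> t"
  defines "C \<equiv> nu_mass 1 * (1 + H_sup 1)"
  shows "fint \<mu> \<phi> * surv_rate * (1 - H_sup s) - exp (- lam * s) * (\<integral>\<eta>. exp (- lam * t) * excess (C * exp (lam * t) * fint \<eta> \<phi>) \<partial>Q s \<mu>)
    \<le> exp (- lam * (s + t)) * surv (s + t) \<mu>"
proof -
  have C0: "0 \<le> C" unfolding C_def using nu_mass_nonneg[of 1] H_sup_nonneg[of 1] by simp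
  have t0: "0 < t" using t by simp
  \<comment> \<open>\<open>C\<close> comes from \<open>v_upper\<close> with one unit of time spent
    on the mean semigroup; \<open>2 \<le> t\<close> leaves at least one unit, where
    \<open>nu_mass\<close> is at most \<open>nu_mass 1\<close>.\<close>
  have vt: "v t x \<le> C * exp (lam * t) * \<phi> x" for x
  proof -
    have "v t x \<le> exp (lam * t) * \<phi> x * nu_mass (t - 1) * (1 + H_sup 1)" using v_upper[of 1 "t - 1" x] t by simp
    also have "\<dots> \<le> exp (lam * t) * \<phi> x * nu_mass 1 * (1 + H_sup 1)"
      using t phi_pos[of x] H_sup_nonneg[of 1] nu_mass_antimono[of 1 "t - 1"] by (intro mult_right_mono mult_left_mono) auto
    finally show ?thesis by (simp add: C_def mult_ac)
  qed
  have fv: "fint \<eta> (v t) \<le> C * exp (lam * t) * fint \<eta> \<phi>" for \<eta>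
  proof -
    have "fint \<eta> (v t) \<le> fint \<eta> (\<lambda>x. (C * exp (lam * t)) * \<phi> x)"
      unfolding fint_def
      by (intro integral_mono integrable_mult_right integrable_meas_bB bpB_D(1) v_bpB phi_bpB t0 vt)
    then show ?thesis by (simp add: fint_cmult)
  qed
  have m1 [measurable]: "(\<lambda>\<eta>. fint \<eta> \<phi>) \<in> borel_measurable borel" "(\<lambda>\<eta>. fint \<eta> (v t)) \<in> borel_measurable borel"
    by (intro fint_bpB_measurable phi_bpB v_bpB t0)+
  have ie: "integrable (Q s \<mu>) (\<lambda>\<eta>. excess (C * exp (lam * t) * fint \<eta> \<phi>))"
  proof (rule Bochner_Integration.integrable_bound)
    show "integrable (Q s \<mu>) (\<lambda>\<eta>. C * exp (lam * t) * fint \<eta> \<phi>)" using s by (intro integrable_mult_right mean phi_bpB) auto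
    show "AE \<eta> in Q s \<mu>. norm (excess (C * exp (lam * t) * fint \<eta> \<phi>)) \<le> norm (C * exp (lam * t) * fint \<eta> \<phi>)"
      using C0 fint_bpB_nonneg[OF phi_bpB] excess_le_self excess_nonneg by (intro AE_I2) simp
  qed (use s in simp)
  have "surv (s + t) \<mu> = (\<integral>\<eta>. 1 - exp (- fint \<eta> (v t)) \<partial>Q s \<mu>)"
    using s t0 surv_add[of s t \<mu>] by (simp add: surv_v)
  also have "\<dots> \<ge> (\<integral>\<eta>. fint \<eta> (v t) - excess (C * exp (lam * t) * fint \<eta> \<phi>) \<partial>Q s \<mu>)"
  proof (rule integral_mono)
    show "integrable (Q s \<mu>) (\<lambda>\<eta>. fint \<eta> (v t) - excess (C * exp (lam * t) * fint \<eta> \<phi>))"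
      using s by (intro Bochner_Integration.integrable_diff ie mean v_bpB t0) auto
    show "integrable (Q s \<mu>) (\<lambda>\<eta>. 1 - exp (- fint \<eta> (v t)))"
      using s t0 fint_bpB_nonneg[OF v_bpB[OF t0]] by (intro Q_integrable[where C=1]) auto
    show "fint \<eta> (v t) - excess (C * exp (lam * t) * fint \<eta> \<phi>) \<le> 1 - exp (- fint \<eta> (v t))" for \<eta>
      using excess_mono[OF fint_bpB_nonneg[OF v_bpB[OF t0], of \<eta>] fv[of \<eta>]] by (simp add: excess_def)
  qed
  finally have 1: "(\<integral>\<eta>. fint \<eta> (v t) - excess (C * exp (lam * t) * fint \<eta> \<phi>) \<partial>Q s \<mu>) \<le> surv (s + t) \<mu>" .
  have "(\<integral>\<eta>. fint \<eta> (v t) - excess (C * exp (lam * t) * fint \<eta> \<phi>) \<partial>Q s \<mu>) = fint \<mu> (T s (v t)) - (\<integral>\<eta>. excess (C * exp (lam * t) * fint \<eta> \<phi>) \<partial>Q s \<mu>)"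
    using s t0 ie by (subst Bochner_Integration.integral_diff) (auto simp: mean v_bpB)
  with 1 have 2: "exp (- lam * (s + t)) * (fint \<mu> (T s (v t)) - (\<integral>\<eta>. excess (C * exp (lam * t) * fint \<eta> \<phi>) \<partial>Q s \<mu>)) \<le> exp (- lam * (s + t)) * surv (s + t) \<mu>"
    by (intro mult_left_mono) auto
  have "fint \<mu> (\<lambda>x. (exp (lam * s) * fint \<nu> (v t) * (1 - H_sup s)) * \<phi> x) \<le> fint \<mu> (T s (v t))"
    unfolding fint_def
  proof (intro integral_mono integrable_mult_right integrable_meas_bB bpB_D(1) T_bpB phi_bpB v_bpB t0)
    show "exp (lam * s) * (\<integral>x. v t x \<partial>meas \<nu>) * (1 - H_sup s) * \<phi> x \<le> T s (v t) x" for x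
      using T_asymp(2)[OF s(1) v_bpB[OF t0], of x] by (simp add: fint_def mult_ac)
  qed (use s in auto)
  then have "exp (lam * s) * fint \<nu> (v t) * (1 - H_sup s) * fint \<mu> \<phi> \<le> fint \<mu> (T s (v t))" by (simp only: fint_cmult)
  then have "exp (- lam * (s + t)) * (exp (lam * s) * fint \<nu> (v t) * (1 - H_sup s) * fint \<mu> \<phi>) \<le> exp (- lam * (s + t)) * fint \<mu> (T s (v t))"
    by (intro mult_left_mono) auto
  also have "exp (- lam * (s + t)) * (exp (lam * s) * fint \<nu> (v t) * (1 - H_sup s) * fint \<mu> \<phi>) = nu_mass t * ((1 - H_sup s) * fint \<mu> \<phi>)"
  proof -
    have "exp (- lam * (s + t)) * exp (lam * s) * exp (lam * t) = 1" by (simp add: exp_add[symmetric] algebra_simps)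
    then have "exp (- lam * (s + t)) * exp (lam * s) * exp (lam * t) * (nu_mass t * ((1 - H_sup s) * fint \<mu> \<phi>)) = nu_mass t * ((1 - H_sup s) * fint \<mu> \<phi>)" by simp
    then show ?thesis unfolding nu_v by (simp only: mult_ac)
  qed
  finally have 3: "nu_mass t * ((1 - H_sup s) * fint \<mu> \<phi>) \<le> exp (- lam * (s + t)) * fint \<mu> (T s (v t))" .
  have "surv_rate * ((1 - H_sup s) * fint \<mu> \<phi>) \<le> nu_mass t * ((1 - H_sup s) * fint \<mu> \<phi>)"
    using s fint_bpB_nonneg[OF phi_bpB, of \<mu>] surv_rate_le[OF t0] by (intro mult_right_mono) auto
  moreover have 5: "exp (- lam * s) * (\<integral>\<eta>. exp (- lam * t) * excess (C * exp (lam * t) * fint \<eta> \<phi>) \<partial>Q s \<mu>) = exp (- lam * (s + t)) * (\<integral>\<eta>. excess (C * exp (lam * t) * fint \<eta> \<phi>) \<partial>Q s \<mu>)"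
  proof -
    have "exp (- lam * (s + t)) = exp (- lam * s) * exp (- lam * t)" by (simp add: exp_add[symmetric] algebra_simps)
    then show ?thesis by (simp only: integral_mult_right_zero mult.assoc)
  qed
  moreover have "fint \<mu> \<phi> * surv_rate * (1 - H_sup s) = surv_rate * ((1 - H_sup s) * fint \<mu> \<phi>)" by (simp only: mult_ac)
  moreover note 2[unfolded right_diff_distrib] 3
  ultimately show ?thesis by linarith
qed

text \<open>For the upper bound both halves of the time tend to infinity. For the lower bound
  \<open>s\<close> is chosen first, large enough for the error of the mean semigroup, and only then
  \<open>t\<close> grows, because the correction in \<open>surv_lower\<close> vanishes at fixed
  \<open>s\<close>.\<close>

theorem surv_asymp: "((\<lambda>t. exp (- lam * t) * surv t \<mu>) \<longlongrightarrow> surv_rate * fint \<mu> \<phi>) at_top"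
proof (rule order_tendstoI)
  fix l assume l: "surv_rate * fint \<mu> \<phi> < l"
  have "((\<lambda>t. fint \<mu> \<phi> * nu_mass (t / 2) * (1 + H_sup (t / 2))) \<longlongrightarrow> fint \<mu> \<phi> * surv_rate * (1 + 0)) at_top"
    by (intro tendsto_intros filterlim_compose[OF nu_mass_tendsto half_at_top] filterlim_compose[OF H_sup_tendsto half_at_top])
  then have "\<forall>\<^sub>F t in at_top. fint \<mu> \<phi> * nu_mass (t / 2) * (1 + H_sup (t / 2)) < l"
    using l by (intro order_tendstoD) (auto simp: mult.commute)
  then show "\<forall>\<^sub>F t in at_top. exp (- lam * t) * surv t \<mu> < l"
    using eventually_gt_at_top[of 0]
  proof eventually_elim
    case (elim t)
    have "exp (- lam * t) * surv t \<mu> \<le> exp (- lam * t) * (exp (lam * t) * fint \<mu> \<phi> * nu_mass (t / 2) * (1 + H_sup (t / 2)))"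
      using surv_upper[of "t / 2" "t / 2" \<mu>] elim by (intro mult_left_mono) auto
    also have "\<dots> = fint \<mu> \<phi> * nu_mass (t / 2) * (1 + H_sup (t / 2))" by (simp add: exp_minus)
    finally show ?case using elim by simp
  qed
next
  fix l assume l: "l < surv_rate * fint \<mu> \<phi>"
  have "((\<lambda>s. fint \<mu> \<phi> * surv_rate * (1 - H_sup s)) \<longlongrightarrow> fint \<mu> \<phi> * surv_rate * (1 - 0)) at_top"
    by (intro tendsto_intros H_sup_tendsto)
  then have "\<forall>\<^sub>F s in at_top. l < fint \<mu> \<phi> * surv_rate * (1 - H_sup s)"
    using l by (intro order_tendstoD) (auto simp: mult.commute)
  moreover have "\<forall>\<^sub>F s in at_top. H_sup s < 1" using H_sup_tendsto by (rule order_tendstoD) simp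
  ultimately have "\<forall>\<^sub>F s in at_top. l < fint \<mu> \<phi> * surv_rate * (1 - H_sup s) \<and> H_sup s < 1 \<and> 0 < s"
    using eventually_gt_at_top[of 0] by eventually_elim simp
  then obtain s where s: "l < fint \<mu> \<phi> * surv_rate * (1 - H_sup s)" "H_sup s < 1" "0 < s"
    using eventually_happens'[OF trivial_limit_at_top_linorder] by blast
  define C where "C = nu_mass 1 * (1 + H_sup 1)"
  have C0: "0 \<le> C" unfolding C_def using nu_mass_nonneg[of 1] H_sup_nonneg[of 1] by simp
  define R where "R t = (\<integral>\<eta>. exp (- lam * t) * excess (C * exp (lam * t) * fint \<eta> \<phi>) \<partial>Q s \<mu>)" for t
  have "((\<lambda>t. fint \<mu> \<phi> * surv_rate * (1 - H_sup s) - exp (- lam * s) * R t) \<longlongrightarrow> fint \<mu> \<phi> * surv_rate * (1 - H_sup s) - exp (- lam * s) * 0) at_top"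
    unfolding R_def using s C0 by (intro tendsto_intros excess_small) auto
  then have "\<forall>\<^sub>F t in at_top. l < fint \<mu> \<phi> * surv_rate * (1 - H_sup s) - exp (- lam * s) * R t"
    using s by (intro order_tendstoD) auto
  then have "\<forall>\<^sub>F t in at_top. l < exp (- lam * (s + t)) * surv (s + t) \<mu>"
    using eventually_ge_at_top[of 2]
  proof eventually_elim
    case (elim t)
    then show ?case using surv_lower[of s t \<mu>] s unfolding C_def R_def by simp
  qed
  then obtain N where N: "\<And>t. N \<le> t \<Longrightarrow> l < exp (- lam * (s + t)) * surv (s + t) \<mu>"
    unfolding eventually_at_top_linorder by blast
  show "\<forall>\<^sub>F t in at_top. l < exp (- lam * t) * surv t \<mu>"
    using eventually_ge_at_top[of "s + N"] by eventually_elim (use N[of "t - s" for t] in force)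
qed

lemma V_le_v: "0 < t \<Longrightarrow> f \<in> bpB \<Longrightarrow> V t f x \<le> v t x"
  using surv_le_laplace[of t f "dirac x"] by (simp add: surv_v fint_dirac V_measurable v_bpB bB_measurable bpB_D(1))

end

section \<open>The \<open>L log L\<close> condition\<close>

text \<open>This sum over unit time steps replaces the time integral of the nonlinear part of the branching
  mechanism along the decay \<open>\<rho>^n\<close>; its growth in \<open>z\<close> is logarithmic.\<close>

definition log_sum :: "real \<Rightarrow> real \<Rightarrow> real"
  where "log_sum \<rho> z = (\<Sum>n. min 1 (\<rho> ^ n * z))"

text \<open>The terms are at most 1 up to an index near \<open>ln z / (- ln \<rho>)\<close>, where
  \<open>\<rho> ^ n * z\<close> drops below 1; from there on a geometric series takes over.\<close>

lemma log_sum: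
  assumes \<rho>: "0 < \<rho>" "\<rho> < 1" and z: "0 \<le> z"
  shows "summable (\<lambda>n. min 1 (\<rho> ^ n * z))" "0 \<le> log_sum \<rho> z" "log_sum \<rho> z \<le> z / (1 - \<rho>)"
    and "1 \<le> z \<Longrightarrow> log_sum \<rho> z \<le> ln z / (- ln \<rho>) + 1 + 1 / (1 - \<rho>)"
proof -
  have gs: "(\<lambda>n. \<rho> ^ n * c) sums (c / (1 - \<rho>))" for c
    using sums_mult2[OF geometric_sums, of \<rho> c] \<rho> by simp
  show s: "summable (\<lambda>n. min 1 (\<rho> ^ n * z))"
    by (rule summable_comparison_test'[OF sums_summable[OF gs[of z]], of 0]) (use \<rho> z in auto)
  show "0 \<le> log_sum \<rho> z" unfolding log_sum_def by (intro suminf_nonneg s) (use \<rho> z in auto)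
  show "log_sum \<rho> z \<le> z / (1 - \<rho>)"
    unfolding log_sum_def sums_unique[OF gs[of z]] by (intro suminf_le s sums_summable[OF gs]) auto
  assume z1: "1 \<le> z"
  define N where "N = nat \<lceil>ln z / (- ln \<rho>)\<rceil>"
  have l0: "0 < - ln \<rho>" using \<rho> by (simp add: ln_less_zero)
  have r0: "0 \<le> ln z / (- ln \<rho>)" using z1 l0 by (intro divide_nonneg_pos) auto
  have N1: "real N \<le> ln z / (- ln \<rho>) + 1" "ln z / (- ln \<rho>) \<le> real N" using r0 unfolding N_def by linarith+
  have "ln z \<le> real N * (- ln \<rho>)" using N1(2) unfolding pos_divide_le_eq[OF l0] .
  then have "real N * ln \<rho> + ln z \<le> 0" by simp
  then have "ln (\<rho> ^ N * z) \<le> 0" using \<rho> z1 by (simp add: ln_mult ln_realpow)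
  then have Nz: "\<rho> ^ N * z \<le> 1" using \<rho> z1 by (simp add: ln_le_zero_iff)
  have "log_sum \<rho> z = (\<Sum>n. min 1 (\<rho> ^ (n + N) * z)) + (\<Sum>n<N. min 1 (\<rho> ^ n * z))"
    unfolding log_sum_def by (rule suminf_split_initial_segment[OF s])
  also have "(\<Sum>n. min 1 (\<rho> ^ (n + N) * z)) \<le> (\<Sum>n. \<rho> ^ n * 1)"
  proof (rule suminf_le)
    show "min 1 (\<rho> ^ (n + N) * z) \<le> \<rho> ^ n * 1" for n
    proof -
      have "\<rho> ^ (n + N) * z = \<rho> ^ n * (\<rho> ^ N * z)" by (simp add: power_add)
      also have "\<dots> \<le> \<rho> ^ n * 1" using \<rho> Nz by (intro mult_left_mono) auto
      finally show ?thesis by simp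
    qed
    show "summable (\<lambda>n. min 1 (\<rho> ^ (n + N) * z))" using s by (subst summable_iff_shift)
    show "summable (\<lambda>n. \<rho> ^ n * 1)" by (rule sums_summable[OF gs])
  qed
  also have "(\<Sum>n. \<rho> ^ n * 1) = 1 / (1 - \<rho>)" using sums_unique[OF gs[of 1]] by simp
  also have "(\<Sum>n<N. min 1 (\<rho> ^ n * z)) \<le> real N" using sum_bounded_above[of "{..<N}" "\<lambda>n. min 1 (\<rho> ^ n * z)" 1] by simp
  finally show "log_sum \<rho> z \<le> ln z / (- ln \<rho>) + 1 + 1 / (1 - \<rho>)" using N1(1) by simp
qed

lemma log_sum_mono: "0 < \<rho> \<Longrightarrow> \<rho> < 1 \<Longrightarrow> 0 \<le> y \<Longrightarrow> y \<le> z \<Longrightarrow> log_sum \<rho> y \<le> log_sum \<rho> z"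
  unfolding log_sum_def by (intro suminf_le log_sum min.mono mult_left_mono) auto

lemma log_sum_measurable [measurable]: "log_sum \<rho> \<in> borel_measurable borel"
  unfolding log_sum_def[abs_def] by measurable

text \<open>For small \<open>z\<close> the geometric bound yields \<open>z\<^sup>2\<close>, for
  large \<open>z\<close> the logarithm appears. The two terms on the right are those controlled by
  the bound on the Levy kernel and by the L log L condition.\<close>

lemma log_sum_growth:
  assumes \<rho>: "0 < \<rho>" "\<rho> < 1"
  shows "\<exists>c\<ge>0. \<forall>z\<ge>0. z * log_sum \<rho> z \<le> c * (min z (z\<^sup>2) + z * max (ln z) 0)"
proof -
  have l0: "0 < - ln \<rho>" using \<rho> by (simp add: ln_less_zero)
  \<comment> \<open>The sum of the constants from both ranges of \<open>z\<close>, so that it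
    dominates each of them.\<close>
  define c where "c = 1 / (- ln \<rho>) + 1 + 1 / (1 - \<rho>)"
  have c0: "0 \<le> c" "1 / (- ln \<rho>) \<le> c" "1 + 1 / (1 - \<rho>) \<le> c" "1 / (1 - \<rho>) \<le> c"
  proof -
    have "0 < 1 / (- ln \<rho>)" "0 < 1 / (1 - \<rho>)" using l0 \<rho> by (intro divide_pos_pos; simp)+
    then show "0 \<le> c" "1 / (- ln \<rho>) \<le> c" "1 + 1 / (1 - \<rho>) \<le> c" "1 / (1 - \<rho>) \<le> c" unfolding c_def by linarith+
  qed
  have "z * log_sum \<rho> z \<le> c * (min z (z\<^sup>2) + z * max (ln z) 0)" if z: "0 \<le> z" for z
  proof (cases "z \<le> 1")
    case True
    then have m: "min z (z\<^sup>2) = z\<^sup>2" using z by (intro min_absorb2) (simp add: power2_eq_square mult_left_le)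
    have "z * log_sum \<rho> z \<le> z * (z / (1 - \<rho>))" using log_sum(3)[OF \<rho> z] z by (intro mult_left_mono)
    also have "\<dots> = 1 / (1 - \<rho>) * z\<^sup>2" by (simp add: power2_eq_square)
    also have "\<dots> \<le> c * z\<^sup>2" using c0 by (intro mult_right_mono) auto
    also have "\<dots> \<le> c * (min z (z\<^sup>2) + z * max (ln z) 0)" unfolding m using c0 z by (intro mult_left_mono) auto
    finally show ?thesis .
  next
    case False
    then have z1: "1 \<le> z" by simp
    then have m: "min z (z\<^sup>2) = z" "max (ln z) 0 = ln z" by (auto simp: power2_eq_square min_def max_def)
    have "log_sum \<rho> z \<le> 1 / (- ln \<rho>) * ln z + (1 + 1 / (1 - \<rho>))" using log_sum(4)[OF \<rho> z z1] by simp
    also have "\<dots> \<le> c * ln z + c" using c0 z1 by (intro add_mono mult_right_mono) auto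
    finally have "z * log_sum \<rho> z \<le> z * (c * ln z + c)" using z by (intro mult_left_mono)
    then show ?thesis unfolding m by (simp add: algebra_simps)
  qed
  then show ?thesis using c0(1) by blast
qed

text \<open>The Levy measures may be infinite near 0, while the argument for parametric integrals
  uses subprobability kernels. Weighting by \<open>min u (u\<^sup>2) / C\<close> produces such a
  kernel, and dividing the integrand by the weight undoes the change.\<close>

lemma (in branching_data) nn_integral_pi_joint_measurable:
  fixes f :: "'e \<Rightarrow> real \<Rightarrow> ennreal"
  assumes f [measurable]: "(\<lambda>(x, u). f x u) \<in> borel_measurable (borel \<Otimes>\<^sub>M borel)"
  shows "(\<lambda>x. \<integral>\<^sup>+u. f x u \<partial>\<pi> x) \<in> borel_measurable borel"
proof -
  let ?R = "restrict_space borel {0::real<..}"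
  obtain C0 where C0: "0 \<le> C0" "\<And>x. (\<integral>\<^sup>+u. ennreal (min u (u\<^sup>2)) \<partial>\<pi> x) \<le> ennreal C0" using levy_bound by blast
  \<comment> \<open>Adding 1 makes the normalizing constant positive.\<close>
  define C where "C = C0 + 1"
  have C: "0 < C" "\<And>x. (\<integral>\<^sup>+u. ennreal (min u (u\<^sup>2)) \<partial>\<pi> x) \<le> ennreal C"
    using C0 unfolding C_def by (auto intro: order_trans[OF C0(2)] ennreal_leI)
  define m where "m u = min u (u\<^sup>2) / C" for u :: real
  have mm [measurable]: "m \<in> borel_measurable borel" unfolding m_def[abs_def] by measurable
  have mm': "(\<lambda>u. ennreal (m u)) \<in> borel_measurable (\<pi> x)" for x by (intro measurable_pi) measurable
  define \<kappa> where "\<kappa> x = density (\<pi> x) (\<lambda>u. ennreal (m u))" for x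
  have k: "\<kappa> \<in> borel \<rightarrow>\<^sub>M subprob_algebra ?R"
  proof (rule measurable_subprob_algebra)
    show "sets (\<kappa> x) = sets ?R" for x by (simp add: \<kappa>_def sets_pi)
    show "subprob_space (\<kappa> x)" for x
    proof (rule subprob_spaceI)
      have "emeasure (\<kappa> x) (space (\<kappa> x)) = (\<integral>\<^sup>+u. ennreal (m u) \<partial>\<pi> x)"
        unfolding \<kappa>_def using mm' by (subst emeasure_density) (auto intro!: nn_integral_cong)
      also have "\<dots> = (\<integral>\<^sup>+u. ennreal (1 / C) * ennreal (min u (u\<^sup>2)) \<partial>\<pi> x)"
        using C(1) by (intro nn_integral_cong) (simp add: m_def space_pi ennreal_mult[symmetric])
      also have "\<dots> = ennreal (1 / C) * (\<integral>\<^sup>+u. ennreal (min u (u\<^sup>2)) \<partial>\<pi> x)"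
        by (intro nn_integral_cmult measurable_pi) measurable
      also have "\<dots> \<le> ennreal (1 / C) * ennreal C" by (intro mult_left_mono C(2)) simp
      also have "\<dots> = 1" using C(1) by (simp add: ennreal_mult[symmetric])
      finally show "emeasure (\<kappa> x) (space (\<kappa> x)) \<le> 1" .
      show "space (\<kappa> x) \<noteq> {}" by (simp add: \<kappa>_def space_pi)
    qed
    fix A assume A: "A \<in> sets ?R"
    have "emeasure (\<kappa> x) A = (\<integral>\<^sup>+u. ennreal (m u) * indicator A u \<partial>\<pi> x)" for x
      unfolding \<kappa>_def using mm' A by (subst emeasure_density) (auto simp: sets_pi)
    moreover have "(\<lambda>x. \<integral>\<^sup>+u. ennreal (m u) * indicator A u \<partial>\<pi> x) \<in> borel_measurable borel"
      using A by (intro nn_integral_pi_measurable borel_measurable_times_ennreal borel_measurable_indicator)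
        (auto intro: measurable_restrict_space1)
    ultimately show "(\<lambda>x. emeasure (\<kappa> x) A) \<in> borel_measurable borel" by simp
  qed
  have id: "(\<lambda>z. (fst z, snd z)) \<in> (borel \<Otimes>\<^sub>M ?R) \<rightarrow>\<^sub>M (borel \<Otimes>\<^sub>M (borel :: real measure))"
    by (intro measurable_Pair measurable_fst measurable_compose[OF measurable_snd measurable_restrict_space1]) simp
  have "(\<lambda>z. (\<lambda>(x, u). f x u / ennreal (m u)) (fst z, snd z)) \<in> borel_measurable (borel \<Otimes>\<^sub>M ?R)"
    by (rule measurable_compose[OF id]) measurable
  then have "(\<lambda>x. \<integral>\<^sup>+u. f x u / ennreal (m u) \<partial>\<kappa> x) \<in> borel_measurable borel"
    by (intro nn_integral_measurable_subprob_algebra2[OF _ k]) (simp add: case_prod_unfold)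
  moreover have "(\<integral>\<^sup>+u. f x u / ennreal (m u) \<partial>\<kappa> x) = (\<integral>\<^sup>+u. f x u \<partial>\<pi> x)" for x
  proof -
    have fx [measurable]: "f x \<in> borel_measurable borel" using measurable_compose[OF measurable_Pair1' f, of x] by simp
    have "(\<lambda>u. f x u / ennreal (m u)) \<in> borel_measurable (\<pi> x)" by (intro measurable_pi) measurable
    then have "(\<integral>\<^sup>+u. f x u / ennreal (m u) \<partial>\<kappa> x) = (\<integral>\<^sup>+u. ennreal (m u) * (f x u / ennreal (m u)) \<partial>\<pi> x)"
      unfolding \<kappa>_def using mm' by (intro nn_integral_density) auto
    also have "\<dots> = (\<integral>\<^sup>+u. f x u \<partial>\<pi> x)"
    proof (rule nn_integral_cong)
      fix u assume "u \<in> space (\<pi> x)"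
      then have "0 < m u" using C(1) by (simp add: space_pi m_def)
      then show "ennreal (m u) * (f x u / ennreal (m u)) = f x u"
        using mult_divide_eq_ennreal[of "ennreal (m u)" "f x u"] by (simp add: ennreal_times_divide mult.commute ennreal_eq_0_iff)
    qed
    finally show ?thesis .
  qed
  ultimately show ?thesis by simp
qed

text \<open>Convexity of the exponential together with the value 0 at \<open>z = 0\<close>; for the
  quadratic term the reason is \<open>c\<^sup>2 \<le> c\<close>.\<close>

lemma (in branching_data) psi0_convex:
  assumes "0 \<le> c" "c \<le> 1" "0 \<le> z"
  shows "psi0 x (c * z) \<le> c * psi0 x z"
proof -
  have ex: "excess (c * y) \<le> c * excess y" for y
  proof -
    have "exp ((1 - c) *\<^sub>R 0 + c *\<^sub>R (- y)) \<le> (1 - c) * exp 0 + c * exp (- y)"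
      using assms by (intro convex_onD[OF exp_convex]) auto
    then show ?thesis by (simp add: excess_def algebra_simps)
  qed
  have "(\<integral>u. excess (c * z * u) \<partial>\<pi> x) \<le> (\<integral>u. c * excess (z * u) \<partial>\<pi> x)"
    using assms ex by (intro integral_mono integrable_mult_right excess_integrable) (auto simp: mult.assoc)
  moreover have "(\<sigma> x)\<^sup>2 * (c * z)\<^sup>2 \<le> c * ((\<sigma> x)\<^sup>2 * z\<^sup>2)"
  proof -
    have "c\<^sup>2 \<le> c" using assms by (simp add: power2_eq_square mult_left_le)
    then have "c\<^sup>2 * ((\<sigma> x)\<^sup>2 * z\<^sup>2) \<le> c * ((\<sigma> x)\<^sup>2 * z\<^sup>2)" by (intro mult_right_mono) auto
    then show ?thesis by (simp add: power_mult_distrib mult_ac)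
  qed
  ultimately show ?thesis unfolding psi0_def by (simp add: distrib_left)
qed


context subcritical_model
begin

definition rho :: real where "rho = exp lam"

lemma rho: "0 < rho" "rho < 1" "exp (lam * real n) = rho ^ n"
  using subcritical by (auto simp: rho_def exp_of_nat_mult[symmetric] mult.commute)

text \<open>Bounds the mass lost through the nonlinear part of the branching mechanism by
  \<open>V t (\<phi> / (m + 1))\<close>, relative to its initial mass.\<close>

definition loss :: "nat \<Rightarrow> ennreal"
  where "loss m = (\<Sum>n. \<integral>\<^sup>+x. ennreal (real (Suc m) / rho ^ n * psi0 x (rho ^ n / real (Suc m) * \<phi> x)) \<partial>meas \<nu>)"

lemma phi_measurable [measurable]: "\<phi> \<in> borel_measurable borel"
  by (rule bB_measurable[OF bpB_D(1)[OF phi_bpB]])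

text \<open>Summation over the time steps inside the integrals bounds the Levy part of the loss by
  the integral of \<open>u * \<phi> x * log_sum rho (u * \<phi> x / Suc m)\<close>, which tends to 0
  in \<open>m\<close>. Dominated convergence is used twice, in \<open>u\<close> and in
  \<open>x\<close>, with the case \<open>m = 0\<close> as majorant; the L log L condition makes it
  integrable.\<close>

lemma loss_tendsto:
  assumes LlogL: "(\<integral>\<^sup>+x. \<integral>\<^sup>+u. ennreal (u * \<phi> x * max (ln (u * \<phi> x)) 0) \<partial>\<pi> x \<partial>meas \<nu>) < \<infinity>"
  shows "loss \<longlonglongrightarrow> 0"
proof -
  obtain b where b: "0 < b" "\<And>x. \<bar>\<phi> x\<bar> \<le> b" using bB_bound[OF bpB_D(1)[OF phi_bpB]] by metis
  obtain S where S: "0 < S" "\<And>x. \<bar>\<sigma> x\<bar> \<le> S" using bB_bound[OF sigma] by metis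
  obtain C0 where C0: "0 \<le> C0" "\<And>x. (\<integral>\<^sup>+u. ennreal (min u (u\<^sup>2)) \<partial>\<pi> x) \<le> ennreal C0" using levy_bound by blast
  obtain c where c: "0 \<le> c" "\<And>z. 0 \<le> z \<Longrightarrow> z * log_sum rho z \<le> c * (min z (z\<^sup>2) + z * max (ln z) 0)"
    using log_sum_growth[OF rho(1,2)] by blast
  define g where "g m x u = u * \<phi> x * log_sum rho (u * \<phi> x / real (Suc m))" for m :: nat and x u
  define G where "G m x = (\<integral>\<^sup>+u. ennreal (g m x u) \<partial>\<pi> x)" for m x
  have gm [measurable]: "(\<lambda>(x, u). ennreal (g m x u)) \<in> borel_measurable (borel \<Otimes>\<^sub>M borel)" for m
    unfolding g_def by measurable
  have Gm [measurable]: "G m \<in> borel_measurable borel" for m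
    unfolding G_def[abs_def] by (rule nn_integral_pi_joint_measurable) measurable
  have gpi: "(\<lambda>u. ennreal (g m x u)) \<in> borel_measurable (\<pi> x)" for m x
    by (intro measurable_pi) (unfold g_def, measurable)
  have g0: "0 \<le> g m x u" if "0 < u" for m x u
    unfolding g_def using that phi_pos[of x] log_sum(2)[OF rho(1,2)] by simp
  have gle: "g m x u \<le> g 0 x u" if "0 < u" for m x u
    unfolding g_def using that phi_pos[of x]
  proof (intro mult_left_mono log_sum_mono rho)
    have "u * \<phi> x / real (Suc m) \<le> u * \<phi> x / 1" using that phi_pos[of x] by (intro divide_left_mono) auto
    then show "u * \<phi> x / real (Suc m) \<le> u * \<phi> x / real (Suc 0)" by simp
  qed (use that phi_pos[of x] in auto)
  have g_lim: "(\<lambda>m. g m x u) \<longlonglongrightarrow> 0" if "0 < u" for x u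
  proof -
    have "g m x u \<le> (u * \<phi> x)\<^sup>2 / (1 - rho) * (1 / real (Suc m))" for m
    proof -
      have "g m x u \<le> u * \<phi> x * (u * \<phi> x / real (Suc m) / (1 - rho))"
        unfolding g_def using that phi_pos[of x] by (intro mult_left_mono log_sum(3) rho) auto
      then show ?thesis by (simp add: power2_eq_square mult_ac)
    qed
    moreover have "(\<lambda>m. (u * \<phi> x)\<^sup>2 / (1 - rho) * (1 / real (Suc m))) \<longlonglongrightarrow> (u * \<phi> x)\<^sup>2 / (1 - rho) * 0"
      by (intro tendsto_intros LIMSEQ_Suc[OF lim_1_over_n])
    ultimately show ?thesis
      using g0[OF that] tendsto_sandwich[of "\<lambda>_. 0" "\<lambda>m. g m x u" sequentially "\<lambda>m. (u * \<phi> x)\<^sup>2 / (1 - rho) * (1 / real (Suc m))" 0] by simp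
  qed
  have G0fin: "(\<integral>\<^sup>+x. G 0 x \<partial>meas \<nu>) < \<infinity>"
  proof -
    \<comment> \<open>This factor pulls the bounded \<open>\<phi> x\<close> out of
      \<open>min z (z\<^sup>2)\<close> at \<open>z = u * \<phi> x\<close>, in either range of
      \<open>u\<close>.\<close>
    define D where "D = max b (b\<^sup>2)"
    have D0: "0 \<le> D" using b by (simp add: D_def le_max_iff_disj)
    define ll where "ll x u = u * \<phi> x * max (ln (u * \<phi> x)) 0" for x u
    have llm: "(\<lambda>(x, u). ennreal (ll x u)) \<in> borel_measurable (borel \<Otimes>\<^sub>M borel)" unfolding ll_def by measurable
    have llpi: "(\<lambda>u. ennreal (ll x u)) \<in> borel_measurable (\<pi> x)" for x
      by (intro measurable_pi) (unfold ll_def, measurable)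
    have le: "g 0 x u \<le> c * D * min u (u\<^sup>2) + c * ll x u" if u: "0 < u" for x u
    proof -
      have z: "0 \<le> u * \<phi> x" using u phi_pos[of x] by simp
      have "min (u * \<phi> x) ((u * \<phi> x)\<^sup>2) \<le> D * min u (u\<^sup>2)"
      proof (cases "u \<le> 1")
        case True
        then have "min u (u\<^sup>2) = u\<^sup>2" using u by (intro min_absorb2) (simp add: power2_eq_square mult_left_le)
        moreover have "(\<phi> x)\<^sup>2 \<le> b\<^sup>2" using b(2)[of x] phi_pos[of x] by (intro power_mono) auto
        then have "(u * \<phi> x)\<^sup>2 \<le> D * u\<^sup>2" unfolding power_mult_distrib D_def mult.commute[of "u\<^sup>2"]
          by (intro mult_right_mono) (auto simp: le_max_iff_disj)
        ultimately show ?thesis by (simp add: min.coboundedI2)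
      next
        case False
        then have "min u (u\<^sup>2) = u" by (intro min_absorb1) (simp add: power2_eq_square)
        moreover have "u * \<phi> x \<le> D * u" unfolding mult.commute[of u] D_def
          using b(2)[of x] u by (intro mult_right_mono) (auto simp: le_max_iff_disj)
        ultimately show ?thesis by (simp add: min.coboundedI1)
      qed
      then have "c * (min (u * \<phi> x) ((u * \<phi> x)\<^sup>2) + ll x u) \<le> c * (D * min u (u\<^sup>2) + ll x u)"
        using c(1) by (intro mult_left_mono add_right_mono)
      moreover have "g 0 x u \<le> c * (min (u * \<phi> x) ((u * \<phi> x)\<^sup>2) + ll x u)"
        using c(2)[OF z] by (simp add: g_def ll_def)
      ultimately show ?thesis by (simp add: distrib_left mult.assoc)
    qed
    have ll0: "0 \<le> ll x u" if "0 < u" for x u using that phi_pos[of x] by (simp add: ll_def)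
    have "G 0 x \<le> ennreal (c * D) * ennreal C0 + ennreal c * (\<integral>\<^sup>+u. ennreal (ll x u) \<partial>\<pi> x)" for x
    proof -
      have mp: "(\<lambda>u. ennreal (min u (u\<^sup>2))) \<in> borel_measurable (\<pi> x)" by (intro measurable_pi) measurable
      have "G 0 x \<le> (\<integral>\<^sup>+u. ennreal (c * D) * ennreal (min u (u\<^sup>2)) + ennreal c * ennreal (ll x u) \<partial>\<pi> x)"
        unfolding G_def
      proof (rule nn_integral_mono)
        fix u assume "u \<in> space (\<pi> x)"
        then have u: "0 < u" by (simp add: space_pi)
        then have "ennreal (g 0 x u) \<le> ennreal (c * D * min u (u\<^sup>2) + c * ll x u)" by (intro ennreal_leI le)
        also have "\<dots> = ennreal (c * D) * ennreal (min u (u\<^sup>2)) + ennreal c * ennreal (ll x u)"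
          using u c(1) D0 ll0[OF u] by (simp add: ennreal_plus ennreal_mult)
        finally show "ennreal (g 0 x u) \<le> ennreal (c * D) * ennreal (min u (u\<^sup>2)) + ennreal c * ennreal (ll x u)" .
      qed
      also have "\<dots> = ennreal (c * D) * (\<integral>\<^sup>+u. ennreal (min u (u\<^sup>2)) \<partial>\<pi> x) + ennreal c * (\<integral>\<^sup>+u. ennreal (ll x u) \<partial>\<pi> x)"
        using mp llpi by (subst nn_integral_add) (auto simp: nn_integral_cmult)
      also have "\<dots> \<le> ennreal (c * D) * ennreal C0 + ennreal c * (\<integral>\<^sup>+u. ennreal (ll x u) \<partial>\<pi> x)"
        by (intro add_right_mono mult_left_mono C0(2)) simp
      finally show ?thesis .
    qed
    then have "(\<integral>\<^sup>+x. G 0 x \<partial>meas \<nu>) \<le> (\<integral>\<^sup>+x. ennreal (c * D) * ennreal C0 + ennreal c * (\<integral>\<^sup>+u. ennreal (ll x u) \<partial>\<pi> x) \<partial>meas \<nu>)"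
      by (intro nn_integral_mono)
    also have "\<dots> = (ennreal (c * D) * ennreal C0) * emeasure (meas \<nu>) UNIV + ennreal c * (\<integral>\<^sup>+x. \<integral>\<^sup>+u. ennreal (ll x u) \<partial>\<pi> x \<partial>meas \<nu>)"
      using nn_integral_pi_joint_measurable[OF llm] by (subst nn_integral_add) (auto simp: nn_integral_cmult)
    also have "\<dots> < \<infinity>"
      using LlogL finite_measure.emeasure_finite[OF finmeas_meas(1), of \<nu> UNIV]
      by (auto simp: ll_def ennreal_mult_eq_top_iff less_top[symmetric])
    finally show ?thesis .
  qed
  have G_lim: "(\<lambda>m. \<integral>\<^sup>+x. G m x \<partial>meas \<nu>) \<longlonglongrightarrow> (\<integral>\<^sup>+x. 0 \<partial>meas \<nu>)"
  proof (rule nn_integral_dominated_convergence[where w="G 0"])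
    show "AE x in meas \<nu>. G m x \<le> G 0 x" for m
      unfolding G_def using gle by (intro AE_I2 nn_integral_mono ennreal_leI) (simp add: space_pi)
    \<comment> \<open>The inner dominated convergence wants a finite majorant \<open>G 0 x\<close>;
      finiteness of its integral provides one for almost every \<open>x\<close>.\<close>
    have "AE x in meas \<nu>. G 0 x \<noteq> \<infinity>" using G0fin by (intro nn_integral_PInf_AE) auto
    then show "AE x in meas \<nu>. (\<lambda>m. G m x) \<longlonglongrightarrow> 0"
    proof eventually_elim
      case (elim x)
      have "(\<lambda>m. \<integral>\<^sup>+u. ennreal (g m x u) \<partial>\<pi> x) \<longlonglongrightarrow> (\<integral>\<^sup>+u. 0 \<partial>\<pi> x)"
      proof (rule nn_integral_dominated_convergence[where w="\<lambda>u. ennreal (g 0 x u)"])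
        show "(\<integral>\<^sup>+u. ennreal (g 0 x u) \<partial>\<pi> x) < \<infinity>" using elim by (simp add: G_def less_top)
        show "AE u in \<pi> x. ennreal (g m x u) \<le> ennreal (g 0 x u)" for m
          using gle by (intro AE_I2 ennreal_leI) (simp add: space_pi)
        show "AE u in \<pi> x. (\<lambda>m. ennreal (g m x u)) \<longlonglongrightarrow> 0"
          using g_lim by (intro AE_I2) (auto simp: space_pi ennreal_0[symmetric] simp del: ennreal_0)
      qed (use gpi in auto)
      then show ?case by (simp add: G_def)
    qed
  qed (use G0fin in auto)
  \<comment> \<open>The contribution of the quadratic term: \<open>\<sigma>\<close> and
    \<open>\<phi>\<close> are bounded, so it is geometric in \<open>n\<close> with ratio
    \<open>rho\<close> and of order \<open>1 / Suc m\<close>.\<close>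
  define A where "A = S\<^sup>2 * b\<^sup>2 / (1 - rho) * measure (meas \<nu>) UNIV"
  have bound: "loss m \<le> ennreal (A * (1 / real (Suc m))) + (\<integral>\<^sup>+x. G m x \<partial>meas \<nu>)" for m
  proof -
    define h where "h n x u = u * \<phi> x * min 1 (rho ^ n * (u * \<phi> x / real (Suc m)))" for n :: nat and x u
    have hm: "(\<lambda>(x, u). ennreal (h n x u)) \<in> borel_measurable (borel \<Otimes>\<^sub>M borel)" for n unfolding h_def by measurable
    have hpi: "(\<lambda>u. ennreal (h n x u)) \<in> borel_measurable (\<pi> x)" for n x by (intro measurable_pi) (unfold h_def, measurable)
    have h0: "0 \<le> h n x u" if "0 < u" for n x u unfolding h_def using that phi_pos[of x] rho(1) by simp
    have tbound: "ennreal (real (Suc m) / rho ^ n * psi0 x (rho ^ n / real (Suc m) * \<phi> x)) \<le>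
        ennreal (S\<^sup>2 * b\<^sup>2 * (1 / real (Suc m)) * rho ^ n) + (\<integral>\<^sup>+u. ennreal (h n x u) \<partial>\<pi> x)" for n x
    proof -
      define k where "k = rho ^ n / real (Suc m)"
      have k0: "0 < k" using rho(1) by (simp add: k_def)
      have kinv: "real (Suc m) / rho ^ n = 1 / k" by (simp add: k_def)
      have z0: "0 \<le> k * \<phi> x" using k0 phi_pos[of x] by simp
      have q: "(\<sigma> x)\<^sup>2 * (\<phi> x)\<^sup>2 \<le> S\<^sup>2 * b\<^sup>2"
        using power_mono[OF S(2)[of x] abs_ge_zero, of 2] power_mono[OF b(2)[of x] abs_ge_zero, of 2] by (intro mult_mono) auto
      have "1 / k * psi0 x (k * \<phi> x) = (\<sigma> x)\<^sup>2 * (\<phi> x)\<^sup>2 * k + 1 / k * (\<integral>u. excess (k * \<phi> x * u) \<partial>\<pi> x)"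
        unfolding psi0_def using k0 by (simp add: distrib_left power_mult_distrib power2_eq_square)
      also have "\<dots> \<le> S\<^sup>2 * b\<^sup>2 * k + 1 / k * (\<integral>u. excess (k * \<phi> x * u) \<partial>\<pi> x)"
        using q k0 by (intro add_right_mono mult_right_mono) auto
      finally have "ennreal (1 / k * psi0 x (k * \<phi> x)) \<le> ennreal (S\<^sup>2 * b\<^sup>2 * k + 1 / k * (\<integral>u. excess (k * \<phi> x * u) \<partial>\<pi> x))"
        by (rule ennreal_leI)
      also have "\<dots> = ennreal (S\<^sup>2 * b\<^sup>2 * k) + ennreal (1 / k) * ennreal (\<integral>u. excess (k * \<phi> x * u) \<partial>\<pi> x)"
      proof -
        have "0 \<le> (\<integral>u. excess (k * \<phi> x * u) \<partial>\<pi> x)" by (intro Bochner_Integration.integral_nonneg excess_nonneg)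
        then show ?thesis using k0 by (subst ennreal_mult[symmetric], simp, simp, intro ennreal_plus) auto
      qed
      also have "ennreal (1 / k) * ennreal (\<integral>u. excess (k * \<phi> x * u) \<partial>\<pi> x) = (\<integral>\<^sup>+u. ennreal (1 / k) * ennreal (excess (k * \<phi> x * u)) \<partial>\<pi> x)"
        unfolding excess_integrable(2)[OF z0, symmetric] by (intro nn_integral_cmult[symmetric] measurable_pi) measurable
      also have "\<dots> \<le> (\<integral>\<^sup>+u. ennreal (h n x u) \<partial>\<pi> x)"
      proof (rule nn_integral_mono)
        fix u assume "u \<in> space (\<pi> x)"
        then have u: "0 < u" by (simp add: space_pi)
        define y where "y = k * \<phi> x * u"
        have y0: "0 \<le> y" using z0 u by (simp add: y_def)
        \<comment> \<open>Both bounds on \<open>excess\<close> in one; the minimum is the origin of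
          the truncation in \<open>log_sum\<close>.\<close>
        have "excess y \<le> y * min 1 y" using excess_le_self[OF y0] excess_le_sq[OF y0] by (simp add: min_def power2_eq_square)
        then have "1 / k * excess y \<le> 1 / k * (y * min 1 y)" using k0 by (intro mult_left_mono) auto
        also have "1 / k * (y * min 1 y) = h n x u"
        proof -
          have "1 / k * y = u * \<phi> x" using k0 by (simp add: y_def)
          moreover have "y = rho ^ n * (u * \<phi> x / real (Suc m))" by (simp add: y_def k_def)
          ultimately show ?thesis unfolding h_def by (metis mult.assoc)
        qed
        finally have "ennreal (1 / k * excess y) \<le> ennreal (h n x u)" by (rule ennreal_leI)
        then show "ennreal (1 / k) * ennreal (excess (k * \<phi> x * u)) \<le> ennreal (h n x u)"
          using k0 by (simp add: y_def ennreal_mult'[symmetric])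
      qed
      finally show ?thesis unfolding kinv k_def by (simp add: mult_ac)
    qed
    have hint: "(\<lambda>x. \<integral>\<^sup>+u. ennreal (h n x u) \<partial>\<pi> x) \<in> borel_measurable borel" for n
      by (rule nn_integral_pi_joint_measurable[OF hm])
    have "loss m \<le> (\<Sum>n. \<integral>\<^sup>+x. ennreal (S\<^sup>2 * b\<^sup>2 * (1 / real (Suc m)) * rho ^ n) + (\<integral>\<^sup>+u. ennreal (h n x u) \<partial>\<pi> x) \<partial>meas \<nu>)"
      unfolding loss_def by (intro suminf_le nn_integral_mono tbound) auto
    also have "\<dots> = (\<Sum>n. (\<integral>\<^sup>+x. ennreal (S\<^sup>2 * b\<^sup>2 * (1 / real (Suc m)) * rho ^ n) \<partial>meas \<nu>) + (\<integral>\<^sup>+x. \<integral>\<^sup>+u. ennreal (h n x u) \<partial>\<pi> x \<partial>meas \<nu>))"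
      using hint by (intro suminf_cong nn_integral_add) auto
    also have "\<dots> = (\<Sum>n. (\<integral>\<^sup>+x. ennreal (S\<^sup>2 * b\<^sup>2 * (1 / real (Suc m)) * rho ^ n) \<partial>meas \<nu>)) + (\<Sum>n. \<integral>\<^sup>+x. \<integral>\<^sup>+u. ennreal (h n x u) \<partial>\<pi> x \<partial>meas \<nu>)"
      by (intro suminf_add[symmetric]) auto
    also have "(\<Sum>n. (\<integral>\<^sup>+x. ennreal (S\<^sup>2 * b\<^sup>2 * (1 / real (Suc m)) * rho ^ n) \<partial>meas \<nu>)) = (\<Sum>n. ennreal (S\<^sup>2 * b\<^sup>2 * (1 / real (Suc m)) * measure (meas \<nu>) UNIV * rho ^ n))"
      using rho(1) by (intro suminf_cong) (simp add: finite_measure.emeasure_eq_measure ennreal_mult[symmetric] mult_ac)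
    also have "\<dots> = ennreal (\<Sum>n. S\<^sup>2 * b\<^sup>2 * (1 / real (Suc m)) * measure (meas \<nu>) UNIV * rho ^ n)"
      using rho by (intro suminf_ennreal2 summable_mult summable_geometric) auto
    also have "(\<Sum>n. S\<^sup>2 * b\<^sup>2 * (1 / real (Suc m)) * measure (meas \<nu>) UNIV * rho ^ n) = A * (1 / real (Suc m))"
      using rho by (subst suminf_mult) (auto simp: suminf_geometric A_def intro!: summable_geometric)
    also have "(\<Sum>n. \<integral>\<^sup>+x. \<integral>\<^sup>+u. ennreal (h n x u) \<partial>\<pi> x \<partial>meas \<nu>) = (\<integral>\<^sup>+x. (\<Sum>n. \<integral>\<^sup>+u. ennreal (h n x u) \<partial>\<pi> x) \<partial>meas \<nu>)"
      using hint by (intro nn_integral_suminf[symmetric]) auto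
    also have "\<dots> = (\<integral>\<^sup>+x. (\<integral>\<^sup>+u. (\<Sum>n. ennreal (h n x u)) \<partial>\<pi> x) \<partial>meas \<nu>)"
      using hpi by (intro nn_integral_cong nn_integral_suminf[symmetric]) auto
    also have "\<dots> = (\<integral>\<^sup>+x. G m x \<partial>meas \<nu>)"
      unfolding G_def
    proof (intro nn_integral_cong)
      fix x u assume "u \<in> space (\<pi> x)"
      then have u: "0 < u" by (simp add: space_pi)
      then have z: "0 \<le> u * \<phi> x / real (Suc m)" using phi_pos[of x] by simp
      have "(\<Sum>n. ennreal (h n x u)) = ennreal (\<Sum>n. h n x u)"
        unfolding h_def using h0[OF u] by (intro suminf_ennreal2 summable_mult log_sum(1) rho z) (simp add: h_def)
      also have "(\<Sum>n. h n x u) = g m x u"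
        unfolding h_def g_def log_sum_def by (intro suminf_mult log_sum(1) rho z)
      finally show "(\<Sum>n. ennreal (h n x u)) = ennreal (g m x u)" .
    qed
    finally show ?thesis .
  qed
  have "(\<lambda>m. ennreal (A * (1 / real (Suc m)))) \<longlonglongrightarrow> ennreal (A * 0)"
    by (intro tendsto_ennrealI tendsto_intros LIMSEQ_Suc[OF lim_1_over_n])
  then have "(\<lambda>m. ennreal (A * (1 / real (Suc m))) + (\<integral>\<^sup>+x. G m x \<partial>meas \<nu>)) \<longlonglongrightarrow> 0 + 0"
    using G_lim by (intro tendsto_add) auto
  then show ?thesis
    using bound tendsto_sandwich[of "\<lambda>_. 0" loss sequentially "\<lambda>m. ennreal (A * (1 / real (Suc m))) + (\<integral>\<^sup>+x. G m x \<partial>meas \<nu>)" 0] by simp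
qed

text \<open>Mass balance under \<open>\<nu>\<close>: the mean mass
  \<open>exp (lam * t) / Suc m\<close> splits into the mass of the cumulant and the mass lost
  through \<open>psi0\<close>. The lost part is at most the proportion \<open>loss m\<close> of the
  whole, for every \<open>t\<close>.\<close>

lemma fint_V_lower:
  assumes t: "0 \<le> t"
  shows "ennreal (exp (lam * t) * (1 / real (Suc m))) \<le> ennreal (fint \<nu> (V t (\<lambda>x. 1 / real (Suc m) * \<phi> x))) + ennreal (exp (lam * t) * (1 / real (Suc m))) * loss m"
proof -
  define \<theta> where "\<theta> = 1 / real (Suc m)"
  have th: "0 < \<theta>" by (simp add: \<theta>_def)
  define f where "f x = \<theta> * \<phi> x" for x
  obtain b where b: "0 < b" "\<And>x. \<bar>\<phi> x\<bar> \<le> b" using bB_bound[OF bpB_D(1)[OF phi_bpB]] by metis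
  have f: "f \<in> bpB"
  proof (rule bpB_I[where B="\<theta> * b"])
    show "f \<in> borel_measurable borel" unfolding f_def[abs_def] by measurable
    show "0 \<le> f x" "f x \<le> \<theta> * b" for x
      using th phi_pos[of x] b(2)[of x] by (auto simp: f_def intro!: mult_left_mono)
  qed
  have Tf: "T s f x = \<theta> * (exp (lam * s) * \<phi> x)" if "0 \<le> s" for s x
    unfolding f_def T_cmult T_phi[OF that] ..
  define q where "q s = (\<lambda>y. psi0 y (V (t - s) f y))" for s
  have qb: "q s \<in> bpB" if "s \<in> {0..t}" for s using that psi0_V_bpB[OF f, of "t - s"] by (simp add: q_def)
  define I where "I x = (\<integral>s. indicator {0..t} s * T s (q s) x \<partial>lborel)" for x
  have Im: "(\<lambda>(s, x). indicator {0..t} s * T s (q s) x) \<in> borel_measurable (borel \<Otimes>\<^sub>M borel)"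
    unfolding q_def by (rule T_psi0_V(1)[OF f t])
  obtain C where C: "\<And>s x. s \<in> {0..t} \<Longrightarrow> \<bar>T s (q s) x\<bar> \<le> C" using T_psi0_V(2)[OF f t] unfolding q_def by blast
  have Im': "(\<lambda>(s, x). indicator {0..t} s * T s (q s) x) \<in> borel_measurable (lborel \<Otimes>\<^sub>M meas \<nu>)"
    using Im by (subst measurable_cong_sets[of _ "borel \<Otimes>\<^sub>M borel" _ borel]) (auto intro!: sets_pair_measure_cong)
  have Ib: "\<bar>(\<lambda>(s, x). indicator {0..t} s * T s (q s) x) (s, x)\<bar> \<le> C * indicator {0..t} s * indicator UNIV x" for s x
    using C[of s x] by (auto simp: indicator_def)
  note F = Fubini_bounded[OF lborel.sigma_finite_measure_axioms finite_measure.sigma_finite_measure[OF finmeas_meas(1)] Im' _ _ _ _ Ib]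
  have FubI: "fint \<nu> I = (\<integral>s. indicator {0..t} s * fint \<nu> (T s (q s)) \<partial>lborel)" and Iint: "integrable (meas \<nu>) I"
    and Fint: "integrable lborel (\<lambda>s. indicator {0..t} s * fint \<nu> (T s (q s)))"
    using F by (auto simp: I_def[abs_def] fint_def emeasure_lborel_Icc_eq finite_measure.emeasure_finite less_top[symmetric])
  have V: "V t f x = T t f x - I x" for x unfolding I_def q_def by (rule V_mean_equation[OF f t])
  have "fint \<nu> (V t f) = fint \<nu> (T t f) - fint \<nu> I"
    unfolding fint_def V
    by (rule Bochner_Integration.integral_diff[OF integrable_meas_bB[OF bpB_D(1)[OF T_bpB[OF t f]]] Iint])
  also have "fint \<nu> (T t f) = exp (lam * t) * \<theta>"
    unfolding nu_T[OF t f] unfolding f_def fint_cmult nu_phi by simp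
  finally have eq: "exp (lam * t) * \<theta> = fint \<nu> (V t f) + fint \<nu> I" by simp
  define J where "J n = (\<integral>\<^sup>+x. ennreal (real (Suc m) / rho ^ n * psi0 x (rho ^ n / real (Suc m) * \<phi> x)) \<partial>meas \<nu>)" for n
  \<comment> \<open>At the remaining time \<open>t - s\<close> the cumulant is below
    \<open>T\<close>, a multiple of \<open>\<phi>\<close>. The decay beyond the integer
    \<open>n\<close> is a factor \<open>e \<le> 1\<close>, which \<open>psi0_convex\<close> pulls
    out; what is left is the summand of \<open>loss\<close> times the total mean mass.\<close>
  have pw: "exp (lam * s) * psi0 x (V (t - s) f x) \<le> exp (lam * t) * \<theta> * (real (Suc m) / rho ^ n * psi0 x (rho ^ n / real (Suc m) * \<phi> x))"
    if s: "s \<in> {0..t}" and n: "real n \<le> t - s" for s n x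
  proof -
    define r where "r = t - s"
    have r: "0 \<le> r" "real n \<le> r" using s n by (auto simp: r_def)
    define e where "e = exp (lam * (r - real n))"
    have e: "0 < e" "e \<le> 1" using r subcritical by (auto simp: e_def mult_nonpos_nonneg)
    have er: "e * rho ^ n = exp (lam * r)" unfolding e_def rho(3)[symmetric] exp_add[symmetric] by (simp add: algebra_simps)
    have "V r f x \<le> T r f x" using r by (intro V_le_T f) auto
    also have "\<dots> = e * (rho ^ n / real (Suc m) * \<phi> x)" using er unfolding Tf[OF r(1)] \<theta>_def by (simp add: mult_ac)
    finally have "psi0 x (V r f x) \<le> psi0 x (e * (rho ^ n / real (Suc m) * \<phi> x))" using r by (intro psi0_mono V_nonneg f) auto
    also have "\<dots> \<le> e * psi0 x (rho ^ n / real (Suc m) * \<phi> x)"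
      using e rho(1) phi_pos[of x] by (intro psi0_convex) auto
    finally have "exp (lam * s) * psi0 x (V r f x) \<le> exp (lam * s) * (e * psi0 x (rho ^ n / real (Suc m) * \<phi> x))" by (intro mult_left_mono) auto
    also have "\<dots> = exp (lam * t) * \<theta> * (real (Suc m) / rho ^ n * psi0 x (rho ^ n / real (Suc m) * \<phi> x))"
    proof -
      have "exp (lam * s) * e * rho ^ n = exp (lam * t)" unfolding mult.assoc er by (simp add: r_def exp_add[symmetric] algebra_simps)
      then have "exp (lam * s) * e = exp (lam * t) * (\<theta> * (real (Suc m) / rho ^ n))" using rho(1) by (simp add: \<theta>_def field_simps)
      then show ?thesis by (simp only: mult.assoc[symmetric])
    qed
    finally show ?thesis by (simp add: r_def)
  qed
  have "ennreal (fint \<nu> I) = (\<integral>\<^sup>+s. ennreal (indicator {0..t} s * fint \<nu> (T s (q s))) \<partial>lborel)"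
    unfolding FubI using qb by (intro nn_integral_eq_integral[symmetric] Fint AE_I2) (auto simp: indicator_def intro!: fint_bpB_nonneg T_bpB)
  \<comment> \<open>The interval \<open>{0..t}\<close> is covered by unit intervals counted
    backwards from \<open>t\<close>, so that the index is the integer part of the remaining time
    \<open>t - s\<close>. Their unit length turns the time integral into the sum in
    \<open>loss\<close>.\<close>
  also have "\<dots> \<le> (\<integral>\<^sup>+s. (\<Sum>n. ennreal (exp (lam * t) * \<theta>) * J n * indicator {t - real n - 1 .. t - real n} s) \<partial>lborel)"
  proof (rule nn_integral_mono)
    fix s
    show "ennreal (indicator {0..t} s * fint \<nu> (T s (q s))) \<le> (\<Sum>n. ennreal (exp (lam * t) * \<theta>) * J n * indicator {t - real n - 1 .. t - real n} s)"
    proof (cases "s \<in> {0..t}")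
      case True
      define n where "n = nat \<lfloor>t - s\<rfloor>"
      have n: "real n \<le> t - s" "t - s \<le> real n + 1" using True unfolding n_def by auto
      have "ennreal (indicator {0..t} s * fint \<nu> (T s (q s))) = ennreal (exp (lam * s) * fint \<nu> (q s))"
        using True nu_T[of s "q s"] qb by simp
      also have "\<dots> = (\<integral>\<^sup>+x. ennreal (exp (lam * s)) * ennreal (q s x) \<partial>meas \<nu>)"
        using True bB_measurable[OF bpB_D(1)[OF qb[OF True]]]
        by (subst nn_integral_cmult) (auto simp: fint_eq_nn[OF qb[OF True], symmetric] ennreal_mult')
      also have "\<dots> \<le> (\<integral>\<^sup>+x. ennreal (exp (lam * t) * \<theta>) * ennreal (real (Suc m) / rho ^ n * psi0 x (rho ^ n / real (Suc m) * \<phi> x)) \<partial>meas \<nu>)"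
        using pw[OF True n(1)] th by (intro nn_integral_mono) (auto simp: q_def ennreal_mult'[symmetric] intro!: ennreal_leI)
      also have "\<dots> = ennreal (exp (lam * t) * \<theta>) * J n"
      proof -
        have "(\<lambda>x. psi0 x (rho ^ n / real (Suc m) * \<phi> x)) \<in> borel_measurable borel"
        proof -
          have pr: "(\<lambda>x. (x, rho ^ n / real (Suc m) * \<phi> x)) \<in> borel \<rightarrow>\<^sub>M (borel \<Otimes>\<^sub>M borel)" by measurable
          have "max 0 (rho ^ n / real (Suc m) * \<phi> x) = rho ^ n / real (Suc m) * \<phi> x" for x
            using rho(1) phi_pos[of x] by (intro max_absorb2) simp
          then show ?thesis using measurable_compose[OF pr psi0_measurable2] by (simp only: split_conv)
        qed
        then show ?thesis unfolding J_def by (intro nn_integral_cmult) simp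
      qed
      also have "\<dots> = ennreal (exp (lam * t) * \<theta>) * J n * indicator {t - real n - 1 .. t - real n} s" using n by simp
      also have "\<dots> \<le> (\<Sum>n. ennreal (exp (lam * t) * \<theta>) * J n * indicator {t - real n - 1 .. t - real n} s)"
      proof -
        define F where "F n = ennreal (exp (lam * t) * \<theta>) * J n * indicator {t - real n - 1 .. t - real n} s" for n
        have "sum F {n} \<le> (\<Sum>n. F n)" by (rule sum_le_suminf) auto
        then have "F n \<le> (\<Sum>n. F n)" by simp
        then show ?thesis unfolding F_def .
      qed
      finally show ?thesis .
    qed simp
  qed
  also have "\<dots> = (\<Sum>n. \<integral>\<^sup>+s. ennreal (exp (lam * t) * \<theta>) * J n * indicator {t - real n - 1 .. t - real n} s \<partial>lborel)"
    by (intro nn_integral_suminf) auto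
  also have "\<dots> = (\<Sum>n. ennreal (exp (lam * t) * \<theta>) * J n)"
    by (intro suminf_cong) (simp add: nn_integral_cmult_indicator)
  also have "\<dots> = ennreal (exp (lam * t) * \<theta>) * loss m"
    unfolding loss_def J_def by (rule ennreal_suminf_cmult)
  finally have "ennreal (fint \<nu> I) \<le> ennreal (exp (lam * t) * \<theta>) * loss m" .
  then have "ennreal (fint \<nu> (V t f)) + ennreal (fint \<nu> I) \<le> ennreal (fint \<nu> (V t f)) + ennreal (exp (lam * t) * \<theta>) * loss m"
    by (rule add_left_mono)
  moreover have "ennreal (exp (lam * t) * \<theta>) \<le> ennreal (fint \<nu> (V t f)) + ennreal (fint \<nu> I)"
    unfolding eq using fint_bpB_nonneg[OF V_bpB[OF f t], of \<nu>]
    by (cases "0 \<le> fint \<nu> I") (auto simp: ennreal_plus ennreal_neg intro!: ennreal_leI)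
  ultimately have "ennreal (exp (lam * t) * \<theta>) \<le> ennreal (fint \<nu> (V t f)) + ennreal (exp (lam * t) * \<theta>) * loss m"
    by (rule order_trans[rotated])
  then show ?thesis unfolding \<theta>_def f_def[abs_def] .
qed

text \<open>An \<open>m\<close> with \<open>loss m < 1 / 2\<close> leaves at least half of the mean
  mass, with the same \<open>m\<close> for all \<open>t\<close>; \<open>V_le_v\<close> transfers
  this lower bound to the extinction exponent.\<close>

theorem surv_rate_pos_LlogL:
  assumes LlogL: "(\<integral>\<^sup>+x. \<integral>\<^sup>+u. ennreal (u * \<phi> x * max (ln (u * \<phi> x)) 0) \<partial>\<pi> x \<partial>meas \<nu>) < \<infinity>"
  shows "0 < surv_rate"
proof -
  have "\<forall>\<^sub>F m in sequentially. loss m < ennreal (1 / 2)"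
  proof (rule order_tendstoD(2)[OF loss_tendsto[OF LlogL]])
    show "(0::ennreal) < ennreal (1 / 2)" by (subst ennreal_less_zero_iff) simp
  qed
  then obtain m where m: "loss m < ennreal (1 / 2)" by (auto simp: eventually_sequentially)
  define \<theta> where "\<theta> = 1 / real (Suc m)"
  define f where "f x = \<theta> * \<phi> x" for x
  have th: "0 < \<theta>" by (simp add: \<theta>_def)
  obtain b where b: "0 < b" "\<And>x. \<bar>\<phi> x\<bar> \<le> b" using bB_bound[OF bpB_D(1)[OF phi_bpB]] by metis
  have f: "f \<in> bpB"
  proof (rule bpB_I[where B="\<theta> * b"])
    show "f \<in> borel_measurable borel" unfolding f_def[abs_def] by measurable
    show "0 \<le> f x" "f x \<le> \<theta> * b" for x
      using th phi_pos[of x] b(2)[of x] by (auto simp: f_def intro!: mult_left_mono)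
  qed
  have "\<theta> / 2 \<le> nu_mass t" if t: "0 < t" for t
  proof -
    have "ennreal (exp (lam * t) * \<theta>) \<le> ennreal (fint \<nu> (V t f)) + ennreal (exp (lam * t) * \<theta>) * loss m"
      using fint_V_lower[of t m] t by (simp add: \<theta>_def f_def[abs_def])
    also have "\<dots> \<le> ennreal (fint \<nu> (V t f)) + ennreal (exp (lam * t) * \<theta>) * ennreal (1 / 2)"
      using m by (intro add_left_mono mult_left_mono) auto
    also have "\<dots> = ennreal (fint \<nu> (V t f) + exp (lam * t) * \<theta> * (1 / 2))"
    proof -
      have "ennreal (fint \<nu> (V t f) + exp (lam * t) * \<theta> * (1 / 2)) = ennreal (fint \<nu> (V t f)) + ennreal (exp (lam * t) * \<theta> * (1 / 2))"
        using th fint_bpB_nonneg[OF V_bpB[OF f], of t \<nu>] t by (intro ennreal_plus) auto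
      moreover have "ennreal (exp (lam * t) * \<theta> * (1 / 2)) = ennreal (exp (lam * t) * \<theta>) * ennreal (1 / 2)"
        using th by (intro ennreal_mult) auto
      ultimately show ?thesis by simp
    qed
    finally have "exp (lam * t) * \<theta> \<le> fint \<nu> (V t f) + exp (lam * t) * \<theta> * (1 / 2)"
      using th fint_bpB_nonneg[OF V_bpB[OF f], of t \<nu>] t by (subst (asm) ennreal_le_iff) auto
    moreover have "fint \<nu> (V t f) \<le> fint \<nu> (v t)"
      using t by (intro fint_mono bpB_D(1) V_bpB v_bpB f V_le_v) auto
    ultimately have "exp (lam * t) * (\<theta> / 2) \<le> exp (lam * t) * nu_mass t" unfolding nu_v by linarith
    then show ?thesis by (rule mult_left_le_imp_le) simp
  qed
  then have "\<theta> / 2 \<le> surv_rate" unfolding surv_rate_def by (intro cINF_greatest) auto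
  then show ?thesis using th by simp
qed

end

section \<open>Conditioned limits\<close>

text \<open>The L log L condition acts on the conditioned limits through positivity of
  \<open>surv_rate\<close>, so that positivity is the assumption recorded here.\<close>

locale yaglom_model = subcritical_model P W L Y \<zeta> \<beta> \<sigma> \<pi> V Q PP lam \<phi> \<nu> H
  for P :: "real \<Rightarrow> 'e::polish_space \<Rightarrow> 'e measure" and W :: "'w measure"
    and L :: "'e \<Rightarrow> 'w measure" and Y :: "real \<Rightarrow> 'w \<Rightarrow> 'e" and \<zeta> :: "'w \<Rightarrow> ereal"
    and \<beta> \<sigma> :: "'e \<Rightarrow> real" and \<pi> :: "'e \<Rightarrow> real measure"
    and V :: "real \<Rightarrow> ('e \<Rightarrow> real) \<Rightarrow> 'e \<Rightarrow> real"
    and Q :: "real \<Rightarrow> 'e finmeas \<Rightarrow> 'e finmeas measure"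
    and PP :: "'e finmeas \<Rightarrow> (real \<Rightarrow> 'e finmeas) measure"
    and lam :: real and \<phi> :: "'e \<Rightarrow> real" and \<nu> :: "'e finmeas" and H :: "real \<Rightarrow> ('e \<Rightarrow> real) \<Rightarrow> 'e \<Rightarrow> real" +
  fixes Q_inf :: "real \<Rightarrow> 'e finmeas measure"
  assumes Q_inf_prob: "\<And>r. 0 \<le> r \<Longrightarrow> prob_space (Q_inf r)"
    and Q_inf_sets: "\<And>r. 0 \<le> r \<Longrightarrow> sets (Q_inf r) = sets borel"
    and Q_inf_limit: "\<And>r \<mu>. 0 \<le> r \<Longrightarrow> \<mu> \<noteq> 0 \<Longrightarrow> weakly_converges (\<lambda>t. conditioned_law PP \<mu> t r) (Q_inf r) at_top"
    and surv_rate_pos: "0 < surv_rate"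
begin

abbreviation "Q0 \<equiv> Q_inf 0"

section \<open>Conditioned means and their domination by the eigenmeasure\<close>

lemma Q0_prob: "prob_space Q0" and sets_Q0 [simp]: "sets Q0 = sets borel"
  using Q_inf_prob Q_inf_sets by auto

lemma space_Q0 [simp]: "space Q0 = UNIV"
  using sets_eq_imp_space_eq[OF sets_Q0] by simp

lemma measurable_Q0 [simp]: "f \<in> measurable Q0 M \<longleftrightarrow> f \<in> measurable borel M"
  by (simp add: measurable_cong_sets[OF sets_Q0 refl])

lemma Q0_integrable:
  fixes F :: "'e finmeas \<Rightarrow> real"
  shows "F \<in> borel_measurable borel \<Longrightarrow> (\<And>\<eta>. \<bar>F \<eta>\<bar> \<le> C) \<Longrightarrow> integrable Q0 F"
  using prob_space.finite_measure[OF Q0_prob] by (intro integrable_bounded[where B=C]) auto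

lemma fint_phi_pos: assumes "\<mu> \<noteq> 0" shows "0 < fint \<mu> \<phi>"
proof (rule ccontr)
  assume "\<not> 0 < fint \<mu> \<phi>"
  then have "fint \<mu> \<phi> = 0" using fint_bpB_nonneg[OF phi_bpB, of \<mu>] by simp
  then have "(\<integral>\<^sup>+x. ennreal (\<phi> x) \<partial>meas \<mu>) = 0" using fint_eq_nn[OF phi_bpB, of \<mu>] by simp
  then have "AE x in meas \<mu>. ennreal (\<phi> x) = 0" by (subst (asm) nn_integral_0_iff_AE) auto
  then have "AE x in meas \<mu>. False"
  proof eventually_elim
    case (elim x)
    then show ?case using phi_pos[of x] by (simp add: ennreal_eq_0_iff)
  qed
  then have "emeasure (meas \<mu>) UNIV = 0" using AE_iff_measurable[of UNIV "meas \<mu>" "\<lambda>_. False"] by simp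
  then show False using assms finmeas_eq_0_iff by blast
qed

lemma surv_ev_pos: assumes "\<mu> \<noteq> 0" shows "\<forall>\<^sub>F t in at_top. surv_rate * fint \<mu> \<phi> / 2 < exp (- lam * t) * surv t \<mu>"
  by (rule order_tendstoD(1)[OF surv_asymp]) (use surv_rate_pos fint_phi_pos[OF assms] in simp)

text \<open>For functionals vanishing at the null measure this is the mean conditioned on survival
  at \<open>t\<close>. Working with \<open>Q t \<mu>\<close> directly also covers unbounded
  functionals such as \<open>fint \<eta> \<phi>\<close>.\<close>

definition cond_mean :: "'e finmeas \<Rightarrow> real \<Rightarrow> ('e finmeas \<Rightarrow> real) \<Rightarrow> real"
  where "cond_mean \<mu> t F = (\<integral>\<eta>. F \<eta> \<partial>Q t \<mu>) / surv t \<mu>"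

lemma surv_0: "surv 0 \<eta> = indicator (- {0}) \<eta>"
  by (simp add: surv_def Q_zero measure_return)

lemma cond_mean_conditioned:
  assumes "0 \<le> t" "0 < surv t \<mu>" "F \<in> borel_measurable borel" "\<And>\<eta>. \<bar>F \<eta>\<bar> \<le> C" "F 0 = 0"
  shows "(\<integral>\<eta>. F \<eta> \<partial>conditioned_law PP \<mu> t 0) = cond_mean \<mu> t F"
proof -
  have eq: "(\<lambda>\<eta>. F \<eta> * surv 0 \<eta>) = F"
  proof
    show "F \<eta> * surv 0 \<eta> = F \<eta>" for \<eta> using assms(5) by (cases "\<eta> = 0") (auto simp: surv_0)
  qed
  have "0 < surv (t + 0) \<mu>" using assms by simp
  from conditioned_integral[OF assms(1) order_refl assms(3,4) this] show ?thesis unfolding eq by (simp add: cond_mean_def)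
qed

lemma surv_pos_ev: assumes "\<mu> \<noteq> 0" shows "\<forall>\<^sub>F t in at_top. 0 < surv t \<mu> \<and> 0 < t"
  using surv_ev_pos[OF assms] eventually_gt_at_top[of 0]
proof eventually_elim
  case (elim t)
  have "0 < surv_rate * fint \<mu> \<phi> / 2" using surv_rate_pos fint_phi_pos[OF assms] by simp
  then have "0 < exp (- lam * t) * surv t \<mu>" using elim by linarith
  then show ?case using elim by (simp add: zero_less_mult_iff)
qed

lemma cond_mean_phi: "0 \<le> t \<Longrightarrow> cond_mean \<mu> t (\<lambda>\<eta>. fint \<eta> \<phi>) = fint \<mu> \<phi> / (exp (- lam * t) * surv t \<mu>)"
proof -
  assume t: "0 \<le> t"
  have "(\<integral>\<eta>. fint \<eta> \<phi> \<partial>Q t \<mu>) = exp (lam * t) * fint \<mu> \<phi>"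
    unfolding mean(2)[OF t phi_bpB] T_phi[OF t] by (simp add: fint_def)
  then show ?thesis by (simp add: cond_mean_def exp_minus field_simps)
qed

lemma cond_mean_phi_tendsto: assumes "\<mu> \<noteq> 0" shows "((\<lambda>t. cond_mean \<mu> t (\<lambda>\<eta>. fint \<eta> \<phi>)) \<longlongrightarrow> 1 / surv_rate) at_top"
proof -
  have "((\<lambda>t. fint \<mu> \<phi> / (exp (- lam * t) * surv t \<mu>)) \<longlongrightarrow> fint \<mu> \<phi> / (surv_rate * fint \<mu> \<phi>)) at_top"
    using surv_rate_pos fint_phi_pos[OF assms] by (intro tendsto_divide tendsto_const surv_asymp) auto
  moreover have "\<forall>\<^sub>F t in at_top. fint \<mu> \<phi> / (exp (- lam * t) * surv t \<mu>) = cond_mean \<mu> t (\<lambda>\<eta>. fint \<eta> \<phi>)"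
    using eventually_ge_at_top[of 0] by eventually_elim (simp add: cond_mean_phi)
  ultimately show ?thesis using fint_phi_pos[OF assms] by (auto elim: Lim_transform_eventually)
qed

text \<open>The constant 4 is 2 * 2: eventually \<open>1 + H_sup t \<le> 2\<close>, and the survival
  probability exceeds half of its asymptotic value. The bound is uniform in \<open>g\<close> because
  \<open>H_sup\<close> is, hence the quantifier over \<open>g\<close> inside the
  eventuality.\<close>

lemma cond_mean_mean_bound:
  assumes mu: "\<mu> \<noteq> 0"
  shows "\<forall>\<^sub>F t in at_top. \<forall>g\<in>bpB. cond_mean \<mu> t (\<lambda>\<eta>. fint \<eta> g) \<le> 4 / surv_rate * fint \<nu> g"
proof -
  have "\<forall>\<^sub>F t in at_top. H_sup t < 1" using H_sup_tendsto by (rule order_tendstoD) simp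
  with surv_ev_pos[OF mu] surv_pos_ev[OF mu] show ?thesis
  proof eventually_elim
    case (elim t)
    show ?case
    proof
      fix g :: "'e \<Rightarrow> real" assume g: "g \<in> bpB"
      have t: "0 < t" using elim by simp
      have "fint \<mu> (T t g) \<le> fint \<mu> (\<lambda>x. (exp (lam * t) * fint \<nu> g * (1 + H_sup t)) * \<phi> x)"
        unfolding fint_def
      proof (intro integral_mono integrable_mult_right integrable_meas_bB bpB_D(1) T_bpB phi_bpB g)
        show "T t g x \<le> exp (lam * t) * (\<integral>x. g x \<partial>meas \<nu>) * (1 + H_sup t) * \<phi> x" for x
          using T_asymp(1)[OF t g, of x] by (simp add: fint_def mult_ac)
      qed (use t in simp)
      also have "\<dots> = exp (lam * t) * fint \<nu> g * (1 + H_sup t) * fint \<mu> \<phi>" by (rule fint_cmult)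
      also have "\<dots> \<le> exp (lam * t) * fint \<nu> g * 2 * fint \<mu> \<phi>"
        using elim fint_bpB_nonneg[OF g] fint_bpB_nonneg[OF phi_bpB] by (intro mult_right_mono mult_left_mono) auto
      finally have 1: "fint \<mu> (T t g) \<le> exp (lam * t) * fint \<nu> g * 2 * fint \<mu> \<phi>" .
      have "exp (lam * t) * (surv_rate * fint \<mu> \<phi> / 2) \<le> exp (lam * t) * (exp (- lam * t) * surv t \<mu>)"
        using elim by (intro mult_left_mono) auto
      moreover have "exp (lam * t) * (exp (- lam * t) * surv t \<mu>) = surv t \<mu>" by (simp add: exp_minus)
      ultimately have 2: "exp (lam * t) * (surv_rate * fint \<mu> \<phi> / 2) \<le> surv t \<mu>" by linarith
      have "exp (lam * t) * fint \<nu> g * 2 * fint \<mu> \<phi> = 4 / surv_rate * fint \<nu> g * (exp (lam * t) * (surv_rate * fint \<mu> \<phi> / 2))"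
        using surv_rate_pos by simp
      also have "\<dots> \<le> 4 / surv_rate * fint \<nu> g * surv t \<mu>"
        using 2 surv_rate_pos fint_bpB_nonneg[OF g, of \<nu>] by (intro mult_left_mono) auto
      finally have "fint \<mu> (T t g) \<le> 4 / surv_rate * fint \<nu> g * surv t \<mu>" using 1 by simp
      then show "cond_mean \<mu> t (\<lambda>\<eta>. fint \<eta> g) \<le> 4 / surv_rate * fint \<nu> g"
        using elim t g by (simp add: cond_mean_def mean(2) divide_le_eq)
    qed
  qed
qed

lemma nu_nonzero: "\<nu> \<noteq> 0"
  using nu_phi by auto

text \<open>\<open>fint \<eta> g\<close> is unbounded, so weak convergence is applied to its
  truncations at \<open>n\<close>, and monotone convergence removes the truncation.\<close>

lemma Q0_mean_bound_continuous:
  assumes g: "continuous_on UNIV g" "bounded (range g)" "g \<in> bpB"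
  shows "(\<integral>\<^sup>+\<eta>. ennreal (fint \<eta> g) \<partial>Q0) \<le> ennreal (4 / surv_rate * fint \<nu> g)"
proof -
  have cont: "continuous_on UNIV (\<lambda>\<eta>. fint \<eta> g)" by (intro continuous_fint g)
  have m: "(\<lambda>\<eta>. fint \<eta> g) \<in> borel_measurable borel" by (intro fint_bpB_measurable g)
  have n0: "0 \<le> fint \<eta> g" for \<eta> by (rule fint_bpB_nonneg[OF g(3)])
  define F where "F n \<eta> = min (real n) (fint \<eta> g)" for n \<eta>
  have Fm: "F n \<in> borel_measurable borel" for n unfolding F_def[abs_def] using m by measurable
  have Fb: "\<bar>F n \<eta>\<bar> \<le> real n" and F0: "0 \<le> F n \<eta>" for n \<eta> using n0[of \<eta>] by (auto simp: F_def)
  have "(\<integral>\<eta>. F n \<eta> \<partial>Q0) \<le> 4 / surv_rate * fint \<nu> g" for n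
  proof (rule tendsto_upperbound)
    have Fc: "continuous_on UNIV (F n)" unfolding F_def by (intro continuous_intros cont)
    have Fbd: "bounded (range (F n))" using Fb by (auto simp: bounded_iff)
    show "((\<lambda>t. \<integral>\<eta>. F n \<eta> \<partial>conditioned_law PP \<nu> t 0) \<longlongrightarrow> (\<integral>\<eta>. F n \<eta> \<partial>Q0)) at_top"
      using Q_inf_limit[OF order_refl nu_nonzero] Fc Fbd unfolding weakly_converges_def by blast
    show "\<forall>\<^sub>F t in at_top. (\<integral>\<eta>. F n \<eta> \<partial>conditioned_law PP \<nu> t 0) \<le> 4 / surv_rate * fint \<nu> g"
      using cond_mean_mean_bound[OF nu_nonzero] surv_pos_ev[OF nu_nonzero]
    proof eventually_elim
      case (elim t)
      then have t: "0 \<le> t" by simp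
      have "(\<integral>\<eta>. F n \<eta> \<partial>conditioned_law PP \<nu> t 0) = cond_mean \<nu> t (F n)"
        by (rule cond_mean_conditioned[OF t _ Fm Fb]) (use elim in \<open>auto simp: F_def\<close>)
      also have "\<dots> \<le> cond_mean \<nu> t (\<lambda>\<eta>. fint \<eta> g)"
        unfolding cond_mean_def
        by (intro divide_right_mono integral_mono Q_integrable[OF t Fm Fb] mean(1)[OF t g(3)])
           (use elim in \<open>auto simp: F_def\<close>)
      also have "\<dots> \<le> 4 / surv_rate * fint \<nu> g" using elim g(3) by blast
      finally show ?case .
    qed
  qed simp
  then have le: "(\<integral>\<^sup>+\<eta>. ennreal (F n \<eta>) \<partial>Q0) \<le> ennreal (4 / surv_rate * fint \<nu> g)" for n
    using F0 by (subst nn_integral_eq_integral[OF Q0_integrable[OF Fm Fb]]) (auto intro!: ennreal_leI)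
  have "(\<lambda>n. \<integral>\<^sup>+\<eta>. ennreal (F n \<eta>) \<partial>Q0) \<longlonglongrightarrow> (\<integral>\<^sup>+\<eta>. ennreal (fint \<eta> g) \<partial>Q0)"
  proof (rule nn_integral_LIMSEQ)
    show "incseq (\<lambda>n \<eta>. ennreal (F n \<eta>))" by (auto simp: incseq_def le_fun_def F_def intro!: ennreal_leI min.mono)
    show "(\<lambda>n. ennreal (F n \<eta>)) \<longlonglongrightarrow> ennreal (fint \<eta> g)" for \<eta>
    proof (intro tendsto_ennrealI tendsto_eventually)
      obtain N where "fint \<eta> g \<le> real N" using real_arch_simple by blast
      then show "\<forall>\<^sub>F n in sequentially. F n \<eta> = fint \<eta> g"
        by (intro eventually_sequentiallyI[of N]) (auto simp: F_def)
    qed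
  qed (use Fm in auto)
  then show ?thesis by (rule LIMSEQ_le_const2) (use le in auto)
qed

text \<open>Open sets are reached from inside by continuous functions, general Borel sets from
  outside by regularity of the finite measure \<open>\<nu>\<close>.\<close>

lemma Q0_mean_bound_set:
  assumes A: "A \<in> sets borel"
  shows "(\<integral>\<^sup>+\<eta>. emeasure (meas \<eta>) A \<partial>Q0) \<le> ennreal (4 / surv_rate) * emeasure (meas \<nu>) A"
proof -
  have op: "(\<integral>\<^sup>+\<eta>. emeasure (meas \<eta>) U \<partial>Q0) \<le> ennreal (4 / surv_rate) * emeasure (meas \<nu>) U" if U: "open U" for U
  proof -
    have ib: "inner_approx U n \<in> bpB" for n
      using inner_approx by (intro bpB_I[where B=1] borel_measurable_continuous_onI) auto
    have lim: "(\<lambda>n. ennreal (fint \<eta> (inner_approx U n))) \<longlonglongrightarrow> emeasure (meas \<eta>) U" for \<eta>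
      using tendsto_ennrealI[OF fint_inner_approx_tendsto[OF U]] by (simp add: finite_measure.emeasure_eq_measure)
    have "(\<lambda>n. \<integral>\<^sup>+\<eta>. ennreal (fint \<eta> (inner_approx U n)) \<partial>Q0) \<longlonglongrightarrow> (\<integral>\<^sup>+\<eta>. emeasure (meas \<eta>) U \<partial>Q0)"
    proof (rule nn_integral_LIMSEQ[OF _ _ lim])
      show "incseq (\<lambda>n \<eta>. ennreal (fint \<eta> (inner_approx U n)))"
        by (auto simp: incseq_def le_fun_def intro!: ennreal_leI fint_mono bpB_D(1) ib inner_approx)
    qed (use fint_bpB_measurable[OF ib] in auto)
    then show ?thesis
    proof (rule LIMSEQ_le_const2)
      have "(\<integral>\<^sup>+\<eta>. ennreal (fint \<eta> (inner_approx U n)) \<partial>Q0) \<le> ennreal (4 / surv_rate) * emeasure (meas \<nu>) U" for n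
      proof -
        have "(\<integral>\<^sup>+\<eta>. ennreal (fint \<eta> (inner_approx U n)) \<partial>Q0) \<le> ennreal (4 / surv_rate * fint \<nu> (inner_approx U n))"
          by (intro Q0_mean_bound_continuous inner_approx inner_approx_bounded ib)
        also have "\<dots> = ennreal (4 / surv_rate) * ennreal (fint \<nu> (inner_approx U n))"
          using surv_rate_pos fint_bpB_nonneg[OF ib, of \<nu> n] by (intro ennreal_mult) auto
        also have "\<dots> \<le> ennreal (4 / surv_rate) * emeasure (meas \<nu>) U"
        proof (rule mult_left_mono)
          have "ennreal (fint \<nu> (inner_approx U n)) = (\<integral>\<^sup>+x. ennreal (inner_approx U n x) \<partial>meas \<nu>)" by (rule fint_eq_nn[OF ib])
          also have "\<dots> \<le> (\<integral>\<^sup>+x. indicator U x \<partial>meas \<nu>)"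
          proof (rule nn_integral_mono)
            show "ennreal (inner_approx U n x) \<le> indicator U x" for x
              using inner_approx_le[of U n x] inner_approx(2,3)[of U n x] by (cases "x \<in> U") (auto simp: ennreal_le_1)
          qed
          also have "\<dots> = emeasure (meas \<nu>) U" using U by simp
          finally show "ennreal (fint \<nu> (inner_approx U n)) \<le> emeasure (meas \<nu>) U" .
        qed simp
        finally show ?thesis .
      qed
      then show "\<exists>N. \<forall>n\<ge>N. (\<integral>\<^sup>+\<eta>. ennreal (fint \<eta> (inner_approx U n)) \<partial>Q0) \<le> ennreal (4 / surv_rate) * emeasure (meas \<nu>) U" by blast
    qed
  qed
  have outer: "emeasure (meas \<nu>) A = (INF U\<in>{U. A \<subseteq> U \<and> open U}. emeasure (meas \<nu>) U)"
    using A finite_measure.emeasure_finite[OF finmeas_meas(1), of \<nu> UNIV] by (intro outer_regular) auto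
  show ?thesis
  proof (rule ennreal_le_epsilon)
    fix e :: real assume e: "0 < e"
    have "\<exists>U\<in>{U. A \<subseteq> U \<and> open U}. emeasure (meas \<nu>) U < emeasure (meas \<nu>) A + ennreal (e * surv_rate / 4)"
      using e surv_rate_pos finite_measure.emeasure_finite[OF finmeas_meas(1), of \<nu> A] by (intro INF_approx_ennreal outer) auto
    then obtain U where U: "A \<subseteq> U" "open U" "emeasure (meas \<nu>) U < emeasure (meas \<nu>) A + ennreal (e * surv_rate / 4)" by blast
    have "(\<integral>\<^sup>+\<eta>. emeasure (meas \<eta>) A \<partial>Q0) \<le> (\<integral>\<^sup>+\<eta>. emeasure (meas \<eta>) U \<partial>Q0)"
      using U by (intro nn_integral_mono emeasure_mono) auto
    also have "\<dots> \<le> ennreal (4 / surv_rate) * emeasure (meas \<nu>) U" by (rule op[OF U(2)])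
    also have "\<dots> \<le> ennreal (4 / surv_rate) * (emeasure (meas \<nu>) A + ennreal (e * surv_rate / 4))" using U(3) by (intro mult_left_mono) auto
    also have "\<dots> = ennreal (4 / surv_rate) * emeasure (meas \<nu>) A + ennreal e"
      using surv_rate_pos e by (simp add: distrib_left ennreal_mult'[symmetric])
    finally show "(\<integral>\<^sup>+\<eta>. emeasure (meas \<eta>) A \<partial>Q0) \<le> ennreal (4 / surv_rate) * emeasure (meas \<nu>) A + ennreal e" .
  qed
qed

lemma Q0_mean_bound_nn:
  assumes "g \<in> borel_measurable borel"
  shows "(\<integral>\<^sup>+\<eta>. (\<integral>\<^sup>+x. g x \<partial>meas \<eta>) \<partial>Q0) \<le> ennreal (4 / surv_rate) * (\<integral>\<^sup>+x. g x \<partial>meas \<nu>)"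
  using assms
proof induction
  case (cong f g)
  then have "f = g" by auto
  then show ?case using cong by simp
next
  case (set A)
  then show ?case using Q0_mean_bound_set[of A] by simp
next
  case (mult u c)
  then show ?case by (simp add: nn_integral_cmult mult.left_commute[of _ c] mult_left_mono)
next
  case (add u v)
  then show ?case by (simp add: nn_integral_add distrib_left add_mono)
next
  case (seq U)
  note inc = \<open>incseq U\<close> and Um = \<open>\<And>i. U i \<in> borel_measurable borel\<close>
  have eq: "(\<integral>\<^sup>+x. (SUP i. U i) x \<partial>meas \<eta>) = (SUP i. \<integral>\<^sup>+x. U i x \<partial>meas \<eta>)" for \<eta>
  proof -
    have "(\<integral>\<^sup>+x. (SUP i. U i) x \<partial>meas \<eta>) = (\<integral>\<^sup>+x. (SUP i. U i x) \<partial>meas \<eta>)" by (simp add: SUP_apply image_comp)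
    also have "\<dots> = (SUP i. \<integral>\<^sup>+x. U i x \<partial>meas \<eta>)"
      using inc Um by (intro nn_integral_monotone_convergence_SUP) auto
    finally show ?thesis .
  qed
  have "(\<integral>\<^sup>+\<eta>. (\<integral>\<^sup>+x. (SUP i. U i) x \<partial>meas \<eta>) \<partial>Q0) = (SUP i. \<integral>\<^sup>+\<eta>. (\<integral>\<^sup>+x. U i x \<partial>meas \<eta>) \<partial>Q0)"
    unfolding eq using inc Um
    by (intro nn_integral_monotone_convergence_SUP) (auto simp: incseq_def le_fun_def intro!: nn_integral_mono)
  also have "\<dots> \<le> (SUP i. ennreal (4 / surv_rate) * (\<integral>\<^sup>+x. U i x \<partial>meas \<nu>))" by (intro SUP_mono) (use seq.IH in auto)
  also have "\<dots> = ennreal (4 / surv_rate) * (\<integral>\<^sup>+x. (SUP i. U i) x \<partial>meas \<nu>)" unfolding eq by (simp add: SUP_mult_left_ennreal)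
  finally show ?case .
qed

lemma Q0_mean:
  assumes g: "g \<in> bpB"
  shows "integrable Q0 (\<lambda>\<eta>. fint \<eta> g)" "(\<integral>\<eta>. fint \<eta> g \<partial>Q0) \<le> 4 / surv_rate * fint \<nu> g"
proof -
  have le: "(\<integral>\<^sup>+\<eta>. ennreal (fint \<eta> g) \<partial>Q0) \<le> ennreal (4 / surv_rate * fint \<nu> g)"
  proof -
    have "ennreal (4 / surv_rate * fint \<nu> g) = ennreal (4 / surv_rate) * ennreal (fint \<nu> g)"
      using surv_rate_pos fint_bpB_nonneg[OF g, of \<nu>] by (intro ennreal_mult) auto
    then show ?thesis
      using Q0_mean_bound_nn[of "\<lambda>x. ennreal (g x)"] bB_measurable[OF bpB_D(1)[OF g]]
      by (simp only: fint_eq_nn[OF g, symmetric] measurable_ennreal measurable_compose[OF _ measurable_ennreal])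
  qed
  show i: "integrable Q0 (\<lambda>\<eta>. fint \<eta> g)"
    using le fint_bpB_measurable[OF g] fint_bpB_nonneg[OF g] by (intro integrableI_nonneg) (auto intro: le_less_trans)
  have "ennreal (\<integral>\<eta>. fint \<eta> g \<partial>Q0) \<le> ennreal (4 / surv_rate * fint \<nu> g)"
    using le fint_bpB_nonneg[OF g] by (subst nn_integral_eq_integral[OF i, symmetric]) auto
  then show "(\<integral>\<eta>. fint \<eta> g \<partial>Q0) \<le> 4 / surv_rate * fint \<nu> g"
    using surv_rate_pos fint_bpB_nonneg[OF g, of \<nu>] by (subst (asm) ennreal_le_iff) auto
qed

text \<open>For \<open>h\<close> in \<open>bpB\<close> these functionals are bounded, vanish at the
  null measure and depend on \<open>h\<close> in a Lipschitz way; by the formula for extinction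
  probabilities \<open>G r\<close> is a multiple of \<open>D (v r)\<close>.\<close>

definition D :: "('e \<Rightarrow> real) \<Rightarrow> 'e finmeas \<Rightarrow> real"
  where "D h \<eta> = 1 - exp (- fint \<eta> h)"

lemma D_bounds: "h \<in> bpB \<Longrightarrow> 0 \<le> D h \<eta>" "h \<in> bpB \<Longrightarrow> D h \<eta> \<le> 1" "h \<in> bpB \<Longrightarrow> D h \<eta> \<le> fint \<eta> h" "D h 0 = 0"
  using fint_bpB_nonneg[of h \<eta>] exp_ge_add_one_self[of "- fint \<eta> h"] by (auto simp: D_def)

lemma D_measurable: "h \<in> bpB \<Longrightarrow> D h \<in> borel_measurable borel"
  unfolding D_def[abs_def] using exp_fint_measurable[of h] by measurable

text \<open>Monotonicity of \<open>excess\<close> is the Lipschitz bound for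
  \<open>exp (- a)\<close> at nonnegative arguments.\<close>

lemma D_diff:
  assumes h: "h \<in> bpB" "g \<in> bpB"
  shows "(\<lambda>x. \<bar>h x - g x\<bar>) \<in> bpB" "\<bar>D h \<eta> - D g \<eta>\<bar> \<le> fint \<eta> (\<lambda>x. \<bar>h x - g x\<bar>)"
proof -
  obtain B where B: "\<And>x. \<bar>h x\<bar> \<le> B" using bB_bound[OF bpB_D(1)[OF h(1)]] by metis
  obtain C where C: "\<And>x. \<bar>g x\<bar> \<le> C" using bB_bound[OF bpB_D(1)[OF h(2)]] by metis
  have [measurable]: "h \<in> borel_measurable borel" "g \<in> borel_measurable borel" using h by (auto intro: bB_measurable bpB_D(1))
  show "(\<lambda>x. \<bar>h x - g x\<bar>) \<in> bpB"
    using B C by (intro bpB_I[where B="B + C"]) (auto intro: order_trans[OF abs_triangle_ineq4] add_mono)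
  have e: "\<bar>exp (- a) - exp (- b)\<bar> \<le> \<bar>a - b\<bar>" if "0 \<le> a" "0 \<le> b" for a b :: real
  proof -
    have *: "exp (- a) - exp (- b) \<le> b - a" if "0 \<le> a" "a \<le> b" for a b :: real
      using excess_mono[OF that] by (simp add: excess_def)
    show ?thesis using *[of a b] *[of b a] that by (cases "a \<le> b") (auto simp: abs_if)
  qed
  have "\<bar>D h \<eta> - D g \<eta>\<bar> \<le> \<bar>fint \<eta> h - fint \<eta> g\<bar>"
    using e[OF fint_bpB_nonneg[OF h(1), of \<eta>] fint_bpB_nonneg[OF h(2), of \<eta>]] by (simp add: D_def abs_minus_commute)
  also have "fint \<eta> h - fint \<eta> g = (\<integral>x. h x - g x \<partial>meas \<eta>)"
    unfolding fint_def by (intro Bochner_Integration.integral_diff[symmetric] integrable_meas_bB bpB_D(1) h)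
  also have "\<bar>\<dots>\<bar> \<le> fint \<eta> (\<lambda>x. \<bar>h x - g x\<bar>)"
    unfolding fint_def using integral_norm_bound[of "meas \<eta>" "\<lambda>x. h x - g x"] by simp
  finally show "\<bar>D h \<eta> - D g \<eta>\<bar> \<le> fint \<eta> (\<lambda>x. \<bar>h x - g x\<bar>)" .
qed

text \<open>Weak convergence only tests continuous functions; the uniform domination of the conditioned mean
  measures by \<open>\<nu>\<close> extends it to functionals of bounded Borel functions on \<open>E\<close>.\<close>

lemma cond_mean_tendsto_Q0:
  assumes mu: "\<mu> \<noteq> 0" and F: "continuous_on UNIV F" "bounded (range F)" and h: "h \<in> bpB"
  shows "((\<lambda>t. cond_mean \<mu> t (\<lambda>\<eta>. F \<eta> * D h \<eta>)) \<longlongrightarrow> (\<integral>\<eta>. F \<eta> * D h \<eta> \<partial>Q0)) at_top"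
proof (rule tendstoI)
  fix e :: real assume e: "0 < e"
  have Fm [measurable]: "F \<in> borel_measurable borel" by (rule borel_measurable_continuous_onI[OF F(1)])
  obtain B0 where B0: "\<And>\<eta>. \<bar>F \<eta>\<bar> \<le> B0" using F(2) by (auto simp: bounded_iff)
  define B where "B = B0 + 1"
  have B: "0 < B" "\<bar>F \<eta>\<bar> \<le> B" for \<eta> using B0[of \<eta>] B0[of 0] by (auto simp: B_def)
  \<comment> \<open>With this choice, replacing \<open>h\<close> by the continuous \<open>g\<close>
    costs less than \<open>e / 3\<close> under \<open>Q0\<close> and less than \<open>e / 3\<close>
    under the conditioned laws; the last third is left for weak convergence with
    \<open>g\<close>.\<close>
  define \<delta> where "\<delta> = e / (3 * B * (4 / surv_rate))"
  have \<delta>: "0 < \<delta>" using e B surv_rate_pos by (simp add: \<delta>_def)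
  obtain g where g: "continuous_on UNIV g" "g \<in> bpB" "bounded (range g)" "fint \<nu> (\<lambda>x. \<bar>h x - g x\<bar>) < \<delta>"
    using bpB_approx_continuous[OF finmeas_meas(1,2) h \<delta>, of \<nu>] by (auto simp: fint_def)
  let ?d = "\<lambda>x. \<bar>h x - g x\<bar>"
  have d: "?d \<in> bpB" by (rule D_diff[OF h g(2)])
  note [measurable] = D_measurable[OF h] D_measurable[OF g(2)]
  have FDb: "\<bar>F \<eta> * D k \<eta>\<bar> \<le> B * 1" if "k \<in> bpB" for k \<eta>
    unfolding abs_mult using B D_bounds(1,2)[OF that] by (intro mult_mono) auto
  have small: "4 / surv_rate * fint \<nu> ?d * B < e / 3"
  proof -
    have "4 / surv_rate * fint \<nu> ?d * B < 4 / surv_rate * \<delta> * B" using g(4) surv_rate_pos B by (intro mult_strict_right_mono mult_strict_left_mono) auto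
    also have "\<dots> = e / 3" using surv_rate_pos B by (simp add: \<delta>_def)
    finally show ?thesis .
  qed
  have diff: "\<bar>F \<eta> * D h \<eta> - F \<eta> * D g \<eta>\<bar> \<le> B * fint \<eta> ?d" for \<eta>
    unfolding right_diff_distrib[symmetric] abs_mult using B D_diff(2)[OF h g(2), of \<eta>] by (intro mult_mono) auto
  have Q0d: "\<bar>(\<integral>\<eta>. F \<eta> * D h \<eta> \<partial>Q0) - (\<integral>\<eta>. F \<eta> * D g \<eta> \<partial>Q0)\<bar> < e / 3"
  proof -
    have i: "integrable Q0 (\<lambda>\<eta>. F \<eta> * D h \<eta>)" "integrable Q0 (\<lambda>\<eta>. F \<eta> * D g \<eta>)"
      using FDb h g by (auto intro!: Q0_integrable[where C="B * 1"])
    have "\<bar>(\<integral>\<eta>. F \<eta> * D h \<eta> \<partial>Q0) - (\<integral>\<eta>. F \<eta> * D g \<eta> \<partial>Q0)\<bar> = \<bar>\<integral>\<eta>. F \<eta> * D h \<eta> - F \<eta> * D g \<eta> \<partial>Q0\<bar>" using i by simp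
    also have "\<dots> \<le> (\<integral>\<eta>. \<bar>F \<eta> * D h \<eta> - F \<eta> * D g \<eta>\<bar> \<partial>Q0)"
      using integral_norm_bound[of Q0 "\<lambda>\<eta>. F \<eta> * D h \<eta> - F \<eta> * D g \<eta>"] by simp
    also have "\<dots> \<le> (\<integral>\<eta>. B * fint \<eta> ?d \<partial>Q0)"
      using i by (intro integral_mono integrable_mult_right Q0_mean d diff) auto
    also have "\<dots> = B * (\<integral>\<eta>. fint \<eta> ?d \<partial>Q0)" by simp
    also have "\<dots> \<le> B * (4 / surv_rate * fint \<nu> ?d)" using Q0_mean(2)[OF d] B by (intro mult_left_mono) auto
    finally show ?thesis using small by (simp add: mult.commute)
  qed
  have "((\<lambda>t. \<integral>\<eta>. F \<eta> * D g \<eta> \<partial>conditioned_law PP \<mu> t 0) \<longlongrightarrow> (\<integral>\<eta>. F \<eta> * D g \<eta> \<partial>Q0)) at_top"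
  proof -
    have "continuous_on UNIV (\<lambda>\<eta>. F \<eta> * D g \<eta>)" unfolding D_def by (intro continuous_intros F continuous_fint g)
    moreover have "bounded (range (\<lambda>\<eta>. F \<eta> * D g \<eta>))" using FDb[OF g(2)] by (auto simp: bounded_iff)
    ultimately show ?thesis using Q_inf_limit[OF order_refl mu] unfolding weakly_converges_def by blast
  qed
  then have "\<forall>\<^sub>F t in at_top. dist (\<integral>\<eta>. F \<eta> * D g \<eta> \<partial>conditioned_law PP \<mu> t 0) (\<integral>\<eta>. F \<eta> * D g \<eta> \<partial>Q0) < e / 3"
    using e by (intro tendstoD) auto
  with cond_mean_mean_bound[OF mu] surv_pos_ev[OF mu]
  show "\<forall>\<^sub>F t in at_top. dist (cond_mean \<mu> t (\<lambda>\<eta>. F \<eta> * D h \<eta>)) (\<integral>\<eta>. F \<eta> * D h \<eta> \<partial>Q0) < e"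
  proof eventually_elim
    case (elim t)
    then have t: "0 \<le> t" and s: "0 < surv t \<mu>" by auto
    have 1: "(\<integral>\<eta>. F \<eta> * D g \<eta> \<partial>conditioned_law PP \<mu> t 0) = cond_mean \<mu> t (\<lambda>\<eta>. F \<eta> * D g \<eta>)"
      by (rule cond_mean_conditioned[OF t s _ FDb[OF g(2)]]) (auto simp: D_bounds)
    have i: "integrable (Q t \<mu>) (\<lambda>\<eta>. F \<eta> * D h \<eta>)" "integrable (Q t \<mu>) (\<lambda>\<eta>. F \<eta> * D g \<eta>)"
      using FDb h g by (auto intro!: Q_integrable[OF t, where C="B * 1"])
    have "\<bar>cond_mean \<mu> t (\<lambda>\<eta>. F \<eta> * D h \<eta>) - cond_mean \<mu> t (\<lambda>\<eta>. F \<eta> * D g \<eta>)\<bar> = \<bar>\<integral>\<eta>. F \<eta> * D h \<eta> - F \<eta> * D g \<eta> \<partial>Q t \<mu>\<bar> / surv t \<mu>"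
      unfolding cond_mean_def using i s by (simp add: diff_divide_distrib[symmetric])
    also have "\<dots> \<le> (\<integral>\<eta>. B * fint \<eta> ?d \<partial>Q t \<mu>) / surv t \<mu>"
    proof (intro divide_right_mono)
      have "\<bar>\<integral>\<eta>. F \<eta> * D h \<eta> - F \<eta> * D g \<eta> \<partial>Q t \<mu>\<bar> \<le> (\<integral>\<eta>. \<bar>F \<eta> * D h \<eta> - F \<eta> * D g \<eta>\<bar> \<partial>Q t \<mu>)"
        using integral_norm_bound[of "Q t \<mu>" "\<lambda>\<eta>. F \<eta> * D h \<eta> - F \<eta> * D g \<eta>"] by simp
      also have "\<dots> \<le> (\<integral>\<eta>. B * fint \<eta> ?d \<partial>Q t \<mu>)"
        using i by (intro integral_mono integrable_mult_right mean t d diff) auto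
      finally show "\<bar>\<integral>\<eta>. F \<eta> * D h \<eta> - F \<eta> * D g \<eta> \<partial>Q t \<mu>\<bar> \<le> (\<integral>\<eta>. B * fint \<eta> ?d \<partial>Q t \<mu>)" .
    qed (use s in simp)
    also have "\<dots> = B * cond_mean \<mu> t (\<lambda>\<eta>. fint \<eta> ?d)" by (simp add: cond_mean_def)
    also have "\<dots> \<le> B * (4 / surv_rate * fint \<nu> ?d)" using elim d B by (intro mult_left_mono) auto
    finally have "\<bar>cond_mean \<mu> t (\<lambda>\<eta>. F \<eta> * D h \<eta>) - cond_mean \<mu> t (\<lambda>\<eta>. F \<eta> * D g \<eta>)\<bar> < e / 3" using small by (simp add: mult.commute)
    then show ?case using elim Q0d unfolding 1 dist_real_def by linarith
  qed
qed

section \<open>The survival density and its limit\<close>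

definition G :: "real \<Rightarrow> 'e finmeas \<Rightarrow> real"
  where "G r \<eta> = exp (- lam * r) * surv r \<eta>"

lemma G_eq: "0 < r \<Longrightarrow> G r \<eta> = exp (- lam * r) * D (v r) \<eta>"
  by (simp add: G_def surv_v D_def)

lemma G_measurable: "0 \<le> r \<Longrightarrow> G r \<in> borel_measurable borel"
  unfolding G_def[abs_def] using surv_measurable[of r] by measurable

lemma G_nonneg: "0 \<le> r \<Longrightarrow> 0 \<le> G r \<eta>"
  by (simp add: G_def surv_bounds)

lemma G_tendsto: "((\<lambda>r. G r \<eta>) \<longlongrightarrow> surv_rate * fint \<eta> \<phi>) at_top"
  unfolding G_def by (rule surv_asymp)

text \<open>The bound is asymptotically sharp: it converges to \<open>surv_rate\<close> itself,
  which the joint limit uses, and not merely to some constant.\<close>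

definition G_bound :: "real \<Rightarrow> real"
  where "G_bound r = nu_mass (r / 2) * (1 + H_sup (r / 2))"

lemma G_le: "0 < r \<Longrightarrow> G r \<eta> \<le> G_bound r * fint \<eta> \<phi>"
proof -
  assume r: "0 < r"
  have "G r \<eta> \<le> exp (- lam * r) * (exp (lam * r) * fint \<eta> \<phi> * nu_mass (r / 2) * (1 + H_sup (r / 2)))"
    unfolding G_def using surv_upper[of "r / 2" "r / 2" \<eta>] r by (intro mult_left_mono) auto
  also have "\<dots> = G_bound r * fint \<eta> \<phi>" by (simp add: exp_minus G_bound_def)
  finally show ?thesis .
qed

lemma G_bound_tendsto: "(G_bound \<longlongrightarrow> surv_rate) at_top"
proof -
  have "((\<lambda>r. nu_mass (r / 2) * (1 + H_sup (r / 2))) \<longlongrightarrow> surv_rate * (1 + 0)) at_top"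
    by (intro tendsto_intros filterlim_compose[OF nu_mass_tendsto half_at_top] filterlim_compose[OF H_sup_tendsto half_at_top])
  then show ?thesis by (simp add: G_bound_def[abs_def])
qed

lemma G_bound_ge: "0 < r \<Longrightarrow> surv_rate \<le> G_bound r"
proof -
  assume r: "0 < r"
  have "surv_rate * 1 \<le> G_bound r" unfolding G_bound_def using surv_rate_le[of "r / 2"] H_sup_nonneg[of "r / 2"] r nu_mass_nonneg[of "r / 2"]
    by (intro mult_mono) auto
  then show ?thesis by simp
qed

lemma G_bound_ev: "\<forall>\<^sub>F r in at_top. 0 < r \<and> (\<forall>\<eta>. \<bar>G r \<eta>\<bar> \<le> (surv_rate + 1) * fint \<eta> \<phi>)"
proof -
  have "\<forall>\<^sub>F r in at_top. G_bound r < surv_rate + 1" using G_bound_tendsto by (rule order_tendstoD) simp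
  then show ?thesis using eventually_gt_at_top[of 0]
  proof eventually_elim
    case (elim r)
    have "\<bar>G r \<eta>\<bar> \<le> (surv_rate + 1) * fint \<eta> \<phi>" for \<eta>
    proof -
      have "G r \<eta> \<le> G_bound r * fint \<eta> \<phi>" using elim by (intro G_le)
      also have "\<dots> \<le> (surv_rate + 1) * fint \<eta> \<phi>" using elim fint_bpB_nonneg[OF phi_bpB] by (intro mult_right_mono) auto
      finally show ?thesis using G_nonneg[of r \<eta>] elim by simp
    qed
    then show ?case using elim by simp
  qed
qed

lemma G_dominated:
  fixes f :: "'e finmeas \<Rightarrow> real"
  assumes M: "sets M = sets borel" and i: "integrable M (\<lambda>\<eta>. fint \<eta> \<phi>)"
    and f: "f \<in> borel_measurable borel" "\<And>\<eta>. \<bar>f \<eta>\<bar> \<le> B"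
  shows "((\<lambda>r. \<integral>\<eta>. f \<eta> * G r \<eta> \<partial>M) \<longlongrightarrow> (\<integral>\<eta>. f \<eta> * (surv_rate * fint \<eta> \<phi>) \<partial>M)) at_top"
proof -
  have mc: "g \<in> borel_measurable M \<longleftrightarrow> g \<in> borel_measurable borel" for g :: "'e finmeas \<Rightarrow> real"
    by (rule measurable_cong_sets[OF M refl, THEN arg_cong[where f="\<lambda>S. g \<in> S"], simplified])
  \<comment> \<open>Dominated convergence along real \<open>r\<close> asks for measurability at
    every \<open>r\<close>; \<open>max 0 r\<close> supplies a value for negative \<open>r\<close>
    and changes nothing for large \<open>r\<close>.\<close>
  have Gm: "(\<lambda>\<eta>. f \<eta> * G (max 0 r) \<eta>) \<in> borel_measurable M" for r
    unfolding mc using f(1) G_measurable[of "max 0 r"] by measurable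
  have "((\<lambda>r. \<integral>\<eta>. f \<eta> * G (max 0 r) \<eta> \<partial>M) \<longlongrightarrow> (\<integral>\<eta>. f \<eta> * (surv_rate * fint \<eta> \<phi>) \<partial>M)) at_top"
  proof (rule integral_dominated_convergence_at_top[where w="\<lambda>\<eta>. B * ((surv_rate + 1) * fint \<eta> \<phi>)"])
    show "integrable M (\<lambda>\<eta>. B * ((surv_rate + 1) * fint \<eta> \<phi>))" by (intro integrable_mult_right i)
    show "\<forall>\<^sub>F r in at_top. AE \<eta> in M. norm (f \<eta> * G (max 0 r) \<eta>) \<le> B * ((surv_rate + 1) * fint \<eta> \<phi>)"
      using G_bound_ev
    proof eventually_elim
      case (elim r)
      have "norm (f \<eta> * G (max 0 r) \<eta>) \<le> B * ((surv_rate + 1) * fint \<eta> \<phi>)" for \<eta>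
        unfolding real_norm_def abs_mult using elim f(2)[of \<eta>] by (intro mult_mono) auto
      then show ?case by simp
    qed
    show "AE \<eta> in M. ((\<lambda>r. f \<eta> * G (max 0 r) \<eta>) \<longlongrightarrow> f \<eta> * (surv_rate * fint \<eta> \<phi>)) at_top"
    proof (rule AE_I2)
      fix \<eta>
      have "\<forall>\<^sub>F r in at_top. G r \<eta> = G (max 0 r) \<eta>" using eventually_ge_at_top[of 0] by eventually_elim simp
      then have "((\<lambda>r. G (max 0 r) \<eta>) \<longlongrightarrow> surv_rate * fint \<eta> \<phi>) at_top" by (rule Lim_transform_eventually[OF G_tendsto])
      then show "((\<lambda>r. f \<eta> * G (max 0 r) \<eta>) \<longlongrightarrow> f \<eta> * (surv_rate * fint \<eta> \<phi>)) at_top" by (intro tendsto_intros)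
    qed
    show "(\<lambda>\<eta>. f \<eta> * (surv_rate * fint \<eta> \<phi>)) \<in> borel_measurable M"
      unfolding mc using f(1) fint_bpB_measurable[OF phi_bpB] by measurable
  qed (rule Gm)
  moreover have "\<forall>\<^sub>F r in at_top. (\<integral>\<eta>. f \<eta> * G (max 0 r) \<eta> \<partial>M) = (\<integral>\<eta>. f \<eta> * G r \<eta> \<partial>M)"
    using eventually_ge_at_top[of 0] by eventually_elim simp
  ultimately show ?thesis by (rule Lim_transform_eventually)
qed

text \<open>Both times are arbitrary functions along a filter, so that the statement serves the
  limit in \<open>t\<close> at fixed \<open>r\<close> as well as the joint limit.\<close>

lemma surv_ratio:
  assumes mu: "\<mu> \<noteq> 0" and ft: "filterlim a at_top F" "filterlim b at_top F"
  shows "((\<lambda>p. exp (- lam * a p) * surv (a p) \<mu> / (exp (- lam * b p) * surv (b p) \<mu>)) \<longlongrightarrow> 1) F"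
proof -
  have "((\<lambda>p. exp (- lam * a p) * surv (a p) \<mu> / (exp (- lam * b p) * surv (b p) \<mu>)) \<longlongrightarrow> (surv_rate * fint \<mu> \<phi>) / (surv_rate * fint \<mu> \<phi>)) F"
    using surv_rate_pos fint_phi_pos[OF mu] by (intro tendsto_divide filterlim_compose[OF surv_asymp] ft) auto
  then show ?thesis using surv_rate_pos fint_phi_pos[OF mu] by simp
qed

lemma cond_mean_G:
  assumes t: "0 \<le> t" "0 \<le> r"
  shows "cond_mean \<mu> t (G r) = exp (- lam * (t + r)) * surv (t + r) \<mu> / (exp (- lam * t) * surv t \<mu>)"
proof -
  have "(\<integral>\<eta>. G r \<eta> \<partial>Q t \<mu>) = exp (- lam * r) * surv (t + r) \<mu>" unfolding G_def surv_add[OF t] by simp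
  moreover have "exp (- lam * (t + r)) = exp (- lam * t) * exp (- lam * r)" by (simp add: exp_add[symmetric] algebra_simps)
  ultimately show ?thesis by (simp add: cond_mean_def)
qed

text \<open>The factor \<open>exp (- lam * r)\<close> cancels in the quotient; with it, numerator
  and denominator each have a limit.\<close>

lemma conditioned_J:
  assumes t: "0 \<le> t" "0 \<le> r" and F: "F \<in> borel_measurable borel" "\<And>\<eta>. \<bar>F \<eta>\<bar> \<le> C"
    and pos: "0 < surv t \<mu>" "0 < surv (t + r) \<mu>"
  shows "(\<integral>\<eta>. F \<eta> \<partial>conditioned_law PP \<mu> t r) = cond_mean \<mu> t (\<lambda>\<eta>. F \<eta> * G r \<eta>) / cond_mean \<mu> t (G r)"
proof -
  have "(\<integral>\<eta>. F \<eta> * G r \<eta> \<partial>Q t \<mu>) = exp (- lam * r) * (\<integral>\<eta>. F \<eta> * surv r \<eta> \<partial>Q t \<mu>)"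
    unfolding G_def by (subst integral_mult_right_zero[symmetric]) (simp add: mult_ac)
  moreover have "(\<integral>\<eta>. G r \<eta> \<partial>Q t \<mu>) = exp (- lam * r) * surv (t + r) \<mu>" unfolding G_def surv_add[OF t] by simp
  ultimately show ?thesis unfolding cond_mean_def conditioned_integral[OF t F pos(2)] using pos by simp
qed

text \<open>The conditioned mean of \<open>G r\<close> is the ratio of the rescaled survival
  probabilities at \<open>t + r\<close> and \<open>t\<close>, which tends to 1, while
  \<open>cond_mean_tendsto_Q0\<close> identifies its limit as the integral under
  \<open>Q0\<close>.\<close>

lemma Q0_G:
  assumes r: "0 < r"
  shows "(\<integral>\<eta>. G r \<eta> \<partial>Q0) = 1"
proof -
  have e: "cond_mean \<nu> t (G r) = exp (- lam * r) * cond_mean \<nu> t (\<lambda>\<eta>. 1 * D (v r) \<eta>)" for t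
    unfolding cond_mean_def G_eq[OF r] by simp
  have "((\<lambda>t. exp (- lam * r) * cond_mean \<nu> t (\<lambda>\<eta>. 1 * D (v r) \<eta>)) \<longlongrightarrow> exp (- lam * r) * (\<integral>\<eta>. 1 * D (v r) \<eta> \<partial>Q0)) at_top"
    by (intro tendsto_intros cond_mean_tendsto_Q0 nu_nonzero v_bpB r) auto
  then have 1: "((\<lambda>t. cond_mean \<nu> t (G r)) \<longlongrightarrow> (\<integral>\<eta>. G r \<eta> \<partial>Q0)) at_top"
    unfolding e by (simp add: G_eq[OF r])
  have "((\<lambda>t. exp (- lam * (t + r)) * surv (t + r) \<nu> / (exp (- lam * t) * surv t \<nu>)) \<longlongrightarrow> 1) at_top"
    using r by (intro surv_ratio nu_nonzero filterlim_ident filterlim_at_top_mono[OF filterlim_ident, of "\<lambda>t. t + r"]) simp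
  moreover have "\<forall>\<^sub>F t in at_top. exp (- lam * (t + r)) * surv (t + r) \<nu> / (exp (- lam * t) * surv t \<nu>) = cond_mean \<nu> t (G r)"
    using eventually_ge_at_top[of 0] by eventually_elim (use r in \<open>simp add: cond_mean_G\<close>)
  ultimately have "((\<lambda>t. cond_mean \<nu> t (G r)) \<longlongrightarrow> 1) at_top" by (rule Lim_transform_eventually)
  then show ?thesis using 1 tendsto_unique[OF trivial_limit_at_top_linorder] by blast
qed

text \<open>The identity \<open>Q0_G\<close> holds for every positive \<open>r\<close>, and
  domination by a multiple of the integrable \<open>fint \<eta> \<phi>\<close> preserves it in the
  limit.\<close>

lemma Q0_phi: "(\<integral>\<eta>. fint \<eta> \<phi> \<partial>Q0) = 1 / surv_rate"
proof -
  have "((\<lambda>r. \<integral>\<eta>. 1 * G r \<eta> \<partial>Q0) \<longlongrightarrow> (\<integral>\<eta>. 1 * (surv_rate * fint \<eta> \<phi>) \<partial>Q0)) at_top"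
    by (rule G_dominated[where B=1]) (auto intro: Q0_mean phi_bpB)
  moreover have "\<forall>\<^sub>F r in at_top. (\<integral>\<eta>. 1 * G r \<eta> \<partial>Q0) = 1"
    using eventually_gt_at_top[of 0] by eventually_elim (simp add: Q0_G)
  ultimately have "((\<lambda>r. 1) \<longlongrightarrow> surv_rate * (\<integral>\<eta>. fint \<eta> \<phi> \<partial>Q0)) (at_top :: real filter)"
    by (auto elim: Lim_transform_eventually)
  then have "surv_rate * (\<integral>\<eta>. fint \<eta> \<phi> \<partial>Q0) = 1"
    using tendsto_unique[OF trivial_limit_at_top_linorder tendsto_const] by metis
  then show ?thesis using surv_rate_pos by (simp add: field_simps)
qed

lemma Q0_phi_nn: "(\<integral>\<^sup>+\<eta>. ennreal (fint \<eta> \<phi>) \<partial>Q0) = ennreal (1 / surv_rate)"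
  unfolding Q0_phi[symmetric]
  using Q0_mean(1)[OF phi_bpB] fint_bpB_nonneg[OF phi_bpB] by (intro nn_integral_eq_integral) auto

section \<open>The limit measure and convergence to it\<close>

definition Qii :: "'e finmeas measure"
  where "Qii = density Q0 (\<lambda>\<eta>. ennreal (surv_rate * fint \<eta> \<phi>))"

lemma Qii_eq: "Qii = density Q0 (\<lambda>\<eta>. ennreal (fint \<eta> \<phi>) / (\<integral>\<^sup>+\<eta>'. ennreal (fint \<eta>' \<phi>) \<partial>Q0))"
proof -
  have "ennreal (fint \<eta> \<phi>) / ennreal (1 / surv_rate) = ennreal (surv_rate * fint \<eta> \<phi>)" for \<eta>
    using surv_rate_pos fint_bpB_nonneg[OF phi_bpB, of \<eta>] by (subst divide_ennreal) (auto simp: mult.commute)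
  then show ?thesis by (simp add: Qii_def Q0_phi_nn)
qed

lemma sets_Qii: "sets Qii = sets borel" by (simp add: Qii_def)

lemma Qii_prob: "prob_space Qii"
proof (rule prob_spaceI)
  have "emeasure Qii (space Qii) = (\<integral>\<^sup>+\<eta>. ennreal (surv_rate * fint \<eta> \<phi>) \<partial>Q0)"
    unfolding Qii_def using fint_bpB_measurable[OF phi_bpB] by (subst emeasure_density) (auto intro!: nn_integral_cong)
  also have "\<dots> = ennreal surv_rate * (\<integral>\<^sup>+\<eta>. ennreal (fint \<eta> \<phi>) \<partial>Q0)"
    using surv_rate_pos fint_bpB_measurable[OF phi_bpB] by (subst nn_integral_cmult[symmetric]) (auto simp: ennreal_mult')
  also have "\<dots> = 1" unfolding Q0_phi_nn using surv_rate_pos by (simp add: ennreal_mult'[symmetric])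
  finally show "emeasure Qii (space Qii) = 1" .
qed

lemma Qii_integral:
  fixes f :: "'e finmeas \<Rightarrow> real"
  assumes "f \<in> borel_measurable borel"
  shows "(\<integral>\<eta>. f \<eta> \<partial>Qii) = (\<integral>\<eta>. f \<eta> * (surv_rate * fint \<eta> \<phi>) \<partial>Q0)"
  unfolding Qii_def using assms surv_rate_pos fint_bpB_nonneg[OF phi_bpB] fint_bpB_measurable[OF phi_bpB]
  by (subst integral_density) (auto simp: mult.commute)

lemma surv_tendsto_Q0:
  assumes "\<mu> \<noteq> 0"
  shows "((\<lambda>t. ennreal (exp (- lam * t)) * emeasure (PP \<mu>) {w \<in> space (PP \<mu>). w t \<noteq> 0}) \<longlongrightarrow>
        ennreal (fint \<mu> \<phi>) / (\<integral>\<^sup>+\<eta>. ennreal (fint \<eta> \<phi>) \<partial>Q0)) at_top"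
proof -
  have "ennreal (fint \<mu> \<phi>) / (\<integral>\<^sup>+\<eta>. ennreal (fint \<eta> \<phi>) \<partial>Q0) = ennreal (surv_rate * fint \<mu> \<phi>)"
    unfolding Q0_phi_nn using surv_rate_pos fint_phi_pos[OF assms] by (subst divide_ennreal) (auto simp: mult.commute)
  moreover have "((\<lambda>t. ennreal (exp (- lam * t) * surv t \<mu>)) \<longlongrightarrow> ennreal (surv_rate * fint \<mu> \<phi>)) at_top"
    by (intro tendsto_ennrealI surv_asymp)
  moreover have "\<forall>\<^sub>F t in at_top. ennreal (exp (- lam * t) * surv t \<mu>) = ennreal (exp (- lam * t)) * emeasure (PP \<mu>) {w \<in> space (PP \<mu>). w t \<noteq> 0}"
    using eventually_ge_at_top[of 0] by eventually_elim (simp add: PP_nonzero ennreal_mult')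
  ultimately show ?thesis by (auto elim: Lim_transform_eventually)
qed

text \<open>The density involves the Borel function \<open>v r\<close>, so
  \<open>cond_mean_tendsto_Q0\<close> is applied to the numerator and to the denominator of the
  conditioned mean. Both measures then integrate bounded continuous functions alike and coincide by
  \<open>finmeas_measure_eqI\<close>.\<close>

lemma Q_inf_density:
  assumes r: "0 < r"
  shows "Q_inf r = density Q0 (\<lambda>\<eta>. ennreal (G r \<eta>))"
proof (rule finmeas_measure_eqI)
  have r0: "0 \<le> r" using r by simp
  have Gb: "\<bar>G r \<eta>\<bar> \<le> exp (- lam * r) * 1" for \<eta>
    unfolding G_def abs_mult using surv_bounds[OF r0, of \<eta>] by (intro mult_mono) auto
  have Gi: "integrable Q0 (G r)" by (rule Q0_integrable[OF G_measurable[OF r0] Gb])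
  show "finite_measure (Q_inf r)" using Q_inf_prob[OF r0] by (rule prob_space.finite_measure)
  show "sets (Q_inf r) = sets borel" by (rule Q_inf_sets[OF r0])
  show "sets (density Q0 (\<lambda>\<eta>. ennreal (G r \<eta>))) = sets borel" by simp
  show "finite_measure (density Q0 (\<lambda>\<eta>. ennreal (G r \<eta>)))"
  proof (rule finite_measureI)
    have "emeasure (density Q0 (\<lambda>\<eta>. ennreal (G r \<eta>))) UNIV = (\<integral>\<^sup>+\<eta>. ennreal (G r \<eta>) \<partial>Q0)"
      using G_measurable[OF r0] by (subst emeasure_density) (auto intro!: nn_integral_cong)
    also have "\<dots> = ennreal (\<integral>\<eta>. G r \<eta> \<partial>Q0)" using G_nonneg[OF r0] by (intro nn_integral_eq_integral Gi) auto
    finally show "emeasure (density Q0 (\<lambda>\<eta>. ennreal (G r \<eta>))) (space (density Q0 (\<lambda>\<eta>. ennreal (G r \<eta>)))) \<noteq> \<infinity>" by simp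
  qed
  fix F :: "'e finmeas \<Rightarrow> real" assume F: "continuous_on UNIV F" "bounded (range F)"
  have Fm: "F \<in> borel_measurable borel" by (rule borel_measurable_continuous_onI[OF F(1)])
  obtain B where B: "\<And>\<eta>. \<bar>F \<eta>\<bar> \<le> B" using F(2) by (auto simp: bounded_iff)
  have 1: "((\<lambda>t. \<integral>\<eta>. F \<eta> \<partial>conditioned_law PP \<nu> t r) \<longlongrightarrow> (\<integral>\<eta>. F \<eta> \<partial>Q_inf r)) at_top"
    using Q_inf_limit[OF r0 nu_nonzero] F unfolding weakly_converges_def by blast
  have e: "cond_mean \<nu> t (\<lambda>\<eta>. F' \<eta> * G r \<eta>) = exp (- lam * r) * cond_mean \<nu> t (\<lambda>\<eta>. F' \<eta> * D (v r) \<eta>)" for t F'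
  proof -
    have "(\<integral>\<eta>. F' \<eta> * G r \<eta> \<partial>Q t \<nu>) = exp (- lam * r) * (\<integral>\<eta>. F' \<eta> * D (v r) \<eta> \<partial>Q t \<nu>)"
      unfolding G_eq[OF r] by (subst integral_mult_right_zero[symmetric]) (simp add: mult_ac)
    then show ?thesis by (simp add: cond_mean_def)
  qed
  have e0: "(\<integral>\<eta>. F' \<eta> * G r \<eta> \<partial>Q0) = exp (- lam * r) * (\<integral>\<eta>. F' \<eta> * D (v r) \<eta> \<partial>Q0)" for F'
    unfolding G_eq[OF r] by (subst integral_mult_right_zero[symmetric]) (simp add: mult_ac)
  have lim: "((\<lambda>t. cond_mean \<nu> t (\<lambda>\<eta>. F' \<eta> * G r \<eta>)) \<longlongrightarrow> (\<integral>\<eta>. F' \<eta> * G r \<eta> \<partial>Q0)) at_top"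
    if "continuous_on UNIV F'" "bounded (range F')" for F'
    unfolding e e0 using that by (intro tendsto_intros cond_mean_tendsto_Q0 nu_nonzero v_bpB r)
  have "((\<lambda>t. cond_mean \<nu> t (\<lambda>\<eta>. F \<eta> * G r \<eta>) / cond_mean \<nu> t (\<lambda>\<eta>. 1 * G r \<eta>)) \<longlongrightarrow> (\<integral>\<eta>. F \<eta> * G r \<eta> \<partial>Q0) / (\<integral>\<eta>. 1 * G r \<eta> \<partial>Q0)) at_top"
    using F Q0_G[OF r] by (intro tendsto_divide lim) auto
  then have "((\<lambda>t. cond_mean \<nu> t (\<lambda>\<eta>. F \<eta> * G r \<eta>) / cond_mean \<nu> t (G r)) \<longlongrightarrow> (\<integral>\<eta>. F \<eta> * G r \<eta> \<partial>Q0)) at_top"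
    by (simp add: Q0_G[OF r])
  moreover have "\<forall>\<^sub>F t in at_top. cond_mean \<nu> t (\<lambda>\<eta>. F \<eta> * G r \<eta>) / cond_mean \<nu> t (G r) = (\<integral>\<eta>. F \<eta> \<partial>conditioned_law PP \<nu> t r)"
  proof -
    have "\<forall>\<^sub>F t in at_top. 0 < surv (t + r) \<nu> \<and> 0 < t + r"
      by (rule eventually_compose_filterlim[OF surv_pos_ev[OF nu_nonzero]])
         (use r in \<open>intro filterlim_at_top_mono[OF filterlim_ident, of "\<lambda>t. t + r"], simp\<close>)
    with surv_pos_ev[OF nu_nonzero] show ?thesis
      by eventually_elim (use conditioned_J[OF _ r0 Fm B] in auto)
  qed
  ultimately have "((\<lambda>t. \<integral>\<eta>. F \<eta> \<partial>conditioned_law PP \<nu> t r) \<longlongrightarrow> (\<integral>\<eta>. F \<eta> * G r \<eta> \<partial>Q0)) at_top"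
    by (rule Lim_transform_eventually)
  then have "(\<integral>\<eta>. F \<eta> \<partial>Q_inf r) = (\<integral>\<eta>. F \<eta> * G r \<eta> \<partial>Q0)"
    using 1 tendsto_unique[OF trivial_limit_at_top_linorder] by blast
  also have "\<dots> = (\<integral>\<eta>. F \<eta> \<partial>density Q0 (\<lambda>\<eta>. ennreal (G r \<eta>)))"
    using Fm G_measurable[OF r0] G_nonneg[OF r0] by (subst integral_density) (auto simp: mult.commute)
  finally show "(\<integral>\<eta>. F \<eta> \<partial>Q_inf r) = (\<integral>\<eta>. F \<eta> \<partial>density Q0 (\<lambda>\<eta>. ennreal (G r \<eta>)))" .
qed

text \<open>The densities with respect to \<open>Q0\<close> converge pointwise under an integrable
  majorant, which gives convergence for every bounded measurable \<open>f\<close>.\<close>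

lemma Q_inf_strong: "strongly_converges Q_inf Qii at_top"
  unfolding strongly_converges_def
proof (intro allI impI)
  fix f :: "'e finmeas \<Rightarrow> real" assume f: "f \<in> borel_measurable borel \<and> bounded (range f)"
  then obtain B where B: "\<And>\<eta>. \<bar>f \<eta>\<bar> \<le> B" by (auto simp: bounded_iff)
  have "((\<lambda>r. \<integral>\<eta>. f \<eta> * G r \<eta> \<partial>Q0) \<longlongrightarrow> (\<integral>\<eta>. f \<eta> * (surv_rate * fint \<eta> \<phi>) \<partial>Q0)) at_top"
    using f B by (intro G_dominated[where B=B] Q0_mean phi_bpB) auto
  moreover have "\<forall>\<^sub>F r in at_top. (\<integral>\<eta>. f \<eta> * G r \<eta> \<partial>Q0) = (\<integral>\<eta>. f \<eta> \<partial>Q_inf r)"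
    using eventually_gt_at_top[of 0]
  proof eventually_elim
    case (elim r)
    then show ?case unfolding Q_inf_density[OF elim]
      using f G_measurable[of r] G_nonneg[of r] by (subst integral_density) (auto simp: mult.commute)
  qed
  ultimately show "((\<lambda>r. \<integral>\<eta>. f \<eta> \<partial>Q_inf r) \<longlongrightarrow> (\<integral>\<eta>. f \<eta> \<partial>Qii)) at_top"
    using f by (simp add: Qii_integral Lim_transform_eventually)
qed

text \<open>\<open>fint \<eta> \<phi>\<close> is approximated from below by the bounded functionals
  \<open>E n\<close>. Its conditioned means converge to its mean under \<open>Q0\<close>, so the
  mean defect of \<open>E n\<close> is small for all large \<open>t\<close> at once: uniform
  integrability obtained from convergence of means.\<close>

lemma cond_mean_phi_continuous_tendsto:
  assumes mu: "\<mu> \<noteq> 0" and F: "continuous_on UNIV F" "bounded (range F)"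
  shows "((\<lambda>t. cond_mean \<mu> t (\<lambda>\<eta>. F \<eta> * fint \<eta> \<phi>)) \<longlongrightarrow> (\<integral>\<eta>. F \<eta> * fint \<eta> \<phi> \<partial>Q0)) at_top"
proof (rule tendstoI)
  fix e :: real assume e: "0 < e"
  have Fm [measurable]: "F \<in> borel_measurable borel" by (rule borel_measurable_continuous_onI[OF F(1)])
  obtain B0 where B0: "\<And>\<eta>. \<bar>F \<eta>\<bar> \<le> B0" using F(2) by (auto simp: bounded_iff)
  define B where "B = B0 + 1"
  have B: "0 < B" "\<bar>F \<eta>\<bar> \<le> B" for \<eta> using B0[of \<eta>] B0[of 0] by (auto simp: B_def)
  have fm [measurable]: "(\<lambda>\<eta>. fint \<eta> \<phi>) \<in> borel_measurable borel" by (rule fint_bpB_measurable[OF phi_bpB])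
  have f0: "0 \<le> fint \<eta> \<phi>" for \<eta> by (rule fint_bpB_nonneg[OF phi_bpB])
  define h where "h n x = 1 / real (Suc n) * \<phi> x" for n x
  have h: "h n \<in> bpB" for n
  proof -
    obtain b where b: "0 < b" "\<And>x. \<bar>\<phi> x\<bar> \<le> b" using bB_bound[OF bpB_D(1)[OF phi_bpB]] by metis
    show ?thesis
    proof (rule bpB_I[where B="1 / real (Suc n) * b"])
      show "h n \<in> borel_measurable borel" unfolding h_def[abs_def] by measurable
      show "0 \<le> h n x" for x using phi_pos[of x] by (simp add: h_def)
      show "h n x \<le> 1 / real (Suc n) * b" for x unfolding h_def using b(2)[of x] by (intro mult_left_mono) auto
    qed
  qed
  define E where "E n \<eta> = real (Suc n) * D (h n) \<eta>" for n \<eta>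
  have Em [measurable]: "E n \<in> borel_measurable borel" for n unfolding E_def[abs_def] using D_measurable[OF h[of n]] by measurable
  have fh: "fint \<eta> (h n) = fint \<eta> \<phi> / real (Suc n)" for \<eta> n
    using fint_cmult[of \<eta> "1 / real (Suc n)" \<phi>] by (simp add: h_def[abs_def])
  have E0: "0 \<le> E n \<eta>" for n \<eta> unfolding E_def using D_bounds(1)[OF h] by simp
  have Eb: "\<bar>E n \<eta>\<bar> \<le> real (Suc n) * 1" for n \<eta> unfolding E_def abs_mult using D_bounds(1,2)[OF h, of n \<eta>] by (intro mult_mono) auto
  have Ele: "E n \<eta> \<le> fint \<eta> \<phi>" for n \<eta>
    using mult_left_mono[OF D_bounds(3)[OF h, of n \<eta>], of "real (Suc n)"] by (simp add: E_def fh)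
  have Elim: "(\<lambda>n. E n \<eta>) \<longlonglongrightarrow> fint \<eta> \<phi>" for \<eta>
  proof -
    define a where "a = fint \<eta> \<phi>"
    have a0: "0 \<le> a" unfolding a_def by (rule f0)
    have "a - a\<^sup>2 * (1 / real (Suc n)) \<le> E n \<eta>" for n
    proof -
      have "excess (a / real (Suc n)) \<le> (a / real (Suc n))\<^sup>2" using a0 by (intro excess_le_sq) simp
      then have "a / real (Suc n) - (a / real (Suc n))\<^sup>2 \<le> 1 - exp (- (a / real (Suc n)))" unfolding excess_def by linarith
      from mult_left_mono[OF this, of "real (Suc n)"]
      show ?thesis unfolding E_def D_def fh a_def[symmetric] by (simp add: right_diff_distrib power2_eq_square)
    qed
    moreover have "(\<lambda>n. a - a\<^sup>2 * (1 / real (Suc n))) \<longlonglongrightarrow> a - a\<^sup>2 * 0"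
      by (intro tendsto_intros LIMSEQ_Suc[OF lim_1_over_n])
    ultimately show ?thesis unfolding a_def[symmetric]
      using Ele[of _ \<eta>] tendsto_sandwich[of "\<lambda>n. a - a\<^sup>2 * (1 / real (Suc n))" "\<lambda>n. E n \<eta>" sequentially "\<lambda>_. a" a]
      by (simp add: a_def)
  qed
  have Q0i: "integrable Q0 (\<lambda>\<eta>. fint \<eta> \<phi>)" by (rule Q0_mean(1)[OF phi_bpB])
  have "(\<lambda>n. \<integral>\<eta>. E n \<eta> \<partial>Q0) \<longlonglongrightarrow> (\<integral>\<eta>. fint \<eta> \<phi> \<partial>Q0)"
    by (rule integral_dominated_convergence[OF _ _ Q0i]) (use Elim Ele E0 in auto)
  \<comment> \<open>The tolerance becomes \<open>e / 4\<close> after multiplication by the bound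
    \<open>B\<close> of \<open>F\<close>. One such part is spent on \<open>Q0\<close>, one on the
    conditioned means, and one on the convergence for \<open>E n\<close>.\<close>
  then have "\<forall>\<^sub>F n in sequentially. 1 / surv_rate - e / (4 * B) < (\<integral>\<eta>. E n \<eta> \<partial>Q0)"
    using e B by (intro order_tendstoD(1)) (auto simp: Q0_phi)
  then obtain n where "1 / surv_rate - e / (4 * B) < (\<integral>\<eta>. E n \<eta> \<partial>Q0)" by (auto simp: eventually_sequentially)
  then have n: "1 / surv_rate - (\<integral>\<eta>. E n \<eta> \<partial>Q0) < e / (4 * B)" by linarith
  have comp: "\<bar>(\<integral>\<eta>. F \<eta> * fint \<eta> \<phi> \<partial>M) - (\<integral>\<eta>. F \<eta> * E n \<eta> \<partial>M)\<bar> \<le> B * ((\<integral>\<eta>. fint \<eta> \<phi> \<partial>M) - (\<integral>\<eta>. E n \<eta> \<partial>M))"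
    if M: "finite_measure M" "sets M = sets borel" and i: "integrable M (\<lambda>\<eta>. fint \<eta> \<phi>)" for M
  proof -
    note M(2)[measurable_cong]
    have i2: "integrable M (E n)" by (rule integrable_bounded[OF M(1) _ Eb]) measurable
    have i3: "integrable M (\<lambda>\<eta>. F \<eta> * k \<eta>)" if "integrable M k" for k
    proof (rule Bochner_Integration.integrable_bound[OF integrable_mult_right[OF that, of B]])
      show "(\<lambda>\<eta>. F \<eta> * k \<eta>) \<in> borel_measurable M" using that by measurable
      show "AE \<eta> in M. norm (F \<eta> * k \<eta>) \<le> norm (B * k \<eta>)"
        using B by (intro AE_I2) (auto simp: abs_mult intro!: mult_right_mono)
    qed
    have "\<bar>(\<integral>\<eta>. F \<eta> * fint \<eta> \<phi> \<partial>M) - (\<integral>\<eta>. F \<eta> * E n \<eta> \<partial>M)\<bar> = \<bar>\<integral>\<eta>. F \<eta> * fint \<eta> \<phi> - F \<eta> * E n \<eta> \<partial>M\<bar>"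
      using i3[OF i] i3[OF i2] by simp
    also have "\<dots> \<le> (\<integral>\<eta>. \<bar>F \<eta> * fint \<eta> \<phi> - F \<eta> * E n \<eta>\<bar> \<partial>M)"
      using integral_norm_bound[of M "\<lambda>\<eta>. F \<eta> * fint \<eta> \<phi> - F \<eta> * E n \<eta>"] by simp
    also have "\<dots> \<le> (\<integral>\<eta>. B * (fint \<eta> \<phi> - E n \<eta>) \<partial>M)"
    proof (rule integral_mono)
      show "integrable M (\<lambda>\<eta>. \<bar>F \<eta> * fint \<eta> \<phi> - F \<eta> * E n \<eta>\<bar>)" using i3[OF i] i3[OF i2] by simp
      show "integrable M (\<lambda>\<eta>. B * (fint \<eta> \<phi> - E n \<eta>))" using i i2 by simp
      show "\<bar>F \<eta> * fint \<eta> \<phi> - F \<eta> * E n \<eta>\<bar> \<le> B * (fint \<eta> \<phi> - E n \<eta>)" for \<eta>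
        unfolding right_diff_distrib[symmetric] abs_mult using B Ele[of n \<eta>] by (intro mult_mono) auto
    qed
    also have "\<dots> = B * ((\<integral>\<eta>. fint \<eta> \<phi> \<partial>M) - (\<integral>\<eta>. E n \<eta> \<partial>M))" using i i2 by simp
    finally show ?thesis .
  qed
  have JE: "cond_mean \<mu> t (\<lambda>\<eta>. F' \<eta> * E n \<eta>) = real (Suc n) * cond_mean \<mu> t (\<lambda>\<eta>. F' \<eta> * D (h n) \<eta>)" for t F'
    unfolding cond_mean_def E_def by (simp only: mult.left_commute[of _ "real (Suc n)"] integral_mult_right_zero times_divide_eq_right)
  have QE: "(\<integral>\<eta>. F' \<eta> * E n \<eta> \<partial>Q0) = real (Suc n) * (\<integral>\<eta>. F' \<eta> * D (h n) \<eta> \<partial>Q0)" for F'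
    unfolding E_def by (simp only: mult.left_commute[of _ "real (Suc n)"] integral_mult_right_zero)
  have limE: "((\<lambda>t. cond_mean \<mu> t (\<lambda>\<eta>. F' \<eta> * E n \<eta>)) \<longlongrightarrow> (\<integral>\<eta>. F' \<eta> * E n \<eta> \<partial>Q0)) at_top"
    if "continuous_on UNIV F'" "bounded (range F')" for F'
    unfolding JE QE using that by (intro tendsto_intros cond_mean_tendsto_Q0 mu h)
  have l1: "\<forall>\<^sub>F t in at_top. dist (cond_mean \<mu> t (\<lambda>\<eta>. F \<eta> * E n \<eta>)) (\<integral>\<eta>. F \<eta> * E n \<eta> \<partial>Q0) < e / 4"
    using limE[OF F] e by (intro tendstoD) auto
  have "((\<lambda>t. cond_mean \<mu> t (\<lambda>\<eta>. fint \<eta> \<phi>) - cond_mean \<mu> t (\<lambda>\<eta>. 1 * E n \<eta>)) \<longlongrightarrow> 1 / surv_rate - (\<integral>\<eta>. 1 * E n \<eta> \<partial>Q0)) at_top"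
    by (intro tendsto_diff cond_mean_phi_tendsto mu limE) auto
  then have l2: "\<forall>\<^sub>F t in at_top. cond_mean \<mu> t (\<lambda>\<eta>. fint \<eta> \<phi>) - cond_mean \<mu> t (\<lambda>\<eta>. 1 * E n \<eta>) < e / (4 * B)"
    using n by (intro order_tendstoD(2)) auto
  have Q0c: "\<bar>(\<integral>\<eta>. F \<eta> * fint \<eta> \<phi> \<partial>Q0) - (\<integral>\<eta>. F \<eta> * E n \<eta> \<partial>Q0)\<bar> < e / 4"
  proof -
    have "B * ((\<integral>\<eta>. fint \<eta> \<phi> \<partial>Q0) - (\<integral>\<eta>. E n \<eta> \<partial>Q0)) < B * (e / (4 * B))"
      using n B unfolding Q0_phi by (intro mult_strict_left_mono) auto
    then show ?thesis using comp[OF prob_space.finite_measure[OF Q0_prob] sets_Q0 Q0i] B by simp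
  qed
  from l1 l2 surv_pos_ev[OF mu]
  show "\<forall>\<^sub>F t in at_top. dist (cond_mean \<mu> t (\<lambda>\<eta>. F \<eta> * fint \<eta> \<phi>)) (\<integral>\<eta>. F \<eta> * fint \<eta> \<phi> \<partial>Q0) < e"
  proof eventually_elim
    case (elim t)
    then have t: "0 \<le> t" and s: "0 < surv t \<mu>" by auto
    have "\<bar>cond_mean \<mu> t (\<lambda>\<eta>. F \<eta> * fint \<eta> \<phi>) - cond_mean \<mu> t (\<lambda>\<eta>. F \<eta> * E n \<eta>)\<bar> = \<bar>(\<integral>\<eta>. F \<eta> * fint \<eta> \<phi> \<partial>Q t \<mu>) - (\<integral>\<eta>. F \<eta> * E n \<eta> \<partial>Q t \<mu>)\<bar> / surv t \<mu>"
      unfolding cond_mean_def using s by (simp add: diff_divide_distrib[symmetric])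
    also have "\<dots> \<le> B * ((\<integral>\<eta>. fint \<eta> \<phi> \<partial>Q t \<mu>) - (\<integral>\<eta>. E n \<eta> \<partial>Q t \<mu>)) / surv t \<mu>"
      using s t by (intro divide_right_mono comp prob_space.finite_measure[OF Q_prob] mean phi_bpB) auto
    also have "\<dots> = B * (cond_mean \<mu> t (\<lambda>\<eta>. fint \<eta> \<phi>) - cond_mean \<mu> t (\<lambda>\<eta>. 1 * E n \<eta>))" by (simp add: cond_mean_def diff_divide_distrib[symmetric])
    also have "\<dots> < B * (e / (4 * B))" using elim B by (intro mult_strict_left_mono) auto
    also have "\<dots> = e / 4" using B by simp
    finally have 1: "\<bar>cond_mean \<mu> t (\<lambda>\<eta>. F \<eta> * fint \<eta> \<phi>) - cond_mean \<mu> t (\<lambda>\<eta>. F \<eta> * E n \<eta>)\<bar> < e / 4" .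
    show ?case using 1 elim(1) Q0c e unfolding dist_real_def by linarith
  qed
qed

text \<open>The strong limit is the transform of \<open>Q t \<mu>\<close> by
  \<open>exp (- lam * t) * fint \<eta> \<phi>\<close>, which is space-time harmonic since
  \<open>\<phi>\<close> is an eigenfunction. The hypothesis supplies convergence; the formula
  follows from uniqueness of the limits of the integrals.\<close>

lemma Q_fin_inf_integral:
  assumes mu: "\<mu> \<noteq> 0" and t: "0 \<le> t"
    and lim: "strongly_converges (\<lambda>r. conditioned_law PP \<mu> t r) R at_top"
    and F: "F \<in> borel_measurable borel" "bounded (range F)"
  shows "(\<integral>\<eta>. F \<eta> \<partial>R) = exp (- lam * t) * (\<integral>\<eta>. F \<eta> * fint \<eta> \<phi> \<partial>Q t \<mu>) / fint \<mu> \<phi>"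
proof -
  obtain B where B: "\<And>\<eta>. \<bar>F \<eta>\<bar> \<le> B" using F(2) by (auto simp: bounded_iff)
  have shift: "filterlim (\<lambda>r. t + r) at_top at_top"
    by (rule filterlim_tendsto_add_at_top[OF tendsto_const filterlim_ident])
  have 1: "((\<lambda>r. \<integral>\<eta>. F \<eta> \<partial>conditioned_law PP \<mu> t r) \<longlongrightarrow> (\<integral>\<eta>. F \<eta> \<partial>R)) at_top"
    using lim F unfolding strongly_converges_def by blast
  have "((\<lambda>r. exp (- lam * t) * (\<integral>\<eta>. F \<eta> * G r \<eta> \<partial>Q t \<mu>) / (exp (- lam * (t + r)) * surv (t + r) \<mu>)) \<longlongrightarrow>
     exp (- lam * t) * (\<integral>\<eta>. F \<eta> * (surv_rate * fint \<eta> \<phi>) \<partial>Q t \<mu>) / (surv_rate * fint \<mu> \<phi>)) at_top"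
    using surv_rate_pos fint_phi_pos[OF mu] t F B
    by (intro tendsto_divide tendsto_mult_left filterlim_compose[OF surv_asymp shift] G_dominated[where B=B] mean phi_bpB) auto
  moreover have "\<forall>\<^sub>F r in at_top. exp (- lam * t) * (\<integral>\<eta>. F \<eta> * G r \<eta> \<partial>Q t \<mu>) / (exp (- lam * (t + r)) * surv (t + r) \<mu>) = (\<integral>\<eta>. F \<eta> \<partial>conditioned_law PP \<mu> t r)"
    using eventually_compose_filterlim[OF surv_pos_ev[OF mu] shift] eventually_ge_at_top[of 0]
  proof eventually_elim
    case (elim r)
    have "(\<integral>\<eta>. F \<eta> * G r \<eta> \<partial>Q t \<mu>) = exp (- lam * r) * (\<integral>\<eta>. F \<eta> * surv r \<eta> \<partial>Q t \<mu>)"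
      unfolding G_def by (subst integral_mult_right_zero[symmetric]) (simp add: mult_ac)
    moreover have "exp (- lam * (t + r)) = exp (- lam * t) * exp (- lam * r)" by (simp add: exp_add[symmetric] algebra_simps)
    ultimately show ?case using conditioned_integral[OF t elim(2) F(1) B] elim by simp
  qed
  ultimately have "((\<lambda>r. \<integral>\<eta>. F \<eta> \<partial>conditioned_law PP \<mu> t r) \<longlongrightarrow> exp (- lam * t) * (\<integral>\<eta>. F \<eta> * (surv_rate * fint \<eta> \<phi>) \<partial>Q t \<mu>) / (surv_rate * fint \<mu> \<phi>)) at_top"
    by (rule Lim_transform_eventually)
  with 1 have "(\<integral>\<eta>. F \<eta> \<partial>R) = exp (- lam * t) * (\<integral>\<eta>. F \<eta> * (surv_rate * fint \<eta> \<phi>) \<partial>Q t \<mu>) / (surv_rate * fint \<mu> \<phi>)"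
    using tendsto_unique[OF trivial_limit_at_top_linorder] by blast
  also have "(\<integral>\<eta>. F \<eta> * (surv_rate * fint \<eta> \<phi>) \<partial>Q t \<mu>) = surv_rate * (\<integral>\<eta>. F \<eta> * fint \<eta> \<phi> \<partial>Q t \<mu>)"
    by (simp only: mult.left_commute[of _ surv_rate] integral_mult_right_zero)
  finally show ?thesis using surv_rate_pos by simp
qed

lemma Q_fin_inf_weak:
  assumes mu: "\<mu> \<noteq> 0"
    and lim: "\<And>t. 0 \<le> t \<Longrightarrow> strongly_converges (\<lambda>r. conditioned_law PP \<mu> t r) (R t) at_top"
  shows "weakly_converges R Qii at_top"
  unfolding weakly_converges_def
proof (intro allI impI)
  fix F :: "'e finmeas \<Rightarrow> real" assume F: "continuous_on UNIV F \<and> bounded (range F)"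
  have Fm: "F \<in> borel_measurable borel" using F by (intro borel_measurable_continuous_onI) simp
  \<comment> \<open>Inserting and cancelling \<open>surv t \<mu>\<close> splits the transform into
    the rescaled survival probability and a conditioned mean, both with known limits.\<close>
  have "((\<lambda>t. exp (- lam * t) * surv t \<mu> / fint \<mu> \<phi> * cond_mean \<mu> t (\<lambda>\<eta>. F \<eta> * fint \<eta> \<phi>)) \<longlongrightarrow> surv_rate * fint \<mu> \<phi> / fint \<mu> \<phi> * (\<integral>\<eta>. F \<eta> * fint \<eta> \<phi> \<partial>Q0)) at_top"
    using F fint_phi_pos[OF mu] by (intro tendsto_mult tendsto_divide surv_asymp tendsto_const cond_mean_phi_continuous_tendsto mu) auto
  moreover have "surv_rate * fint \<mu> \<phi> / fint \<mu> \<phi> * (\<integral>\<eta>. F \<eta> * fint \<eta> \<phi> \<partial>Q0) = (\<integral>\<eta>. F \<eta> \<partial>Qii)"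
    unfolding Qii_integral[OF Fm] using fint_phi_pos[OF mu]
    by (simp only: mult.left_commute[of _ surv_rate] integral_mult_right_zero) simp
  moreover have "\<forall>\<^sub>F t in at_top. exp (- lam * t) * surv t \<mu> / fint \<mu> \<phi> * cond_mean \<mu> t (\<lambda>\<eta>. F \<eta> * fint \<eta> \<phi>) = (\<integral>\<eta>. F \<eta> \<partial>R t)"
    using surv_pos_ev[OF mu]
  proof eventually_elim
    case (elim t)
    then show ?case using Q_fin_inf_integral[OF mu, of t "R t" F, OF _ lim Fm] F by (simp add: cond_mean_def)
  qed
  ultimately show "((\<lambda>t. \<integral>\<eta>. F \<eta> \<partial>R t) \<longlongrightarrow> (\<integral>\<eta>. F \<eta> \<partial>Qii)) at_top"
    by (simp add: Lim_transform_eventually)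
qed

text \<open>Since \<open>G r\<close> lies below \<open>G_bound r\<close> times \<open>\<eta>(\<phi>)\<close>, convergence of the means forces \<open>L\<^sup>1\<close>-closeness
  of \<open>G r\<close> to its limit, uniformly in \<open>t\<close>.\<close>

lemma conditioned_joint:
  assumes mu: "\<mu> \<noteq> 0"
  shows "weakly_converges (\<lambda>(t, r). conditioned_law PP \<mu> t r) Qii (at_top \<times>\<^sub>F at_top)"
  unfolding weakly_converges_def
proof (intro allI impI)
  let ?F = "at_top \<times>\<^sub>F at_top :: (real \<times> real) filter"
  fix F :: "'e finmeas \<Rightarrow> real" assume F: "continuous_on UNIV F \<and> bounded (range F)"
  have Fm [measurable]: "F \<in> borel_measurable borel" using F by (intro borel_measurable_continuous_onI) simp
  obtain B where B: "\<And>\<eta>. \<bar>F \<eta>\<bar> \<le> B" using F by (auto simp: bounded_iff)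
  have B0: "0 \<le> B" using B[of 0] by simp
  have lf: "filterlim fst at_top ?F" and ls: "filterlim snd at_top ?F" by (rule filterlim_fst filterlim_snd)+
  have lp: "filterlim (\<lambda>p. fst p + snd p) at_top ?F" by (rule filterlim_at_top_add_at_top[OF lf ls])
  define A where "A p = exp (- lam * (fst p + snd p)) * surv (fst p + snd p) \<mu> / (exp (- lam * fst p) * surv (fst p) \<mu>)" for p
  have Alim: "(A \<longlongrightarrow> 1) ?F" unfolding A_def[abs_def] by (rule surv_ratio[OF mu lp lf])
  define M where "M t = cond_mean \<mu> t (\<lambda>\<eta>. fint \<eta> \<phi>)" for t
  define N where "N p = cond_mean \<mu> (fst p) (\<lambda>\<eta>. F \<eta> * G (snd p) \<eta>)" for p
  have Mlim: "((\<lambda>p. M (fst p)) \<longlongrightarrow> 1 / surv_rate) ?F"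
    unfolding M_def by (rule filterlim_compose[OF cond_mean_phi_tendsto[OF mu] lf])
  have glim: "((\<lambda>p. G_bound (snd p)) \<longlongrightarrow> surv_rate) ?F" by (rule filterlim_compose[OF G_bound_tendsto ls])
  have evpos: "\<forall>\<^sub>F p in ?F. 0 < surv (fst p) \<mu> \<and> 0 < fst p" by (rule eventually_compose_filterlim[OF surv_pos_ev[OF mu] lf])
  have evpos2: "\<forall>\<^sub>F p in ?F. 0 < surv (fst p + snd p) \<mu> \<and> 0 < fst p + snd p" by (rule eventually_compose_filterlim[OF surv_pos_ev[OF mu] lp])
  have evr: "\<forall>\<^sub>F p in ?F. 0 < snd p" by (rule eventually_compose_filterlim[OF eventually_gt_at_top ls])
  have close: "\<forall>\<^sub>F p in ?F. \<bar>N p - surv_rate * cond_mean \<mu> (fst p) (\<lambda>\<eta>. F \<eta> * fint \<eta> \<phi>)\<bar> \<le> B * ((2 * G_bound (snd p) - surv_rate) * M (fst p) - A p)"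
    using evpos evr
  proof eventually_elim
    case (elim p)
    define t r where "t = fst p" and "r = snd p"
    have t: "0 \<le> t" and s: "0 < surv t \<mu>" and r: "0 < r" using elim by (auto simp: t_def r_def)
    then have r0: "0 \<le> r" by simp
    note [measurable] = G_measurable[OF r0] fint_bpB_measurable[OF phi_bpB]
    have ip: "integrable (Q t \<mu>) (\<lambda>\<eta>. fint \<eta> \<phi>)" by (rule mean(1)[OF t phi_bpB])
    have ig: "integrable (Q t \<mu>) (G r)"
    proof (rule Q_integrable[OF t])
      show "\<bar>G r \<eta>\<bar> \<le> exp (- lam * r) * 1" for \<eta>
        unfolding G_def abs_mult using surv_bounds[OF r0, of \<eta>] by (intro mult_mono) auto
    qed measurable
    have iF: "integrable (Q t \<mu>) (\<lambda>\<eta>. F \<eta> * k \<eta>)" if "integrable (Q t \<mu>) k" for k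
    proof (rule Bochner_Integration.integrable_bound[OF integrable_mult_right[OF that, of B]])
      show "(\<lambda>\<eta>. F \<eta> * k \<eta>) \<in> borel_measurable (Q t \<mu>)"
        using that t by (intro borel_measurable_times) auto
      show "AE \<eta> in Q t \<mu>. norm (F \<eta> * k \<eta>) \<le> norm (B * k \<eta>)"
        using B B0 by (intro AE_I2) (auto simp: abs_mult intro!: mult_right_mono)
    qed
    \<comment> \<open>\<open>G r \<eta>\<close> and \<open>surv_rate * fint \<eta> \<phi>\<close>
      both lie below \<open>G_bound r * fint \<eta> \<phi>\<close>, so their distance is at most the
      sum of the two gaps. This bound is linear in \<open>G r \<eta>\<close> and
      \<open>fint \<eta> \<phi>\<close>, whose conditioned means are known.\<close>
    have pw: "\<bar>F \<eta> * G r \<eta> - surv_rate * (F \<eta> * fint \<eta> \<phi>)\<bar> \<le> B * ((2 * G_bound r - surv_rate) * fint \<eta> \<phi> - G r \<eta>)" for \<eta>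
    proof -
      have "\<bar>G r \<eta> - surv_rate * fint \<eta> \<phi>\<bar> \<le> (G_bound r * fint \<eta> \<phi> - G r \<eta>) + (G_bound r * fint \<eta> \<phi> - surv_rate * fint \<eta> \<phi>)"
        using G_le[OF r, of \<eta>] mult_right_mono[OF G_bound_ge[OF r] fint_bpB_nonneg[OF phi_bpB, of \<eta>]] by linarith
      also have "\<dots> = (2 * G_bound r - surv_rate) * fint \<eta> \<phi> - G r \<eta>" by (simp add: algebra_simps)
      finally have 1: "\<bar>G r \<eta> - surv_rate * fint \<eta> \<phi>\<bar> \<le> (2 * G_bound r - surv_rate) * fint \<eta> \<phi> - G r \<eta>" .
      have "F \<eta> * G r \<eta> - surv_rate * (F \<eta> * fint \<eta> \<phi>) = F \<eta> * (G r \<eta> - surv_rate * fint \<eta> \<phi>)" by (simp add: algebra_simps)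
      then show ?thesis using 1 B[of \<eta>] B0 by (auto simp: abs_mult intro!: mult_mono)
    qed
    have "\<bar>cond_mean \<mu> t (\<lambda>\<eta>. F \<eta> * G r \<eta>) - surv_rate * cond_mean \<mu> t (\<lambda>\<eta>. F \<eta> * fint \<eta> \<phi>)\<bar> = \<bar>\<integral>\<eta>. F \<eta> * G r \<eta> - surv_rate * (F \<eta> * fint \<eta> \<phi>) \<partial>Q t \<mu>\<bar> / surv t \<mu>"
      unfolding cond_mean_def using s iF[OF ig] iF[OF ip] by (simp add: diff_divide_distrib[symmetric])
    also have "\<dots> \<le> (\<integral>\<eta>. B * ((2 * G_bound r - surv_rate) * fint \<eta> \<phi> - G r \<eta>) \<partial>Q t \<mu>) / surv t \<mu>"
    proof (rule divide_right_mono)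
      have "\<bar>\<integral>\<eta>. F \<eta> * G r \<eta> - surv_rate * (F \<eta> * fint \<eta> \<phi>) \<partial>Q t \<mu>\<bar> \<le> (\<integral>\<eta>. \<bar>F \<eta> * G r \<eta> - surv_rate * (F \<eta> * fint \<eta> \<phi>)\<bar> \<partial>Q t \<mu>)"
        using integral_norm_bound[of "Q t \<mu>" "\<lambda>\<eta>. F \<eta> * G r \<eta> - surv_rate * (F \<eta> * fint \<eta> \<phi>)"] by simp
      also have "\<dots> \<le> (\<integral>\<eta>. B * ((2 * G_bound r - surv_rate) * fint \<eta> \<phi> - G r \<eta>) \<partial>Q t \<mu>)"
        using iF[OF ig] iF[OF ip] ig ip by (intro integral_mono pw) auto
      finally show "\<bar>\<integral>\<eta>. F \<eta> * G r \<eta> - surv_rate * (F \<eta> * fint \<eta> \<phi>) \<partial>Q t \<mu>\<bar> \<le> (\<integral>\<eta>. B * ((2 * G_bound r - surv_rate) * fint \<eta> \<phi> - G r \<eta>) \<partial>Q t \<mu>)" .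
    qed (use s in simp)
    also have "\<dots> = B * ((2 * G_bound r - surv_rate) * M t - cond_mean \<mu> t (G r))"
      unfolding M_def cond_mean_def using ig ip by (simp add: diff_divide_distrib[symmetric])
    also have "cond_mean \<mu> t (G r) = A p" unfolding A_def t_def r_def using t r0 by (intro cond_mean_G) (auto simp: t_def r_def)
    finally show ?case by (simp add: N_def t_def r_def)
  qed
  \<comment> \<open>The two gaps vanish in the mean: with \<open>k\<close> the survival rate,
    \<open>(2 * k - k) / k - 1 = 0\<close>.\<close>
  have "((\<lambda>p. B * ((2 * G_bound (snd p) - surv_rate) * M (fst p) - A p)) \<longlongrightarrow> B * ((2 * surv_rate - surv_rate) * (1 / surv_rate) - 1)) ?F"
    by (intro tendsto_intros glim Mlim Alim)
  then have lim0: "((\<lambda>p. B * ((2 * G_bound (snd p) - surv_rate) * M (fst p) - A p)) \<longlongrightarrow> 0) ?F" using surv_rate_pos by simp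
  have "((\<lambda>p. N p - surv_rate * cond_mean \<mu> (fst p) (\<lambda>\<eta>. F \<eta> * fint \<eta> \<phi>)) \<longlongrightarrow> 0) ?F"
    by (rule Lim_null_comparison[OF _ lim0]) (use close in simp)
  moreover have "((\<lambda>p. surv_rate * cond_mean \<mu> (fst p) (\<lambda>\<eta>. F \<eta> * fint \<eta> \<phi>)) \<longlongrightarrow> surv_rate * (\<integral>\<eta>. F \<eta> * fint \<eta> \<phi> \<partial>Q0)) ?F"
    using F by (intro tendsto_mult_left filterlim_compose[OF cond_mean_phi_continuous_tendsto[OF mu] lf]) auto
  ultimately have "((\<lambda>p. N p - surv_rate * cond_mean \<mu> (fst p) (\<lambda>\<eta>. F \<eta> * fint \<eta> \<phi>) + surv_rate * cond_mean \<mu> (fst p) (\<lambda>\<eta>. F \<eta> * fint \<eta> \<phi>)) \<longlongrightarrow> 0 + surv_rate * (\<integral>\<eta>. F \<eta> * fint \<eta> \<phi> \<partial>Q0)) ?F"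
    by (rule tendsto_add)
  then have Nlim: "(N \<longlongrightarrow> surv_rate * (\<integral>\<eta>. F \<eta> * fint \<eta> \<phi> \<partial>Q0)) ?F" by simp
  have "((\<lambda>p. N p / A p) \<longlongrightarrow> surv_rate * (\<integral>\<eta>. F \<eta> * fint \<eta> \<phi> \<partial>Q0) / 1) ?F"
    by (intro tendsto_divide Nlim Alim) simp
  moreover have "surv_rate * (\<integral>\<eta>. F \<eta> * fint \<eta> \<phi> \<partial>Q0) / 1 = (\<integral>\<eta>. F \<eta> \<partial>Qii)"
    unfolding Qii_integral[OF Fm] by (simp only: mult.left_commute[of _ surv_rate] integral_mult_right_zero div_by_1)
  moreover have "\<forall>\<^sub>F p in ?F. N p / A p = (\<integral>\<eta>. F \<eta> \<partial>(case p of (t, r) \<Rightarrow> conditioned_law PP \<mu> t r))"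
    using evpos evpos2 evr
  proof eventually_elim
    case (elim p)
    then show ?case using conditioned_J[OF _ _ Fm B, of "fst p" "snd p" \<mu>] cond_mean_G[of "fst p" "snd p" \<mu>]
      by (simp add: N_def A_def case_prod_unfold)
  qed
  ultimately show "((\<lambda>p. \<integral>\<eta>. F \<eta> \<partial>(case p of (t, r) \<Rightarrow> conditioned_law PP \<mu> t r)) \<longlongrightarrow> (\<integral>\<eta>. F \<eta> \<partial>Qii)) ?F"
    by (simp add: Lim_transform_eventually)
qed

end

theorem theorem1p4:
  fixes P :: "real \<Rightarrow> 'e::polish_space \<Rightarrow> 'e measure"
    and W :: "'w measure"
    and L :: "'e \<Rightarrow> 'w measure"
    and \<xi> :: "real \<Rightarrow> 'w \<Rightarrow> 'e"
    and \<zeta> :: "'w \<Rightarrow> ereal"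
    and \<beta> \<sigma> :: "'e \<Rightarrow> real"
    and \<pi> :: "'e \<Rightarrow> real measure"
    and V :: "real \<Rightarrow> ('e \<Rightarrow> real) \<Rightarrow> 'e \<Rightarrow> real"
    and Q :: "real \<Rightarrow> 'e finmeas \<Rightarrow> 'e finmeas measure"
    and PP :: "'e finmeas \<Rightarrow> (real \<Rightarrow> 'e finmeas) measure"
    and lam :: real
    and \<phi> :: "'e \<Rightarrow> real"
    and \<nu> :: "'e finmeas"
    and H :: "real \<Rightarrow> ('e \<Rightarrow> real) \<Rightarrow> 'e \<Rightarrow> real"
    and Q_inf :: "real \<Rightarrow> 'e finmeas measure"
    and Q_fin_inf :: "'e finmeas \<Rightarrow> real \<Rightarrow> 'e finmeas measure"
  assumes spatial_motion: "borel_right_process P W L \<xi> \<zeta>"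
    and branching: "\<beta> \<in> bB" "\<sigma> \<in> bB" "levy_kernel \<pi>"
    and cumulant: "cumulant_semigroup P (branching_mechanism \<beta> \<sigma> \<pi>) V"
    and superprocess: "superprocess V Q PP"
    and eigen: "principal_triple (mean_semigroup L \<xi> \<zeta> \<beta>) lam \<phi> \<nu>"
    and asymptotics: "uniform_asymptotics (mean_semigroup L \<xi> \<zeta> \<beta>) lam \<phi> \<nu> H"
    and subcritical: "lam < 0"
    and extinction: "\<And>t. 0 < t \<Longrightarrow> 0 < emeasure (PP \<nu>) {w \<in> space (PP \<nu>). w t = 0}"
    and Q_inf: "\<And>r. 0 \<le> r \<Longrightarrow> prob_space (Q_inf r)"
      "\<And>r. 0 \<le> r \<Longrightarrow> sets (Q_inf r) = sets borel"
      "\<And>r \<mu>. 0 \<le> r \<Longrightarrow> \<mu> \<noteq> 0 \<Longrightarrow>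
         weakly_converges (\<lambda>t. conditioned_law PP \<mu> t r) (Q_inf r) at_top"
    and Q_fin_inf: "\<And>\<mu> t. \<mu> \<noteq> 0 \<Longrightarrow> 0 \<le> t \<Longrightarrow> prob_space (Q_fin_inf \<mu> t)"
      "\<And>\<mu> t. \<mu> \<noteq> 0 \<Longrightarrow> 0 \<le> t \<Longrightarrow> sets (Q_fin_inf \<mu> t) = sets borel"
      "\<And>\<mu> t. \<mu> \<noteq> 0 \<Longrightarrow> 0 \<le> t \<Longrightarrow>
         strongly_converges (\<lambda>r. conditioned_law PP \<mu> t r) (Q_fin_inf \<mu> t) at_top"
    and LlogL: "(\<integral>\<^sup>+x. \<integral>\<^sup>+u. ennreal (u * \<phi> x * max (ln (u * \<phi> x)) 0) \<partial>\<pi> x \<partial>meas \<nu>) < \<infinity>"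
  shows "\<exists>Q_inf_inf :: 'e finmeas measure. prob_space Q_inf_inf \<and> sets Q_inf_inf = sets borel \<and>
    (\<forall>\<mu>. \<mu> \<noteq> 0 \<longrightarrow>
      Q_inf_inf = density (Q_inf 0)
        (\<lambda>\<eta>. ennreal (fint \<eta> \<phi>) / (\<integral>\<^sup>+\<eta>'. ennreal (fint \<eta>' \<phi>) \<partial>Q_inf 0)) \<and>
      ((\<lambda>t. ennreal (exp (- lam * t)) * emeasure (PP \<mu>) {w \<in> space (PP \<mu>). w t \<noteq> 0}) \<longlongrightarrow>
        ennreal (fint \<mu> \<phi>) / (\<integral>\<^sup>+\<eta>. ennreal (fint \<eta> \<phi>) \<partial>Q_inf 0)) at_top \<and>
      strongly_converges Q_inf Q_inf_inf at_top \<and>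
      weakly_converges (\<lambda>t. Q_fin_inf \<mu> t) Q_inf_inf at_top \<and>
      weakly_converges (\<lambda>(t, r). conditioned_law PP \<mu> t r) Q_inf_inf (at_top \<times>\<^sub>F at_top))"
proof -
  interpret subcritical_model P W L \<xi> \<zeta> \<beta> \<sigma> \<pi> V Q PP lam \<phi> \<nu> H
    using spatial_motion branching cumulant superprocess eigen asymptotics subcritical extinction
    by (simp add: subcritical_model_def subcritical_model_axioms_def superprocess_model_def superprocess_model_axioms_def
        branching_motion_def branching_data_def)
  interpret yaglom_model P W L \<xi> \<zeta> \<beta> \<sigma> \<pi> V Q PP lam \<phi> \<nu> H Q_inf
    by (intro yaglom_model.intro subcritical_model_axioms yaglom_model_axioms.intro Q_inf surv_rate_pos_LlogL[OF LlogL])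
  show ?thesis
    using Qii_prob sets_Qii Qii_eq surv_tendsto_Q0 Q_inf_strong Q_fin_inf_weak[OF _ Q_fin_inf(3)] conditioned_joint
    by (intro exI[of _ Qii]) blast
qed

end
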